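(* Let $\alpha\in(0,\infty)$. Suppose $\mathcal{M}$ is a smooth, $n$-dimensional, closed, connected hypersurface in $\mathbb{R}^{n+1}$ and let $h$ be the metric on $\mathcal{M}$ induced by the Euclidean metric $\mathfrak{e}$ of the ambient space. Let $\hat x_\alpha:\mathcal{M}\times[0,T)\to\mathbb{R}^{n+1}$ be the mean curvature-DeTurck flow, i.e. $\hat x_\alpha(t)=x(t)\circ\psi_\alpha(t)^{-1}$, where $x:\mathcal{M}\times[0,T)\to\mathbb{R}^{n+1}$ is a time-dependent embedding with $$\frac{\partial}{\partial t}x=-(H\nu)\circ x,\qquad x(\cdot,0)=x_0,$$ and $\psi_\alpha(t):\mathcal{M}\to\mathcal{M}$, $t\in[0,T)$, are diffeomorphisms with $$\frac{\partial}{\partial t}\psi_\alpha=\frac1\alpha\Delta_{g(t),h}\psi_\alpha,\qquad g(t):=x(t)^*\mathfrak{e},\qquad \psi_\alpha(\cdot,0)=\mathrm{id}(\cdot).$$ Let $\Gamma(t):=\hat x_\alpha(\mathcal{M},t)$, $\hat g_\alpha(t):=\hat x_\alpha(t)^*\mathfrak{e}$, $w_\alpha:=(\Delta_{\hat g_\alpha}\mathrm{id})\circ\hat x_\alpha^{-1}$, and $$\hat H_\alpha(t):=(\nabla_{\Gamma(t)}\hat x_\alpha^{-1}(t))^T\nabla_{\Gamma(t)}\hat x_\alpha^{-1}(t)+\nu(t)\otimes\nu(t).$$ Then the identity map $u=\mathrm{id}_{\Gamma(t)}$ on $\Gamma(t)$ satisfies \begin{align*} 0&=\alpha\int_{\Gamma(t)}\partial^\bullet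 u\cdot\eta\,d\sigma+(1-\alpha)\int_{\Gamma(t)}(\partial^\bullet u\cdot\nu)(\nu\cdot\eta)\,d\sigma\\ &\quad+\int_{\Gamma(t)}\nabla_{\Gamma(t)}u:\nabla_{\Gamma(t)}\eta\,d\sigma+\int_{\Gamma(t)}w_\alpha\cdot\big(\nabla_{\Gamma(t)}\hat x_\alpha^{-1}\,\hat H_\alpha^{-1}\eta\big)\,d\sigma,\\ 0&=\int_{\Gamma(t)}w_\alpha\cdot\zeta\,d\sigma+\int_{\Gamma(t)}\nabla_{\Gamma(t)}\hat x_\alpha^{-1}:\nabla_{\Gamma(t)}\zeta\,d\sigma, \end{align*} for all $\eta,\zeta\in H^{1,2}(\Gamma(t),\mathbb{R}^{n+1})$ and $t\in[0,T)$.
   Context: Repeated indices are summed. For an embedding $x$ with local representation $X=x\circ\mathcal{C}^{-1}$ in a chart $\mathcal{C}$ of $\mathcal{M}$, $x^*\mathfrak{e}$ has components $\frac{\partial X}{\partial\theta^i}\cdot\frac{\partial X}{\partial\theta^j}$. For a metric $g$, $(g^{ij})=(g_{ij})^{-1}$ and $\Gamma(g)^k_{ij}=\frac12g^{kl}(\partial_ig_{lj}+\partial_jg_{li}-\partial_lg_{ij})$. The Laplacian of a function $f$ on $\mathcal{M}$ with $F=f\circ\mathcal{C}^{-1}$ is $\Delta_gf=g^{ij}(\frac{\partial^2F}{\partial\theta^i\partial\theta^j}-\Gamma(g)^k_{ij}\frac{\partial F}{\partial\theta^k})$; it is applied componentwise to vector-valued maps, and $\mathrm{id}:\mathcal{M}\to\mathbb{R}^{n+1}$,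 $\mathrm{id}(p)=p$, is regarded as an $\mathbb{R}^{n+1}$-valued map in $\Delta_{\hat g_\alpha}\mathrm{id}$. All maps are sufficiently regular: $x$ and $\psi_\alpha$ are at least of class $C^2$ in space and $C^1$ in time. $\nu$ is a unit normal field on $\Gamma(t)=x(\mathcal{M},t)$, and the mean curvature $H$ is the sum of the principal curvatures, $H\circ X=-g^{ij}\frac{\partial^2X}{\partial\theta^i\partial\theta^j}\cdot(\nu\circ X)$ with $g=x^*\mathfrak{e}$; $H\nu$ is independent of the choice of $\nu$. Map Laplacian: for metrics $g,h$ on $\mathcal{M}$ and $\psi:\mathcal{M}\to\mathcal{M}$ with local representation $\Psi=\mathcal{C}_2\circ\psi\circ\mathcal{C}_1^{-1}$, $\Delta_{g,h}\psi$ is the vector field along $\psi$ with $\mathcal{C}_2$-components $g^{ij}\big(\frac{\partial^2\Psi^q}{\partial\theta^i\partial\theta^j}-\Gamma(g)^k_{ij}\frac{\partial\Psi^q}{\partial\theta^k}+(\Gamma(h)^q_{mn}\circ\Psi)\frac{\partial\Psi^m}{\partial\theta^i}\frac{\partial\Psi^n}{\partial\theta^j}\big)$. Tangential gradient on a hypersurface $\mathcal{N}\subset\mathbb{R}^{n+1}$ with unit normal $\nu$: $\nabla_{\mathcal{N}}f=\nabla\bar f-(\nu\cdot\nabla\bar f)\nu$ for any differentiable extension $\bar f$ of $f$, with components $\underline{D}_\beta f$, $\beta=1,\dots,n+1$. For a vector-valued $f$, $\nabla_{\mathcal{N}}f$ is the matrix with entries $(\nabla_{\mathcal{N}}f)_{\kappa\beta}=\underline{D}_\beta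 f_\kappa$. $A:B=\sum_{\alpha,\beta}A_{\alpha\beta}B_{\alpha\beta}$. $\hat x_\alpha^{-1}(t):\Gamma(t)\to\mathcal{M}\subset\mathbb{R}^{n+1}$ is the inverse of $\hat x_\alpha(t)$. The material derivative is defined by $(\partial^\bullet f)\circ\hat x_\alpha=\frac{\partial}{\partial t}(f\circ\hat x_\alpha)$, so $\partial^\bullet u=\frac{\partial\hat x_\alpha}{\partial t}\circ\hat x_\alpha^{-1}$. $d\sigma$ is the $n$-dimensional Hausdorff measure on $\Gamma(t)$. *)

theory Defs
  imports "HOL-Analysis.Analysis"
begin

text \<open>
  Throughout, the ambient space of dimension $n+1$ is \<^typ>\<open>real^('n option)\<close>, where $n$ is the
  cardinality of the finite type \<^typ>\<open>'n::finite\<close> that indexes the chart coordinates in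
  \<^typ>\<open>real^'n\<close>. A chart is represented by its inverse, a local parametrization
  $X : U \to M$ with $U$ open in \<^typ>\<open>real^'n\<close>.
\<close>

section \<open>Calculus in coordinates\<close>

definition pd :: "'n \<Rightarrow> (real^'n::finite \<Rightarrow> 'b::real_normed_vector) \<Rightarrow> real^'n \<Rightarrow> 'b" where
  "pd i F \<theta> = frechet_derivative F (at \<theta>) (axis i 1)"

text \<open>Continuous differentiability of order \<open>k\<close>, intended for open \<open>U\<close>.\<close>

primrec Ck_on :: "nat \<Rightarrow> ('a::euclidean_space \<Rightarrow> 'b::real_normed_vector) \<Rightarrow> 'a set \<Rightarrow> bool" where
  "Ck_on 0 f U \<longleftrightarrow> continuous_on U f"
| "Ck_on (Suc k) f U \<longleftrightarrow> (\<forall>x\<in>U. f differentiable (at x)) \<and>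
     (\<forall>b\<in>Basis. Ck_on k (\<lambda>x. frechet_derivative f (at x) b) U)"

definition smooth_on :: "('a::euclidean_space \<Rightarrow> 'b::real_normed_vector) \<Rightarrow> 'a set \<Rightarrow> bool" where
  "smooth_on f U \<longleftrightarrow> (\<forall>k. Ck_on k f U)"

definition immersion_on :: "('a::euclidean_space \<Rightarrow> 'b::real_normed_vector) \<Rightarrow> 'a set \<Rightarrow> bool" where
  "immersion_on f U \<longleftrightarrow> (\<forall>\<theta>\<in>U. inj (frechet_derivative f (at \<theta>)))"

section \<open>Hypersurfaces\<close>

definition local_parametrization ::
  "(real^('n::finite option)) set \<Rightarrow> (real^'n) set \<Rightarrow> (real^'n \<Rightarrow> real^('n option)) \<Rightarrow> bool" where
  "local_parametrization M U X \<longleftrightarrow>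
     open U \<and> openin (top_of_set M) (X ` U) \<and> (\<exists>Y. homeomorphism U (X ` U) X Y) \<and>
     smooth_on X U \<and> immersion_on X U"

text \<open>Since the parameter domains are open, such a compact \<open>M\<close> has no boundary.\<close>

definition smooth_closed_connected_hypersurface :: "(real^('n::finite option)) set \<Rightarrow> bool" where
  "smooth_closed_connected_hypersurface M \<longleftrightarrow>
     M \<noteq> {} \<and> compact M \<and> connected M \<and>
     (\<forall>p\<in>M. \<exists>U X. local_parametrization M U X \<and> p \<in> X ` U)"

text \<open>
  The Laplacians and the mean curvature below do not depend on the parametrization in which their
  coordinate formulas are evaluated; they are evaluated in a chosen one around the given point.
\<close>

definition param_at :: "(real^('n::finite option)) set \<Rightarrow> real^('n option) \<Rightarrow>
    (real^'n) set \<times> (real^'n \<Rightarrow> real^('n option))" where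
  "param_at M p = (SOME (U, X). local_parametrization M U X \<and> p \<in> X ` U)"

definition C2_map :: "(real^('n::finite option)) set \<Rightarrow> (real^('n option) \<Rightarrow> real^('n option)) \<Rightarrow> bool"
  where
  "C2_map M f \<longleftrightarrow> (\<forall>U X. local_parametrization M U X \<longrightarrow> Ck_on 2 (f \<circ> X) U)"

definition C2_embedding :: "(real^('n::finite option)) set \<Rightarrow>
    (real^('n option) \<Rightarrow> real^('n option)) \<Rightarrow> bool" where
  "C2_embedding M f \<longleftrightarrow> C2_map M f \<and>
     (\<forall>U X. local_parametrization M U X \<longrightarrow> immersion_on (f \<circ> X) U) \<and>
     (\<exists>g. homeomorphism M (f ` M) f g)"

text \<open>As \<open>M\<close> is an embedded submanifold, a map into \<open>M\<close> is of class $C^2$ if and only if it is so as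
  a map into the ambient space.\<close>

definition C2_diffeomorphism :: "(real^('n::finite option)) set \<Rightarrow>
    (real^('n option) \<Rightarrow> real^('n option)) \<Rightarrow> bool" where
  "C2_diffeomorphism M f \<longleftrightarrow> bij_betw f M M \<and> C2_map M f \<and> C2_map M (inv_into M f)"

text \<open>Class $C^2$ in space and $C^1$ in time: the derivatives concerned exist (one-sided in time at
  $t=0$) and are jointly continuous in space and time.\<close>

definition C2_space_C1_time :: "(real^('n::finite option)) set \<Rightarrow> real \<Rightarrow>
    (real \<Rightarrow> real^('n option) \<Rightarrow> real^('n option)) \<Rightarrow> bool" where
  "C2_space_C1_time M T f \<longleftrightarrow>
     (\<forall>U X. local_parametrization M U X \<longrightarrow>
        (\<forall>t\<in>{0..<T}. Ck_on 2 (f t \<circ> X) U) \<and>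
        (\<forall>\<theta>\<in>U. \<forall>t\<in>{0..<T}. (\<lambda>s. f s (X \<theta>)) differentiable (at t within {0..<T})) \<and>
        continuous_on ({0..<T} \<times> U) (\<lambda>(t, \<theta>). f t (X \<theta>)) \<and>
        (\<forall>i. continuous_on ({0..<T} \<times> U) (\<lambda>(t, \<theta>). pd i (f t \<circ> X) \<theta>)) \<and>
        (\<forall>i j. continuous_on ({0..<T} \<times> U) (\<lambda>(t, \<theta>). pd i (pd j (f t \<circ> X)) \<theta>)) \<and>
        continuous_on ({0..<T} \<times> U)
          (\<lambda>(t, \<theta>). vector_derivative (\<lambda>s. f s (X \<theta>)) (at t within {0..<T})))"

section \<open>Metrics, Christoffel symbols and Laplacians\<close>

text \<open>A metric is represented by its component matrices with respect to all parametrizations.\<close>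

type_synonym 'n metric = "(real^'n \<Rightarrow> real^('n option)) \<Rightarrow> real^'n \<Rightarrow> real^'n^'n"

definition pullback_metric :: "(real^('n::finite option) \<Rightarrow> real^('n option)) \<Rightarrow> 'n metric" where
  "pullback_metric f X \<theta> = (\<chi> i j. pd i (f \<circ> X) \<theta> \<bullet> pd j (f \<circ> X) \<theta>)"

definition christoffel :: "(real^'n \<Rightarrow> real^'n^'n) \<Rightarrow> real^'n::finite \<Rightarrow> 'n \<Rightarrow> 'n \<Rightarrow> 'n \<Rightarrow> real" where
  "christoffel G \<theta> k i j = 1/2 * (\<Sum>l\<in>UNIV. matrix_inv (G \<theta>) $ k $ l *
     (pd i (\<lambda>\<xi>. G \<xi> $ l $ j) \<theta> + pd j (\<lambda>\<xi>. G \<xi> $ l $ i) \<theta> - pd l (\<lambda>\<xi>. G \<xi> $ i $ j) \<theta>))"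

definition laplacian :: "(real^('n::finite option)) set \<Rightarrow> 'n metric \<Rightarrow>
    (real^('n option) \<Rightarrow> 'b::real_normed_vector) \<Rightarrow> real^('n option) \<Rightarrow> 'b" where
  "laplacian M g f p =
     (let (U, X) = param_at M p; \<theta> = inv_into U X p; F = f \<circ> X
      in \<Sum>i\<in>UNIV. \<Sum>j\<in>UNIV. matrix_inv (g X \<theta>) $ i $ j *\<^sub>R
           (pd i (pd j F) \<theta> - (\<Sum>k\<in>UNIV. christoffel (g X) \<theta> k i j *\<^sub>R pd k F \<theta>)))"

text \<open>The vector field $\Delta_{g,h}\psi$ along $\psi$, as a vector in the ambient space:
  its components are taken with respect to the coordinate basis at $\psi(p)$.\<close>

definition map_laplacian :: "(real^('n::finite option)) set \<Rightarrow> 'n metric \<Rightarrow> 'n metric \<Rightarrow>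
    (real^('n option) \<Rightarrow> real^('n option)) \<Rightarrow> real^('n option) \<Rightarrow> real^('n option)" where
  "map_laplacian M g h \<psi> p =
     (let (U1, X1) = param_at M p; \<theta> = inv_into U1 X1 p;
          (U2, X2) = param_at M (\<psi> p);
          \<Psi> = (\<lambda>\<xi>. inv_into U2 X2 (\<psi> (X1 \<xi>)));
          L = (\<lambda>q. \<Sum>i\<in>UNIV. \<Sum>j\<in>UNIV. matrix_inv (g X1 \<theta>) $ i $ j *
                (pd i (pd j (\<lambda>\<xi>. \<Psi> \<xi> $ q)) \<theta>
                 - (\<Sum>k\<in>UNIV. christoffel (g X1) \<theta> k i j * pd k (\<lambda>\<xi>. \<Psi> \<xi> $ q) \<theta>)
                 + (\<Sum>m\<in>UNIV. \<Sum>n\<in>UNIV. christoffel (h X2) (\<Psi> \<theta>) q m n *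
                      pd i (\<lambda>\<xi>. \<Psi> \<xi> $ m) \<theta> * pd j (\<lambda>\<xi>. \<Psi> \<xi> $ n) \<theta>)))
      in \<Sum>q\<in>UNIV. L q *\<^sub>R pd q X2 (\<Psi> \<theta>))"

section \<open>Normal field and mean curvature of an embedded surface\<close>

definition unit_normal_field :: "(real^('n::finite option)) set \<Rightarrow>
    (real^('n option) \<Rightarrow> real^('n option)) \<Rightarrow> (real^('n option) \<Rightarrow> real^('n option)) \<Rightarrow> bool" where
  "unit_normal_field M f \<nu> \<longleftrightarrow>
     continuous_on (f ` M) \<nu> \<and> (\<forall>y\<in>f ` M. norm (\<nu> y) = 1) \<and>
     (\<forall>U X. local_parametrization M U X \<longrightarrow> (\<forall>\<theta>\<in>U. \<forall>i. \<nu> (f (X \<theta>)) \<bullet> pd i (f \<circ> X) \<theta> = 0))"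

definition mean_curvature :: "(real^('n::finite option)) set \<Rightarrow>
    (real^('n option) \<Rightarrow> real^('n option)) \<Rightarrow> (real^('n option) \<Rightarrow> real^('n option)) \<Rightarrow>
    real^('n option) \<Rightarrow> real" where
  "mean_curvature M f \<nu> y =
     (let p = inv_into M f y; (U, X) = param_at M p; \<theta> = inv_into U X p
      in - (\<Sum>i\<in>UNIV. \<Sum>j\<in>UNIV. matrix_inv (pullback_metric f X \<theta>) $ i $ j *
              (pd i (pd j (f \<circ> X)) \<theta> \<bullet> \<nu> y)))"

section \<open>The flows\<close>

definition mean_curvature_flow :: "(real^('n::finite option)) set \<Rightarrow> real \<Rightarrow>
    (real^('n option) \<Rightarrow> real^('n option)) \<Rightarrow> (real \<Rightarrow> real^('n option) \<Rightarrow> real^('n option)) \<Rightarrow>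
    (real \<Rightarrow> real^('n option) \<Rightarrow> real^('n option)) \<Rightarrow> bool" where
  "mean_curvature_flow M T x0 \<nu> x \<longleftrightarrow>
     C2_space_C1_time M T x \<and>
     (\<forall>t\<in>{0..<T}. C2_embedding M (x t) \<and> unit_normal_field M (x t) (\<nu> t)) \<and>
     (\<forall>p\<in>M. \<forall>t\<in>{0..<T}. ((\<lambda>s. x s p) has_vector_derivative
        - (mean_curvature M (x t) (\<nu> t) (x t p) *\<^sub>R \<nu> t (x t p))) (at t within {0..<T})) \<and>
     (\<forall>p\<in>M. x 0 p = x0 p)"

definition deturck_diffeomorphisms :: "(real^('n::finite option)) set \<Rightarrow> real \<Rightarrow> real \<Rightarrow>
    (real \<Rightarrow> real^('n option) \<Rightarrow> real^('n option)) \<Rightarrow>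
    (real \<Rightarrow> real^('n option) \<Rightarrow> real^('n option)) \<Rightarrow> bool" where
  "deturck_diffeomorphisms M \<alpha> T x \<psi> \<longleftrightarrow>
     C2_space_C1_time M T \<psi> \<and>
     (\<forall>t\<in>{0..<T}. C2_diffeomorphism M (\<psi> t)) \<and>
     (\<forall>p\<in>M. \<forall>t\<in>{0..<T}. ((\<lambda>s. \<psi> s p) has_vector_derivative
        (1/\<alpha>) *\<^sub>R map_laplacian M (pullback_metric (x t)) (pullback_metric id) (\<psi> t) p)
        (at t within {0..<T})) \<and>
     (\<forall>p\<in>M. \<psi> 0 p = p)"

section \<open>Tangential gradient and material derivative\<close>

definition tangential_gradient :: "'a::euclidean_space set \<Rightarrow> ('a \<Rightarrow> 'a) \<Rightarrow> ('a \<Rightarrow> real) \<Rightarrow> 'a \<Rightarrow> 'a"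
  where
  "tangential_gradient N \<nu> f y =
     (THE v. \<exists>W F D. open W \<and> y \<in> W \<and> F differentiable_on W \<and> (\<forall>z\<in>N \<inter> W. F z = f z) \<and>
        GDERIV F y :> D \<and> v = D - (\<nu> y \<bullet> D) *\<^sub>R \<nu> y)"

text \<open>Row index: component of \<open>f\<close>; column index: direction of differentiation. The inner product of
  matrices is $A : B$ and their norm is the Frobenius norm.\<close>

definition tgrad :: "(real^'m::finite) set \<Rightarrow> (real^'m \<Rightarrow> real^'m) \<Rightarrow> (real^'m \<Rightarrow> real^'m) \<Rightarrow>
    real^'m \<Rightarrow> real^'m^'m" where
  "tgrad N \<nu> f y = (\<chi> \<kappa> \<beta>. tangential_gradient N \<nu> (\<lambda>z. f z $ \<kappa>) y $ \<beta>)"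

definition outer :: "real^'m::finite \<Rightarrow> real^'m \<Rightarrow> real^'m^'m" where
  "outer a b = (\<chi> i j. a $ i * b $ j)"

definition material_derivative :: "'p set \<Rightarrow> real \<Rightarrow> (real \<Rightarrow> 'p \<Rightarrow> 'a) \<Rightarrow>
    (real \<Rightarrow> 'a \<Rightarrow> 'b::real_normed_vector) \<Rightarrow> real \<Rightarrow> 'a \<Rightarrow> 'b" where
  "material_derivative M T z f t y =
     vector_derivative (\<lambda>s. f s (z s (inv_into M (z t) y))) (at t within {0..<T})"

section \<open>Hausdorff measure\<close>

definition hausdorff_premeasure :: "nat \<Rightarrow> real \<Rightarrow> 'a::metric_space set \<Rightarrow> ennreal" where
  "hausdorff_premeasure n \<delta> A =
     (INF C\<in>{C :: nat \<Rightarrow> 'a set. A \<subseteq> (\<Union>i. C i) \<and> (\<forall>i. bounded (C i) \<and> diameter (C i) \<le> \<delta>)}.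
        \<Sum>i. if C i = {} then 0 else ennreal (unit_ball_vol (real n) * (diameter (C i) / 2) ^ n))"

definition hausdorff_outer :: "nat \<Rightarrow> 'a::metric_space set \<Rightarrow> ennreal" where
  "hausdorff_outer n A = (SUP \<delta>\<in>{0<..}. hausdorff_premeasure n \<delta> A)"

definition hausdorff_measure :: "nat \<Rightarrow> 'a::metric_space measure" where
  "hausdorff_measure n = measure_of UNIV (sets borel) (hausdorff_outer n)"

abbreviation surface_measure :: "(real^('n::finite option)) measure" where
  "surface_measure \<equiv> hausdorff_measure CARD('n)"

section \<open>Sobolev space\<close>

definition L2_on :: "'a measure \<Rightarrow> 'a set \<Rightarrow>
    ('a \<Rightarrow> 'b::{real_normed_vector, second_countable_topology}) set" where
  "L2_on \<mu> N = {f. set_borel_measurable \<mu> N f \<and> (\<integral>\<^sup>+y\<in>N. ennreal ((norm (f y))\<^sup>2) \<partial>\<mu>) < \<infinity>}"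

text \<open>$H^{1,2}$ is the completion, inside $L^2$, of the restrictions of $C^1$ maps with respect to
  the $L^2$ norms of the map and of its tangential gradient. The weak gradient is the $L^2$ limit of
  the gradients; it is determined almost everywhere.\<close>

definition weak_tgrad :: "(real^('n::finite option)) set \<Rightarrow>
    (real^('n option) \<Rightarrow> real^('n option)) \<Rightarrow> (real^('n option) \<Rightarrow> real^('n option)) \<Rightarrow>
    (real^('n option) \<Rightarrow> real^('n option)^('n option)) \<Rightarrow> bool" where
  "weak_tgrad N \<nu> \<eta> D \<longleftrightarrow>
     \<eta> \<in> L2_on surface_measure N \<and> D \<in> L2_on surface_measure N \<and>
     (\<exists>\<phi> :: nat \<Rightarrow> real^('n option) \<Rightarrow> real^('n option).
        (\<forall>k. \<exists>W. open W \<and> N \<subseteq> W \<and> Ck_on 1 (\<phi> k) W) \<and>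
        (\<lambda>k. \<integral>\<^sup>+y\<in>N. ennreal ((norm (\<phi> k y - \<eta> y))\<^sup>2) \<partial>surface_measure) \<longlonglongrightarrow> 0 \<and>
        (\<lambda>k. \<integral>\<^sup>+y\<in>N. ennreal ((norm (tgrad N \<nu> (\<phi> k) y - D y))\<^sup>2) \<partial>surface_measure) \<longlonglongrightarrow> 0)"

definition H12 :: "(real^('n::finite option)) set \<Rightarrow> (real^('n option) \<Rightarrow> real^('n option)) \<Rightarrow>
    (real^('n option) \<Rightarrow> real^('n option)) set" where
  "H12 N \<nu> = {\<eta>. \<exists>D. weak_tgrad N \<nu> \<eta> D}"

end

theory Submission
  imports Defs
begin

text \<open>
  In coordinates $Y = x \circ X$ of $\Gamma(t)$ the mean curvature vector is the Laplacian of the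
  identity of $\Gamma(t)$, and $w_\alpha$ is the Laplacian of $\hat x_\alpha^{-1}$. The second
  equation, and the first one for the mean curvature vector in place of $\partial^\bullet u$, are
  therefore instances of integration by parts on the closed hypersurface $\Gamma(t)$.
  Differentiating $\hat x_\alpha \circ \psi_\alpha = x$ in time shows that $\partial^\bullet u$ is the
  mean curvature vector minus $1/\alpha$ times the tangential vector that $B = \nabla \hat x_\alpha^{-1}$
  maps to $\Delta_{g,h}\psi_\alpha$. The map Laplacian is the tangential projection of the ambient
  Laplacian $w_\alpha$ onto $\mathcal{M}$, so this vector is $\hat H_\alpha^{-1} B^T w_\alpha$, which
  accounts for the last integral; being tangential, it does not contribute to the normal part.

  Integration by parts reduces by a partition of unity to the divergence theorem in one patch. This
  needs the area formula only up to a constant factor: a Hausdorff measure of a flat piece is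
  translation invariant, hence a multiple of Lebesgue measure, and a patch is locally almost isometric
  to its tangent plane.
\<close>

section \<open>Partial derivatives\<close>

text \<open>The definitions evaluate every coordinate formula in a chart picked by choice, and the
  map Laplacian in two unrelated charts, so identities between them presuppose chart independence.
  Chart transitions arise only as the inverse of a patch after another map, so their second
  derivatives have to be constructed. The classical transformation law of Christoffel symbols is
  bypassed: for an induced metric they are the unique coefficients that make the second derivatives
  of the immersion normal. The surface \<open>\<Gamma> t\<close> is parametrized by
  \<open>x t \<circ> X\<close> with \<open>X\<close> a chart of \<open>M\<close>; in these
  parameters the inverse of \<open>xhat t\<close> is \<open>\<psi> t \<circ> X\<close>. Since
  \<open>x t\<close> is only C2, the metric is C1 and Laplacians are just continuous, which still
  allows pairing them with L2 maps. The time derivative of the inverse diffeomorphisms is not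
  assumed. It comes from a differentiation lemma for left inverses, relative to arbitrary sets so as
  to include the one-sided derivative at t = 0; the continuity that this lemma presupposes follows
  from compactness of \<open>M\<close>.\<close>

lemma pd_eqI: "(F has_derivative F') (at \<theta>) \<Longrightarrow> pd i F \<theta> = F' (axis i 1)"
  unfolding pd_def by (metis frechet_derivative_at)

lemma sum_axis_representation: "(\<Sum>i\<in>UNIV. v $ i *\<^sub>R axis i 1) = (v :: real^'n)"
  using basis_expansion[of v] by (simp add: scalar_mult_eq_scaleR)

lemma sum_axis_scaleR:
  fixes g :: "'n::finite \<Rightarrow> 'b::real_vector"
  shows "(\<Sum>k\<in>UNIV. axis i (1::real) $ k *\<^sub>R g k) = g i"
proof -
  have "(\<Sum>k\<in>UNIV. axis i (1::real) $ k *\<^sub>R g k) = (\<Sum>k\<in>UNIV. if k = i then g k else 0)"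
    by (rule sum.cong) (auto simp: axis_def)
  then show ?thesis by simp
qed

lemma linear_axis_expansion:
  fixes f :: "real^'n \<Rightarrow> 'b::real_vector"
  assumes "linear f"
  shows "f v = (\<Sum>i\<in>UNIV. v $ i *\<^sub>R f (axis i 1))"
proof -
  interpret linear f by fact
  have "f v = f (\<Sum>i\<in>UNIV. v $ i *\<^sub>R axis i 1)"
    by (simp add: sum_axis_representation)
  then show ?thesis by (simp add: sum scale)
qed

lemma has_derivative_pd:
  fixes F :: "real^'n \<Rightarrow> 'b::real_normed_vector"
  assumes "F differentiable (at \<theta>)"
  shows "(F has_derivative (\<lambda>v. \<Sum>i\<in>UNIV. v $ i *\<^sub>R pd i F \<theta>)) (at \<theta>)"
proof -
  have F: "(F has_derivative frechet_derivative F (at \<theta>)) (at \<theta>)"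
    using assms by (simp add: frechet_derivative_works)
  have "frechet_derivative F (at \<theta>) = (\<lambda>v. \<Sum>i\<in>UNIV. v $ i *\<^sub>R pd i F \<theta>)"
    unfolding pd_def by (intro ext linear_axis_expansion has_derivative_linear[OF F])
  with F show ?thesis by simp
qed

lemma has_derivative_cong_nhds:
  assumes "eventually (\<lambda>\<xi>. F \<xi> = G \<xi>) (nhds \<theta>)"
  shows "(F has_derivative D) (at \<theta>) \<longleftrightarrow> (G has_derivative D) (at \<theta>)"
proof -
  obtain S where S: "open S" "\<theta> \<in> S" "\<And>\<xi>. \<xi> \<in> S \<Longrightarrow> F \<xi> = G \<xi>"
    using assms by (auto simp: eventually_nhds)
  show ?thesis
    using has_derivative_transform_within_open[OF _ S(1,2), of F D UNIV G]
      has_derivative_transform_within_open[OF _ S(1,2), of G D UNIV F] S(3) by metis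
qed

lemma differentiable_cong_nhds:
  assumes "eventually (\<lambda>\<xi>. F \<xi> = G \<xi>) (nhds \<theta>)"
  shows "F differentiable (at \<theta>) \<longleftrightarrow> G differentiable (at \<theta>)"
proof -
  have *: "(F has_derivative D) (at \<theta>) = (G has_derivative D) (at \<theta>)" for D
    by (rule has_derivative_cong_nhds[OF assms])
  then show ?thesis by (simp add: differentiable_def)
qed

lemma pd_cong_nhds:
  assumes "eventually (\<lambda>\<xi>. F \<xi> = G \<xi>) (nhds \<theta>)"
  shows "pd i F \<theta> = pd i G \<theta>"
proof -
  have *: "(F has_derivative D) (at \<theta>) = (G has_derivative D) (at \<theta>)" for D
    by (rule has_derivative_cong_nhds[OF assms])
  then show ?thesis by (simp add: pd_def frechet_derivative_def)
qed

lemma pd2_cong_nhds: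
  assumes "eventually (\<lambda>\<xi>. F \<xi> = G \<xi>) (nhds \<theta>)"
  shows "pd i (pd j F) \<theta> = pd i (pd j G) \<theta>"
proof (rule pd_cong_nhds)
  have "eventually (\<lambda>\<xi>. eventually (\<lambda>\<xi>. F \<xi> = G \<xi>) (nhds \<xi>)) (nhds \<theta>)"
    using assms by (simp add: eventually_eventually)
  then show "eventually (\<lambda>\<xi>. pd j F \<xi> = pd j G \<xi>) (nhds \<theta>)"
    by (rule eventually_mono) (rule pd_cong_nhds)
qed

lemma pd_const [simp]: "pd i (\<lambda>\<xi>. c) \<theta> = 0"
  by (rule pd_eqI[where F'="\<lambda>v. 0"]) simp

lemma pd_bilinear:
  assumes "bounded_bilinear b" "f differentiable (at \<theta>)" "g differentiable (at \<theta>)"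
  shows "pd i (\<lambda>\<xi>. b (f \<xi>) (g \<xi>)) \<theta> = b (f \<theta>) (pd i g \<theta>) + b (pd i f \<theta>) (g \<theta>)"
    and "(\<lambda>\<xi>. b (f \<xi>) (g \<xi>)) differentiable (at \<theta>)"
proof -
  have "((\<lambda>\<xi>. b (f \<xi>) (g \<xi>)) has_derivative
      (\<lambda>v. b (f \<theta>) (frechet_derivative g (at \<theta>) v) + b (frechet_derivative f (at \<theta>) v) (g \<theta>))) (at \<theta>)"
    using assms by - (rule bounded_bilinear.FDERIV, simp_all add: frechet_derivative_works)
  note D = this
  show "pd i (\<lambda>\<xi>. b (f \<xi>) (g \<xi>)) \<theta> = b (f \<theta>) (pd i g \<theta>) + b (pd i f \<theta>) (g \<theta>)"
    using pd_eqI[OF D, of i] by (simp add: pd_def[of i g] pd_def[of i f])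
  show "(\<lambda>\<xi>. b (f \<xi>) (g \<xi>)) differentiable (at \<theta>)"
    using D by (rule differentiableI)
qed

lemmas pd_inner = pd_bilinear(1)[OF bounded_bilinear_inner]
  and differentiable_inner' = pd_bilinear(2)[OF bounded_bilinear_inner]
  and pd_scaleR = pd_bilinear(1)[OF bounded_bilinear_scaleR]
  and differentiable_scaleR' = pd_bilinear(2)[OF bounded_bilinear_scaleR]
  and pd_mult = pd_bilinear(1)[OF bounded_bilinear_mult]
  and differentiable_mult' = pd_bilinear(2)[OF bounded_bilinear_mult]

lemma pd_linear:
  assumes "bounded_linear L" "f differentiable (at \<theta>)"
  shows "pd i (\<lambda>\<xi>. L (f \<xi>)) \<theta> = L (pd i f \<theta>)"
    and "(\<lambda>\<xi>. L (f \<xi>)) differentiable (at \<theta>)"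
proof -
  have "((\<lambda>\<xi>. L (f \<xi>)) has_derivative (\<lambda>v. L (frechet_derivative f (at \<theta>) v))) (at \<theta>)"
    using assms by - (rule bounded_linear.has_derivative, simp_all add: frechet_derivative_works)
  note D = this
  show "pd i (\<lambda>\<xi>. L (f \<xi>)) \<theta> = L (pd i f \<theta>)"
    using pd_eqI[OF D, of i] by (simp add: pd_def[of i f])
  show "(\<lambda>\<xi>. L (f \<xi>)) differentiable (at \<theta>)"
    using D by (rule differentiableI)
qed

lemmas pd_nth = pd_linear(1)[OF bounded_linear_vec_nth]
  and differentiable_nth = pd_linear(2)[OF bounded_linear_vec_nth]

lemma pd_sum:
  assumes "\<And>a. a \<in> A \<Longrightarrow> f a differentiable (at \<theta>)"
  shows "pd i (\<lambda>\<xi>. \<Sum>a\<in>A. f a \<xi>) \<theta> = (\<Sum>a\<in>A. pd i (f a) \<theta>)"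
    and "(\<lambda>\<xi>. \<Sum>a\<in>A. f a \<xi>) differentiable (at \<theta>)"
proof -
  have "((\<lambda>\<xi>. \<Sum>a\<in>A. f a \<xi>) has_derivative (\<lambda>v. \<Sum>a\<in>A. frechet_derivative (f a) (at \<theta>) v)) (at \<theta>)"
    using assms by - (rule has_derivative_sum, simp add: frechet_derivative_works)
  note D = this
  show "pd i (\<lambda>\<xi>. \<Sum>a\<in>A. f a \<xi>) \<theta> = (\<Sum>a\<in>A. pd i (f a) \<theta>)"
    using pd_eqI[OF D, of i] by (simp add: pd_def[of i "f _"])
  show "(\<lambda>\<xi>. \<Sum>a\<in>A. f a \<xi>) differentiable (at \<theta>)"
    using D by (rule differentiableI)
qed

lemma differentiable_vec:
  fixes f :: "real^'n \<Rightarrow> 'b::euclidean_space^'m"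
  assumes "\<And>k. (\<lambda>\<xi>. f \<xi> $ k) differentiable (at \<theta>)"
  shows "f differentiable (at \<theta>)"
proof (subst differentiable_componentwise_within, intro ballI)
  fix b :: "'b^'m" assume "b \<in> Basis"
  then obtain k u where b: "b = axis k u" by (auto simp: Basis_vec_def)
  have "(\<lambda>\<xi>. f \<xi> $ k \<bullet> u) differentiable (at \<theta>)"
    by (rule pd_linear(2)[OF bounded_linear_inner_left assms])
  then show "(\<lambda>x. f x \<bullet> b) differentiable (at \<theta>)" by (simp add: b inner_axis)
qed

lemma pd_compose:
  fixes F :: "real^'m \<Rightarrow> 'b::real_normed_vector" and \<tau> :: "real^'n \<Rightarrow> real^'m"
  assumes "\<tau> differentiable (at \<theta>)" "F differentiable (at (\<tau> \<theta>))"
  shows "pd i (\<lambda>\<xi>. F (\<tau> \<xi>)) \<theta> = (\<Sum>a\<in>UNIV. pd i \<tau> \<theta> $ a *\<^sub>R pd a F (\<tau> \<theta>))"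
    and "(\<lambda>\<xi>. F (\<tau> \<xi>)) differentiable (at \<theta>)"
proof -
  have "((\<lambda>\<xi>. F (\<tau> \<xi>)) has_derivative
     (\<lambda>v. (\<lambda>v. \<Sum>i\<in>UNIV. v $ i *\<^sub>R pd i F (\<tau> \<theta>)) (frechet_derivative \<tau> (at \<theta>) v))) (at \<theta>)"
    using has_derivative_compose[of \<tau> "frechet_derivative \<tau> (at \<theta>)" \<theta> UNIV F, OF _ has_derivative_pd] assms
    by (simp add: frechet_derivative_works)
  note D = this
  show "pd i (\<lambda>\<xi>. F (\<tau> \<xi>)) \<theta> = (\<Sum>a\<in>UNIV. pd i \<tau> \<theta> $ a *\<^sub>R pd a F (\<tau> \<theta>))"
    using pd_eqI[OF D, of i] by (simp add: pd_def[of i \<tau>])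
  show "(\<lambda>\<xi>. F (\<tau> \<xi>)) differentiable (at \<theta>)"
    using D by (rule differentiableI)
qed

text \<open>Pointwise on purpose: chart transitions are handled at the point in question, and
  symmetry of their second derivatives is carried along as a separate hypothesis.\<close>

definition twice_differentiable_at :: "(real^'n \<Rightarrow> 'b::real_normed_vector) \<Rightarrow> real^'n \<Rightarrow> bool" where
  "twice_differentiable_at F \<theta> \<longleftrightarrow>
     eventually (\<lambda>\<xi>. F differentiable (at \<xi>)) (nhds \<theta>) \<and> (\<forall>i. pd i F differentiable (at \<theta>))"

lemma twice_differentiable_atD:
  assumes "twice_differentiable_at F \<theta>"
  shows "F differentiable (at \<theta>)" "pd i F differentiable (at \<theta>)" 
    "eventually (\<lambda>\<xi>. F differentiable (at \<xi>)) (nhds \<theta>)"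
proof -
  show *: "eventually (\<lambda>\<xi>. F differentiable (at \<xi>)) (nhds \<theta>)"
    and "pd i F differentiable (at \<theta>)"
    using assms by (simp_all add: twice_differentiable_at_def)
  show "F differentiable (at \<theta>)"
    using * by (rule eventually_nhds_x_imp_x)
qed

lemma pd2_compose:
  fixes F :: "real^'m \<Rightarrow> 'b::real_normed_vector" and \<tau> :: "real^'n \<Rightarrow> real^'m"
  assumes \<tau>: "twice_differentiable_at \<tau> \<theta>" and F: "twice_differentiable_at F (\<tau> \<theta>)"
  shows "pd i (pd j (\<lambda>\<xi>. F (\<tau> \<xi>))) \<theta> =
      (\<Sum>a\<in>UNIV. pd i (pd j \<tau>) \<theta> $ a *\<^sub>R pd a F (\<tau> \<theta>)) +
      (\<Sum>a\<in>UNIV. \<Sum>b\<in>UNIV. (pd j \<tau> \<theta> $ a * pd i \<tau> \<theta> $ b) *\<^sub>R pd b (pd a F) (\<tau> \<theta>))" (is ?eq)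
    and "twice_differentiable_at (\<lambda>\<xi>. F (\<tau> \<xi>)) \<theta>"
proof -
  have c: "isCont \<tau> \<theta>"
    using twice_differentiable_atD(1)[OF \<tau>] by (rule differentiable_imp_continuous_within)
  have ev: "eventually (\<lambda>\<xi>. F differentiable (at (\<tau> \<xi>))) (nhds \<theta>)"
    using eventually_compose_filterlim[OF twice_differentiable_atD(3)[OF F]] c
    by (simp add: isCont_def tendsto_at_iff_tendsto_nhds)
  have ev1: "eventually (\<lambda>\<xi>. pd j (\<lambda>\<xi>. F (\<tau> \<xi>)) \<xi> = (\<Sum>a\<in>UNIV. pd j \<tau> \<xi> $ a *\<^sub>R pd a F (\<tau> \<xi>)))
     (nhds \<theta>)" for j
    using ev twice_differentiable_atD(3)[OF \<tau>] by eventually_elim (rule pd_compose)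
  have d1: "(\<lambda>\<xi>. pd j \<tau> \<xi> $ a) differentiable (at \<theta>)" for j a
    by (rule differentiable_nth[OF twice_differentiable_atD(2)[OF \<tau>]])
  have d2: "(\<lambda>\<xi>. pd a F (\<tau> \<xi>)) differentiable (at \<theta>)" for a
    by (rule pd_compose(2)[OF twice_differentiable_atD(1)[OF \<tau>] twice_differentiable_atD(2)[OF F]])
  have d3: "(\<lambda>\<xi>. \<Sum>a\<in>UNIV. pd j \<tau> \<xi> $ a *\<^sub>R pd a F (\<tau> \<xi>)) differentiable (at \<theta>)" for j
    by (rule pd_sum(2)) (rule differentiable_scaleR'[OF d1 d2])
  show "twice_differentiable_at (\<lambda>\<xi>. F (\<tau> \<xi>)) \<theta>"
    unfolding twice_differentiable_at_def
  proof (intro conjI allI)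
    show "\<forall>\<^sub>F \<xi> in nhds \<theta>. (\<lambda>\<xi>. F (\<tau> \<xi>)) differentiable at \<xi>"
      using ev twice_differentiable_atD(3)[OF \<tau>] by eventually_elim (rule pd_compose)
    show "pd j (\<lambda>\<xi>. F (\<tau> \<xi>)) differentiable at \<theta>" for j
      using d3 differentiable_cong_nhds[OF ev1] by blast
  qed
  have "pd i (pd j (\<lambda>\<xi>. F (\<tau> \<xi>))) \<theta> = pd i (\<lambda>\<xi>. \<Sum>a\<in>UNIV. pd j \<tau> \<xi> $ a *\<^sub>R pd a F (\<tau> \<xi>)) \<theta>"
    by (rule pd_cong_nhds[OF ev1])
  also have "\<dots> = (\<Sum>a\<in>UNIV. pd j \<tau> \<theta> $ a *\<^sub>R (\<Sum>b\<in>UNIV. pd i \<tau> \<theta> $ b *\<^sub>R pd b (pd a F) (\<tau> \<theta>))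
      + pd i (pd j \<tau>) \<theta> $ a *\<^sub>R pd a F (\<tau> \<theta>))"
    by (simp add: pd_sum(1)[OF differentiable_scaleR'[OF d1 d2]] pd_scaleR[OF d1 d2]
        pd_nth[OF twice_differentiable_atD(2)[OF \<tau>]]
        pd_compose(1)[OF twice_differentiable_atD(1)[OF \<tau>] twice_differentiable_atD(2)[OF F]])
  finally show ?eq by (simp add: sum.distrib scaleR_sum_right add.commute)
qed

section \<open>Symmetry of second derivatives\<close>

lemma pd_line:
  fixes F :: "real^'n \<Rightarrow> real"
  assumes "F differentiable (at (a + s *\<^sub>R axis i 1))"
  shows "((\<lambda>s. F (a + s *\<^sub>R axis i 1)) has_real_derivative pd i F (a + s *\<^sub>R axis i 1)) (at s)"
proof -
  have "((\<lambda>s. a + s *\<^sub>R axis i 1 :: real^'n) has_derivative (\<lambda>h. h *\<^sub>R axis i 1)) (at s)"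
    by (auto intro!: derivative_eq_intros)
  then have "((\<lambda>s. F (a + s *\<^sub>R axis i 1)) has_derivative
     (\<lambda>h. (\<lambda>v. \<Sum>k\<in>UNIV. v $ k *\<^sub>R pd k F (a + s *\<^sub>R axis i 1)) (h *\<^sub>R axis i 1))) (at s)"
    using has_derivative_compose[of "\<lambda>s. a + s *\<^sub>R axis i 1" "\<lambda>h. h *\<^sub>R axis i 1" s UNIV F,
        OF _ has_derivative_pd[OF assms]]
    by simp
  moreover have "(\<lambda>v. \<Sum>k\<in>UNIV. v $ k *\<^sub>R pd k F (a + s *\<^sub>R axis i 1)) (h *\<^sub>R axis i 1)
     = pd i F (a + s *\<^sub>R axis i 1) * h" for h
    using sum_axis_scaleR[of i "\<lambda>k. h * pd k F (a + s *\<^sub>R axis i 1)"] by (simp add: mult_ac)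
  ultimately show ?thesis unfolding has_field_derivative_def by (simp only:)
qed

text \<open>The mean value theorem is applied twice: to the increment in direction j as a function
  of the i-th coordinate, then to \<open>pd i F\<close> along direction j. The whole square lies
  within 2h of \<open>\<theta>\<close>, hence in the ball.\<close>

lemma second_difference:
  fixes F :: "real^'n \<Rightarrow> real"
  assumes U: "ball \<theta> r \<subseteq> U" and h: "0 < h" "2 * h < r"
    and d1: "\<And>\<xi>. \<xi> \<in> U \<Longrightarrow> F differentiable (at \<xi>)"
    and d2: "\<And>\<xi>. \<xi> \<in> U \<Longrightarrow> pd i F differentiable (at \<xi>)"
  obtains \<xi> where "dist \<theta> \<xi> \<le> 2 * h"
    "F (\<theta> + h *\<^sub>R axis i 1 + h *\<^sub>R axis j 1) - F (\<theta> + h *\<^sub>R axis i 1) - F (\<theta> + h *\<^sub>R axis j 1) + F \<theta>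
       = h * (h * pd j (pd i F) \<xi>)"
proof -
  have d: "dist \<theta> (\<theta> + s *\<^sub>R axis i 1 + t *\<^sub>R axis j 1) \<le> 2 * h" if "0 \<le> s" "s \<le> h" "0 \<le> t" "t \<le> h" for s t
  proof -
    have "norm (s *\<^sub>R axis i 1 + t *\<^sub>R axis j (1::real) :: real^'n) \<le> \<bar>s\<bar> + \<bar>t\<bar>"
      by (rule order_trans[OF norm_triangle_ineq]) simp
    also have "\<dots> \<le> 2 * h" using that by simp
    finally show ?thesis by (metis add.assoc add_diff_cancel_left' dist_commute dist_norm)
  qed
  have inU: "\<theta> + s *\<^sub>R axis i 1 + t *\<^sub>R axis j 1 \<in> U" if "0 \<le> s" "s \<le> h" "0 \<le> t" "t \<le> h" for s t
    using d[OF that] h U by (auto simp: subset_iff)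
  define \<phi> where "\<phi> s = F (\<theta> + h *\<^sub>R axis j 1 + s *\<^sub>R axis i 1) - F (\<theta> + s *\<^sub>R axis i 1)" for s
  have "\<exists>s. 0 < s \<and> s < h \<and> \<phi> h - \<phi> 0 = (h - 0) *
     (pd i F (\<theta> + h *\<^sub>R axis j 1 + s *\<^sub>R axis i 1) - pd i F (\<theta> + s *\<^sub>R axis i 1))"
  proof (rule MVT2)
    fix s assume s: "0 \<le> s" "s \<le> h"
    have "\<theta> + h *\<^sub>R axis j 1 + s *\<^sub>R axis i 1 \<in> U" "\<theta> + s *\<^sub>R axis i 1 \<in> U"
      using inU[of s h] inU[of s 0] s h by (simp_all add: add_ac)
    then show "(\<phi> has_real_derivative
        pd i F (\<theta> + h *\<^sub>R axis j 1 + s *\<^sub>R axis i 1) - pd i F (\<theta> + s *\<^sub>R axis i 1)) (at s)"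
      unfolding \<phi>_def by (intro DERIV_diff pd_line d1)
  qed (use h in auto)
  then obtain s where s: "0 < s" "s < h" "\<phi> h - \<phi> 0 = h *
     (pd i F (\<theta> + h *\<^sub>R axis j 1 + s *\<^sub>R axis i 1) - pd i F (\<theta> + s *\<^sub>R axis i 1))" by auto
  have "\<exists>t. 0 < t \<and> t < h \<and> pd i F (\<theta> + s *\<^sub>R axis i 1 + h *\<^sub>R axis j 1) - pd i F (\<theta> + s *\<^sub>R axis i 1 + 0 *\<^sub>R axis j 1)
      = (h - 0) * (pd j (pd i F) (\<theta> + s *\<^sub>R axis i 1 + t *\<^sub>R axis j 1))"
    by (rule MVT2) (use h s in \<open>auto intro!: pd_line d2 inU\<close>)
  then obtain t where t: "0 < t" "t < h" "pd i F (\<theta> + s *\<^sub>R axis i 1 + h *\<^sub>R axis j 1) - pd i F (\<theta> + s *\<^sub>R axis i 1)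
      = h * (pd j (pd i F) (\<theta> + s *\<^sub>R axis i 1 + t *\<^sub>R axis j 1))" by auto
  show ?thesis
  proof (rule that)
    show "dist \<theta> (\<theta> + s *\<^sub>R axis i 1 + t *\<^sub>R axis j 1) \<le> 2 * h" using s t by (intro d) auto
    show "F (\<theta> + h *\<^sub>R axis i 1 + h *\<^sub>R axis j 1) - F (\<theta> + h *\<^sub>R axis i 1) - F (\<theta> + h *\<^sub>R axis j 1) + F \<theta>
       = h * (h * pd j (pd i F) (\<theta> + s *\<^sub>R axis i 1 + t *\<^sub>R axis j 1))"
      using s(3) t(3) by (simp add: \<phi>_def add_ac)
  qed
qed

text \<open>The second difference over a small square is unchanged when i and j are swapped, so the
  two mixed derivatives coincide at a pair of points arbitrarily close to \<open>\<theta>\<close>;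
  continuity closes the gap.\<close>

lemma pd_commute_real:
  fixes F :: "real^'n \<Rightarrow> real"
  assumes U: "open U" "\<theta> \<in> U"
    and d1: "\<And>\<xi>. \<xi> \<in> U \<Longrightarrow> F differentiable (at \<xi>)"
    and d2: "\<And>\<xi> i. \<xi> \<in> U \<Longrightarrow> pd i F differentiable (at \<xi>)"
    and c: "\<And>i j. isCont (pd i (pd j F)) \<theta>"
  shows "pd i (pd j F) \<theta> = pd j (pd i F) \<theta>"
proof -
  obtain r where r: "r > 0" "ball \<theta> r \<subseteq> U" using U openE by blast
  have "\<bar>pd i (pd j F) \<theta> - pd j (pd i F) \<theta>\<bar> \<le> 0 + e" if e: "e > 0" for e
  proof -
    obtain d where d: "d > 0"
      "\<And>\<xi>. dist \<xi> \<theta> < d \<Longrightarrow> dist (pd i (pd j F) \<xi>) (pd i (pd j F) \<theta>) < e/2"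
      using c[of i j] e unfolding continuous_at_eps_delta by (metis half_gt_zero)
    obtain d' where d': "d' > 0"
      "\<And>\<xi>. dist \<xi> \<theta> < d' \<Longrightarrow> dist (pd j (pd i F) \<xi>) (pd j (pd i F) \<theta>) < e/2"
      using c[of j i] e unfolding continuous_at_eps_delta by (metis half_gt_zero)
    \<comment> \<open>Division by 3 keeps twice the side of the square below all three
      radii.\<close>
    define h where "h = min r (min d d') / 3"
    have h: "0 < h" "2 * h < r" "2 * h < d" "2 * h < d'" using r d d' by (auto simp: h_def min_def)
    obtain \<xi> where \<xi>: "dist \<theta> \<xi> \<le> 2 * h"
    "F (\<theta> + h *\<^sub>R axis i 1 + h *\<^sub>R axis j 1) - F (\<theta> + h *\<^sub>R axis i 1) - F (\<theta> + h *\<^sub>R axis j 1) + F \<theta>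
       = h * (h * pd j (pd i F) \<xi>)"
      using second_difference[OF r(2) h(1,2) d1 d2] by blast
    obtain \<xi>' where \<xi>': "dist \<theta> \<xi>' \<le> 2 * h"
    "F (\<theta> + h *\<^sub>R axis j 1 + h *\<^sub>R axis i 1) - F (\<theta> + h *\<^sub>R axis j 1) - F (\<theta> + h *\<^sub>R axis i 1) + F \<theta>
       = h * (h * pd i (pd j F) \<xi>')"
      using second_difference[OF r(2) h(1,2) d1 d2] by blast
    have "h * (h * pd i (pd j F) \<xi>') = h * (h * pd j (pd i F) \<xi>)"
      unfolding \<xi>(2)[symmetric] \<xi>'(2)[symmetric] by (simp add: add_ac)
    then have "pd i (pd j F) \<xi>' = pd j (pd i F) \<xi>" using h by auto
    moreover have "dist \<xi>' \<theta> < d" "dist \<xi> \<theta> < d'" using \<xi> \<xi>' h by (auto simp: dist_commute)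
    ultimately show ?thesis using d(2)[of \<xi>'] d'(2)[of \<xi>] by (auto simp: dist_real_def abs_if split: if_splits)
  qed
  then have "\<bar>pd i (pd j F) \<theta> - pd j (pd i F) \<theta>\<bar> \<le> 0" by (rule field_le_epsilon)
  then show ?thesis by simp
qed

lemma pd_commute:
  fixes F :: "real^'n \<Rightarrow> 'b::euclidean_space"
  assumes U: "open U" "\<theta> \<in> U"
    and d1: "\<And>\<xi>. \<xi> \<in> U \<Longrightarrow> F differentiable (at \<xi>)"
    and d2: "\<And>\<xi> i. \<xi> \<in> U \<Longrightarrow> pd i F differentiable (at \<xi>)"
    and c: "\<And>i j. continuous_on U (pd i (pd j F))"
  shows "pd i (pd j F) \<theta> = pd j (pd i F) \<theta>"
proof (rule euclidean_eqI)
  fix b :: 'b assume "b \<in> Basis"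
  let ?G = "\<lambda>\<xi>. F \<xi> \<bullet> b"
  have p1: "pd i ?G \<xi> = pd i F \<xi> \<bullet> b" if "\<xi> \<in> U" for i \<xi>
    using pd_linear(1)[OF bounded_linear_inner_left d1[OF that]] .
  have e1: "eventually (\<lambda>\<xi>. pd i ?G \<xi> = pd i F \<xi> \<bullet> b) (nhds \<xi>)" if "\<xi> \<in> U" for i \<xi>
    using p1 U that by (auto simp: eventually_nhds)
  have p2: "pd i (pd j ?G) \<xi> = pd i (pd j F) \<xi> \<bullet> b" if "\<xi> \<in> U" for i j \<xi>
    using pd_cong_nhds[OF e1[OF that]] pd_linear(1)[OF bounded_linear_inner_left d2[OF that]] by metis
  have "pd i (pd j ?G) \<theta> = pd j (pd i ?G) \<theta>"
  proof (rule pd_commute_real[OF U])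
    show "?G differentiable at \<xi>" if "\<xi> \<in> U" for \<xi> 
      using pd_linear(2)[OF bounded_linear_inner_left d1[OF that]] .
    show "pd i ?G differentiable at \<xi>" if "\<xi> \<in> U" for i \<xi>
      using differentiable_cong_nhds[OF e1[OF that]] pd_linear(2)[OF bounded_linear_inner_left d2[OF that]] by blast
    fix i j
    have "continuous_on U (\<lambda>\<xi>. pd i (pd j F) \<xi> \<bullet> b)"
      by (intro continuous_intros c)
    then have "continuous_on U (pd i (pd j ?G))"
      by (rule continuous_on_eq) (simp add: p2)
    then show "isCont (pd i (pd j ?G)) \<theta>" using U continuous_on_eq_continuous_at by blast
  qed
  then show "pd i (pd j F) \<theta> \<bullet> b = pd j (pd i F) \<theta> \<bullet> b" using p2 U by simp
qed

section \<open>Maps of class C1 and C2\<close>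

lemma ball_Basis_vec: "(\<forall>b\<in>Basis. P b) \<longleftrightarrow> (\<forall>i. P (axis i (1::real)))"
  by (auto simp: Basis_vec_def)

lemma Ck_on_1:
  fixes F :: "real^'n \<Rightarrow> 'b::real_normed_vector"
  shows "Ck_on 1 F U \<longleftrightarrow> (\<forall>\<theta>\<in>U. F differentiable (at \<theta>)) \<and> (\<forall>i. continuous_on U (pd i F))"
  by (simp only: One_nat_def Ck_on.simps ball_Basis_vec pd_def[abs_def])

lemma Ck_on_2:
  fixes F :: "real^'n \<Rightarrow> 'b::real_normed_vector"
  shows "Ck_on 2 F U \<longleftrightarrow> (\<forall>\<theta>\<in>U. F differentiable (at \<theta>)) \<and>
     (\<forall>i. \<forall>\<theta>\<in>U. pd i F differentiable (at \<theta>)) \<and> (\<forall>i j. continuous_on U (pd i (pd j F)))"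
  by (simp only: numeral_2_eq_2 Ck_on.simps ball_Basis_vec pd_def[abs_def]) blast

lemma Ck_on_2D:
  fixes F :: "real^'n \<Rightarrow> 'b::real_normed_vector"
  assumes "Ck_on 2 F U"
  shows "\<theta> \<in> U \<Longrightarrow> F differentiable (at \<theta>)" "\<theta> \<in> U \<Longrightarrow> pd i F differentiable (at \<theta>)"
    "continuous_on U (pd i (pd j F))" "continuous_on U F" "continuous_on U (pd i F)"
proof -
  show d1: "F differentiable (at \<theta>)" if "\<theta> \<in> U" for \<theta>
    using assms that by (simp add: Ck_on_2)
  show d2: "pd i F differentiable (at \<theta>)" if "\<theta> \<in> U" for \<theta>
    using assms that by (simp add: Ck_on_2)
  show "continuous_on U (pd i (pd j F))"
    using assms by (simp add: Ck_on_2)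
  show "continuous_on U F" "continuous_on U (pd i F)"
    using d1 d2 by (auto intro: continuous_at_imp_continuous_on differentiable_imp_continuous_within)
qed

lemma Ck_on_2_imp_1:
  fixes F :: "real^'n \<Rightarrow> 'b::real_normed_vector"
  assumes "Ck_on 2 F U"
  shows "Ck_on 1 F U"
  unfolding Ck_on_1 by (intro conjI ballI allI Ck_on_2D[OF assms])

lemma Ck_on_2_imp_twice_differentiable:
  fixes F :: "real^'n \<Rightarrow> 'b::real_normed_vector"
  assumes "Ck_on 2 F U" "open U" "\<theta> \<in> U"
  shows "twice_differentiable_at F \<theta>"
  unfolding twice_differentiable_at_def
proof (intro conjI allI)
  show "\<forall>\<^sub>F \<xi> in nhds \<theta>. F differentiable at \<xi>"
    using eventually_nhds_in_open[OF assms(2,3)] by (rule eventually_mono) (rule Ck_on_2D(1)[OF assms(1)])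
qed (rule Ck_on_2D(2)[OF assms(1,3)])

lemma Ck_on_2_pd_commute:
  fixes F :: "real^'n \<Rightarrow> 'b::euclidean_space"
  assumes "Ck_on 2 F U" "open U" "\<theta> \<in> U"
  shows "pd i (pd j F) \<theta> = pd j (pd i F) \<theta>"
  by (rule pd_commute[OF assms(2,3) Ck_on_2D(1-3)[OF assms(1)]])

lemma smooth_on_Ck: "smooth_on F U \<Longrightarrow> Ck_on k F U"
  by (simp add: smooth_on_def)

lemma Ck_on_cong:
  assumes "open U" "\<And>\<xi>. \<xi> \<in> U \<Longrightarrow> f \<xi> = g \<xi>" "Ck_on k f U"
  shows "Ck_on k g U"
  using assms(2,3)
proof (induction k arbitrary: f g)
  case 0
  then show ?case by (auto cong: continuous_on_cong)
next
  case (Suc k)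
  have ev: "eventually (\<lambda>\<xi>. f \<xi> = g \<xi>) (nhds \<xi>)" if "\<xi> \<in> U" for \<xi>
    using eventually_nhds_in_open[OF assms(1) that] by (rule eventually_mono) (rule Suc.prems(1))
  have fd: "frechet_derivative f (at \<xi>) = frechet_derivative g (at \<xi>)" if "\<xi> \<in> U" for \<xi>
    unfolding frechet_derivative_def by (simp add: has_derivative_cong_nhds[OF ev[OF that]])
  show ?case
    unfolding Ck_on.simps
  proof (intro conjI ballI)
    show "g differentiable (at \<xi>)" if "\<xi> \<in> U" for \<xi>
      using differentiable_cong_nhds[OF ev[OF that]] Suc.prems(2) that by simp
    show "Ck_on k (\<lambda>\<xi>. frechet_derivative g (at \<xi>) b) U" if "b \<in> Basis" for b
      by (rule Suc.IH[of "\<lambda>\<xi>. frechet_derivative f (at \<xi>) b"]) (use fd Suc.prems(2) that in auto)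
  qed
qed

section \<open>Determinants and inverse matrices depending on parameters\<close>

lemma matrix_inv_left: "invertible (A :: real^'m^'m) \<Longrightarrow> matrix_inv A ** A = mat 1"
  and matrix_inv_right: "invertible (A :: real^'m^'m) \<Longrightarrow> A ** matrix_inv A = mat 1"
  unfolding invertible_def matrix_inv_def by (metis (mono_tags, lifting) someI_ex)+

lemma matrix_left_right_inverse_eq:
  fixes A B C :: "real^'m^'m"
  assumes "B ** A = mat 1" "A ** C = mat 1"
  shows "B = C"
proof -
  have "B = B ** (A ** C)" by (simp add: assms(2))
  also have "\<dots> = (B ** A) ** C" by (rule matrix_mul_assoc)
  finally show ?thesis by (simp add: assms(1))
qed

text \<open>In terms of the rows of \<open>A\<close> the vector \<open>v\<close> has the
  coefficients \<open>transpose (matrix_inv A) *v v\<close>. The determinant is multilinear and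
  alternating in the rows, so only the k-th coefficient survives.\<close>

lemma det_replace_row:
  fixes A :: "real^'m^'m"
  assumes "det A \<noteq> 0"
  shows "det (\<chi> r. if r = k then v else A $ r) = det A * (\<Sum>c\<in>UNIV. v $ c * matrix_inv A $ c $ k)"
proof -
  have inv: "matrix_inv A ** A = mat 1"
    using assms invertible_det_nz matrix_inv_left by blast
  define x where "x = transpose (matrix_inv A) *v v"
  have "(\<Sum>i\<in>UNIV. x $ i *s row i A) = transpose A *v x"
    by (simp add: matrix_mult_sum column_transpose[symmetric] row_def column_def transpose_def)
  also have "\<dots> = v"
    unfolding x_def matrix_vector_mul_assoc matrix_transpose_mul[symmetric] inv by (simp add: transpose_mat)
  finally have v: "(\<Sum>i\<in>UNIV. x $ i *s row i A) = v" .
  have "det (\<chi> r. if r = k then v else A $ r) =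
      det (\<chi> i. if i = k then (\<Sum>i\<in>UNIV. x $ i *s row i A) else row i A)"
    unfolding v by (rule arg_cong[of _ _ det]) (simp add: vec_eq_iff row_def)
  also have "\<dots> = x $ k * det A" by (rule cramer_lemma_transpose)
  finally show ?thesis
    by (simp add: x_def matrix_vector_mult_def transpose_def mult.commute)
qed

text \<open>Jacobi's formula. The product rule on the Leibniz expansion yields one determinant per
  row, with that row differentiated, and \<open>det_replace_row\<close> evaluates each of
  them.\<close>

lemma pd_det:
  fixes A :: "real^'n \<Rightarrow> real^'m^'m"
  assumes A: "\<And>r c. (\<lambda>\<xi>. A \<xi> $ r $ c) differentiable (at \<theta>)"
  shows "(\<lambda>\<xi>. det (A \<xi>)) differentiable (at \<theta>)"
    and "det (A \<theta>) \<noteq> 0 \<Longrightarrow> pd i (\<lambda>\<xi>. det (A \<xi>)) \<theta> =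
      det (A \<theta>) * (\<Sum>r\<in>UNIV. \<Sum>c\<in>UNIV. pd i (\<lambda>\<xi>. A \<xi> $ r $ c) \<theta> * matrix_inv (A \<theta>) $ c $ r)"
proof -
  let ?d = "\<lambda>r c. frechet_derivative (\<lambda>\<xi>. A \<xi> $ r $ c) (at \<theta>)"
  have D: "((\<lambda>\<xi>. det (A \<xi>)) has_derivative (\<lambda>v. \<Sum>p\<in>{p. p permutes UNIV}. of_int (sign p) *
      (\<Sum>r\<in>UNIV. ?d r (p r) v * (\<Prod>j\<in>UNIV - {r}. A \<theta> $ j $ p j)))) (at \<theta>)"
    unfolding det_def using A
    by (intro has_derivative_sum has_derivative_mult_right has_derivative_prod)
      (simp add: frechet_derivative_works)
  then show "(\<lambda>\<xi>. det (A \<xi>)) differentiable (at \<theta>)" by (rule differentiableI)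
  assume nz: "det (A \<theta>) \<noteq> 0"
  have "pd i (\<lambda>\<xi>. det (A \<xi>)) \<theta> = (\<Sum>p\<in>{p. p permutes UNIV}. of_int (sign p) *
      (\<Sum>r\<in>UNIV. pd i (\<lambda>\<xi>. A \<xi> $ r $ p r) \<theta> * (\<Prod>j\<in>UNIV - {r}. A \<theta> $ j $ p j)))"
    using pd_eqI[OF D, of i] by (simp add: pd_def)
  also have "\<dots> = (\<Sum>r\<in>UNIV. \<Sum>p\<in>{p. p permutes UNIV}. of_int (sign p) *
      (pd i (\<lambda>\<xi>. A \<xi> $ r $ p r) \<theta> * (\<Prod>j\<in>UNIV - {r}. A \<theta> $ j $ p j)))"
    by (simp add: sum_distrib_left sum.swap[of _ UNIV])
  also have "\<dots> = (\<Sum>r\<in>UNIV. det (\<chi> j. if j = r then (\<chi> c. pd i (\<lambda>\<xi>. A \<xi> $ r $ c) \<theta>) else A \<theta> $ j))"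
  proof (rule sum.cong[OF refl])
    fix r :: 'm
    show "(\<Sum>p\<in>{p. p permutes UNIV}. of_int (sign p) *
      (pd i (\<lambda>\<xi>. A \<xi> $ r $ p r) \<theta> * (\<Prod>j\<in>UNIV - {r}. A \<theta> $ j $ p j))) =
      det (\<chi> j. if j = r then (\<chi> c. pd i (\<lambda>\<xi>. A \<xi> $ r $ c) \<theta>) else A \<theta> $ j)"
      unfolding det_def by (rule sum.cong[OF refl]) (simp add: prod.remove[of UNIV r])
  qed
  also have "\<dots> = det (A \<theta>) * (\<Sum>r\<in>UNIV. \<Sum>c\<in>UNIV. pd i (\<lambda>\<xi>. A \<xi> $ r $ c) \<theta> * matrix_inv (A \<theta>) $ c $ r)"
    by (simp add: det_replace_row[OF nz] sum_distrib_left)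
  finally show "pd i (\<lambda>\<xi>. det (A \<xi>)) \<theta> =
      det (A \<theta>) * (\<Sum>r\<in>UNIV. \<Sum>c\<in>UNIV. pd i (\<lambda>\<xi>. A \<xi> $ r $ c) \<theta> * matrix_inv (A \<theta>) $ c $ r)" .
qed

text \<open>Cramer's rule. Being quotients of determinants, the entries of the inverse inherit
  continuity and differentiability from the entries of the matrix.\<close>

lemma matrix_inv_nth:
  fixes A :: "real^'m^'m"
  assumes "det A \<noteq> 0"
  shows "matrix_inv A $ k $ l = det (\<chi> i j. if j = k then axis l 1 $ i else A $ i $ j) / det A"
proof -
  have "A ** matrix_inv A = mat 1"
    using assms invertible_det_nz matrix_inv_right by blast
  then have "A *v (matrix_inv A *v axis l 1) = axis l 1"
    by (simp add: matrix_vector_mul_assoc)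
  then have "matrix_inv A *v axis l 1 = (\<chi> k. det (\<chi> i j. if j = k then axis l 1 $ i else A $ i $ j) / det A)"
    using cramer[OF assms] by blast
  moreover have "matrix_inv A $ k $ l = (matrix_inv A *v axis l 1) $ k"
    by (simp add: matrix_vector_mul_component inner_axis row_def)
  ultimately show ?thesis by simp
qed

lemma differentiable_matrix_inv:
  fixes A :: "real^'n \<Rightarrow> real^'m^'m"
  assumes A: "\<And>r c. (\<lambda>\<xi>. A \<xi> $ r $ c) differentiable (at \<theta>)" and nz: "det (A \<theta>) \<noteq> 0"
  shows "(\<lambda>\<xi>. matrix_inv (A \<xi>) $ k $ l) differentiable (at \<theta>)"
    and "eventually (\<lambda>\<xi>. det (A \<xi>) \<noteq> 0) (nhds \<theta>)"
proof -
  note d = pd_det(1)[OF A]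
  have "isCont (\<lambda>\<xi>. det (A \<xi>)) \<theta>"
    using d by (rule differentiable_imp_continuous_within)
  then have "eventually (\<lambda>\<xi>. det (A \<xi>) \<noteq> 0) (at \<theta>)"
    using nz by (metis continuous_within tendsto_imp_eventually_ne)
  then show ev: "eventually (\<lambda>\<xi>. det (A \<xi>) \<noteq> 0) (nhds \<theta>)"
    using nz by (simp add: eventually_nhds_conv_at)
  have "(\<lambda>\<xi>. det (\<chi> i j. if j = k then axis l 1 $ i else A \<xi> $ i $ j)) differentiable (at \<theta>)"
  proof (rule pd_det(1))
    fix r c
    show "(\<lambda>\<xi>. (\<chi> i j. if j = k then axis l 1 $ i else A \<xi> $ i $ j) $ r $ c) differentiable at \<theta>"
      using A by (cases "c = k") simp_all
  qed
  then have "(\<lambda>\<xi>. det (\<chi> i j. if j = k then axis l 1 $ i else A \<xi> $ i $ j) / det (A \<xi>))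
      differentiable (at \<theta>)"
    using d nz by (rule differentiable_divide)
  moreover have "eventually (\<lambda>\<xi>. matrix_inv (A \<xi>) $ k $ l =
      det (\<chi> i j. if j = k then axis l 1 $ i else A \<xi> $ i $ j) / det (A \<xi>)) (nhds \<theta>)"
    using ev by eventually_elim (rule matrix_inv_nth)
  ultimately show "(\<lambda>\<xi>. matrix_inv (A \<xi>) $ k $ l) differentiable (at \<theta>)"
    by (simp add: differentiable_cong_nhds)
qed

lemma continuous_on_det:
  fixes A :: "'a::topological_space \<Rightarrow> real^'m^'m"
  assumes "\<And>r c. continuous_on S (\<lambda>\<xi>. A \<xi> $ r $ c)"
  shows "continuous_on S (\<lambda>\<xi>. det (A \<xi>))"
  unfolding det_def by (intro continuous_intros assms)

lemma continuous_on_matrix_inv: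
  fixes A :: "'a::topological_space \<Rightarrow> real^'m^'m"
  assumes A: "\<And>r c. continuous_on S (\<lambda>\<xi>. A \<xi> $ r $ c)" and nz: "\<And>\<xi>. \<xi> \<in> S \<Longrightarrow> det (A \<xi>) \<noteq> 0"
  shows "continuous_on S (\<lambda>\<xi>. matrix_inv (A \<xi>) $ k $ l)"
proof -
  have "continuous_on S (\<lambda>\<xi>. det (\<chi> i j. if j = k then axis l 1 $ i else A \<xi> $ i $ j))"
  proof (rule continuous_on_det)
    fix r c
    show "continuous_on S (\<lambda>\<xi>. (\<chi> i j. if j = k then axis l 1 $ i else A \<xi> $ i $ j) $ r $ c)"
      using A by (cases "c = k") simp_all
  qed
  then have "continuous_on S (\<lambda>\<xi>. det (\<chi> i j. if j = k then axis l 1 $ i else A \<xi> $ i $ j) / det (A \<xi>))"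
    using continuous_on_det[OF A] nz by (intro continuous_on_divide) auto
  then show ?thesis by (rule continuous_on_eq) (simp add: matrix_inv_nth[OF nz])
qed

lemma matrix_inv_mult_nth:
  fixes A :: "real^'m^'m"
  assumes "det A \<noteq> 0"
  shows "(\<Sum>b\<in>UNIV. A $ a $ b * matrix_inv A $ b $ l) = (if a = l then 1 else 0)"
    and "(\<Sum>b\<in>UNIV. matrix_inv A $ a $ b * A $ b $ l) = (if a = l then 1 else 0)"
proof -
  have "A ** matrix_inv A = mat 1" "matrix_inv A ** A = mat 1"
    using assms invertible_det_nz matrix_inv_right matrix_inv_left by blast+
  then have "(A ** matrix_inv A) $ a $ l = mat 1 $ a $ l" "(matrix_inv A ** A) $ a $ l = mat 1 $ a $ l"
    by simp_all
  then show "(\<Sum>b\<in>UNIV. A $ a $ b * matrix_inv A $ b $ l) = (if a = l then 1 else 0)"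
    and "(\<Sum>b\<in>UNIV. matrix_inv A $ a $ b * A $ b $ l) = (if a = l then 1 else 0)"
    by (simp_all add: matrix_matrix_mult_def mat_def)
qed

text \<open>Obtained by differentiating \<open>A ** matrix_inv A = mat 1\<close> entrywise and
  multiplying by the inverse from the left.\<close>

lemma pd_matrix_inv:
  fixes A :: "real^'n \<Rightarrow> real^'m^'m"
  assumes A: "\<And>r c. (\<lambda>\<xi>. A \<xi> $ r $ c) differentiable (at \<theta>)" and nz: "det (A \<theta>) \<noteq> 0"
  shows "pd i (\<lambda>\<xi>. matrix_inv (A \<xi>) $ k $ l) \<theta> =
    - (\<Sum>a\<in>UNIV. \<Sum>b\<in>UNIV. matrix_inv (A \<theta>) $ k $ a * pd i (\<lambda>\<xi>. A \<xi> $ a $ b) \<theta> * matrix_inv (A \<theta>) $ b $ l)"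
proof -
  let ?I = "\<lambda>\<xi>. matrix_inv (A \<xi>)"
  note dI = differentiable_matrix_inv(1)[OF A nz]
  have "(\<Sum>b\<in>UNIV. A \<theta> $ a $ b * pd i (\<lambda>\<xi>. ?I \<xi> $ b $ l) \<theta>) =
      - (\<Sum>b\<in>UNIV. pd i (\<lambda>\<xi>. A \<xi> $ a $ b) \<theta> * ?I \<theta> $ b $ l)" for a
  proof -
    have "eventually (\<lambda>\<xi>. (\<Sum>b\<in>UNIV. A \<xi> $ a $ b * ?I \<xi> $ b $ l) = (if a = l then 1 else 0)) (nhds \<theta>)"
      using differentiable_matrix_inv(2)[OF A nz] by eventually_elim (rule matrix_inv_mult_nth)
    then have "pd i (\<lambda>\<xi>. \<Sum>b\<in>UNIV. A \<xi> $ a $ b * ?I \<xi> $ b $ l) \<theta> = pd i (\<lambda>\<xi>. if a = l then 1 else 0) \<theta>"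
      by (rule pd_cong_nhds)
    then have "(\<Sum>b\<in>UNIV. A \<theta> $ a $ b * pd i (\<lambda>\<xi>. ?I \<xi> $ b $ l) \<theta> + pd i (\<lambda>\<xi>. A \<xi> $ a $ b) \<theta> * ?I \<theta> $ b $ l) = 0"
      by (simp add: pd_sum(1)[OF differentiable_mult'[OF A dI]] pd_mult[OF A dI])
    then show ?thesis by (simp add: sum.distrib)
  qed
  then have "(\<Sum>a\<in>UNIV. ?I \<theta> $ k $ a * (\<Sum>b\<in>UNIV. A \<theta> $ a $ b * pd i (\<lambda>\<xi>. ?I \<xi> $ b $ l) \<theta>)) =
      - (\<Sum>a\<in>UNIV. \<Sum>b\<in>UNIV. ?I \<theta> $ k $ a * pd i (\<lambda>\<xi>. A \<xi> $ a $ b) \<theta> * ?I \<theta> $ b $ l)"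
    by (simp add: sum_distrib_left sum_negf mult.assoc)
  moreover have "(\<Sum>a\<in>UNIV. ?I \<theta> $ k $ a * (\<Sum>b\<in>UNIV. A \<theta> $ a $ b * pd i (\<lambda>\<xi>. ?I \<xi> $ b $ l) \<theta>)) =
      (\<Sum>b\<in>UNIV. (\<Sum>a\<in>UNIV. ?I \<theta> $ k $ a * A \<theta> $ a $ b) * pd i (\<lambda>\<xi>. ?I \<xi> $ b $ l) \<theta>)"
    unfolding sum_distrib_left sum_distrib_right by (subst sum.swap) (simp add: mult.assoc)
  moreover have "\<dots> = (\<Sum>b\<in>UNIV. if k = b then pd i (\<lambda>\<xi>. ?I \<xi> $ b $ l) \<theta> else 0)"
    by (rule sum.cong[OF refl]) (simp add: matrix_inv_mult_nth(2)[OF nz])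
  ultimately show ?thesis by simp
qed

lemma matrix_inv_symmetric:
  fixes A :: "real^'m^'m"
  assumes "det A \<noteq> 0" "transpose A = A"
  shows "matrix_inv A $ k $ l = matrix_inv A $ l $ k"
proof -
  have i: "matrix_inv A ** A = mat 1"  "A ** matrix_inv A = mat 1"
    using assms invertible_det_nz matrix_inv_left matrix_inv_right by blast+
  have "transpose (matrix_inv A) ** A = mat 1"
    using i(2) assms(2) by (metis matrix_transpose_mul transpose_mat)
  then have "transpose (matrix_inv A) = matrix_inv A"
    using i(2) by (rule matrix_left_right_inverse_eq)
  then have "transpose (matrix_inv A) $ k $ l = matrix_inv A $ k $ l" by simp
  then show ?thesis by (simp add: transpose_def)
qed

section \<open>Induced metric and Laplacian of an immersion\<close>

definition gram :: "(real^'n \<Rightarrow> 'v::real_inner) \<Rightarrow> real^'n \<Rightarrow> real^'n^'n" where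
  "gram Y \<theta> = (\<chi> i j. pd i Y \<theta> \<bullet> pd j Y \<theta>)"

lemma gram_nth: "gram Y \<theta> $ i $ j = pd i Y \<theta> \<bullet> pd j Y \<theta>"
  by (simp add: gram_def)

lemma pullback_metric_eq_gram: "pullback_metric f X = gram (f \<circ> X)"
  by (rule ext) (simp add: pullback_metric_def gram_def)

text \<open>Injectivity of the differential in terms of partial derivatives alone, so that it passes
  directly to maps that agree near \<open>\<theta>\<close>.\<close>

definition immersed_at :: "(real^'n \<Rightarrow> 'v::real_normed_vector) \<Rightarrow> real^'n \<Rightarrow> bool" where
  "immersed_at Y \<theta> \<longleftrightarrow> (\<forall>v. (\<Sum>i\<in>UNIV. v $ i *\<^sub>R pd i Y \<theta>) = 0 \<longrightarrow> v = 0)"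

lemma immersed_at_iff_inj:
  fixes Y :: "real^'n \<Rightarrow> 'v::real_normed_vector"
  assumes "Y differentiable (at \<theta>)"
  shows "immersed_at Y \<theta> \<longleftrightarrow> inj (frechet_derivative Y (at \<theta>))"
proof -
  have l: "linear (frechet_derivative Y (at \<theta>))"
    by (rule linear_frechet_derivative[OF assms])
  show ?thesis
    unfolding immersed_at_def linear_injective_0[OF l] pd_def linear_axis_expansion[OF l, symmetric] ..
qed

lemma gram_quadratic: "v \<bullet> (gram Y \<theta> *v w) = (\<Sum>i\<in>UNIV. v $ i *\<^sub>R pd i Y \<theta>) \<bullet> (\<Sum>i\<in>UNIV. w $ i *\<^sub>R pd i Y \<theta>)"
  by (simp add: gram_def inner_vec_def matrix_vector_mult_def inner_sum_left inner_sum_right sum_distrib_left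
      mult.assoc mult.commute mult.left_commute) (rule sum.swap)

text \<open>For v in the kernel of the Gram matrix, the quadratic form, which is the squared length
  of the differential applied to v, vanishes.\<close>

lemma det_gram_nonzero:
  assumes "immersed_at Y \<theta>"
  shows "det (gram Y \<theta>) \<noteq> 0"
proof -
  have "v = 0" if "gram Y \<theta> *v v = 0" for v
  proof -
    have "v \<bullet> (gram Y \<theta> *v v) = 0" using that by simp
    then show ?thesis using assms unfolding gram_quadratic immersed_at_def by simp
  qed
  then have "inj ((*v) (gram Y \<theta>))"
    using linear_injective_0[OF matrix_vector_mul_linear] by blast
  then show ?thesis
    using det_nz_iff_inj[OF matrix_vector_mul_linear, of "gram Y \<theta>"] by simp
qed

lemma transpose_gram: "transpose (gram Y \<theta>) = gram Y \<theta>"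
  by (simp add: gram_def transpose_def vec_eq_iff inner_commute)

lemma matrix_inv_gram_symmetric:
  "immersed_at Y \<theta> \<Longrightarrow> matrix_inv (gram Y \<theta>) $ k $ l = matrix_inv (gram Y \<theta>) $ l $ k"
  by (rule matrix_inv_symmetric[OF det_gram_nonzero transpose_gram])

lemma pd_gram:
  assumes "twice_differentiable_at Y \<theta>"
  shows "pd i (\<lambda>\<xi>. gram Y \<xi> $ l $ j) \<theta> = pd l Y \<theta> \<bullet> pd i (pd j Y) \<theta> + pd i (pd l Y) \<theta> \<bullet> pd j Y \<theta>"
    and "(\<lambda>\<xi>. gram Y \<xi> $ l $ j) differentiable (at \<theta>)"
  using twice_differentiable_atD(2)[OF assms] by (auto simp: gram_def intro: pd_inner differentiable_inner')

text \<open>Of the six products that arise from the three metric derivatives, four cancel by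
  symmetry of the second derivatives, and the product of \<open>pd i (pd j Y)\<close> with
  \<open>pd l Y\<close> is left twice.\<close>

lemma christoffel_gram:
  assumes "twice_differentiable_at Y \<theta>" and sym: "\<And>i j. pd i (pd j Y) \<theta> = pd j (pd i Y) \<theta>"
  shows "christoffel (gram Y) \<theta> k i j =
    (\<Sum>l\<in>UNIV. matrix_inv (gram Y \<theta>) $ k $ l * (pd i (pd j Y) \<theta> \<bullet> pd l Y \<theta>))"
proof -
  have "pd i (\<lambda>\<xi>. gram Y \<xi> $ l $ j) \<theta> + pd j (\<lambda>\<xi>. gram Y \<xi> $ l $ i) \<theta> - pd l (\<lambda>\<xi>. gram Y \<xi> $ i $ j) \<theta>
     = 2 * (pd i (pd j Y) \<theta> \<bullet> pd l Y \<theta>)" for l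
    using sym[of i j] sym[of i l] sym[of j l] by (simp add: pd_gram(1)[OF assms(1)] inner_commute)
  then show ?thesis
    by (simp add: christoffel_def sum_distrib_left)
qed

text \<open>Covariant Hessian for the metric induced by \<open>Y\<close>; for \<open>F = Y\<close>
  it is the vector-valued second fundamental form.\<close>

definition hess :: "(real^'n \<Rightarrow> 'v::real_inner) \<Rightarrow> (real^'n \<Rightarrow> 'b::real_normed_vector) \<Rightarrow> real^'n \<Rightarrow> 'n \<Rightarrow> 'n \<Rightarrow> 'b" where
  "hess Y F \<theta> i j = pd i (pd j F) \<theta> - (\<Sum>k\<in>UNIV. christoffel (gram Y) \<theta> k i j *\<^sub>R pd k F \<theta>)"

definition lap :: "(real^'n \<Rightarrow> 'v::real_inner) \<Rightarrow> (real^'n \<Rightarrow> 'b::real_normed_vector) \<Rightarrow> real^'n \<Rightarrow> 'b" where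
  "lap Y F \<theta> = (\<Sum>i\<in>UNIV. \<Sum>j\<in>UNIV. matrix_inv (gram Y \<theta>) $ i $ j *\<^sub>R hess Y F \<theta> i j)"

text \<open>Normality of the remainder fixes the tangential part of \<open>pd i (pd j Y)\<close>,
  and invertibility of the Gram matrix then fixes the coefficients. This identifies Christoffel
  symbols in a new chart without expanding derivatives of the transformed metric.\<close>

lemma christoffel_unique:
  assumes Y: "twice_differentiable_at Y \<theta>" "\<And>i j. pd i (pd j Y) \<theta> = pd j (pd i Y) \<theta>" "immersed_at Y \<theta>"
    and c: "\<And>l. (pd i (pd j Y) \<theta> - (\<Sum>k\<in>UNIV. c k *\<^sub>R pd k Y \<theta>)) \<bullet> pd l Y \<theta> = 0"
  shows "christoffel (gram Y) \<theta> k i j = c k"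
proof -
  have "pd i (pd j Y) \<theta> \<bullet> pd l Y \<theta> = (\<Sum>m\<in>UNIV. gram Y \<theta> $ l $ m * c m)" for l
  proof -
    have "gram Y \<theta> $ l $ m * c m = c m * (pd m Y \<theta> \<bullet> pd l Y \<theta>)" for m
      by (simp add: gram_nth inner_commute)
    then have "(\<Sum>m\<in>UNIV. gram Y \<theta> $ l $ m * c m) = (\<Sum>m\<in>UNIV. c m * (pd m Y \<theta> \<bullet> pd l Y \<theta>))"
      by (rule sum.cong[OF refl])
    then show ?thesis using c[of l] by (simp add: inner_diff_left inner_sum_left)
  qed
  then have "christoffel (gram Y) \<theta> k i j = (\<Sum>l\<in>UNIV. \<Sum>m\<in>UNIV. matrix_inv (gram Y \<theta>) $ k $ l * gram Y \<theta> $ l $ m * c m)"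
    by (simp add: christoffel_gram[OF Y(1,2)] sum_distrib_left mult.assoc)
  also have "\<dots> = (\<Sum>m\<in>UNIV. (\<Sum>l\<in>UNIV. matrix_inv (gram Y \<theta>) $ k $ l * gram Y \<theta> $ l $ m) * c m)"
    by (subst sum.swap) (simp add: sum_distrib_right)
  also have "\<dots> = (\<Sum>m\<in>UNIV. if k = m then c m else 0)"
    by (rule sum.cong[OF refl]) (simp add: matrix_inv_mult_nth(2)[OF det_gram_nonzero[OF Y(3)]])
  finally show ?thesis by simp
qed

text \<open>Gauss formula: the Christoffel term is exactly the tangential part of the second
  derivative.\<close>

lemma hess_self_normal:
  assumes Y: "twice_differentiable_at Y \<theta>" "\<And>i j. pd i (pd j Y) \<theta> = pd j (pd i Y) \<theta>" "immersed_at Y \<theta>"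
  shows "hess Y Y \<theta> i j \<bullet> pd l Y \<theta> = 0"
proof -
  note sy = matrix_inv_gram_symmetric[OF Y(3)]
  have "(\<Sum>k\<in>UNIV. christoffel (gram Y) \<theta> k i j *\<^sub>R pd k Y \<theta>) \<bullet> pd l Y \<theta> =
     (\<Sum>k\<in>UNIV. \<Sum>m\<in>UNIV. matrix_inv (gram Y \<theta>) $ m $ k * (pd i (pd j Y) \<theta> \<bullet> pd m Y \<theta>) * gram Y \<theta> $ k $ l)"
    unfolding christoffel_gram[OF Y(1,2)] inner_sum_left inner_scaleR_left sum_distrib_right
    by (intro sum.cong refl) (subst sy, simp add: gram_nth)
  also have "\<dots> = (\<Sum>m\<in>UNIV. (pd i (pd j Y) \<theta> \<bullet> pd m Y \<theta>) * (\<Sum>k\<in>UNIV. matrix_inv (gram Y \<theta>) $ m $ k * gram Y \<theta> $ k $ l))"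
    by (subst sum.swap) (simp add: sum_distrib_left mult_ac)
  also have "\<dots> = (\<Sum>m\<in>UNIV. if m = l then pd i (pd j Y) \<theta> \<bullet> pd m Y \<theta> else 0)"
    by (rule sum.cong[OF refl]) (simp add: matrix_inv_mult_nth(2)[OF det_gram_nonzero[OF Y(3)]])
  finally show ?thesis by (simp add: hess_def inner_diff_left)
qed

lemma lap_self_normal:
  assumes Y: "twice_differentiable_at Y \<theta>" "\<And>i j. pd i (pd j Y) \<theta> = pd j (pd i Y) \<theta>" "immersed_at Y \<theta>"
  shows "lap Y Y \<theta> \<bullet> pd l Y \<theta> = 0"
  by (simp add: lap_def inner_sum_left hess_self_normal[OF Y])

text \<open>With J the matrix of the entries \<open>pd i \<tau> \<theta> $ a\<close>, the new Gram
  matrix is J G J^T. Cancelling the invertible J gives J^T (J G J^T)^-1 J = G^-1.\<close>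

lemma matrix_inv_gram_change:
  fixes Y :: "real^'n \<Rightarrow> 'v::real_inner" and \<tau> :: "real^'n \<Rightarrow> real^'n"
  assumes \<tau>: "\<tau> differentiable (at \<theta>)" "immersed_at \<tau> \<theta>" and Y: "Y differentiable (at (\<tau> \<theta>))" "immersed_at Y (\<tau> \<theta>)"
  shows "immersed_at (\<lambda>\<xi>. Y (\<tau> \<xi>)) \<theta>"
    and "(\<Sum>i\<in>UNIV. \<Sum>j\<in>UNIV. matrix_inv (gram (\<lambda>\<xi>. Y (\<tau> \<xi>)) \<theta>) $ i $ j * (pd j \<tau> \<theta> $ a * pd i \<tau> \<theta> $ b)) =
      matrix_inv (gram Y (\<tau> \<theta>)) $ b $ a"
proof -
  let ?Y = "\<lambda>\<xi>. Y (\<tau> \<xi>)"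
  define J where "J = (\<chi> i a. pd i \<tau> \<theta> $ a)"
  note p = pd_compose(1)[OF \<tau>(1) Y(1)]
  show im: "immersed_at ?Y \<theta>"
    unfolding immersed_at_def
  proof (intro allI impI)
    fix v assume "(\<Sum>i\<in>UNIV. v $ i *\<^sub>R pd i ?Y \<theta>) = 0"
    moreover have "(\<Sum>i\<in>UNIV. v $ i *\<^sub>R pd i ?Y \<theta>) =
       (\<Sum>a\<in>UNIV. (\<Sum>i\<in>UNIV. v $ i *\<^sub>R pd i \<tau> \<theta>) $ a *\<^sub>R pd a Y (\<tau> \<theta>))"
      unfolding p by (simp add: scaleR_sum_right scaleR_sum_left) (rule sum.swap)
    ultimately have "(\<Sum>i\<in>UNIV. v $ i *\<^sub>R pd i \<tau> \<theta>) = 0"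
      using Y(2)[unfolded immersed_at_def, rule_format, of "\<Sum>i\<in>UNIV. v $ i *\<^sub>R pd i \<tau> \<theta>"] by simp
    then show "v = 0" using \<tau>(2) unfolding immersed_at_def by blast
  qed
  let ?G1 = "gram ?Y \<theta>" and ?G = "gram Y (\<tau> \<theta>)"
  have g: "?G1 = J ** ?G ** transpose J"
    by (simp add: vec_eq_iff gram_def p J_def matrix_matrix_mult_def transpose_def inner_sum_left inner_sum_right
        sum_distrib_left sum_distrib_right mult_ac)
  have nz: "det ?G1 \<noteq> 0" by (rule det_gram_nonzero[OF im])
  then have nJ: "det J \<noteq> 0" by (auto simp: g det_mul)
  have nG: "det ?G \<noteq> 0" by (rule det_gram_nonzero[OF Y(2)])
  have i1: "matrix_inv ?G1 ** ?G1 = mat 1" using nz invertible_det_nz matrix_inv_left by blast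
  have iJ: "J ** matrix_inv J = mat 1" "matrix_inv J ** J = mat 1"
    using nJ invertible_det_nz matrix_inv_left matrix_inv_right by blast+
  have iG: "?G ** matrix_inv ?G = mat 1" using nG invertible_det_nz matrix_inv_right by blast
  define T where "T = transpose J" 
  have TT: "T ** transpose (matrix_inv J) = mat 1" "transpose (matrix_inv J) ** T = mat 1"
    unfolding T_def by (simp_all add: matrix_transpose_mul[symmetric] iJ transpose_mat)
  have g': "?G1 = J ** (?G ** T)" by (simp add: g T_def matrix_mul_assoc)
  have JG: "J ** ?G = ?G1 ** transpose (matrix_inv J)"
    unfolding g' by (simp add: matrix_mul_assoc[symmetric] TT)
  have "(T ** matrix_inv ?G1 ** J) ** ?G = T ** (matrix_inv ?G1 ** (J ** ?G))"
    by (simp add: matrix_mul_assoc)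
  also have "\<dots> = T ** ((matrix_inv ?G1 ** ?G1) ** transpose (matrix_inv J))"
    by (simp add: JG matrix_mul_assoc)
  also have "\<dots> = mat 1" by (simp add: i1 TT)
  finally have "T ** matrix_inv ?G1 ** J = matrix_inv ?G"
    using iG by (rule matrix_left_right_inverse_eq)
  then have "matrix_inv ?G $ b $ a = (T ** matrix_inv ?G1 ** J) $ b $ a" by simp
  also have "\<dots> = (\<Sum>i\<in>UNIV. \<Sum>j\<in>UNIV. matrix_inv ?G1 $ i $ j * (pd j \<tau> \<theta> $ a * pd i \<tau> \<theta> $ b))"
    by (simp add: T_def J_def matrix_matrix_mult_def transpose_def sum_distrib_right sum_distrib_left mult_ac)
      (subst sum.swap, simp add: mult_ac)
  finally show "(\<Sum>i\<in>UNIV. \<Sum>j\<in>UNIV. matrix_inv ?G1 $ i $ j * (pd j \<tau> \<theta> $ a * pd i \<tau> \<theta> $ b)) =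
      matrix_inv ?G $ b $ a" by simp
qed

lemma immersed_at_surj:
  fixes \<tau> :: "real^'n \<Rightarrow> real^'n"
  assumes "immersed_at \<tau> \<theta>"
  obtains c where "(\<Sum>k\<in>UNIV. c $ k *\<^sub>R pd k \<tau> \<theta>) = d"
proof -
  let ?L = "\<lambda>c. \<Sum>k\<in>UNIV. c $ k *\<^sub>R pd k \<tau> \<theta>"
  have l: "linear ?L"
    by (rule linearI) (simp_all add: sum.distrib scaleR_add_left scaleR_sum_right)
  have "inj ?L" using assms unfolding immersed_at_def linear_injective_0[OF l] .
  then have "surj ?L" by (rule linear_inj_imp_surj[OF l])
  then have "d \<in> range ?L" by simp
  then obtain c where "d = ?L c" by (rule rangeE)
  then show ?thesis by (intro that[of c]) simp
qed

text \<open>Besides Hessian terms, the second-order chain rule produces first derivatives of the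
  composite, with coefficients c that depend only on \<open>\<tau>\<close> and \<open>Y\<close>. For
  \<open>F = Y\<close> the Hessian terms are normal, so \<open>christoffel_unique\<close> recognizes
  c as the Christoffel symbols of the composite immersion; the formula for general \<open>F\<close>
  follows.\<close>

lemma hess_compose:
  fixes Y :: "real^'n \<Rightarrow> 'v::real_inner" and \<tau> :: "real^'n \<Rightarrow> real^'n" and F :: "real^'n \<Rightarrow> 'b::real_normed_vector"
  assumes \<tau>: "twice_differentiable_at \<tau> \<theta>" "immersed_at \<tau> \<theta>" "\<And>i j. pd i (pd j \<tau>) \<theta> = pd j (pd i \<tau>) \<theta>"
    and Y: "twice_differentiable_at Y (\<tau> \<theta>)" "immersed_at Y (\<tau> \<theta>)" "\<And>i j. pd i (pd j Y) (\<tau> \<theta>) = pd j (pd i Y) (\<tau> \<theta>)"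
    and F: "twice_differentiable_at F (\<tau> \<theta>)"
  shows "hess (\<lambda>\<xi>. Y (\<tau> \<xi>)) (\<lambda>\<xi>. F (\<tau> \<xi>)) \<theta> i j =
     (\<Sum>a\<in>UNIV. \<Sum>b\<in>UNIV. (pd j \<tau> \<theta> $ a * pd i \<tau> \<theta> $ b) *\<^sub>R hess Y F (\<tau> \<theta>) b a)"
proof -
  let ?Y = "\<lambda>\<xi>. Y (\<tau> \<xi>)" and ?J = "\<lambda>a b. pd j \<tau> \<theta> $ a * pd i \<tau> \<theta> $ b"
  \<comment> \<open>The vector that the new Christoffel symbols have to represent in the basis of
    the \<open>pd k \<tau> \<theta>\<close>: the inhomogeneous second derivative of
    \<open>\<tau>\<close> plus the pulled-back old symbols.\<close>
  define d where "d = (\<chi> q. pd i (pd j \<tau>) \<theta> $ q + (\<Sum>a\<in>UNIV. \<Sum>b\<in>UNIV. ?J a b * christoffel (gram Y) (\<tau> \<theta>) q b a))"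
  obtain c where c: "(\<Sum>k\<in>UNIV. c $ k *\<^sub>R pd k \<tau> \<theta>) = d"
    using immersed_at_surj[OF \<tau>(2)] by blast
  \<comment> \<open>Stated for an arbitrary target space because it serves both \<open>Y\<close> and
    the given \<open>F\<close>, with the same c.\<close>
  have key: "pd i (pd j (\<lambda>\<xi>. F (\<tau> \<xi>))) \<theta> - (\<Sum>k\<in>UNIV. c $ k *\<^sub>R pd k (\<lambda>\<xi>. F (\<tau> \<xi>)) \<theta>) =
     (\<Sum>a\<in>UNIV. \<Sum>b\<in>UNIV. ?J a b *\<^sub>R hess Y F (\<tau> \<theta>) b a)"
    if F: "twice_differentiable_at F (\<tau> \<theta>)" for F :: "real^'n \<Rightarrow> 'c::real_normed_vector"
  proof -
    have "(\<Sum>k\<in>UNIV. c $ k *\<^sub>R pd k (\<lambda>\<xi>. F (\<tau> \<xi>)) \<theta>) =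
       (\<Sum>q\<in>UNIV. (\<Sum>k\<in>UNIV. c $ k *\<^sub>R pd k \<tau> \<theta>) $ q *\<^sub>R pd q F (\<tau> \<theta>))"
      unfolding pd_compose(1)[OF twice_differentiable_atD(1)[OF \<tau>(1)] twice_differentiable_atD(1)[OF F]]
      by (simp add: scaleR_sum_right scaleR_sum_left) (rule sum.swap)
    also have "\<dots> = (\<Sum>q\<in>UNIV. pd i (pd j \<tau>) \<theta> $ q *\<^sub>R pd q F (\<tau> \<theta>)) +
       (\<Sum>q\<in>UNIV. \<Sum>a\<in>UNIV. \<Sum>b\<in>UNIV. (?J a b * christoffel (gram Y) (\<tau> \<theta>) q b a) *\<^sub>R pd q F (\<tau> \<theta>))"
      unfolding c d_def by (simp add: scaleR_add_left sum.distrib scaleR_sum_left)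
    also have "(\<Sum>q\<in>UNIV. \<Sum>a\<in>UNIV. \<Sum>b\<in>UNIV. (?J a b * christoffel (gram Y) (\<tau> \<theta>) q b a) *\<^sub>R pd q F (\<tau> \<theta>)) =
       (\<Sum>a\<in>UNIV. \<Sum>b\<in>UNIV. \<Sum>q\<in>UNIV. (?J a b * christoffel (gram Y) (\<tau> \<theta>) q b a) *\<^sub>R pd q F (\<tau> \<theta>))"
      by (subst sum.swap) (intro sum.cong refl sum.swap)
    finally show ?thesis
      unfolding pd2_compose(1)[OF \<tau>(1) F] hess_def
      by (simp add: scaleR_diff_right sum_subtractf scaleR_sum_right)
  qed
  have tY: "twice_differentiable_at ?Y \<theta>" by (rule pd2_compose(2)[OF \<tau>(1) Y(1)])
  have symY: "pd i (pd j ?Y) \<theta> = pd j (pd i ?Y) \<theta>" for i j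
    unfolding pd2_compose(1)[OF \<tau>(1) Y(1)]
    by (subst \<tau>(3), rule arg_cong2[of _ _ _ _ "(+)"], rule refl, subst sum.swap, subst Y(3), simp add: mult.commute)
  have imY: "immersed_at ?Y \<theta>"
    by (rule matrix_inv_gram_change(1)[OF twice_differentiable_atD(1)[OF \<tau>(1)] \<tau>(2) twice_differentiable_atD(1)[OF Y(1)] Y(2)])
  have "christoffel (gram ?Y) \<theta> k i j = c $ k" for k
  proof (rule christoffel_unique[OF tY symY imY])
    fix l
    have n: "hess Y Y (\<tau> \<theta>) b a \<bullet> pd m Y (\<tau> \<theta>) = 0" for a b m
      by (rule hess_self_normal[OF Y(1,3,2)])
    show "(pd i (pd j ?Y) \<theta> - (\<Sum>k\<in>UNIV. c $ k *\<^sub>R pd k ?Y \<theta>)) \<bullet> pd l ?Y \<theta> = 0"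
      unfolding key[OF Y(1)] unfolding pd_compose(1)[OF twice_differentiable_atD(1)[OF \<tau>(1)] twice_differentiable_atD(1)[OF Y(1)]]
      by (simp add: inner_sum_left inner_sum_right n)
  qed
  then show ?thesis
    using key[OF F] by (simp add: hess_def[of ?Y])
qed

text \<open>The two Jacobian factors produced by \<open>hess_compose\<close> are those that
  \<open>matrix_inv_gram_change\<close> absorbs into the inverse metric.\<close>

theorem lap_compose:
  fixes Y :: "real^'n \<Rightarrow> 'v::real_inner" and \<tau> :: "real^'n \<Rightarrow> real^'n" and F :: "real^'n \<Rightarrow> 'b::real_normed_vector"
  assumes \<tau>: "twice_differentiable_at \<tau> \<theta>" "immersed_at \<tau> \<theta>" "\<And>i j. pd i (pd j \<tau>) \<theta> = pd j (pd i \<tau>) \<theta>"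
    and Y: "twice_differentiable_at Y (\<tau> \<theta>)" "immersed_at Y (\<tau> \<theta>)" "\<And>i j. pd i (pd j Y) (\<tau> \<theta>) = pd j (pd i Y) (\<tau> \<theta>)"
    and F: "twice_differentiable_at F (\<tau> \<theta>)"
  shows "lap (\<lambda>\<xi>. Y (\<tau> \<xi>)) (\<lambda>\<xi>. F (\<tau> \<xi>)) \<theta> = lap Y F (\<tau> \<theta>)"
proof -
  let ?Y = "\<lambda>\<xi>. Y (\<tau> \<xi>)"
  let ?t = "\<lambda>i j a b. (matrix_inv (gram ?Y \<theta>) $ i $ j * (pd j \<tau> \<theta> $ a * pd i \<tau> \<theta> $ b)) *\<^sub>R hess Y F (\<tau> \<theta>) b a"
  note ch = matrix_inv_gram_change(2)[OF twice_differentiable_atD(1)[OF \<tau>(1)] \<tau>(2) twice_differentiable_atD(1)[OF Y(1)] Y(2)]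
  have "lap ?Y (\<lambda>\<xi>. F (\<tau> \<xi>)) \<theta> = (\<Sum>i\<in>UNIV. \<Sum>j\<in>UNIV. \<Sum>a\<in>UNIV. \<Sum>b\<in>UNIV. ?t i j a b)"
    by (simp add: lap_def hess_compose[OF assms] scaleR_sum_right)
  also have "\<dots> = (\<Sum>i\<in>UNIV. \<Sum>a\<in>UNIV. \<Sum>b\<in>UNIV. \<Sum>j\<in>UNIV. ?t i j a b)"
    by (rule sum.cong[OF refl], subst sum.swap, intro sum.cong refl sum.swap)
  also have "\<dots> = (\<Sum>a\<in>UNIV. \<Sum>b\<in>UNIV. \<Sum>i\<in>UNIV. \<Sum>j\<in>UNIV. ?t i j a b)"
    by (subst sum.swap, intro sum.cong refl sum.swap)
  also have "\<dots> = (\<Sum>a\<in>UNIV. \<Sum>b\<in>UNIV. matrix_inv (gram Y (\<tau> \<theta>)) $ b $ a *\<^sub>R hess Y F (\<tau> \<theta>) b a)"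
    by (simp add: ch[symmetric] scaleR_sum_left)
  also have "\<dots> = lap Y F (\<tau> \<theta>)"
    unfolding lap_def by (rule sum.swap)
  finally show ?thesis .
qed

section \<open>Hausdorff measure\<close>

lemma hausdorff_premeasure_le:
  assumes "A \<subseteq> (\<Union>i. C i)" "\<And>i. bounded (C i)" "\<And>i. diameter (C i) \<le> \<delta>"
  shows "hausdorff_premeasure n \<delta> A \<le>
    (\<Sum>i. if C i = {} then 0 else ennreal (unit_ball_vol (real n) * (diameter (C i) / 2) ^ n))"
  unfolding hausdorff_premeasure_def using assms by (intro INF_lower) auto

lemma hausdorff_outer_mono: "A \<subseteq> B \<Longrightarrow> hausdorff_outer n A \<le> hausdorff_outer n B"
  unfolding hausdorff_outer_def hausdorff_premeasure_def
  by (intro SUP_mono') (intro INF_superset_mono, auto)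

lemma diameter_image_le:
  fixes f :: "'a::metric_space \<Rightarrow> 'b::metric_space"
  assumes L: "0 \<le> L" and f: "\<And>a b. a \<in> S \<Longrightarrow> b \<in> S \<Longrightarrow> dist (f a) (f b) \<le> L * dist a b" and S: "bounded S"
  shows "bounded (f ` S)" "diameter (f ` S) \<le> L * diameter S"
proof -
  have le: "dist (f a) (f b) \<le> L * diameter S" if "a \<in> S" "b \<in> S" for a b
    using f[OF that] diameter_bounded_bound[OF S that] L by (meson mult_left_mono order_trans)
  show "bounded (f ` S)"
    unfolding bounded_def using le by (cases "S = {}") blast+
  show "diameter (f ` S) \<le> L * diameter S"
  proof (cases "S = {}")
    case False
    then show ?thesis
      unfolding diameter_def[of "f ` S"] using le by (auto intro!: cSUP_least)
  qed (simp add: diameter_def)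
qed

text \<open>A cover of S is intersected with S, where alone the Lipschitz bound is known, and mapped
  by f. Diameters grow at most by the factor L, their n-th powers by \<open>L ^ n\<close>.\<close>

lemma hausdorff_premeasure_lipschitz:
  fixes f :: "'a::metric_space \<Rightarrow> 'b::metric_space"
  assumes L: "0 < L" and f: "\<And>a b. a \<in> S \<Longrightarrow> b \<in> S \<Longrightarrow> dist (f a) (f b) \<le> L * dist a b"
  shows "hausdorff_premeasure n (L * \<delta>) (f ` S) \<le> ennreal (L ^ n) * hausdorff_premeasure n \<delta> S"
proof -
  let ?t = "\<lambda>C. if C = {} then 0 else ennreal (unit_ball_vol (real n) * (diameter C / 2) ^ n)"
  let ?t' = "\<lambda>C. if C = {} then 0 else ennreal (unit_ball_vol (real n) * (diameter C / 2) ^ n)"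
  \<comment> \<open>Dividing by \<open>L ^ n\<close> turns the claim into a lower bound for an
    infimum over covers.\<close>
  have "ennreal (1 / L ^ n) * hausdorff_premeasure n (L * \<delta>) (f ` S) \<le> hausdorff_premeasure n \<delta> S"
    unfolding hausdorff_premeasure_def[of n \<delta> S]
  proof (rule INF_greatest)
    fix C :: "nat \<Rightarrow> 'a set"
    assume C: "C \<in> {C. S \<subseteq> (\<Union>i. C i) \<and> (\<forall>i. bounded (C i) \<and> diameter (C i) \<le> \<delta>)}"
    define C' where "C' i = f ` (C i \<inter> S)" for i
    have b: "bounded (C i \<inter> S)" for i using C by (auto intro: bounded_subset)
    have d0: "diameter (C i \<inter> S) \<le> diameter (C i)" for i
      using C by (intro diameter_subset) auto
    have d: "bounded (C' i)" "diameter (C' i) \<le> L * diameter (C i)" for i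
    proof -
      have "diameter (C' i) \<le> L * diameter (C i \<inter> S)" "bounded (C' i)"
        unfolding C'_def by (intro diameter_image_le; use L f b in auto)+
      then show "bounded (C' i)" "diameter (C' i) \<le> L * diameter (C i)"
        using order_trans[OF _ mult_left_mono[OF d0[of i], of L]] L by auto
    qed
    have le: "?t' (C' i) \<le> ennreal (L ^ n) * ?t (C i)" for i
    proof (cases "C' i = {}")
      case False
      then have ne: "C i \<noteq> {}" by (auto simp: C'_def)
      have "(diameter (C' i) / 2) ^ n \<le> (L * diameter (C i) / 2) ^ n"
        using d[of i] by (intro power_mono) (auto simp: diameter_ge_0)
      also have "\<dots> = L ^ n * (diameter (C i) / 2) ^ n" by (simp add: power_mult_distrib power_divide)
      finally have "unit_ball_vol (real n) * (diameter (C' i) / 2) ^ n \<le> L ^ n * (unit_ball_vol (real n) * (diameter (C i) / 2) ^ n)"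
        using mult_left_mono[of _ _ "unit_ball_vol (real n)"] by (fastforce simp: mult.left_commute)
      then show ?thesis using False ne L
        by (simp add: ennreal_mult'[symmetric] ennreal_leI)
    qed simp
    have "hausdorff_premeasure n (L * \<delta>) (f ` S) \<le> (\<Sum>i. ?t' (C' i))"
    proof (rule hausdorff_premeasure_le)
      show "f ` S \<subseteq> (\<Union>i. C' i)" using C by (auto simp: C'_def) blast
      show "diameter (C' i) \<le> L * \<delta>" for i
        using d(2)[of i] C L by (auto intro: order_trans mult_left_mono)
    qed (rule d)
    also have "\<dots> \<le> (\<Sum>i. ennreal (L ^ n) * ?t (C i))"
      by (intro suminf_le le) auto
    also have "\<dots> = ennreal (L ^ n) * (\<Sum>i. ?t (C i))" by (rule ennreal_suminf_cmult)
    finally have "ennreal (1 / L ^ n) * hausdorff_premeasure n (L * \<delta>) (f ` S)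
       \<le> ennreal (1 / L ^ n) * (ennreal (L ^ n) * (\<Sum>i. ?t (C i)))"
      by (rule mult_left_mono) simp
    also have "\<dots> = (\<Sum>i. ?t (C i))"
      using L by (simp add: mult.assoc[symmetric] ennreal_mult'[symmetric])
    finally show "ennreal (1 / L ^ n) * hausdorff_premeasure n (L * \<delta>) (f ` S) \<le> (\<Sum>i. ?t (C i))" .
  qed
  then have "ennreal (L ^ n) * (ennreal (1 / L ^ n) * hausdorff_premeasure n (L * \<delta>) (f ` S))
     \<le> ennreal (L ^ n) * hausdorff_premeasure n \<delta> S"
    by (rule mult_left_mono) simp
  then show ?thesis
    using L by (simp add: mult.assoc[symmetric] ennreal_mult'[symmetric])
qed

lemma hausdorff_outer_lipschitz:
  fixes f :: "'a::metric_space \<Rightarrow> 'b::metric_space"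
  assumes L: "0 < L" and f: "\<And>a b. a \<in> S \<Longrightarrow> b \<in> S \<Longrightarrow> dist (f a) (f b) \<le> L * dist a b"
  shows "hausdorff_outer n (f ` S) \<le> ennreal (L ^ n) * hausdorff_outer n S"
  unfolding hausdorff_outer_def[of n "f ` S"]
proof (rule SUP_least)
  fix \<delta> :: real assume \<delta>: "\<delta> \<in> {0<..}"
  have "hausdorff_premeasure n \<delta> (f ` S) = hausdorff_premeasure n (L * (\<delta> / L)) (f ` S)" using L by simp
  also have "\<dots> \<le> ennreal (L ^ n) * hausdorff_premeasure n (\<delta> / L) S"
    by (rule hausdorff_premeasure_lipschitz[OF assms])
  also have "\<dots> \<le> ennreal (L ^ n) * hausdorff_outer n S"
    unfolding hausdorff_outer_def using \<delta> L by (intro mult_left_mono SUP_upper) auto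
  finally show "hausdorff_premeasure n \<delta> (f ` S) \<le> ennreal (L ^ n) * hausdorff_outer n S" .
qed

text \<open>The hypothesis makes f constant where g is constant, so on S the map f factors as an
  L-Lipschitz map after g.\<close>

lemma hausdorff_outer_compare:
  fixes f :: "'c \<Rightarrow> 'b::metric_space" and g :: "'c \<Rightarrow> 'a::metric_space"
  assumes L: "0 < L" and f: "\<And>a b. a \<in> S \<Longrightarrow> b \<in> S \<Longrightarrow> dist (f a) (f b) \<le> L * dist (g a) (g b)"
  shows "hausdorff_outer n (f ` S) \<le> ennreal (L ^ n) * hausdorff_outer n (g ` S)"
proof -
  let ?h = "f \<circ> inv_into S g"
  have h: "f a = ?h (g a)" if "a \<in> S" for a
    using f[OF that, of "inv_into S g (g a)"] that by (simp add: inv_into_into f_inv_into_f)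
  have "f ` S = ?h ` g ` S" using h by (force simp: image_iff)
  moreover have "hausdorff_outer n (?h ` g ` S) \<le> ennreal (L ^ n) * hausdorff_outer n (g ` S)"
  proof (rule hausdorff_outer_lipschitz[OF L])
    show "dist (?h a) (?h b) \<le> L * dist a b" if "a \<in> g ` S" "b \<in> g ` S" for a b
      using that f h by auto
  qed
  ultimately show ?thesis by simp
qed

text \<open>A grid of k^n cells of side 1/k has diameters at most n/k. In the sum the powers of k
  cancel, so the bound is the same for every \<open>\<delta>\<close>.\<close>

lemma hausdorff_outer_unit_cube_finite:
  "hausdorff_outer CARD('n) {x :: real^'n. \<forall>i. 0 \<le> x $ i \<and> x $ i \<le> 1} < \<infinity>" (is "hausdorff_outer ?n ?Q < _")
proof -
  have "hausdorff_premeasure ?n \<delta> ?Q \<le> ennreal (unit_ball_vol (real ?n) * (real ?n / 2) ^ ?n)"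
    if \<delta>: "\<delta> > 0" for \<delta>
  proof -
    obtain k :: nat where k: "k > 0" "real ?n / real k \<le> \<delta>"
    proof -
      obtain k :: nat where "real ?n / \<delta> < real k" using reals_Archimedean2 by blast
      moreover from this \<delta> have "k > 0" by (auto intro: gr0I simp: field_simps)
      ultimately have "k > 0" "real ?n / real k \<le> \<delta>"
        using \<delta> by (auto simp: field_simps)
      then show ?thesis using that by blast
    qed
    define I where "I = (UNIV :: 'n set) \<rightarrow>\<^sub>E {..<k}"
    have fI: "finite I" and cI: "card I = k ^ ?n"
      by (simp_all add: I_def finite_PiE card_PiE)
    obtain h where h: "bij_betw h {0..<card I} I" using ex_bij_betw_nat_finite[OF fI] by blast
    define cell where "cell a = {x :: real^'n. \<forall>i. real (a i) / k \<le> x $ i \<and> x $ i \<le> (real (a i) + 1) / k}" for a :: "'n \<Rightarrow> nat"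
    define C where "C j = (if j < card I then cell (h j) else {})" for j
    have dc: "dist x y \<le> real ?n / k" if "x \<in> cell a" "y \<in> cell a" for a x y
    proof -
      have "\<bar>(x - y) $ i\<bar> \<le> 1 / k" for i
        using that[unfolded cell_def, simplified, rule_format, of i] k by (auto simp: field_simps abs_if)
      then have "(\<Sum>i\<in>UNIV. \<bar>(x - y) $ i\<bar>) \<le> (\<Sum>i\<in>(UNIV::'n set). 1 / k)" by (intro sum_mono)
      then show ?thesis using norm_le_l1_cart[of "x - y"] by (simp add: dist_norm)
    qed
    have bc: "bounded (cell a)" for a
      unfolding bounded_def using dc by (cases "cell a = {}") blast+
    have dic: "diameter (cell a) \<le> real ?n / k" for a
    proof (cases "cell a = {}")
      case False
      then show ?thesis unfolding diameter_def using dc by (auto intro!: cSUP_least)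
    qed (simp add: diameter_def)
    have "hausdorff_premeasure ?n \<delta> ?Q \<le>
      (\<Sum>j. if C j = {} then 0 else ennreal (unit_ball_vol (real ?n) * (diameter (C j) / 2) ^ ?n))"
    proof (rule hausdorff_premeasure_le)
      show "?Q \<subseteq> (\<Union>j. C j)"
      proof
        fix x :: "real^'n" assume x: "x \<in> ?Q"
        \<comment> \<open>The minimum with k - 1 puts a coordinate equal to 1 into the last cell
          rather than into one outside the grid.\<close>
        define a where "a i = min (nat \<lfloor>k * x $ i\<rfloor>) (k - 1)" for i
        have "a \<in> I" using k by (auto simp: I_def a_def min_def)
        then obtain j where j: "j < card I" "h j = a"
          using h unfolding bij_betw_def by (metis atLeastLessThan_iff imageE)
        have "real (a i) / k \<le> x $ i \<and> x $ i \<le> (real (a i) + 1) / k" for i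
        proof -
          have xi: "0 \<le> x $ i" "x $ i \<le> 1" using x by auto
          have f: "real (nat \<lfloor>k * x $ i\<rfloor>) \<le> k * x $ i" "k * x $ i \<le> real (nat \<lfloor>k * x $ i\<rfloor>) + 1"
            using xi by (auto simp: of_nat_nat)
          have "real (a i) \<le> k * x $ i" using f(1) by (auto simp: a_def min_def)
          moreover have "k * x $ i \<le> real (a i) + 1"
            using f(2) xi k by (auto simp: a_def min_def of_nat_diff mult_left_le)
          ultimately show ?thesis using k by (simp add: field_simps)
        qed
        then have "x \<in> C j" by (simp add: C_def j cell_def)
        then show "x \<in> (\<Union>j. C j)" by blast
      qed
      show "bounded (C j)" for j using bc by (simp add: C_def)
      show "diameter (C j) \<le> \<delta>" for j using order_trans[OF dic k(2)] \<delta> by (simp add: C_def)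
    qed
    also have "\<dots> = (\<Sum>j\<in>{0..<card I}. if C j = {} then 0 else ennreal (unit_ball_vol (real ?n) * (diameter (C j) / 2) ^ ?n))"
      by (rule suminf_finite) (auto simp: C_def)
    also have "\<dots> \<le> (\<Sum>j\<in>{0..<card I}. ennreal (unit_ball_vol (real ?n) * (real ?n / k / 2) ^ ?n))"
      using dic by (intro sum_mono)
        (auto simp: C_def diameter_ge_0 bc intro!: ennreal_leI mult_left_mono power_mono divide_right_mono)
    also have "\<dots> = ennreal (real (k ^ ?n) * (unit_ball_vol (real ?n) * (real ?n / k / 2) ^ ?n))"
      by (simp add: cI ennreal_mult' ennreal_of_nat_eq_real_of_nat del: of_nat_power)
    also have "real (k ^ ?n) * (unit_ball_vol (real ?n) * (real ?n / k / 2) ^ ?n) = unit_ball_vol (real ?n) * (real ?n / 2) ^ ?n"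
      using k by (simp add: power_divide field_simps)
    finally show ?thesis .
  qed
  then have "hausdorff_outer ?n ?Q \<le> ennreal (unit_ball_vol (real ?n) * (real ?n / 2) ^ ?n)"
    unfolding hausdorff_outer_def by (intro SUP_least) auto
  then show ?thesis using le_less_trans[OF _ ennreal_less_top] by simp
qed

lemma hausdorff_outer_bounded_finite:
  fixes S :: "(real^'n) set"
  assumes "bounded S"
  shows "hausdorff_outer CARD('n) S < \<infinity>"
proof -
  obtain r where r: "r > 0" "\<And>x. x \<in> S \<Longrightarrow> norm x \<le> r" using assms by (auto simp: bounded_pos)
  let ?Q = "{x :: real^'n. \<forall>i. 0 \<le> x $ i \<and> x $ i \<le> 1}"
  let ?f = "\<lambda>x :: real^'n. (2 * r) *\<^sub>R x - (\<chi> i. r)"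
  have "S \<subseteq> ?f ` ?Q"
  proof
    fix x assume "x \<in> S"
    then have b: "\<bar>x $ i\<bar> \<le> r" for i using r(2) component_le_norm_cart[of x i] by (metis order_trans)
    have "(\<chi> i. (x $ i + r) / (2 * r)) \<in> ?Q"
    proof (clarsimp, intro conjI)
      fix i
      show "0 \<le> (x $ i + r) / (2 * r)" "(x $ i + r) / (2 * r) \<le> 1" using b[of i] r by (auto simp: field_simps abs_le_iff)
    qed
    moreover have "x = ?f (\<chi> i. (x $ i + r) / (2 * r))" using r by (simp add: vec_eq_iff)
    ultimately show "x \<in> ?f ` ?Q" by blast
  qed
  then have "hausdorff_outer CARD('n) S \<le> hausdorff_outer CARD('n) (?f ` ?Q)" by (rule hausdorff_outer_mono)
  also have "\<dots> \<le> ennreal ((2 * r) ^ CARD('n)) * hausdorff_outer CARD('n) ?Q"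
    using r by (intro hausdorff_outer_lipschitz) (auto simp: dist_norm scaleR_diff_right[symmetric])
  also have "\<dots> < \<infinity>"
    using hausdorff_outer_unit_cube_finite[where 'n='n] by (simp add: ennreal_mult_less_top)
  finally show ?thesis .
qed

section \<open>Translation invariant measures\<close>

lemma nn_integral_lborel_reflect:
  fixes f :: "'a::euclidean_space \<Rightarrow> ennreal"
  assumes [measurable]: "f \<in> borel_measurable borel"
  shows "(\<integral>\<^sup>+y. f (t - y) \<partial>lborel) = (\<integral>\<^sup>+y. f y \<partial>lborel)"
proof -
  have "lborel = distr lborel borel (\<lambda>x :: 'a. t - x)"
    using lborel_affine[of "-1" t] by (simp add: density_1)
  then have "(\<integral>\<^sup>+y. f y \<partial>lborel) = (\<integral>\<^sup>+y. f y \<partial>distr lborel borel (\<lambda>x. t - x))" by simp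
  also have "\<dots> = (\<integral>\<^sup>+y. f (t - y) \<partial>lborel)" by (subst nn_integral_distr) auto
  finally show ?thesis by simp
qed

lemma nn_integral_lborel_translate:
  fixes f :: "'a::euclidean_space \<Rightarrow> ennreal"
  assumes [measurable]: "f \<in> borel_measurable borel"
  shows "(\<integral>\<^sup>+y. f (t + y) \<partial>lborel) = (\<integral>\<^sup>+y. f y \<partial>lborel)"
proof -
  have "(\<integral>\<^sup>+y. f y \<partial>lborel) = (\<integral>\<^sup>+y. f y \<partial>distr lborel borel ((+) t))" by (simp add: lborel_distr_plus)
  also have "\<dots> = (\<integral>\<^sup>+y. f (t + y) \<partial>lborel)" by (subst nn_integral_distr) auto
  finally show ?thesis by simp
qed

text \<open>Uniqueness up to a factor: Tonelli's theorem applied to \<open>indicator A x * indicator B (x + y)\<close>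
  gives \<open>M A * lborel B = M B * lborel A\<close>.\<close>

theorem translation_invariant_measure:
  fixes M :: "'a::euclidean_space measure"
  assumes sets: "sets M = sets borel"
    and inv: "\<And>a. distr M borel ((+) a) = M"
    and fin: "\<And>r. emeasure M (ball 0 r) < \<infinity>"
    and S: "S \<in> sets borel"
  shows "emeasure M S = emeasure M (box 0 One) * emeasure lborel S"
proof -
  note [measurable_cong] = sets
  have sM: "space M = UNIV" using sets_eq_imp_space_eq[OF sets] by simp
  have "sigma_finite_measure M"
  proof
    show "\<exists>A. countable A \<and> A \<subseteq> sets M \<and> \<Union>A = space M \<and> (\<forall>a\<in>A. emeasure M a \<noteq> \<infinity>)"
    proof (intro exI conjI ballI)
      show "countable (range (\<lambda>n::nat. ball (0::'a) (real n)))" by simp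
      show "range (\<lambda>n::nat. ball (0::'a) (real n)) \<subseteq> sets M" by (auto simp: sets)
      show "\<Union>(range (\<lambda>n::nat. ball (0::'a) (real n))) = space M"
        using reals_Archimedean2 by (auto simp: sM)
      show "emeasure M a \<noteq> \<infinity>" if "a \<in> range (\<lambda>n::nat. ball (0::'a) (real n))" for a
        using that fin by (auto simp: less_top[symmetric])
    qed
  qed
  then interpret M: sigma_finite_measure M .
  interpret pair_sigma_finite M lborel ..
  let ?B = "box 0 One :: 'a set"
  have B[measurable]: "?B \<in> sets borel" by simp
  note S[measurable]
  have eq: "emeasure M A * emeasure lborel B = (\<integral>\<^sup>+y. \<integral>\<^sup>+x. indicator A x * indicator B (x + y) \<partial>M \<partial>lborel)"
    if [measurable]: "A \<in> sets borel" "B \<in> sets borel" for A B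
  proof -
    have "(\<integral>\<^sup>+y. \<integral>\<^sup>+x. indicator A x * indicator B (x + y) \<partial>M \<partial>lborel) =
       (\<integral>\<^sup>+x. \<integral>\<^sup>+y. indicator A x * indicator B (x + y) \<partial>lborel \<partial>M)"
      by (rule Fubini') measurable
    also have "\<dots> = (\<integral>\<^sup>+x. indicator A x * emeasure lborel B \<partial>M)"
    proof (rule nn_integral_cong)
      fix x
      have "(\<integral>\<^sup>+y. indicator B (x + y) \<partial>lborel) = emeasure lborel B"
        using nn_integral_lborel_translate[of "indicator B" x] by simp
      then show "(\<integral>\<^sup>+y. indicator A x * indicator B (x + y) \<partial>lborel) = indicator A x * emeasure lborel B"
        by (subst nn_integral_cmult) auto
    qed
    also have "\<dots> = emeasure M A * emeasure lborel B"
      by (subst nn_integral_multc) (auto simp: sets)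
    finally show ?thesis by simp
  qed
  have "emeasure M S * emeasure lborel ?B = (\<integral>\<^sup>+y. \<integral>\<^sup>+x. indicator S x * indicator ?B (x + y) \<partial>M \<partial>lborel)"
    by (rule eq) auto
  also have "\<dots> = (\<integral>\<^sup>+y. \<integral>\<^sup>+x. indicator S (x - y) * indicator ?B x \<partial>M \<partial>lborel)"
  proof (rule nn_integral_cong)
    fix y
    have "(\<integral>\<^sup>+x. indicator S (x - y) * indicator ?B x \<partial>M) = (\<integral>\<^sup>+x. indicator S (x - y) * indicator ?B x \<partial>distr M borel ((+) y))"
      by (simp add: inv)
    also have "\<dots> = (\<integral>\<^sup>+x. indicator S x * indicator ?B (x + y) \<partial>M)"
      by (subst nn_integral_distr) (auto simp: add.commute)
    finally show "(\<integral>\<^sup>+x. indicator S x * indicator ?B (x + y) \<partial>M) = (\<integral>\<^sup>+x. indicator S (x - y) * indicator ?B x \<partial>M)" by simp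
  qed
  also have "\<dots> = (\<integral>\<^sup>+x. \<integral>\<^sup>+y. indicator S (x - y) * indicator ?B x \<partial>lborel \<partial>M)"
    by (rule Fubini') measurable
  also have "\<dots> = (\<integral>\<^sup>+x. emeasure lborel S * indicator ?B x \<partial>M)"
  proof (rule nn_integral_cong)
    fix x
    have "(\<integral>\<^sup>+y. indicator S (x - y) \<partial>lborel) = emeasure lborel S"
      using nn_integral_lborel_reflect[of "indicator S" x] S by simp
    then show "(\<integral>\<^sup>+y. indicator S (x - y) * indicator ?B x \<partial>lborel) = emeasure lborel S * indicator ?B x"
      by (subst nn_integral_multc) auto
  qed
  also have "\<dots> = emeasure lborel S * emeasure M ?B"
    by (subst nn_integral_cmult) (auto simp: sets)
  finally show ?thesis
    by (simp add: mult.commute emeasure_lborel_box_eq)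
qed

section \<open>The area formula\<close>

text \<open>The Lindelof property reduces the local bounds to countably many balls. Disjoint pieces
  inside these balls add up to a global bound with the same factor K, and K tends to 1 at the
  end.\<close>

lemma measure_le_of_locally_le:
  fixes M N :: "'a::{metric_space, second_countable_topology} measure"
  assumes sets: "sets M = sets borel" "sets N = sets borel" and U: "open U"
    and loc: "\<And>K \<theta>. 1 < K \<Longrightarrow> \<theta> \<in> U \<Longrightarrow>
      \<exists>r>0. \<forall>S\<in>sets borel. S \<subseteq> ball \<theta> r \<longrightarrow> emeasure M S \<le> ennreal K * emeasure N S"
    and S: "S \<in> sets borel" "S \<subseteq> U"
  shows "emeasure M S \<le> emeasure N S"
proof -
  have K: "emeasure M S \<le> ennreal K * emeasure N S" if K: "1 < K" for K
  proof (cases "U = {}")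
    case False
    obtain r where r: "\<And>\<theta>. \<theta> \<in> U \<Longrightarrow> r \<theta> > 0"
      "\<And>\<theta> S. \<theta> \<in> U \<Longrightarrow> S \<in> sets borel \<Longrightarrow> S \<subseteq> ball \<theta> (r \<theta>) \<Longrightarrow> emeasure M S \<le> ennreal K * emeasure N S"
      using loc[OF K] by metis
    obtain F where F: "F \<subseteq> (\<lambda>\<theta>. ball \<theta> (r \<theta>)) ` U" "countable F" "\<Union>F = (\<Union>\<theta>\<in>U. ball \<theta> (r \<theta>))"
      using Lindelof[of "(\<lambda>\<theta>. ball \<theta> (r \<theta>)) ` U"] by auto
    have cov: "U \<subseteq> \<Union>F" using r(1) F(3) by (force simp: subset_iff)
    then have "F \<noteq> {}" using False by auto
    define D where "D n = S \<inter> disjointed (from_nat_into F) n" for n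
    have Fin: "from_nat_into F n \<in> F" for n using from_nat_into[OF \<open>F \<noteq> {}\<close>] .
    have Fb: "from_nat_into F n \<in> sets borel" for n using Fin[of n] F(1) by auto
    have "range (disjointed (from_nat_into F)) \<subseteq> sets borel"
      by (rule sets.range_disjointed_sets) (use Fb in auto)
    then have Db: "D n \<in> sets borel" for n using S(1) by (auto simp: D_def)
    have dj: "disjoint_family D"
      using disjoint_family_disjointed[of "from_nat_into F"] unfolding D_def disjoint_family_on_def by blast
    have "(\<Union>n. D n) = S \<inter> (\<Union>n. from_nat_into F n)"
      by (simp add: D_def UN_disjointed_eq flip: Int_UN_distrib)
    also have "(\<Union>n. from_nat_into F n) = \<Union>F"
      using range_from_nat_into[OF \<open>F \<noteq> {}\<close> F(2)] by simp
    also have "S \<inter> \<Union>F = S" using subset_trans[OF S(2) cov] by (rule Int_absorb2)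
    finally have un: "(\<Union>n. D n) = S" .
    have le: "emeasure M (D n) \<le> ennreal K * emeasure N (D n)" for n
    proof -
      obtain \<theta> where "\<theta> \<in> U" "from_nat_into F n = ball \<theta> (r \<theta>)" using Fin[of n] F(1) by blast
      then show ?thesis
        using r(2)[of \<theta> "D n"] Db disjointed_subset[of "from_nat_into F" n] by (auto simp: D_def)
    qed
    have "emeasure M S = (\<Sum>n. emeasure M (D n))"
      using suminf_emeasure[of D M] dj Db un by (simp add: sets subset_eq)
    also have "\<dots> \<le> (\<Sum>n. ennreal K * emeasure N (D n))" by (intro suminf_le le) auto
    also have "\<dots> = ennreal K * (\<Sum>n. emeasure N (D n))" by (rule ennreal_suminf_cmult)
    also have "(\<Sum>n. emeasure N (D n)) = emeasure N S"
      using suminf_emeasure[of D N] dj Db un by (simp add: sets subset_eq)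
    finally show ?thesis .
  qed (use S in simp)
  show ?thesis
  proof (cases "emeasure N S = \<infinity>")
    case False
    have "(\<lambda>n. 1 + 1 / real (Suc n)) \<longlonglongrightarrow> 1 + 0"
      by (intro tendsto_add tendsto_const LIMSEQ_Suc lim_1_over_n)
    then have "(\<lambda>n. ennreal (1 + 1 / real (Suc n))) \<longlonglongrightarrow> ennreal 1" by (intro tendsto_ennrealI) simp
    then have "(\<lambda>n. ennreal (1 + 1 / real (Suc n)) * emeasure N S) \<longlonglongrightarrow> ennreal 1 * emeasure N S"
      using False by (intro tendsto_mult_ennreal tendsto_const) (auto simp: less_top)
    then have "emeasure M S \<le> ennreal 1 * emeasure N S"
      by (rule LIMSEQ_le_const) (intro exI allI impI K, simp)
    then show ?thesis by simp
  qed simp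
qed

text \<open>An isometric copy of the parameter space inside the ambient space. Flat pieces have to
  live there because countable additivity is available for the Hausdorff measure of the ambient
  space.\<close>

definition flat :: "real^'n \<Rightarrow> real^('n option)" where
  "flat v = (\<chi> o'. case o' of None \<Rightarrow> 0 | Some i \<Rightarrow> v $ i)"

definition flat_inv :: "real^('n option) \<Rightarrow> real^'n" where
  "flat_inv y = (\<chi> i. y $ Some i)"

lemma flat_inv_flat [simp]: "flat_inv (flat v) = v"
  by (simp add: flat_def flat_inv_def vec_eq_iff)

lemma linear_flat: "linear flat"
  by (rule linearI) (auto simp: flat_def vec_eq_iff split: option.split)

lemma linear_flat_inv: "linear flat_inv"
  by (rule linearI) (auto simp: flat_inv_def vec_eq_iff)

lemma inner_flat: "flat v \<bullet> flat w = (v :: real^'n) \<bullet> w"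
  by (simp add: inner_vec_def flat_def UNIV_option_conv sum.reindex)

lemma norm_flat: "norm (flat v) = norm (v :: real^'n)"
  by (simp add: norm_eq_sqrt_inner inner_flat)

lemma dist_flat: "dist (flat v) (flat w) = dist v (w :: real^'n)"
  by (simp add: dist_norm linear_diff[OF linear_flat, symmetric] norm_flat)

text \<open>The surface measure of a patch, transported to parameter space by a left inverse
  \<open>J\<close> of \<open>Y\<close>, so that the area formula becomes an equality of two measures
  on the same space.\<close>

definition param_measure :: "(real^'n::finite) set \<Rightarrow> (real^'n \<Rightarrow> real^('n option)) \<Rightarrow>
    (real^('n option) \<Rightarrow> real^'n) \<Rightarrow> (real^'n) measure" where
  "param_measure U Y J = distr (density surface_measure (indicator (Y ` U))) borel J"

text \<open>The factor by which the Hausdorff measure of a flat set exceeds its Lebesgue measure. Its value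
  is irrelevant below.\<close>

definition flat_density :: "'n::finite itself \<Rightarrow> ennreal" where
  "flat_density _ = hausdorff_outer CARD('n) (flat ` (box 0 One :: (real^'n) set))"

lemma sets_surface_measure [simp, measurable_cong]: "sets surface_measure = sets borel"
  unfolding hausdorff_measure_def by (simp add: sets_measure_of_conv sets.sigma_sets_eq[of borel, simplified])

lemma space_surface_measure [simp]: "space surface_measure = UNIV"
  using sets_eq_imp_space_eq[OF sets_surface_measure] by simp

text \<open>\<open>measure_of\<close> returns the null measure when its set function is not a measure; in that case every
  integral in the theorem is 0, so that \<open>hausdorff_outer\<close> may be assumed to be a measure from here on.\<close>

lemma surface_measure_null:
  assumes "\<not> measure_space UNIV (sets borel) (hausdorff_outer CARD('n::finite) :: (real^('n option)) set \<Rightarrow> ennreal)"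
  shows "(\<integral>y. f y \<partial>(surface_measure :: (real^('n option)) measure)) = 0"
proof -
  have "emeasure (surface_measure :: (real^('n option)) measure) UNIV = 0"
    using assms sets.sigma_sets_eq[of "borel :: (real^('n option)) measure"]
    unfolding hausdorff_measure_def by (simp add: emeasure_measure_of_conv)
  then have "AE y in (surface_measure :: (real^('n option)) measure). False"
    by (intro AE_I[of _ _ UNIV]) auto
  then show ?thesis by (intro integral_eq_zero_AE) (auto elim: eventually_mono)
qed

lemma flat_density_finite: "flat_density TYPE('n::finite) < \<infinity>"
proof -
  have "flat_density TYPE('n) \<le> ennreal (1 ^ CARD('n)) * hausdorff_outer CARD('n) (box 0 One :: (real^'n) set)"
    unfolding flat_density_def by (rule hausdorff_outer_lipschitz) (auto simp: dist_flat)
  also have "\<dots> < \<infinity>" using hausdorff_outer_bounded_finite[OF bounded_box, of 0 "One :: real^'n"] by simp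
  finally show ?thesis .
qed

context
  assumes ms: "measure_space UNIV (sets borel) (hausdorff_outer CARD('n::finite) :: (real^('n option)) set \<Rightarrow> ennreal)"
begin

lemma emeasure_surface_measure:
  "A \<in> sets borel \<Longrightarrow> emeasure (surface_measure :: (real^('n option)) measure) A = hausdorff_outer CARD('n) A"
  using ms sets.sigma_sets_eq[of "borel :: (real^('n option)) measure"]
  unfolding hausdorff_measure_def by (simp add: emeasure_measure_of_conv)

lemma emeasure_param_measure:
  fixes Y :: "real^'n \<Rightarrow> real^('n option)"
  assumes Y: "Y ` U \<in> sets borel" and J[measurable]: "J \<in> borel_measurable borel"
    and JY: "\<And>\<theta>. \<theta> \<in> U \<Longrightarrow> J (Y \<theta>) = \<theta>" and S[measurable]: "S \<in> sets borel"
  shows "emeasure (param_measure U Y J) S = hausdorff_outer CARD('n) (Y ` (S \<inter> U))"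
    and "Y ` (S \<inter> U) \<in> sets borel"
proof -
  note Y[measurable]
  have eq: "Y ` (S \<inter> U) = Y ` U \<inter> J -` S" using JY by force
  have J': "J -` S \<in> sets borel" using measurable_sets_borel[OF J S] .
  then show "Y ` (S \<inter> U) \<in> sets borel" unfolding eq using sets.Int[OF Y J'] by simp
  have "emeasure (param_measure U Y J) S = emeasure (density surface_measure (indicator (Y ` U))) (J -` S)"
    unfolding param_measure_def by (subst emeasure_distr) auto
  also have "\<dots> = (\<integral>\<^sup>+y. indicator (Y ` U) y * indicator (J -` S) y \<partial>surface_measure)"
    using J' Y by (subst emeasure_density) auto
  also have "\<dots> = (\<integral>\<^sup>+y. indicator (Y ` U \<inter> J -` S) y \<partial>surface_measure)"
    by (intro nn_integral_cong) (auto split: split_indicator)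
  also have "\<dots> = emeasure surface_measure (Y ` U \<inter> J -` S)"
    using J' Y by (subst nn_integral_indicator) auto
  also have "\<dots> = hausdorff_outer CARD('n) (Y ` (S \<inter> U))"
    unfolding eq using J' Y by (intro emeasure_surface_measure) auto
  finally show "emeasure (param_measure U Y J) S = hausdorff_outer CARD('n) (Y ` (S \<inter> U))" .
qed

lemma flat_param:
  fixes S :: "(real^'n) set"
  assumes "S \<in> sets borel"
  shows "emeasure (param_measure UNIV flat flat_inv) S = hausdorff_outer CARD('n) (flat ` S)"
proof -
  have c: "continuous_on UNIV (flat :: real^'n \<Rightarrow> _)" "continuous_on UNIV (flat_inv :: _ \<Rightarrow> real^'n)"
    using linear_flat linear_flat_inv by (auto intro!: linear_continuous_on simp: linear_conv_bounded_linear)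
  have "range (flat :: real^'n \<Rightarrow> _) = {y. y $ None = 0}"
    by (auto simp: flat_def image_iff vec_eq_iff intro!: exI[of _ "flat_inv _"] split: option.split)
      (auto simp: flat_inv_def)
  moreover have "closed {y :: real^('n option). y $ None = 0}"
    by (intro closed_Collect_eq continuous_intros)
  ultimately have "range (flat :: real^'n \<Rightarrow> _) \<in> sets borel" by (simp add: borel_closed)
  then show ?thesis
    using emeasure_param_measure(1)[of flat UNIV flat_inv S] assms c
    by (simp add: borel_measurable_continuous_onI)
qed

lemma hausdorff_outer_flat:
  fixes S :: "(real^'n) set"
  assumes "S \<in> sets borel"
  shows "hausdorff_outer CARD('n) (flat ` S) = flat_density TYPE('n) * emeasure lborel S"
proof -
  let ?M = "param_measure UNIV flat flat_inv :: (real^'n) measure"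
  have sM: "sets ?M = sets borel" by (simp add: param_measure_def)
  have "emeasure ?M S = emeasure ?M (box 0 One) * emeasure lborel S"
  proof (rule translation_invariant_measure[OF sM _ _ assms])
    show "distr ?M borel ((+) a) = ?M" for a
    proof (rule measure_eqI)
      fix A assume "A \<in> sets (distr ?M borel ((+) a))"
      then have A: "A \<in> sets borel" by simp
      let ?A = "(+) a -` A"
      have A': "?A \<in> sets borel" using measurable_sets_borel[OF _ A, of "(+) a"] by simp
      have "A = (\<lambda>x. a + x) ` ?A" by (force simp: image_iff intro: exI[of _ "_ - a"])
      then have e: "flat ` A = (\<lambda>x. flat (a + x)) ` ?A" by (metis image_image)
      \<comment> \<open>A translate of a flat set has the same mutual distances, so comparison with
        constant 1 works in both directions.\<close>
      have "hausdorff_outer CARD('n) (flat ` ?A) \<le> ennreal (1 ^ CARD('n)) * hausdorff_outer CARD('n) ((\<lambda>x. flat (a + x)) ` ?A)"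
        by (rule hausdorff_outer_compare) (auto simp: dist_flat)
      moreover have "hausdorff_outer CARD('n) ((\<lambda>x. flat (a + x)) ` ?A) \<le> ennreal (1 ^ CARD('n)) * hausdorff_outer CARD('n) (flat ` ?A)"
        by (rule hausdorff_outer_compare) (auto simp: dist_flat)
      ultimately have "hausdorff_outer CARD('n) (flat ` ?A) = hausdorff_outer CARD('n) (flat ` A)"
        unfolding e by simp
      moreover have "emeasure (distr ?M borel ((+) a)) A = emeasure ?M ?A"
        using A by (subst emeasure_distr) (auto simp: param_measure_def)
      ultimately show "emeasure (distr ?M borel ((+) a)) A = emeasure ?M A"
        using A A' by (simp add: flat_param)
    qed (simp add: sM)
    show "emeasure ?M (ball 0 r) < \<infinity>" for r
    proof -
      have "emeasure ?M (ball 0 r) \<le> ennreal (1 ^ CARD('n)) * hausdorff_outer CARD('n) (ball 0 r :: (real^'n) set)"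
        by (subst flat_param, simp, rule hausdorff_outer_lipschitz) (auto simp: dist_flat)
      also have "\<dots> < \<infinity>" using hausdorff_outer_bounded_finite[OF bounded_ball, of "0 :: real^'n" r] by simp
      finally show ?thesis .
    qed
  qed
  then show ?thesis using assms by (simp add: flat_param flat_density_def)
qed

end

section \<open>Lebesgue measure of linear images\<close>

lemma mem_cbox_One: "(x :: real^'n) \<in> cbox 0 One \<longleftrightarrow> (\<forall>i. 0 \<le> x $ i \<and> x $ i \<le> 1)"
proof -
  have "(One :: real^'n) $ i = 1" for i
    using inner_sum_Basis[of "axis i 1 :: real^'n"] by (simp add: inner_axis axis_in_Basis_iff)
  then show ?thesis by (simp add: mem_box_cart)
qed

lemma measure_lebesgue_cbox_One: "measure lebesgue (cbox 0 One :: (real^'n) set) = 1"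
  using emeasure_lborel_cbox_eq[of 0 "One :: real^'n"] by (simp add: measure_completion content_cbox_if)

text \<open>Lebesgue measure transported by the inverse of B is translation invariant. Hence the
  volume of an image is proportional to the volume of the set, and the unit cube shows the
  factor.\<close>

lemma emeasure_lborel_linear_image_cube:
  fixes B :: "'a::euclidean_space \<Rightarrow> 'a"
  assumes B: "linear B" "inj B" and S: "S \<in> sets borel"
  shows "B ` S \<in> sets borel" "emeasure lborel (B ` S) = emeasure lborel (B ` cbox 0 One) * emeasure lborel S"
proof -
  obtain B' where B': "linear B'" "\<And>x. B' (B x) = x" "\<And>x. B (B' x) = x"
    using linear_injective_isomorphism[OF B] by metis
  have m[measurable]: "B' \<in> borel_measurable borel" "B \<in> borel_measurable borel"
    using B' B by (auto intro!: borel_measurable_continuous_onI linear_continuous_on simp: linear_conv_bounded_linear)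
  have im: "B ` A = B' -` A" for A
    using B'(2,3) by (auto simp: image_iff) metis
  show BS: "B ` S \<in> sets borel" unfolding im by (rule measurable_sets_borel[OF m(1) S])
  let ?M = "distr lborel borel B'"
  have eM: "emeasure ?M A = emeasure lborel (B ` A)" if "A \<in> sets borel" for A
    using that by (subst emeasure_distr) (auto simp: im)
  have *: "emeasure ?M A = emeasure ?M (box 0 One) * emeasure lborel A" if "A \<in> sets borel" for A
  proof (rule translation_invariant_measure[OF _ _ _ that])
    show "distr ?M borel ((+) a) = ?M" for a
    proof -
      have "distr ?M borel ((+) a) = distr lborel borel (B' \<circ> (+) (B a))"
        by (subst distr_distr) (auto simp: o_def linear_add[OF B'(1)] B'(2))
      also have "\<dots> = distr (distr lborel borel ((+) (B a))) borel B'"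
        by (subst distr_distr) auto
      finally show ?thesis by (simp add: lborel_distr_plus)
    qed
    show "emeasure ?M (ball 0 r) < \<infinity>" for r
    proof -
      have "bounded (B ` ball 0 r)"
        using B(1) by (intro bounded_linear_image) (auto simp: linear_conv_bounded_linear)
      from emeasure_bounded_finite[OF this] show ?thesis by (simp add: eM)
    qed
  qed simp
  have "emeasure ?M (cbox 0 One) = emeasure ?M (box 0 One)"
    by (subst *) (simp_all add: emeasure_lborel_cbox_eq)
  then show "emeasure lborel (B ` S) = emeasure lborel (B ` cbox 0 One) * emeasure lborel S"
    using *[OF S] S by (simp add: eM)
qed

lemma emeasure_lborel_eq_measure_lebesgue:
  "S \<in> sets borel \<Longrightarrow> S \<in> lmeasurable \<Longrightarrow> emeasure lborel S = ennreal (measure lebesgue S)"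
  using emeasure_eq_measure2[of S lebesgue] emeasure_completion[of S lborel] by simp

text \<open>Induction over elementary linear maps. By proportionality only the image of the unit
  cube matters, and under composition the cube factors multiply just as determinants do.\<close>

lemma emeasure_lborel_linear_image:
  fixes B :: "real^'n \<Rightarrow> real^'n"
  assumes B: "linear B" "inj B" and S: "S \<in> sets borel"
  shows "emeasure lborel (B ` S) = ennreal \<bar>det (matrix B)\<bar> * emeasure lborel S"
proof -
  have "linear B \<and> (inj B \<longrightarrow> emeasure lborel (B ` cbox 0 One) = ennreal \<bar>det (matrix B)\<bar>)"
  proof (rule induct_linear_elementary[OF B(1)], goal_cases)
    case (1 f g)
    have "emeasure lborel ((f \<circ> g) ` cbox 0 One) = ennreal \<bar>det (matrix (f \<circ> g))\<bar>" if "inj (f \<circ> g)"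
    proof -
      have g: "inj g" using that by (rule inj_on_imageI2)
      then have "surj g" using 1 linear_inj_imp_surj by blast
      then have f: "inj f" using that by (metis inj_on_imageI inj_on_def comp_def surjD)
      have gb: "g ` cbox 0 One \<in> sets borel"
        using emeasure_lborel_linear_image_cube(1)[of g "cbox 0 One"] 1 g by simp
      have "emeasure lborel ((f \<circ> g) ` cbox 0 One) = emeasure lborel (f ` cbox 0 One) * emeasure lborel (g ` cbox 0 One)"
        unfolding image_comp[symmetric] using 1 f gb by (intro emeasure_lborel_linear_image_cube(2)) auto
      then show ?thesis
        using 1 f g by (simp add: matrix_compose det_mul abs_mult ennreal_mult)
    qed
    then show ?case using 1 linear_compose by blast
  next
    \<comment> \<open>A map with a vanishing component is not injective, so nothing is claimed in
      this case.\<close>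
    case (2 f i)
    have "\<not> inj f"
    proof
      assume "inj f"
      then have "surj f" using 2 linear_inj_imp_surj by blast
      then obtain x where "axis i 1 = f x" by (metis surjD)
      with 2(2)[of x] show False by (metis axis_nth zero_neq_one)
    qed
    with 2 show ?case by blast
  next
    case (3 c)
    let ?f = "\<lambda>x :: real^'n. \<chi> i. c i * x $ i"
    have l: "linear ?f" by (rule linearI) (auto simp: vec_eq_iff algebra_simps)
    have "matrix ?f $ i $ j = (if i = j then c i else 0)" for i j
      by (auto simp: matrix_def axis_def)
    then have d: "det (matrix ?f) = prod c UNIV" by (subst det_diagonal) auto
    have "emeasure lborel (?f ` cbox 0 One) = ennreal \<bar>det (matrix ?f)\<bar>" if "inj ?f"
      using emeasure_lborel_linear_image_cube(1)[OF l that, of "cbox 0 One"] measurable_stretch[of "cbox 0 One" c]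
        measure_stretch[of "cbox 0 One" c]
      by (simp add: emeasure_lborel_eq_measure_lebesgue d measure_lebesgue_cbox_One)
    with l show ?case by blast
  next
    case (4 m n)
    let ?f = "\<lambda>x :: real^'n. \<chi> i. x $ Transposition.transpose m n i"
    have l: "linear ?f" by (rule linearI) (auto simp: vec_eq_iff)
    have "?f \<circ> ?f = id" by (auto simp: vec_eq_iff fun_eq_iff)
    then have "matrix ?f ** matrix ?f = mat 1"
      unfolding matrix_compose[OF l l, symmetric] by (simp only: matrix_id_mat_1)
    then have "det (matrix ?f) * det (matrix ?f) = 1" by (metis det_I det_mul)
    then have d: "\<bar>det (matrix ?f)\<bar> = 1" using square_eq_1_iff by fastforce
    have "?f ` cbox 0 One = cbox 0 One"
    proof
      show *: "?f ` cbox 0 One \<subseteq> cbox 0 One" by (auto simp: mem_cbox_One)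
      show "cbox 0 One \<subseteq> ?f ` cbox 0 One"
      proof
        fix x :: "real^'n" assume "x \<in> cbox 0 One"
        then have "?f x \<in> cbox 0 One" "x = ?f (?f x)" using * by (auto simp: vec_eq_iff)
        then show "x \<in> ?f ` cbox 0 One" by blast
      qed
    qed
    with l d show ?case by (simp add: emeasure_lborel_cbox_eq)
  next
    case (5 m n)
    let ?f = "\<lambda>x :: real^'n. \<chi> i. if i = m then x $ m + x $ n else x $ i"
    have l: "linear ?f" by (rule linearI) (auto simp: vec_eq_iff algebra_simps)
    have "matrix ?f = (\<chi> k. if k = m then row m (mat 1) + 1 *s row n (mat 1) else row k (mat 1))"
      by (auto simp: matrix_def row_def mat_def axis_def vec_eq_iff)
    then have d: "det (matrix ?f) = 1" by (simp only: det_row_operation[OF 5] det_I)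
    have "emeasure lborel (?f ` cbox 0 One) = ennreal \<bar>det (matrix ?f)\<bar>" if "inj ?f"
      using emeasure_lborel_linear_image_cube(1)[OF l that, of "cbox 0 One"] measurable_shear_interval[OF 5, of 0 One]
        measure_shear_interval[OF 5, of 0 One]
      by (simp add: emeasure_lborel_eq_measure_lebesgue d measure_lebesgue_cbox_One)
    with l show ?case by blast
  qed
  then show ?thesis using emeasure_lborel_linear_image_cube(2)[OF B S] B by simp
qed

section \<open>Immersions compared with their differentials\<close>

lemma linear_sum_pd: "linear (\<lambda>v. \<Sum>i\<in>UNIV. v $ i *\<^sub>R pd i Y \<theta>)"
  by (rule linearI) (simp_all add: sum.distrib scaleR_add_left scaleR_sum_right)

text \<open>Following the differential by a linear isometry of the tangent space onto parameter
  space gives a square matrix B with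
  \<open>transpose (matrix B) ** matrix B = gram Y \<theta>\<close>. Determinants and Lebesgue
  measure thereby become applicable.\<close>

lemma immersed_at_isometric_linear:
  fixes Y :: "real^'n \<Rightarrow> real^('n option)"
  assumes im: "immersed_at Y \<theta>"
  obtains B :: "real^'n \<Rightarrow> real^'n" where "linear B"
    "\<And>v. norm (B v) = norm (\<Sum>i\<in>UNIV. v $ i *\<^sub>R pd i Y \<theta>)" "(det (matrix B))\<^sup>2 = det (gram Y \<theta>)"
proof -
  let ?A = "\<lambda>v. \<Sum>i\<in>UNIV. v $ i *\<^sub>R pd i Y \<theta>"
  note lA = linear_sum_pd[of Y \<theta>]
  have inj: "inj ?A" using im unfolding immersed_at_def linear_injective_0[OF lA] .
  have dm: "dim (range ?A) = dim (UNIV :: (real^'n) set)"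
    using dim_image_eq[OF lA, of UNIV] inj by (simp add: inj_on_subset)
  have sp: "subspace (range ?A)" using linear_subspace_image[OF lA subspace_UNIV] .
  obtain f :: "real^('n option) \<Rightarrow> real^'n" where f: "linear f" "\<And>x. x \<in> range ?A \<Longrightarrow> norm (f x) = norm x"
    by (rule isometries_subspaces[OF sp subspace_UNIV dm]) (rule that; assumption)
  define B where "B = f \<circ> ?A"
  have lB: "linear B" unfolding B_def by (rule linear_compose[OF lA f(1)])
  have nB: "norm (B v) = norm (?A v)" for v using f(2) by (simp add: B_def)
  have iB: "B v \<bullet> B w = ?A v \<bullet> ?A w" for v w
  proof -
    \<comment> \<open>Polarization: equal norms give equal inner products.\<close>
    have "B v \<bullet> B w = ((norm (B (v + w)))\<^sup>2 - (norm (B v))\<^sup>2 - (norm (B w))\<^sup>2) / 2"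
      by (simp add: linear_add[OF lB] power2_norm_eq_inner algebra_simps inner_commute)
    also have "\<dots> = ((norm (?A v + ?A w))\<^sup>2 - (norm (?A v))\<^sup>2 - (norm (?A w))\<^sup>2) / 2"
      by (simp only: nB linear_add[OF lA])
    also have "\<dots> = ?A v \<bullet> ?A w"
      by (simp add: power2_norm_eq_inner algebra_simps inner_commute)
    finally show ?thesis .
  qed
  have "transpose (matrix B) ** matrix B = gram Y \<theta>"
  proof -
    have "(transpose (matrix B) ** matrix B) $ i $ j = B (axis i 1) \<bullet> B (axis j 1)" for i j
      by (simp add: matrix_matrix_mult_def transpose_def matrix_def inner_vec_def)
    then show ?thesis by (simp add: vec_eq_iff iB sum_axis_scaleR gram_nth)
  qed
  then have "det (gram Y \<theta>) = (det (matrix B))\<^sup>2"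
    by (metis det_mul det_transpose power2_eq_square)
  then show ?thesis using that[OF lB nB] by simp
qed

lemma det_gram_pos:
  fixes Y :: "real^'n \<Rightarrow> real^('n option)"
  assumes "immersed_at Y \<theta>"
  shows "det (gram Y \<theta>) > 0"
proof -
  obtain B :: "real^'n \<Rightarrow> real^'n" where "(det (matrix B))\<^sup>2 = det (gram Y \<theta>)"
    using immersed_at_isometric_linear[OF assms] by blast
  then have "det (gram Y \<theta>) \<ge> 0" by (metis zero_le_power2)
  with det_gram_nonzero[OF assms] show ?thesis by simp
qed

text \<open>The mean value inequality is applied to \<open>Y\<close> minus its linearization at
  \<open>\<theta>\<close>, whose differential is small on a ball by continuity of the partial
  derivatives. The estimate holds between any two points of the ball, as injectivity and
  bi-Lipschitz arguments require.\<close>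

lemma C1_strictly_differentiable:
  fixes Y :: "real^'n \<Rightarrow> 'b::real_normed_vector"
  assumes U: "open U" "\<theta> \<in> U" and Y: "Ck_on 1 Y U" and e: "e > 0"
  obtains r where "r > 0" "ball \<theta> r \<subseteq> U"
    "\<And>a b. a \<in> ball \<theta> r \<Longrightarrow> b \<in> ball \<theta> r \<Longrightarrow>
       norm (Y a - Y b - (\<Sum>i\<in>UNIV. (a - b) $ i *\<^sub>R pd i Y \<theta>)) \<le> e * norm (a - b)"
proof -
  let ?A = "\<lambda>v. \<Sum>i\<in>UNIV. v $ i *\<^sub>R pd i Y \<theta>"
  have "continuous_on U (\<lambda>\<xi>. \<Sum>i\<in>UNIV. norm (pd i Y \<xi> - pd i Y \<theta>))"
    using Y unfolding Ck_on_1 by (intro continuous_intros) auto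
  then have "isCont (\<lambda>\<xi>. \<Sum>i\<in>UNIV. norm (pd i Y \<xi> - pd i Y \<theta>)) \<theta>"
    using U continuous_on_eq_continuous_at by blast
  then obtain d where d: "d > 0" "\<And>\<xi>. dist \<xi> \<theta> < d \<Longrightarrow> (\<Sum>i\<in>UNIV. norm (pd i Y \<xi> - pd i Y \<theta>)) < e"
    using e unfolding continuous_at_eps_delta by (fastforce simp: dist_real_def)
  obtain r' where r': "r' > 0" "ball \<theta> r' \<subseteq> U" using U openE by blast
  define r where "r = min d r'"
  show ?thesis
  proof (rule that)
    show "r > 0" "ball \<theta> r \<subseteq> U" using d r' by (auto simp: r_def)
    fix a b assume ab: "a \<in> ball \<theta> r" "b \<in> ball \<theta> r"
    have "norm ((Y a - ?A a) - (Y b - ?A b)) \<le> e * norm (a - b)"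
    proof (rule differentiable_bound[where f'="\<lambda>\<xi> v. (\<Sum>i\<in>UNIV. v $ i *\<^sub>R pd i Y \<xi>) - ?A v"])
      show "convex (ball \<theta> r)" by simp
      fix \<xi> assume \<xi>: "\<xi> \<in> ball \<theta> r"
      then have dY: "Y differentiable (at \<xi>)" using Y r' unfolding Ck_on_1 by (auto simp: r_def)
      show "((\<lambda>\<xi>. Y \<xi> - ?A \<xi>) has_derivative (\<lambda>v. (\<Sum>i\<in>UNIV. v $ i *\<^sub>R pd i Y \<xi>) - ?A v)) (at \<xi> within ball \<theta> r)"
        by (intro has_derivative_diff has_derivative_at_withinI[OF has_derivative_pd[OF dY]]
            linear_imp_has_derivative linear_sum_pd)
      show "onorm (\<lambda>v. (\<Sum>i\<in>UNIV. v $ i *\<^sub>R pd i Y \<xi>) - ?A v) \<le> e"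
      proof (rule onorm_le)
        fix v :: "real^'n"
        have "norm ((\<Sum>i\<in>UNIV. v $ i *\<^sub>R pd i Y \<xi>) - ?A v) = norm (\<Sum>i\<in>UNIV. v $ i *\<^sub>R (pd i Y \<xi> - pd i Y \<theta>))"
          by (simp add: scaleR_diff_right sum_subtractf)
        also have "\<dots> \<le> (\<Sum>i\<in>UNIV. norm v * norm (pd i Y \<xi> - pd i Y \<theta>))"
          by (rule sum_norm_le) (simp add: mult_right_mono component_le_norm_cart)
        also have "\<dots> \<le> norm v * e"
          unfolding sum_distrib_left[symmetric] using d(2)[of \<xi>] \<xi>
          by (intro mult_left_mono) (auto simp: r_def dist_commute)
        finally show "norm ((\<Sum>i\<in>UNIV. v $ i *\<^sub>R pd i Y \<xi>) - ?A v) \<le> e * norm v" by (simp add: mult.commute)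
      qed
    qed (use ab in auto)
    moreover have "(Y a - ?A a) - (Y b - ?A b) = Y a - Y b - ?A (a - b)"
      unfolding linear_diff[OF linear_sum_pd] by simp
    ultimately show "norm (Y a - Y b - ?A (a - b)) \<le> e * norm (a - b)" by simp
  qed
qed

text \<open>Once the linearization error is at most the fraction 1 - 1/k of the length of the linear
  increment, the triangle inequality gives both bounds against the linear model B.\<close>

lemma immersion_local_comparison:
  fixes Y :: "real^'n \<Rightarrow> real^('n option)"
  assumes U: "open U" "\<theta> \<in> U" and Y: "Ck_on 1 Y U" and im: "immersed_at Y \<theta>" and k: "k > 1"
    and B: "linear B" "\<And>v. norm (B v) = norm (\<Sum>i\<in>UNIV. v $ i *\<^sub>R pd i Y \<theta>)"
  obtains r where "r > 0" "ball \<theta> r \<subseteq> U"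
    "\<And>a b. a \<in> ball \<theta> r \<Longrightarrow> b \<in> ball \<theta> r \<Longrightarrow> dist (Y a) (Y b) \<le> k * dist (B a) (B b)"
    "\<And>a b. a \<in> ball \<theta> r \<Longrightarrow> b \<in> ball \<theta> r \<Longrightarrow> dist (B a) (B b) \<le> k * dist (Y a) (Y b)"
proof -
  let ?A = "\<lambda>v. \<Sum>i\<in>UNIV. v $ i *\<^sub>R pd i Y \<theta>"
  have i: "inj ?A" using im unfolding immersed_at_def linear_injective_0[OF linear_sum_pd] .
  obtain m where m: "m > 0" "\<And>v. m * norm v \<le> norm (?A v)"
    by (rule linear_inj_bounded_below_pos[OF linear_sum_pd i]) (rule that; assumption)
  \<comment> \<open>As m bounds the differential from below, this constant converts an error in
    terms of \<open>norm (a - b)\<close> into one in terms of the linear increment.\<close>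
  have e: "m * (1 - 1 / k) > 0" using m k by simp
  obtain r where r: "r > 0" "ball \<theta> r \<subseteq> U"
    "\<And>a b. a \<in> ball \<theta> r \<Longrightarrow> b \<in> ball \<theta> r \<Longrightarrow> norm (Y a - Y b - ?A (a - b)) \<le> m * (1 - 1 / k) * norm (a - b)"
    by (rule C1_strictly_differentiable[OF U Y e]) (rule that; assumption)
  show ?thesis
  proof (rule that[OF r(1,2)])
    fix a b assume ab: "a \<in> ball \<theta> r" "b \<in> ball \<theta> r"
    let ?n = "dist (B a) (B b)"
    have n: "?n = norm (?A (a - b))"
      by (simp add: dist_norm linear_diff[OF B(1), symmetric] B(2))
    have "norm (Y a - Y b - ?A (a - b)) \<le> (1 - 1 / k) * (m * norm (a - b))"
      using r(3)[OF ab] by (simp add: mult_ac)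
    also have "\<dots> \<le> (1 - 1 / k) * ?n"
      unfolding n using k by (intro mult_left_mono m) auto
    finally have d: "norm (Y a - Y b - ?A (a - b)) \<le> (1 - 1 / k) * ?n" .
    have "dist (Y a) (Y b) \<le> ?n + (1 - 1 / k) * ?n"
      using norm_triangle_ineq[of "?A (a - b)" "Y a - Y b - ?A (a - b)"] d n by (simp add: dist_norm)
    also have "\<dots> = (2 - 1 / k) * ?n" by (simp add: algebra_simps)
    \<comment> \<open>The difference of the two factors is
      \<open>(k - 1)\<^sup>2 / k\<close>.\<close>
    also have "\<dots> \<le> k * ?n"
    proof (rule mult_right_mono)
      have "0 \<le> (k - 1)\<^sup>2 / k" using k by simp
      also have "(k - 1)\<^sup>2 / k = k - (2 - 1 / k)" using k by (simp add: power2_eq_square field_simps)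
      finally show "2 - 1 / k \<le> k" by simp
    qed simp
    finally show "dist (Y a) (Y b) \<le> k * ?n" .
    have "?n \<le> dist (Y a) (Y b) + (1 - 1 / k) * ?n"
      using norm_triangle_ineq2[of "?A (a - b)" "?A (a - b) - (Y a - Y b)"] d n
      by (simp add: dist_norm norm_minus_commute)
    then have "?n / k \<le> dist (Y a) (Y b)" by (simp add: algebra_simps)
    then show "?n \<le> k * dist (Y a) (Y b)" using k by (simp add: field_simps)
  qed
qed

definition area_density :: "(real^'n \<Rightarrow> real^('n option)) \<Rightarrow> real^'n \<Rightarrow> real" where
  "area_density Y \<theta> = sqrt (det (gram Y \<theta>))"

lemma continuous_on_gram:
  assumes "Ck_on 1 Y U"
  shows "continuous_on U (\<lambda>\<xi>. gram Y \<xi> $ i $ j)"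
  using assms unfolding Ck_on_1 gram_nth by (intro continuous_intros) auto

lemma continuous_on_area_density:
  assumes "Ck_on 1 Y U"
  shows "continuous_on U (area_density Y)"
  unfolding area_density_def[abs_def] by (intro continuous_intros continuous_on_det continuous_on_gram[OF assms])

text \<open>The C2 analogue of \<open>local_parametrization\<close>: the moving surfaces are
  parametrized by smooth charts of \<open>M\<close> followed by an embedding that is only
  C2.\<close>

definition patch :: "(real^('n::finite option)) set \<Rightarrow> (real^'n) set \<Rightarrow> (real^'n \<Rightarrow> real^('n option)) \<Rightarrow> bool" where
  "patch N U Y \<longleftrightarrow> open U \<and> openin (top_of_set N) (Y ` U) \<and> (\<exists>J. homeomorphism U (Y ` U) Y J) \<and>
     Ck_on 2 Y U \<and> (\<forall>\<theta>\<in>U. immersed_at Y \<theta>)"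

lemma patchD:
  assumes "patch N U Y"
  shows "open U" "openin (top_of_set N) (Y ` U)" "Ck_on 2 Y U" "Ck_on 1 Y U" "\<theta> \<in> U \<Longrightarrow> immersed_at Y \<theta>"
    "Y ` U \<subseteq> N" "continuous_on U Y" "inj_on Y U"
proof -
  show o: "openin (top_of_set N) (Y ` U)" and "open U" and C: "Ck_on 2 Y U"
    and "\<theta> \<in> U \<Longrightarrow> immersed_at Y \<theta>"
    using assms by (simp_all add: patch_def)
  show "Ck_on 1 Y U" by (rule Ck_on_2_imp_1[OF C])
  show "Y ` U \<subseteq> N" by (rule openin_imp_subset[OF o])
  show "continuous_on U Y" by (rule Ck_on_2D(4)[OF C])
  obtain J where "homeomorphism U (Y ` U) Y J" using assms by (auto simp: patch_def)
  then show "inj_on Y U" by (intro inj_on_inverseI[of _ J]) (rule homeomorphism_apply1)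
qed

lemma patch_openin_image:
  assumes p: "patch N U Y" and V: "open V" "V \<subseteq> U"
  shows "openin (top_of_set N) (Y ` V)"
proof -
  obtain J where J: "homeomorphism U (Y ` U) Y J" using p by (auto simp: patch_def)
  have "openin (top_of_set (Y ` U)) (Y ` V)"
    using V by (intro homeomorphism_imp_open_map[OF J] open_subset)
  then show ?thesis using patchD(2)[OF p] openin_trans by blast
qed

text \<open>The inverse on the patch is extended by 0. The patch is relatively open in a closed set,
  hence Borel, and so the extension is Borel measurable.\<close>

lemma patch_borel_inverse:
  assumes p: "patch N U Y" and N: "closed N"
  obtains J where "J \<in> borel_measurable borel" "\<And>\<theta>. \<theta> \<in> U \<Longrightarrow> J (Y \<theta>) = \<theta>" "Y ` U \<in> sets borel"
proof -
  obtain J where J: "homeomorphism U (Y ` U) Y J" using p by (auto simp: patch_def)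
  obtain T where T: "open T" "Y ` U = N \<inter> T" using patchD(2)[OF p] by (auto simp: openin_open)
  have b: "Y ` U \<in> sets borel" unfolding T using T N by (intro sets.Int) auto
  let ?J = "\<lambda>y. if y \<in> Y ` U then J y else 0"
  have "?J \<in> borel_measurable borel"
    by (rule borel_measurable_continuous_on_if[OF b homeomorphism_cont2[OF J]]) simp
  moreover have "?J (Y \<theta>) = \<theta>" if "\<theta> \<in> U" for \<theta>
    using homeomorphism_apply1[OF J that] that by simp
  ultimately show ?thesis using that b by blast
qed

definition flat_const :: "'n::finite itself \<Rightarrow> real" where
  "flat_const _ = enn2real (flat_density TYPE('n))"

lemma flat_density_eq: "flat_density TYPE('n::finite) = ennreal (flat_const TYPE('n))"
  using flat_density_finite[where 'n='n] by (simp add: flat_const_def)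

context
  assumes ms: "measure_space UNIV (sets borel) (hausdorff_outer CARD('n::finite) :: (real^('n option)) set \<Rightarrow> ennreal)"
begin

text \<open>On a small ball, distances under \<open>Y\<close> and under the linear model differ by a
  factor at most k, and so do the area density and its value at the centre, which is the absolute
  determinant of the model.\<close>

lemma area_local:
  fixes Y :: "real^'n \<Rightarrow> real^('n option)"
  assumes U: "open U" "\<theta> \<in> U" and Y: "Ck_on 1 Y U" and im: "immersed_at Y \<theta>" and K: "K > 1"
  obtains r where "r > 0" "ball \<theta> r \<subseteq> U"
    "\<And>S. S \<in> sets borel \<Longrightarrow> S \<subseteq> ball \<theta> r \<Longrightarrow> hausdorff_outer CARD('n) (Y ` S) \<le>
       ennreal K * (flat_density TYPE('n) * (\<integral>\<^sup>+\<xi>\<in>S. ennreal (area_density Y \<xi>) \<partial>lborel))"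
    "\<And>S. S \<in> sets borel \<Longrightarrow> S \<subseteq> ball \<theta> r \<Longrightarrow>
       flat_density TYPE('n) * (\<integral>\<^sup>+\<xi>\<in>S. ennreal (area_density Y \<xi>) \<partial>lborel) \<le>
       ennreal K * hausdorff_outer CARD('n) (Y ` S)"
    "hausdorff_outer CARD('n) (Y ` ball \<theta> r) < \<infinity>"
proof -
  let ?n = "CARD('n)" and ?c = "flat_density TYPE('n)"
  \<comment> \<open>An (n+1)-st root: n factors are spent on the Hausdorff comparison of
    \<open>Y\<close> with the linear model, one on the oscillation of the area density.\<close>
  define k where "k = root (Suc ?n) K"
  have k: "k > 1" "k ^ Suc ?n = K" using K by (auto simp: k_def simp del: power_Suc)
  obtain B :: "real^'n \<Rightarrow> real^'n" where B: "linear B"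
    "\<And>v. norm (B v) = norm (\<Sum>i\<in>UNIV. v $ i *\<^sub>R pd i Y \<theta>)" "(det (matrix B))\<^sup>2 = det (gram Y \<theta>)"
    by (rule immersed_at_isometric_linear[OF im]) (rule that; assumption)
  define d where "d = area_density Y \<theta>"
  have d: "d > 0" "d = \<bar>det (matrix B)\<bar>"
    using det_gram_pos[OF im] by (simp_all add: d_def area_density_def flip: B(3))
  have "inj B" using d det_nz_iff_inj[OF B(1)] by auto
  obtain r1 where r1: "r1 > 0" "ball \<theta> r1 \<subseteq> U"
    "\<And>a b. a \<in> ball \<theta> r1 \<Longrightarrow> b \<in> ball \<theta> r1 \<Longrightarrow> dist (Y a) (Y b) \<le> k * dist (B a) (B b)"
    "\<And>a b. a \<in> ball \<theta> r1 \<Longrightarrow> b \<in> ball \<theta> r1 \<Longrightarrow> dist (B a) (B b) \<le> k * dist (Y a) (Y b)"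
    by (rule immersion_local_comparison[OF U Y im k(1) B(1,2)]) (rule that; assumption)
  have "isCont (area_density Y) \<theta>"
    using continuous_on_area_density[OF Y] U continuous_on_eq_continuous_at by blast
  then have ev: "eventually (\<lambda>\<xi>. d / k < area_density Y \<xi> \<and> area_density Y \<xi> < k * d) (nhds \<theta>)"
    using d k unfolding isCont_def tendsto_at_iff_tendsto_nhds d_def
    by (intro eventually_conj order_tendstoD) (auto simp: field_simps)
  then obtain r2 where r2: "r2 > 0" "\<And>\<xi>. dist \<xi> \<theta> < r2 \<Longrightarrow> d / k < area_density Y \<xi> \<and> area_density Y \<xi> < k * d"
    by (auto simp: eventually_nhds_metric)
  define r where "r = min r1 r2"
  have FB: "hausdorff_outer ?n ((\<lambda>x. flat (B x)) ` S) = ?c * (ennreal d * emeasure lborel S)" if S: "S \<in> sets borel" for S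
  proof -
    have "hausdorff_outer ?n (flat ` B ` S) = ?c * emeasure lborel (B ` S)"
      by (intro hausdorff_outer_flat[OF ms] emeasure_lborel_linear_image_cube(1) B \<open>inj B\<close> S)
    then show ?thesis
      by (simp add: image_image emeasure_lborel_linear_image[OF B(1) \<open>inj B\<close> S] d(2))
  qed
  have I1: "ennreal d * emeasure lborel S \<le> ennreal k * (\<integral>\<^sup>+\<xi>\<in>S. ennreal (area_density Y \<xi>) \<partial>lborel)"
    and I2: "(\<integral>\<^sup>+\<xi>\<in>S. ennreal (area_density Y \<xi>) \<partial>lborel) \<le> ennreal k * (ennreal d * emeasure lborel S)"
    if S: "S \<in> sets borel" "S \<subseteq> ball \<theta> r" for S
  proof -
    have "ball \<theta> r \<subseteq> U" using r1 by (auto simp: r_def)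
    then have "continuous_on (ball \<theta> r) (area_density Y)"
      using continuous_on_area_density[OF Y] continuous_on_subset by blast
    then have m: "(\<lambda>\<xi>. indicator (ball \<theta> r) \<xi> *\<^sub>R area_density Y \<xi>) \<in> borel_measurable borel"
      by (intro borel_measurable_continuous_on_indicator) auto
    have eq: "ennreal (area_density Y \<xi>) * indicator S \<xi> = ennreal (indicator (ball \<theta> r) \<xi> *\<^sub>R area_density Y \<xi>) * indicator S \<xi>" for \<xi>
      using S(2) by (auto split: split_indicator)
    have m': "(\<lambda>\<xi>. ennreal (area_density Y \<xi>) * indicator S \<xi>) \<in> borel_measurable lborel"
      unfolding eq using m S by (intro borel_measurable_times_ennreal borel_measurable_indicator) simp_all
    have bd: "d \<le> k * area_density Y \<xi>" "area_density Y \<xi> \<le> k * d" if "\<xi> \<in> S" for \<xi>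
      using r2(2)[of \<xi>] S(2) that k by (auto simp: r_def dist_commute field_simps subset_iff)
    have "ennreal d * emeasure lborel S = (\<integral>\<^sup>+\<xi>. ennreal d * indicator S \<xi> \<partial>lborel)"
      using S by (simp add: nn_integral_cmult_indicator)
    also have "\<dots> \<le> (\<integral>\<^sup>+\<xi>. ennreal k * (ennreal (area_density Y \<xi>) * indicator S \<xi>) \<partial>lborel)"
      using bd k by (intro nn_integral_mono) (auto split: split_indicator simp: ennreal_mult'[symmetric] intro!: ennreal_leI)
    also have "\<dots> = ennreal k * (\<integral>\<^sup>+\<xi>\<in>S. ennreal (area_density Y \<xi>) \<partial>lborel)"
      by (rule nn_integral_cmult[OF m'])
    finally show "ennreal d * emeasure lborel S \<le> ennreal k * (\<integral>\<^sup>+\<xi>\<in>S. ennreal (area_density Y \<xi>) \<partial>lborel)" .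
    have "(\<integral>\<^sup>+\<xi>\<in>S. ennreal (area_density Y \<xi>) \<partial>lborel) \<le> (\<integral>\<^sup>+\<xi>. ennreal (k * d) * indicator S \<xi> \<partial>lborel)"
      using bd by (intro nn_integral_mono) (auto split: split_indicator intro!: ennreal_leI)
    also have "\<dots> = ennreal (k * d) * emeasure lborel S"
      using S by (intro nn_integral_cmult_indicator) simp
    also have "\<dots> = ennreal k * (ennreal d * emeasure lborel S)"
      using k d(1) by (simp add: ennreal_mult mult.assoc del: d(2))
    finally show "(\<integral>\<^sup>+\<xi>\<in>S. ennreal (area_density Y \<xi>) \<partial>lborel) \<le> ennreal k * (ennreal d * emeasure lborel S)" .
  qed
  have kk: "ennreal (k ^ ?n) * ennreal k = ennreal K" "ennreal k * ennreal (k ^ ?n) = ennreal K"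
    using k by (simp_all add: ennreal_mult'[symmetric] mult.commute)
  have H1: "hausdorff_outer ?n (Y ` S) \<le> ennreal (k ^ ?n) * hausdorff_outer ?n ((\<lambda>x. flat (B x)) ` S)"
    and H2: "hausdorff_outer ?n ((\<lambda>x. flat (B x)) ` S) \<le> ennreal (k ^ ?n) * hausdorff_outer ?n (Y ` S)"
    if "S \<subseteq> ball \<theta> r" for S
  proof -
    have S: "a \<in> ball \<theta> r1" if "a \<in> S" for a
      using \<open>S \<subseteq> ball \<theta> r\<close> that by (auto simp: r_def)
    show "hausdorff_outer ?n (Y ` S) \<le> ennreal (k ^ ?n) * hausdorff_outer ?n ((\<lambda>x. flat (B x)) ` S)"
      using k(1) r1(3)[OF S S] by (intro hausdorff_outer_compare) (simp_all add: dist_flat)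
    show "hausdorff_outer ?n ((\<lambda>x. flat (B x)) ` S) \<le> ennreal (k ^ ?n) * hausdorff_outer ?n (Y ` S)"
      using k(1) r1(4)[OF S S] by (intro hausdorff_outer_compare) (simp_all add: dist_flat)
  qed
  show ?thesis
  proof (rule that)
    show "r > 0" "ball \<theta> r \<subseteq> U" using r1 r2 by (auto simp: r_def)
    fix S assume S: "S \<in> sets borel" "S \<subseteq> ball \<theta> r"
    let ?I = "\<integral>\<^sup>+\<xi>\<in>S. ennreal (area_density Y \<xi>) \<partial>lborel"
    have "hausdorff_outer ?n (Y ` S) \<le> ennreal (k ^ ?n) * (?c * (ennreal d * emeasure lborel S))"
      using H1[OF S(2)] FB[OF S(1)] by simp
    also have "\<dots> \<le> ennreal (k ^ ?n) * (?c * (ennreal k * ?I))"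
      by (intro mult_left_mono I1 S) auto
    also have "\<dots> = (ennreal (k ^ ?n) * ennreal k) * (?c * ?I)" by (simp only: mult_ac)
    finally show "hausdorff_outer ?n (Y ` S) \<le> ennreal K * (?c * ?I)" unfolding kk .
    have "?c * ?I \<le> ?c * (ennreal k * (ennreal d * emeasure lborel S))"
      by (intro mult_left_mono I2 S) auto
    also have "\<dots> = ennreal k * hausdorff_outer ?n ((\<lambda>x. flat (B x)) ` S)"
      unfolding FB[OF S(1)] by (simp only: mult_ac)
    also have "\<dots> \<le> ennreal k * (ennreal (k ^ ?n) * hausdorff_outer ?n (Y ` S))"
      by (intro mult_left_mono H2 S) auto
    also have "\<dots> = ennreal K * hausdorff_outer ?n (Y ` S)" by (simp only: mult.assoc[symmetric] kk)
    finally show "?c * ?I \<le> ennreal K * hausdorff_outer ?n (Y ` S)" .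
  next
    have "hausdorff_outer ?n (Y ` ball \<theta> r) \<le> ennreal (k ^ ?n) * (?c * (ennreal d * emeasure lborel (ball \<theta> r)))"
      using H1[of "ball \<theta> r"] FB[of "ball \<theta> r"] by simp
    also have "\<dots> < \<infinity>"
      using flat_density_finite[where 'n='n] emeasure_bounded_finite[OF bounded_ball, of \<theta> r]
      by (simp add: ennreal_mult_less_top)
    finally show "hausdorff_outer ?n (Y ` ball \<theta> r) < \<infinity>" .
  qed
qed

text \<open>Near each point of U the two measures dominate each other up to any factor K > 1, and
  both depend only on the part of a set inside U. So \<open>measure_le_of_locally_le\<close> is
  applied in both directions.\<close>

theorem area_formula:
  fixes Y :: "real^'n \<Rightarrow> real^('n option)"
  assumes U: "open U" and Y: "Ck_on 1 Y U" "\<And>\<theta>. \<theta> \<in> U \<Longrightarrow> immersed_at Y \<theta>"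
    and J: "J \<in> borel_measurable borel" "\<And>\<theta>. \<theta> \<in> U \<Longrightarrow> J (Y \<theta>) = \<theta>" and YU: "Y ` U \<in> sets borel"
  shows "param_measure U Y J =
    density lborel (\<lambda>\<theta>. ennreal (flat_const TYPE('n) * (indicator U \<theta> *\<^sub>R area_density Y \<theta>)))" (is "?M = ?N")
proof (rule measure_eqI)
  have sM: "sets ?M = sets borel" "sets ?N = sets borel" by (simp_all add: param_measure_def)
  then show "sets ?M = sets ?N" by simp
  have m: "(\<lambda>\<xi>. indicator U \<xi> *\<^sub>R area_density Y \<xi>) \<in> borel_measurable borel"
    using continuous_on_area_density[OF Y(1)] U by (intro borel_measurable_continuous_on_indicator) auto
  have eM: "emeasure ?M S = hausdorff_outer CARD('n) (Y ` (S \<inter> U))" if "S \<in> sets borel" for S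
    by (rule emeasure_param_measure(1)[OF ms YU J that])
  have eN: "emeasure ?N S = flat_density TYPE('n) * (\<integral>\<^sup>+\<xi>\<in>S \<inter> U. ennreal (area_density Y \<xi>) \<partial>lborel)"
    if S: "S \<in> sets borel" for S
  proof -
    have "emeasure ?N S = (\<integral>\<^sup>+\<xi>. ennreal (flat_const TYPE('n) * (indicator U \<xi> *\<^sub>R area_density Y \<xi>)) * indicator S \<xi> \<partial>lborel)"
      using m S by (intro emeasure_density) auto
    also have "\<dots> = (\<integral>\<^sup>+\<xi>. flat_density TYPE('n) * (ennreal (indicator U \<xi> *\<^sub>R area_density Y \<xi>) * indicator S \<xi>) \<partial>lborel)"
      unfolding flat_density_eq by (intro nn_integral_cong) (simp add: ennreal_mult'' flat_const_def mult.assoc ennreal_mult')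
    also have "\<dots> = flat_density TYPE('n) * (\<integral>\<^sup>+\<xi>. ennreal (indicator U \<xi> *\<^sub>R area_density Y \<xi>) * indicator S \<xi> \<partial>lborel)"
      using m S by (intro nn_integral_cmult borel_measurable_times_ennreal borel_measurable_indicator) simp_all
    also have "(\<integral>\<^sup>+\<xi>. ennreal (indicator U \<xi> *\<^sub>R area_density Y \<xi>) * indicator S \<xi> \<partial>lborel) =
       (\<integral>\<^sup>+\<xi>\<in>S \<inter> U. ennreal (area_density Y \<xi>) \<partial>lborel)"
      by (intro nn_integral_cong) (auto split: split_indicator)
    finally show ?thesis .
  qed
  have locM: "\<exists>r>0. \<forall>S\<in>sets borel. S \<subseteq> ball \<theta> r \<longrightarrow> emeasure ?M S \<le> ennreal K * emeasure ?N S"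
    and locN: "\<exists>r>0. \<forall>S\<in>sets borel. S \<subseteq> ball \<theta> r \<longrightarrow> emeasure ?N S \<le> ennreal K * emeasure ?M S"
    if K: "1 < K" and \<theta>: "\<theta> \<in> U" for K \<theta>
  proof -
    obtain r where r: "r > 0" "ball \<theta> r \<subseteq> U"
    "\<And>S. S \<in> sets borel \<Longrightarrow> S \<subseteq> ball \<theta> r \<Longrightarrow> hausdorff_outer CARD('n) (Y ` S) \<le>
       ennreal K * (flat_density TYPE('n) * (\<integral>\<^sup>+\<xi>\<in>S. ennreal (area_density Y \<xi>) \<partial>lborel))"
    "\<And>S. S \<in> sets borel \<Longrightarrow> S \<subseteq> ball \<theta> r \<Longrightarrow>
       flat_density TYPE('n) * (\<integral>\<^sup>+\<xi>\<in>S. ennreal (area_density Y \<xi>) \<partial>lborel) \<le>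
       ennreal K * hausdorff_outer CARD('n) (Y ` S)"
      by (rule area_local[OF U \<theta> Y(1) Y(2)[OF \<theta>] K]) (rule that; assumption)
    have SU: "S \<inter> U = S" if "S \<subseteq> ball \<theta> r" for S using that r(2) by blast
    show "\<exists>r>0. \<forall>S\<in>sets borel. S \<subseteq> ball \<theta> r \<longrightarrow> emeasure ?M S \<le> ennreal K * emeasure ?N S"
      by (intro exI[of _ r] conjI ballI impI r(1), simp only: eM eN SU, rule r(3))
    show "\<exists>r>0. \<forall>S\<in>sets borel. S \<subseteq> ball \<theta> r \<longrightarrow> emeasure ?N S \<le> ennreal K * emeasure ?M S"
      by (intro exI[of _ r] conjI ballI impI r(1), simp only: eM eN SU, rule r(4))
  qed
  fix S assume "S \<in> sets ?M"
  then have S: "S \<in> sets borel" by (simp add: sM)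
  have SU: "S \<inter> U \<in> sets borel" "S \<inter> U \<subseteq> U" using S U by auto
  have "emeasure ?M (S \<inter> U) = emeasure ?N (S \<inter> U)"
    using measure_le_of_locally_le[OF sM U locM SU] measure_le_of_locally_le[OF sM(2,1) U locN SU]
    by (rule antisym)
  then show "emeasure ?M S = emeasure ?N S" by (simp only: eM[OF S] eN[OF S] eM[OF SU(1)] eN[OF SU(1)] Int_assoc Int_absorb)
qed

lemma integral_over_patch:
  fixes Y :: "real^'n \<Rightarrow> real^('n option)" and h :: "real^('n option) \<Rightarrow> real"
  assumes p: "patch N U Y" and N: "closed N" and h: "continuous_on U (\<lambda>\<theta>. h (Y \<theta>))"
  shows "(LINT y:Y ` U|surface_measure. h y) = flat_const TYPE('n) * (LINT \<theta>:U|lborel. area_density Y \<theta> * h (Y \<theta>))"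
proof -
  obtain J where J: "J \<in> borel_measurable borel" "\<And>\<theta>. \<theta> \<in> U \<Longrightarrow> J (Y \<theta>) = \<theta>" and YU: "Y ` U \<in> sets borel"
    using patch_borel_inverse[OF p N] by metis
  note pD = patchD[OF p]
  define k where "k \<theta> = indicator U \<theta> *\<^sub>R h (Y \<theta>)" for \<theta>
  have k: "k \<in> borel_measurable borel"
    unfolding k_def using h pD(1) by (intro borel_measurable_continuous_on_indicator) auto
  have m: "(\<lambda>\<xi>. indicator U \<xi> *\<^sub>R area_density Y \<xi>) \<in> borel_measurable borel"
    using continuous_on_area_density[OF pD(4)] pD(1) by (intro borel_measurable_continuous_on_indicator) auto
  have ind: "indicator (Y ` U) = (\<lambda>y. ennreal (indicator (Y ` U) y))" by (auto simp: fun_eq_iff split: split_indicator)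
  have "(LINT y:Y ` U|surface_measure. h y) = (\<integral>y. indicator (Y ` U) y *\<^sub>R k (J y) \<partial>surface_measure)"
    unfolding set_lebesgue_integral_def by (intro Bochner_Integration.integral_cong) (auto simp: k_def J split: split_indicator)
  also have "\<dots> = (\<integral>y. k (J y) \<partial>density surface_measure (indicator (Y ` U)))"
    unfolding ind using J k YU by (subst integral_density) auto
  also have "\<dots> = (\<integral>\<theta>. k \<theta> \<partial>param_measure U Y J)"
    unfolding param_measure_def using J k by (subst integral_distr) auto
  also have "\<dots> = (\<integral>\<theta>. (flat_const TYPE('n) * (indicator U \<theta> *\<^sub>R area_density Y \<theta>)) *\<^sub>R k \<theta> \<partial>lborel)"
  proof (subst area_formula[OF pD(1,4,5) J YU], simp, subst integral_density)
    show "AE \<theta> in lborel. 0 \<le> flat_const TYPE('n) * (indicator U \<theta> *\<^sub>R area_density Y \<theta>)"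
      using det_gram_pos[OF pD(5)] by (auto simp: flat_const_def area_density_def less_imp_le split: split_indicator)
  qed (use k m in auto)
  also have "\<dots> = (\<integral>\<theta>. flat_const TYPE('n) * (indicator U \<theta> *\<^sub>R (area_density Y \<theta> * h (Y \<theta>))) \<partial>lborel)"
    by (intro Bochner_Integration.integral_cong) (auto simp: k_def split: split_indicator)
  finally show ?thesis unfolding set_lebesgue_integral_def by simp
qed

text \<open>\<open>area_local\<close> gives each point a relative neighbourhood of finite measure,
  and compactness leaves finitely many. Finite area is what makes continuous functions
  integrable.\<close>

lemma emeasure_hypersurface_finite:
  fixes N :: "(real^('n option)) set"
  assumes N: "compact N" and cov: "\<And>y. y \<in> N \<Longrightarrow> \<exists>U Y. patch N U Y \<and> y \<in> Y ` U"
  shows "emeasure surface_measure N < \<infinity>"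
proof -
  have "\<exists>T. open T \<and> y \<in> T \<and> emeasure surface_measure (N \<inter> T) < \<infinity>" if y: "y \<in> N" for y
  proof -
    obtain U Y where p: "patch N U Y" and "y \<in> Y ` U" using cov[OF y] by blast
    then obtain \<theta> where \<theta>: "\<theta> \<in> U" "y = Y \<theta>" by blast
    note pD = patchD[OF p]
    obtain r where r: "r > 0" "ball \<theta> r \<subseteq> U" "hausdorff_outer CARD('n) (Y ` ball \<theta> r) < \<infinity>"
      by (rule area_local[OF pD(1) \<theta>(1) pD(4) pD(5)[OF \<theta>(1)], of 2]) (simp, (rule that; assumption))
    obtain T where T: "open T" "Y ` ball \<theta> r = N \<inter> T"
      using patch_openin_image[OF p _ r(2)] by (auto simp: openin_open)
    have "N \<inter> T \<in> sets borel" using T compact_imp_closed[OF N] by (intro sets.Int) auto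
    then have "emeasure surface_measure (N \<inter> T) < \<infinity>"
      using r(3) emeasure_surface_measure[OF ms, of "N \<inter> T"] by (simp add: T(2))
    moreover have "y \<in> T" using T r \<theta> by auto
    ultimately show ?thesis using T by blast
  qed
  then obtain T where T: "\<And>y. y \<in> N \<Longrightarrow> open (T y)" "\<And>y. y \<in> N \<Longrightarrow> y \<in> T y"
    "\<And>y. y \<in> N \<Longrightarrow> emeasure surface_measure (N \<inter> T y) < \<infinity>" by metis
  obtain F where F: "F \<subseteq> N" "finite F" "N \<subseteq> (\<Union>y\<in>F. T y)"
    using compactE_image[OF N, of N T] T by blast
  have b: "N \<inter> T y \<in> sets borel" if "y \<in> N" for y
    using T(1)[OF that] compact_imp_closed[OF N] by (intro sets.Int) auto
  have "emeasure surface_measure N \<le> emeasure surface_measure (\<Union>y\<in>F. N \<inter> T y)"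
  proof (rule emeasure_mono)
    show "N \<subseteq> (\<Union>y\<in>F. N \<inter> T y)" using F(3) by blast
    show "(\<Union>y\<in>F. N \<inter> T y) \<in> sets surface_measure"
      unfolding sets_surface_measure using b F(1) by (intro sets.finite_UN F(2)) blast
  qed
  also have "\<dots> \<le> (\<Sum>y\<in>F. emeasure surface_measure (N \<inter> T y))"
    using F b by (intro emeasure_subadditive_finite) auto
  also have "\<dots> < \<infinity>" using F T(3) by (auto simp: less_top[symmetric])
  finally show ?thesis .
qed

end

section \<open>The divergence theorem in coordinates\<close>

lemma pd_zero_outside:
  fixes f :: "real^'n \<Rightarrow> 'b::real_normed_vector"
  assumes "closed K" "\<And>\<theta>. \<theta> \<notin> K \<Longrightarrow> f \<theta> = 0" "\<theta> \<notin> K"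
  shows "pd j f \<theta> = 0"
proof -
  have "eventually (\<lambda>\<xi>. \<xi> \<in> - K) (nhds \<theta>)"
    using assms by (intro eventually_nhds_in_open) (auto simp: open_Compl)
  then have "eventually (\<lambda>\<xi>. f \<xi> = 0) (nhds \<theta>)" by (rule eventually_mono) (simp add: assms(2))
  from pd_cong_nhds[OF this] show ?thesis by simp
qed

lemma integrable_continuous_compact_support:
  fixes f :: "real^'n \<Rightarrow> real"
  assumes "continuous_on UNIV f" "compact K" "\<And>\<theta>. \<theta> \<notin> K \<Longrightarrow> f \<theta> = 0"
  shows "integrable lborel f"
proof -
  have "integrable lborel (\<lambda>x. indicator K x *\<^sub>R f x)"
    using assms by (intro borel_integrable_compact) (auto intro: continuous_on_subset)
  moreover have "(\<lambda>x. indicator K x *\<^sub>R f x) = f"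
    using assms(3) by (auto simp: fun_eq_iff split: split_indicator)
  ultimately show ?thesis by simp
qed

text \<open>Difference quotients have integral 0 by translation invariance of Lebesgue measure. They
  converge to the partial derivative and are dominated by its bound M on a fixed ball, so the limit
  has integral 0 as well.\<close>

lemma integral_pd_eq_0:
  fixes f :: "real^'n \<Rightarrow> real"
  assumes d: "\<And>\<theta>. f differentiable (at \<theta>)" and c: "continuous_on UNIV (pd j f)"
    and K: "compact K" "\<And>\<theta>. \<theta> \<notin> K \<Longrightarrow> f \<theta> = 0"
  shows "(\<integral>\<theta>. pd j f \<theta> \<partial>lborel) = 0"
proof -
  let ?e = "axis j 1 :: real^'n"
  define q where "q k \<theta> = real (Suc k) * (f (\<theta> + (1 / real (Suc k)) *\<^sub>R ?e) - f \<theta>)" for k \<theta>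
  have cf: "continuous_on UNIV f"
    using d by (intro continuous_at_imp_continuous_on ballI differentiable_imp_continuous_within)
  have intf: "integrable lborel f" by (rule integrable_continuous_compact_support[OF cf K])
  have mf[measurable]: "f \<in> borel_measurable borel" and mp[measurable]: "pd j f \<in> borel_measurable borel"
    using cf c by (auto intro: borel_measurable_continuous_onI)
  have pz: "pd j f \<theta> = 0" if "\<theta> \<notin> K" for \<theta>
    by (rule pd_zero_outside[OF compact_imp_closed[OF K(1)] K(2) that])
  obtain M where M: "\<And>\<theta>. \<bar>pd j f \<theta>\<bar> \<le> M" "M \<ge> 0"
  proof -
    have "bounded (pd j f ` K)"
      using K(1) c by (intro compact_imp_bounded compact_continuous_image) (auto intro: continuous_on_subset)
    then obtain b where b: "b > 0" "\<And>\<theta>. \<theta> \<in> K \<Longrightarrow> \<bar>pd j f \<theta>\<bar> \<le> b" by (auto simp: bounded_pos)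
    then have "\<bar>pd j f \<theta>\<bar> \<le> b" for \<theta> using pz[of \<theta>] by (cases "\<theta> \<in> K") auto
    with b that[of b] show ?thesis by auto
  qed
  obtain R where R: "\<And>\<theta>. \<theta> \<in> K \<Longrightarrow> norm \<theta> \<le> R"
    using compact_imp_bounded[OF K(1)] by (auto simp: bounded_iff)
  have mvt: "\<exists>s. 0 < s \<and> s < 1 / real (Suc k) \<and> q k \<theta> = pd j f (\<theta> + s *\<^sub>R ?e)" for k \<theta>
  proof -
    have "\<exists>s. 0 < s \<and> s < 1 / real (Suc k) \<and> f (\<theta> + (1 / real (Suc k)) *\<^sub>R ?e) - f (\<theta> + 0 *\<^sub>R ?e) =
       (1 / real (Suc k) - 0) * pd j f (\<theta> + s *\<^sub>R ?e)"
      by (rule MVT2) (auto intro: pd_line d)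
    then show ?thesis by (auto simp: q_def field_simps)
  qed
  \<comment> \<open>The increments have length at most 1, so for \<open>\<theta>\<close> outside the
    ball of radius R + 1 the mean value point still lies outside K.\<close>
  have bound: "\<bar>q k \<theta>\<bar> \<le> M * indicator (cball 0 (R + 1)) \<theta>" for k \<theta>
  proof -
    obtain s where s: "0 < s" "s < 1 / real (Suc k)" "q k \<theta> = pd j f (\<theta> + s *\<^sub>R ?e)" using mvt by blast
    have "s \<le> 1"
      using s(2) by (rule order_trans[OF less_imp_le]) simp
    show ?thesis
    proof (cases "\<theta> \<in> cball 0 (R + 1)")
      case False
      have "norm \<theta> \<le> norm (\<theta> + s *\<^sub>R ?e) + norm (s *\<^sub>R ?e)"
        using norm_triangle_ineq4[of "\<theta> + s *\<^sub>R ?e" "s *\<^sub>R ?e"] by simp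
      then have "norm (\<theta> + s *\<^sub>R ?e) > R" using False s \<open>s \<le> 1\<close> by simp
      then have "\<theta> + s *\<^sub>R ?e \<notin> K" using R by fastforce
      then show ?thesis using s pz M by simp
    qed (use s M in simp)
  qed
  have lim: "(\<lambda>k. q k \<theta>) \<longlonglongrightarrow> pd j f \<theta>" for \<theta>
  proof -
    have "((\<lambda>s. f (\<theta> + s *\<^sub>R ?e)) has_real_derivative pd j f (\<theta> + 0 *\<^sub>R ?e)) (at 0)"
      by (rule pd_line) (simp add: d)
    then have "((\<lambda>h. (f (\<theta> + (0 + h) *\<^sub>R ?e) - f (\<theta> + 0 *\<^sub>R ?e)) / h) \<longlongrightarrow> pd j f (\<theta> + 0 *\<^sub>R ?e)) (at 0)"
      by (simp add: DERIV_def)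
    moreover have "filterlim (\<lambda>k. 1 / real (Suc k)) (at 0) sequentially"
      unfolding filterlim_at using LIMSEQ_Suc[OF lim_1_over_n] by auto
    ultimately have "(\<lambda>k. (f (\<theta> + (0 + 1 / real (Suc k)) *\<^sub>R ?e) - f (\<theta> + 0 *\<^sub>R ?e)) / (1 / real (Suc k)))
       \<longlonglongrightarrow> pd j f (\<theta> + 0 *\<^sub>R ?e)"
      by (rule filterlim_compose)
    then show ?thesis by (simp add: q_def field_simps)
  qed
  have trans: "(\<integral>\<theta>. f (\<theta> + a) \<partial>lborel) = (\<integral>\<theta>. f \<theta> \<partial>lborel)" "integrable lborel (\<lambda>\<theta>. f (\<theta> + a))" for a
  proof -
    have "(\<integral>\<theta>. f \<theta> \<partial>lborel) = (\<integral>\<theta>. f \<theta> \<partial>distr lborel borel ((+) a))" by (simp add: lborel_distr_plus)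
    also have "\<dots> = (\<integral>\<theta>. f (a + \<theta>) \<partial>lborel)" by (subst integral_distr) auto
    finally show "(\<integral>\<theta>. f (\<theta> + a) \<partial>lborel) = (\<integral>\<theta>. f \<theta> \<partial>lborel)" by (simp add: add.commute)
    have "integrable (distr lborel borel ((+) a)) f" using intf by (simp add: lborel_distr_plus)
    then have "integrable lborel (\<lambda>\<theta>. f (a + \<theta>))" by (subst (asm) integrable_distr_eq) auto
    then show "integrable lborel (\<lambda>\<theta>. f (\<theta> + a))" by (simp add: add.commute)
  qed
  have "(\<integral>\<theta>. q k \<theta> \<partial>lborel) = 0" for k
    unfolding q_def using intf trans by simp
  moreover have "(\<lambda>k. \<integral>\<theta>. q k \<theta> \<partial>lborel) \<longlonglongrightarrow> (\<integral>\<theta>. pd j f \<theta> \<partial>lborel)"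
  proof (rule integral_dominated_convergence[where w="\<lambda>\<theta>. M * indicator (cball 0 (R + 1)) \<theta>"])
    show "integrable lborel (\<lambda>\<theta> :: real^'n. M * indicator (cball 0 (R + 1)) \<theta>)"
      using emeasure_bounded_finite[OF bounded_cball, of "0 :: real^'n" "R + 1"]
      by (intro integrable_mult_right integrable_real_indicator) auto
    show "q k \<in> borel_measurable lborel" for k unfolding q_def by measurable
  qed (use lim bound in auto)
  ultimately show ?thesis by (simp add: LIMSEQ_const_iff)
qed

section \<open>Operations on C1 maps\<close>

lemma C1_bilinear:
  fixes f :: "real^'n \<Rightarrow> 'b::real_normed_vector" and g :: "real^'n \<Rightarrow> 'c::real_normed_vector"
  assumes b: "bounded_bilinear b" and f: "Ck_on 1 f U" and g: "Ck_on 1 g U"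
  shows "Ck_on 1 (\<lambda>\<xi>. b (f \<xi>) (g \<xi>)) U"
  unfolding Ck_on_1
proof (intro conjI ballI allI)
  have d: "f differentiable (at \<theta>)" "g differentiable (at \<theta>)" if "\<theta> \<in> U" for \<theta>
    using f g that unfolding Ck_on_1 by auto
  show "(\<lambda>\<xi>. b (f \<xi>) (g \<xi>)) differentiable at \<theta>" if "\<theta> \<in> U" for \<theta>
    by (rule pd_bilinear(2)[OF b d[OF that]])
  have c: "continuous_on U f" "continuous_on U g"
    using d by (auto intro!: continuous_at_imp_continuous_on differentiable_imp_continuous_within)
  fix i
  have "continuous_on U (\<lambda>\<theta>. b (f \<theta>) (pd i g \<theta>) + b (pd i f \<theta>) (g \<theta>))"
    using f g c unfolding Ck_on_1
    by (intro continuous_on_add bounded_bilinear.continuous_on[OF b]) auto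
  then show "continuous_on U (pd i (\<lambda>\<xi>. b (f \<xi>) (g \<xi>)))"
    by (rule continuous_on_eq) (simp add: pd_bilinear(1)[OF b d])
qed

lemmas C1_inner = C1_bilinear[OF bounded_bilinear_inner]
  and C1_mult = C1_bilinear[OF bounded_bilinear_mult]

lemma C1_sum:
  fixes f :: "'a \<Rightarrow> real^'n \<Rightarrow> 'b::real_normed_vector"
  assumes "\<And>a. a \<in> A \<Longrightarrow> Ck_on 1 (f a) U"
  shows "Ck_on 1 (\<lambda>\<xi>. \<Sum>a\<in>A. f a \<xi>) U"
  unfolding Ck_on_1
proof (intro conjI ballI allI)
  have d: "f a differentiable (at \<theta>)" if "\<theta> \<in> U" "a \<in> A" for \<theta> a
    using assms that unfolding Ck_on_1 by auto
  show "(\<lambda>\<xi>. \<Sum>a\<in>A. f a \<xi>) differentiable at \<theta>" if "\<theta> \<in> U" for \<theta>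
    by (rule pd_sum(2)) (rule d[OF that])
  fix i
  have "continuous_on U (\<lambda>\<theta>. \<Sum>a\<in>A. pd i (f a) \<theta>)"
    using assms unfolding Ck_on_1 by (intro continuous_on_sum) auto
  then show "continuous_on U (pd i (\<lambda>\<xi>. \<Sum>a\<in>A. f a \<xi>))"
    by (rule continuous_on_eq) (simp add: pd_sum(1) d)
qed

lemma C1_pd:
  fixes F :: "real^'n \<Rightarrow> 'b::real_normed_vector"
  assumes "Ck_on 2 F U"
  shows "Ck_on 1 (pd i F) U"
  using assms unfolding Ck_on_1 Ck_on_2 by blast

lemma C1_continuous: 
  fixes F :: "real^'n \<Rightarrow> 'b::real_normed_vector"
  assumes "Ck_on 1 F U"
  shows "continuous_on U F"
  using assms unfolding Ck_on_1
  by (intro continuous_at_imp_continuous_on ballI differentiable_imp_continuous_within) auto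

section \<open>The Laplacian in divergence form\<close>

context
  fixes Y :: "real^'n \<Rightarrow> real^('n option)" and U
  assumes U: "open U" and Y: "Ck_on 2 Y U" and im: "\<And>\<theta>. \<theta> \<in> U \<Longrightarrow> immersed_at Y \<theta>"
begin

lemma C1_gram: "Ck_on 1 (\<lambda>\<xi>. gram Y \<xi> $ i $ j) U"
  unfolding gram_nth by (intro C1_inner C1_pd Y)

lemma gram_differentiable: "\<theta> \<in> U \<Longrightarrow> (\<lambda>\<xi>. gram Y \<xi> $ i $ j) differentiable (at \<theta>)"
  using C1_gram unfolding Ck_on_1 by blast

lemma continuous_on_inverse_gram: "continuous_on U (\<lambda>\<xi>. matrix_inv (gram Y \<xi>) $ i $ j)"
  by (intro continuous_on_matrix_inv C1_continuous C1_gram det_gram_nonzero im)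

lemma C1_inverse_gram: "Ck_on 1 (\<lambda>\<xi>. matrix_inv (gram Y \<xi>) $ i $ j) U"
  unfolding Ck_on_1
proof (intro conjI ballI allI)
  show "(\<lambda>\<xi>. matrix_inv (gram Y \<xi>) $ i $ j) differentiable at \<theta>" if "\<theta> \<in> U" for \<theta>
    by (rule differentiable_matrix_inv(1)[OF gram_differentiable[OF that] det_gram_nonzero[OF im[OF that]]])
  fix k
  have "continuous_on U (\<lambda>\<theta>. - (\<Sum>a\<in>UNIV. \<Sum>b\<in>UNIV. matrix_inv (gram Y \<theta>) $ i $ a * pd k (\<lambda>\<xi>. gram Y \<xi> $ a $ b) \<theta> * matrix_inv (gram Y \<theta>) $ b $ j))"
    using C1_gram unfolding Ck_on_1 by (intro continuous_intros continuous_on_inverse_gram) auto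
  then show "continuous_on U (pd k (\<lambda>\<xi>. matrix_inv (gram Y \<xi>) $ i $ j))"
    by (rule continuous_on_eq) (simp add: pd_matrix_inv[OF gram_differentiable det_gram_nonzero[OF im]])
qed

text \<open>Jacobi's formula for the determinant, combined with the derivative of the square
  root.\<close>

lemma area_density_derivative:
  assumes \<theta>: "\<theta> \<in> U"
  shows "area_density Y differentiable (at \<theta>)"
    and "pd k (area_density Y) \<theta> = area_density Y \<theta> / 2 *
      (\<Sum>a\<in>UNIV. \<Sum>b\<in>UNIV. matrix_inv (gram Y \<theta>) $ a $ b * pd k (\<lambda>\<xi>. gram Y \<xi> $ a $ b) \<theta>)"
proof -
  note gd = gram_differentiable[OF \<theta>] and nz = det_gram_nonzero[OF im[OF \<theta>]] and pos = det_gram_pos[OF im[OF \<theta>]]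
  let ?d = "\<lambda>\<xi>. det (gram Y \<xi>)"
  have "(?d has_derivative frechet_derivative ?d (at \<theta>)) (at \<theta>)"
    using pd_det(1)[OF gd] by (simp add: frechet_derivative_works)
  moreover have "(sqrt has_derivative (\<lambda>h. inverse (sqrt (?d \<theta>)) / 2 * h)) (at (?d \<theta>))"
    using DERIV_real_sqrt[OF pos] unfolding has_field_derivative_def .
  ultimately have D: "(area_density Y has_derivative (\<lambda>v. inverse (sqrt (?d \<theta>)) / 2 * frechet_derivative ?d (at \<theta>) v)) (at \<theta>)"
    unfolding area_density_def[abs_def] by (rule has_derivative_compose)
  then show "area_density Y differentiable (at \<theta>)" by (rule differentiableI)
  define s where "s = sqrt (?d \<theta>)"
  have s: "s \<noteq> 0" "s * s = ?d \<theta>" "area_density Y \<theta> = s" using pos by (simp_all add: s_def area_density_def)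
  have "pd k (area_density Y) \<theta> = inverse s / 2 * pd k ?d \<theta>"
    using pd_eqI[OF D, of k] by (simp add: pd_def[of k ?d] s_def)
  also have "pd k ?d \<theta> = s * s * (\<Sum>a\<in>UNIV. \<Sum>b\<in>UNIV. matrix_inv (gram Y \<theta>) $ a $ b * pd k (\<lambda>\<xi>. gram Y \<xi> $ a $ b) \<theta>)"
    unfolding s(2) by (simp add: pd_det(2)[OF gd nz] matrix_inv_gram_symmetric[OF im[OF \<theta>]] mult.commute)
  finally show "pd k (area_density Y) \<theta> = area_density Y \<theta> / 2 *
      (\<Sum>a\<in>UNIV. \<Sum>b\<in>UNIV. matrix_inv (gram Y \<theta>) $ a $ b * pd k (\<lambda>\<xi>. gram Y \<xi> $ a $ b) \<theta>)"
    unfolding s(3) using s(1) by (simp add: field_simps)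
qed

lemma C1_area_density: "Ck_on 1 (area_density Y) U"
  unfolding Ck_on_1
proof (intro conjI ballI allI)
  show "area_density Y differentiable at \<theta>" if "\<theta> \<in> U" for \<theta> by (rule area_density_derivative(1)[OF that])
  fix k
  have "continuous_on U (\<lambda>\<theta>. area_density Y \<theta> / 2 *
      (\<Sum>a\<in>UNIV. \<Sum>b\<in>UNIV. matrix_inv (gram Y \<theta>) $ a $ b * pd k (\<lambda>\<xi>. gram Y \<xi> $ a $ b) \<theta>))"
    using C1_gram unfolding Ck_on_1
    by (intro continuous_intros continuous_on_inverse_gram continuous_on_area_density Ck_on_2_imp_1[OF Y]) auto
  then show "continuous_on U (pd k (area_density Y))"
    by (rule continuous_on_eq) (simp add: area_density_derivative(2))
qed

text \<open>The derivatives of the area density and of the inverse metric contribute two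
  contractions S1 and S2 of the metric derivatives, and the trace of the Christoffel symbols
  involves the same two. Both sides equal the area density times S1/2 - S2. This is the identity
  that puts the Laplacian into divergence form.\<close>

lemma divergence_metric_density:
  assumes \<theta>: "\<theta> \<in> U"
  shows "(\<Sum>j\<in>UNIV. pd j (\<lambda>\<xi>. area_density Y \<xi> * matrix_inv (gram Y \<xi>) $ i $ j) \<theta>) =
    - area_density Y \<theta> * (\<Sum>a\<in>UNIV. \<Sum>b\<in>UNIV. matrix_inv (gram Y \<theta>) $ a $ b * christoffel (gram Y) \<theta> i a b)"
proof -
  let ?\<rho> = "area_density Y \<theta>"
  define I where "I a b = matrix_inv (gram Y \<theta>) $ a $ b" for a b
  define D where "D k a b = pd k (\<lambda>\<xi>. gram Y \<xi> $ a $ b) \<theta>" for k a b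
  have I: "I a b = I b a" for a b unfolding I_def by (rule matrix_inv_gram_symmetric[OF im[OF \<theta>]])
  have Ds: "D k a b = D k b a" for k a b unfolding D_def by (simp add: gram_nth inner_commute)
  define S1 where "S1 = (\<Sum>j\<in>UNIV. \<Sum>a\<in>UNIV. \<Sum>b\<in>UNIV. I a b * I i j * D j a b)"
  define S2 where "S2 = (\<Sum>a\<in>UNIV. \<Sum>b\<in>UNIV. \<Sum>l\<in>UNIV. I a b * I i l * D a l b)"
  have di: "(\<lambda>\<xi>. matrix_inv (gram Y \<xi>) $ i $ j) differentiable (at \<theta>)" for j
    using C1_inverse_gram \<theta> unfolding Ck_on_1 by blast
  have "pd j (\<lambda>\<xi>. area_density Y \<xi> * matrix_inv (gram Y \<xi>) $ i $ j) \<theta> =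
     ?\<rho> / 2 * (\<Sum>a\<in>UNIV. \<Sum>b\<in>UNIV. I a b * I i j * D j a b) - ?\<rho> * (\<Sum>a\<in>UNIV. \<Sum>b\<in>UNIV. I b j * I i a * D j a b)" for j
    unfolding pd_mult[OF area_density_derivative(1)[OF \<theta>] di] area_density_derivative(2)[OF \<theta>]
      pd_matrix_inv[OF gram_differentiable[OF \<theta>] det_gram_nonzero[OF im[OF \<theta>]]] I_def D_def
    by (simp add: sum_distrib_left sum_distrib_right mult_ac)
  then have L: "(\<Sum>j\<in>UNIV. pd j (\<lambda>\<xi>. area_density Y \<xi> * matrix_inv (gram Y \<xi>) $ i $ j) \<theta>) =
     ?\<rho> / 2 * S1 - ?\<rho> * (\<Sum>j\<in>UNIV. \<Sum>a\<in>UNIV. \<Sum>b\<in>UNIV. I b j * I i a * D j a b)"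
    by (simp add: S1_def sum_subtractf sum_distrib_left)
  have e1: "(\<Sum>j\<in>UNIV. \<Sum>a\<in>UNIV. \<Sum>b\<in>UNIV. I b j * I i a * D j a b) = S2"
    unfolding S2_def
  proof (rule sum.cong[OF refl])
    fix j
    show "(\<Sum>a\<in>UNIV. \<Sum>b\<in>UNIV. I b j * I i a * D j a b) = (\<Sum>b\<in>UNIV. \<Sum>l\<in>UNIV. I j b * I i l * D j l b)"
      by (subst sum.swap) (simp add: I[of _ j])
  qed
  have "(\<Sum>a\<in>UNIV. \<Sum>b\<in>UNIV. I a b * christoffel (gram Y) \<theta> i a b) =
     1/2 * (\<Sum>a\<in>UNIV. \<Sum>b\<in>UNIV. \<Sum>l\<in>UNIV. I a b * I i l * D a l b + I a b * I i l * D b l a - I a b * I i l * D l a b)"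
    unfolding christoffel_def I_def[symmetric] D_def[symmetric]
    by (simp add: sum_distrib_left sum_distrib_right algebra_simps)
  also have "\<dots> = 1/2 * (S2 + (\<Sum>a\<in>UNIV. \<Sum>b\<in>UNIV. \<Sum>l\<in>UNIV. I a b * I i l * D b l a) -
      (\<Sum>a\<in>UNIV. \<Sum>b\<in>UNIV. \<Sum>l\<in>UNIV. I a b * I i l * D l a b))"
    by (simp add: S2_def sum.distrib sum_subtractf)
  also have "(\<Sum>a\<in>UNIV. \<Sum>b\<in>UNIV. \<Sum>l\<in>UNIV. I a b * I i l * D b l a) = S2"
    unfolding S2_def by (subst sum.swap) (simp add: I)
  also have "(\<Sum>a\<in>UNIV. \<Sum>b\<in>UNIV. \<Sum>l\<in>UNIV. I a b * I i l * D l a b) = S1"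
    unfolding S1_def by (subst (2) sum.swap, subst sum.swap, intro sum.cong refl sum.swap)
  finally have e2: "(\<Sum>a\<in>UNIV. \<Sum>b\<in>UNIV. I a b * christoffel (gram Y) \<theta> i a b) = 1/2 * (S2 + S2 - S1)" .
  show ?thesis unfolding L e1 I_def[symmetric] e2 by (simp add: algebra_simps)
qed

text \<open>Product rule; the divergence of the metric density supplies precisely the Christoffel
  part of \<open>lap\<close>.\<close>

lemma divergence_gradient:
  fixes F \<Phi> :: "real^'n \<Rightarrow> 'v::real_inner"
  assumes \<theta>: "\<theta> \<in> U" and F: "Ck_on 2 F U" and \<Phi>: "Ck_on 1 \<Phi> U"
  shows "(\<Sum>j\<in>UNIV. pd j (\<lambda>\<xi>. \<Sum>i\<in>UNIV. (area_density Y \<xi> * matrix_inv (gram Y \<xi>) $ i $ j) * (pd i F \<xi> \<bullet> \<Phi> \<xi>)) \<theta>) =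
    area_density Y \<theta> * (lap Y F \<theta> \<bullet> \<Phi> \<theta> +
      (\<Sum>i\<in>UNIV. \<Sum>j\<in>UNIV. matrix_inv (gram Y \<theta>) $ i $ j * (pd i F \<theta> \<bullet> pd j \<Phi> \<theta>)))"
proof -
  let ?\<rho> = "area_density Y \<theta>" and ?I = "\<lambda>i j. matrix_inv (gram Y \<theta>) $ i $ j"
  let ?W = "\<lambda>i j \<xi>. area_density Y \<xi> * matrix_inv (gram Y \<xi>) $ i $ j"
  note I = matrix_inv_gram_symmetric[OF im[OF \<theta>]]
  have dW: "?W i j differentiable (at \<theta>)" for i j
    using C1_mult[OF C1_area_density C1_inverse_gram] \<theta> unfolding Ck_on_1 by blast
  have dP: "\<Phi> differentiable (at \<theta>)" using \<Phi> \<theta> unfolding Ck_on_1 by blast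
  note dF = Ck_on_2D(2)[OF F \<theta>]
  note dFP = differentiable_inner'[OF dF dP]
  have "(\<Sum>j\<in>UNIV. pd j (\<lambda>\<xi>. \<Sum>i\<in>UNIV. ?W i j \<xi> * (pd i F \<xi> \<bullet> \<Phi> \<xi>)) \<theta>) =
     (\<Sum>j\<in>UNIV. \<Sum>i\<in>UNIV. pd j (?W i j) \<theta> * (pd i F \<theta> \<bullet> \<Phi> \<theta>)) +
     (\<Sum>j\<in>UNIV. \<Sum>i\<in>UNIV. ?W i j \<theta> * (pd j (pd i F) \<theta> \<bullet> \<Phi> \<theta>)) +
     (\<Sum>j\<in>UNIV. \<Sum>i\<in>UNIV. ?W i j \<theta> * (pd i F \<theta> \<bullet> pd j \<Phi> \<theta>))"
    by (simp add: pd_sum(1)[OF differentiable_mult'[OF dW dFP]] pd_mult[OF dW dFP] pd_inner[OF dF dP]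
        distrib_left sum.distrib)
  also have "(\<Sum>j\<in>UNIV. \<Sum>i\<in>UNIV. pd j (?W i j) \<theta> * (pd i F \<theta> \<bullet> \<Phi> \<theta>)) =
     (\<Sum>i\<in>UNIV. (\<Sum>j\<in>UNIV. pd j (?W i j) \<theta>) * (pd i F \<theta> \<bullet> \<Phi> \<theta>))"
    by (subst sum.swap) (simp add: sum_distrib_right)
  also have "\<dots> = - ?\<rho> * (\<Sum>k\<in>UNIV. \<Sum>a\<in>UNIV. \<Sum>b\<in>UNIV. ?I a b * christoffel (gram Y) \<theta> k a b * (pd k F \<theta> \<bullet> \<Phi> \<theta>))"
    unfolding divergence_metric_density[OF \<theta>] by (simp add: sum_distrib_left sum_distrib_right mult_ac sum_negf)
  also have "(\<Sum>k\<in>UNIV. \<Sum>a\<in>UNIV. \<Sum>b\<in>UNIV. ?I a b * christoffel (gram Y) \<theta> k a b * (pd k F \<theta> \<bullet> \<Phi> \<theta>)) =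
     (\<Sum>a\<in>UNIV. \<Sum>b\<in>UNIV. \<Sum>k\<in>UNIV. ?I a b * christoffel (gram Y) \<theta> k a b * (pd k F \<theta> \<bullet> \<Phi> \<theta>))"
    by (subst sum.swap, intro sum.cong refl sum.swap)
  also have "(\<Sum>j\<in>UNIV. \<Sum>i\<in>UNIV. ?W i j \<theta> * (pd j (pd i F) \<theta> \<bullet> \<Phi> \<theta>)) =
     ?\<rho> * (\<Sum>a\<in>UNIV. \<Sum>b\<in>UNIV. ?I a b * (pd a (pd b F) \<theta> \<bullet> \<Phi> \<theta>))"
    by (simp add: sum_distrib_left mult.assoc I)
  also have "(\<Sum>j\<in>UNIV. \<Sum>i\<in>UNIV. ?W i j \<theta> * (pd i F \<theta> \<bullet> pd j \<Phi> \<theta>)) =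
     ?\<rho> * (\<Sum>i\<in>UNIV. \<Sum>j\<in>UNIV. ?I i j * (pd i F \<theta> \<bullet> pd j \<Phi> \<theta>))"
    by (subst sum.swap) (simp add: sum_distrib_left mult.assoc)
  finally show ?thesis
    by (simp add: lap_def hess_def inner_sum_left inner_diff_left right_diff_distrib sum_subtractf
        sum_distrib_left distrib_left mult.assoc sum_negf)
qed

text \<open>The integrand is the divergence of a C1 field V that vanishes off K. Its extension by 0
  is C1 on the whole space, because U and the complement of K are open and cover it; each component
  then falls under \<open>integral_pd_eq_0\<close>.\<close>

theorem integral_lap_parts:
  fixes F \<Phi> :: "real^'n \<Rightarrow> 'v::real_inner"
  assumes F: "Ck_on 2 F U" and \<Phi>: "Ck_on 1 \<Phi> U"
    and K: "compact K" "K \<subseteq> U" "\<And>\<theta>. \<theta> \<in> U - K \<Longrightarrow> \<Phi> \<theta> = 0"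
  shows "(LINT \<theta>:U|lborel. area_density Y \<theta> * (lap Y F \<theta> \<bullet> \<Phi> \<theta> +
      (\<Sum>i\<in>UNIV. \<Sum>j\<in>UNIV. matrix_inv (gram Y \<theta>) $ i $ j * (pd i F \<theta> \<bullet> pd j \<Phi> \<theta>)))) = 0"
proof -
  define V where "V j \<xi> = (\<Sum>i\<in>UNIV. (area_density Y \<xi> * matrix_inv (gram Y \<xi>) $ i $ j) * (pd i F \<xi> \<bullet> \<Phi> \<xi>))" for j \<xi>
  define V' where "V' j \<xi> = (if \<xi> \<in> U then V j \<xi> else 0)" for j \<xi>
  have VC: "Ck_on 1 (V j) U" for j
    unfolding V_def by (intro C1_sum C1_mult C1_area_density C1_inverse_gram C1_inner C1_pd F \<Phi>)
  have z: "V' j \<xi> = 0" if "\<xi> \<notin> K" for j \<xi>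
    using K(3)[of \<xi>] that by (auto simp: V'_def V_def)
  have evU: "eventually (\<lambda>\<xi>. V' j \<xi> = V j \<xi>) (nhds \<theta>)" if "\<theta> \<in> U" for j \<theta>
    using eventually_nhds_in_open[OF U that] by (rule eventually_mono) (simp add: V'_def)
  have evK: "eventually (\<lambda>\<xi>. V' j \<xi> = 0) (nhds \<theta>)" if "\<theta> \<notin> K" for j \<theta>
    using eventually_nhds_in_open[of "- K" \<theta>] compact_imp_closed[OF K(1)] that
    by (auto elim!: eventually_mono simp: open_Compl z)
  have dV: "V' j differentiable (at \<theta>)" for j \<theta>
  proof (cases "\<theta> \<in> U")
    case True
    then show ?thesis using differentiable_cong_nhds[OF evU[OF True]] VC unfolding Ck_on_1 by blast
  next
    case False
    then have "\<theta> \<notin> K" using K(2) by blast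
    then show ?thesis using differentiable_cong_nhds[OF evK] differentiable_const by blast
  qed
  have pU: "pd j (V' j) \<theta> = pd j (V j) \<theta>" if "\<theta> \<in> U" for j \<theta> by (rule pd_cong_nhds[OF evU[OF that]])
  have pK: "pd j (V' j) \<theta> = 0" if "\<theta> \<notin> K" for j \<theta> using pd_cong_nhds[OF evK[OF that]] by simp
  have cV: "continuous_on UNIV (pd j (V' j))" for j
  proof -
    have "continuous_on U (pd j (V' j))"
    proof (rule continuous_on_eq)
      show "continuous_on U (pd j (V j))" using VC unfolding Ck_on_1 by blast
    qed (simp add: pU)
    moreover have "continuous_on (- K) (pd j (V' j))"
      by (rule continuous_on_eq[of _ "\<lambda>_. 0"]) (auto simp: pK)
    ultimately have "continuous_on (U \<union> - K) (pd j (V' j))"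
      using U compact_imp_closed[OF K(1)] by (intro continuous_on_open_Un) (auto simp: open_Compl)
    moreover have "U \<union> - K = UNIV" using K(2) by blast
    ultimately show ?thesis by simp
  qed
  have i0: "(\<integral>\<theta>. pd j (V' j) \<theta> \<partial>lborel) = 0" for j by (rule integral_pd_eq_0[OF dV cV K(1) z])
  have ii: "integrable lborel (pd j (V' j))" for j by (rule integrable_continuous_compact_support[OF cV K(1) pK])
  have "(LINT \<theta>:U|lborel. area_density Y \<theta> * (lap Y F \<theta> \<bullet> \<Phi> \<theta> +
      (\<Sum>i\<in>UNIV. \<Sum>j\<in>UNIV. matrix_inv (gram Y \<theta>) $ i $ j * (pd i F \<theta> \<bullet> pd j \<Phi> \<theta>)))) =
      (\<integral>\<theta>. (\<Sum>j\<in>UNIV. pd j (V' j) \<theta>) \<partial>lborel)"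
    unfolding set_lebesgue_integral_def
  proof (rule Bochner_Integration.integral_cong[OF refl])
    fix \<theta>
    show "indicator U \<theta> *\<^sub>R (area_density Y \<theta> * (lap Y F \<theta> \<bullet> \<Phi> \<theta> +
      (\<Sum>i\<in>UNIV. \<Sum>j\<in>UNIV. matrix_inv (gram Y \<theta>) $ i $ j * (pd i F \<theta> \<bullet> pd j \<Phi> \<theta>)))) = (\<Sum>j\<in>UNIV. pd j (V' j) \<theta>)"
    proof (cases "\<theta> \<in> U")
      case True
      then show ?thesis
        unfolding divergence_gradient[OF True F \<Phi>, symmetric] by (simp add: pU) (simp add: V_def[abs_def])
    next
      case False
      then have "\<theta> \<notin> K" using K(2) by blast
      with False show ?thesis by (simp add: pK)
    qed
  qed
  also have "\<dots> = 0" using ii i0 by (subst Bochner_Integration.integral_sum) auto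
  finally show ?thesis .
qed

end

section \<open>Tangential gradients in coordinates\<close>

text \<open>The n tangent vectors together with the normal span the ambient space of dimension n+1,
  so v is orthogonal to itself.\<close>

lemma tangent_normal_eq_0:
  fixes Y :: "real^'n \<Rightarrow> real^('n option)"
  assumes im: "immersed_at Y \<theta>" and \<nu>: "\<nu> \<noteq> 0" "\<And>i. \<nu> \<bullet> pd i Y \<theta> = 0"
    and v: "\<And>i. v \<bullet> pd i Y \<theta> = 0" "v \<bullet> \<nu> = 0"
  shows "v = 0"
proof -
  let ?A = "\<lambda>a :: real^'n. \<Sum>i\<in>UNIV. a $ i *\<^sub>R pd i Y \<theta>"
  let ?L = "\<lambda>p :: (real^'n) \<times> real. ?A (fst p) + snd p *\<^sub>R \<nu>"
  have l: "linear ?L"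
    by (rule linearI) (simp_all add: sum.distrib scaleR_add_left scaleR_sum_right scaleR_add_right)
  have A\<nu>: "\<nu> \<bullet> ?A a = 0" for a by (simp add: inner_sum_right \<nu>)
  have "p = 0" if "?L p = 0" for p
  proof -
    have "\<nu> \<bullet> ?L p = 0" using that by simp
    then have s: "snd p = 0" using \<nu>(1) by (simp add: inner_add_right A\<nu>)
    then have "?A (fst p) = 0" using that by simp
    then have "fst p = 0" using im unfolding immersed_at_def by blast
    with s show ?thesis by (simp add: prod_eq_iff)
  qed
  then have "inj ?L" using linear_injective_0[OF l] by blast
  moreover have "dim (UNIV :: (real^('n option)) set) = dim (UNIV :: ((real^'n) \<times> real) set)"
    by simp
  ultimately have "surj ?L" using linear_injective_imp_surjective[OF l] by blast
  then have "v \<in> range ?L" by simp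
  then obtain p where "v = ?L p" by (rule rangeE)
  then have "v \<bullet> v = v \<bullet> ?L p" by simp
  then have "v \<bullet> v = 0" by (simp add: inner_add_right inner_sum_right v)
  then show ?thesis by simp
qed

lemma immersed_at_if_det_gram:
  assumes "det (gram Y \<theta>) \<noteq> 0"
  shows "immersed_at Y \<theta>"
  unfolding immersed_at_def
proof (intro allI impI)
  fix v assume v: "(\<Sum>i\<in>UNIV. v $ i *\<^sub>R pd i Y \<theta>) = 0"
  have "(gram Y \<theta> *v v) $ j = pd j Y \<theta> \<bullet> (\<Sum>i\<in>UNIV. v $ i *\<^sub>R pd i Y \<theta>)" for j
    by (simp add: matrix_vector_mult_def gram_nth inner_sum_right mult.commute)
  then have "gram Y \<theta> *v v = 0" using v by (simp add: vec_eq_iff)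
  moreover have "matrix_inv (gram Y \<theta>) ** gram Y \<theta> = mat 1"
    using assms invertible_det_nz matrix_inv_left by blast
  ultimately show "v = 0"
    by (metis matrix_vector_mul_assoc matrix_vector_mul_lid matrix_vector_mult_0_right)
qed

text \<open>\<open>tangential_gradient\<close> speaks of differentiable extensions to ambient
  neighbourhoods, so a differentiable left inverse of the patch is needed on such a neighbourhood. A
  linear projection of the patch to parameter space gives a map \<open>Z\<close> between spaces of
  equal dimension, invertible near \<open>\<theta>\<close>; its inverse after the projection is
  \<open>g\<close>.\<close>

lemma patch_local_retraction:
  fixes N :: "(real^('n::finite option)) set"
  assumes p: "patch N U Y" and \<theta>: "\<theta> \<in> U"
  obtains W g where "open W" "Y \<theta> \<in> W" "\<And>y. y \<in> W \<Longrightarrow> g y \<in> U" "g differentiable_on W"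
    "\<And>y. y \<in> N \<inter> W \<Longrightarrow> Y (g y) = y"
proof -
  note pD = patchD[OF p]
  let ?I = "\<lambda>k l. matrix_inv (gram Y \<theta>) $ k $ l"
  \<comment> \<open>The pseudo-inverse of the differential at \<open>\<theta>\<close>, so that
    \<open>Z\<close> has the identity as its differential there.\<close>
  define \<pi> where "\<pi> y = (\<chi> k. \<Sum>l\<in>UNIV. ?I k l * (pd l Y \<theta> \<bullet> y))" for y
  have l\<pi>: "linear \<pi>"
    by (rule linearI) (auto simp: \<pi>_def vec_eq_iff inner_add_right sum.distrib distrib_left sum_distrib_left mult_ac)
  then have bl: "bounded_linear \<pi>" by (simp add: linear_conv_bounded_linear)
  define Z where "Z \<xi> = \<pi> (Y \<xi>)" for \<xi>
  have dY: "Y differentiable (at \<xi>)" if "\<xi> \<in> U" for \<xi> using pD(4) that unfolding Ck_on_1 by blast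
  have pdZ: "pd i Z \<xi> = \<pi> (pd i Y \<xi>)" "Z differentiable (at \<xi>)" if "\<xi> \<in> U" for i \<xi>
    unfolding Z_def using pd_linear[OF bl dY[OF that]] by auto
  have "continuous_on U (\<lambda>\<xi>. \<pi> (pd i Y \<xi>))" for i
    using pD(4) unfolding Ck_on_1 by (intro bounded_linear.continuous_on[OF bl]) blast
  then have "continuous_on U (pd i Z)" for i by (rule continuous_on_eq) (simp add: pdZ)
  then have CZ: "Ck_on 1 Z U" unfolding Ck_on_1 using pdZ by blast
  have Z0: "pd i Z \<theta> = axis i 1" for i
  proof -
    have "\<pi> (pd i Y \<theta>) $ k = (if k = i then 1 else 0)" for k
      using matrix_inv_mult_nth(2)[OF det_gram_nonzero[OF pD(5)[OF \<theta>]], of k i]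
      by (simp add: \<pi>_def gram_nth)
    then show ?thesis by (simp add: pdZ[OF \<theta>] vec_eq_iff axis_def)
  qed
  \<comment> \<open>Since the differential at \<open>\<theta>\<close> is the identity, an error
    constant below 1 makes \<open>Z\<close> injective on the ball.\<close>
  obtain r1 where r1: "r1 > 0" "ball \<theta> r1 \<subseteq> U"
    "\<And>a b. a \<in> ball \<theta> r1 \<Longrightarrow> b \<in> ball \<theta> r1 \<Longrightarrow>
       norm (Z a - Z b - (\<Sum>i\<in>UNIV. (a - b) $ i *\<^sub>R pd i Z \<theta>)) \<le> (1/2) * norm (a - b)"
    by (rule C1_strictly_differentiable[OF pD(1) \<theta> CZ, of "1/2"]) (simp, (rule that; assumption))
  have "continuous_on U (\<lambda>\<xi>. det (gram Z \<xi>))"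
    using CZ unfolding Ck_on_1 gram_nth[symmetric]
    by (intro continuous_on_det) (auto simp: gram_nth intro!: continuous_intros)
  moreover have "immersed_at Z \<theta>" unfolding immersed_at_def Z0 by (simp add: sum_axis_representation)
  ultimately have "eventually (\<lambda>\<xi>. det (gram Z \<xi>) \<noteq> 0) (at \<theta>)"
    using det_gram_nonzero pD(1) \<theta> continuous_on_eq_continuous_at continuous_at
    by (metis tendsto_imp_eventually_ne)
  then obtain r2 where r2: "r2 > 0" "\<And>\<xi>. \<xi> \<noteq> \<theta> \<Longrightarrow> dist \<xi> \<theta> < r2 \<Longrightarrow> det (gram Z \<xi>) \<noteq> 0"
    by (auto simp: eventually_at)
  define B where "B = ball \<theta> (min r1 r2)"
  have BU: "B \<subseteq> U" "open B" "\<theta> \<in> B" "B \<subseteq> ball \<theta> r1" using r1 r2 by (auto simp: B_def)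
  have imB: "immersed_at Z \<xi>" if "\<xi> \<in> B" for \<xi>
    using r2(2)[of \<xi>] that \<open>immersed_at Z \<theta>\<close> immersed_at_if_det_gram[of Z \<xi>]
    by (cases "\<xi> = \<theta>") (auto simp: B_def dist_commute)
  have inj: "inj_on Z B"
  proof (rule inj_onI)
    fix a b assume ab: "a \<in> B" "b \<in> B" "Z a = Z b"
    have "a \<in> ball \<theta> r1" "b \<in> ball \<theta> r1" using ab BU(4) by blast+
    from r1(3)[OF this] have "norm (b - a) \<le> (1/2) * norm (b - a)"
      unfolding Z0 sum_axis_representation by (simp add: ab(3) norm_minus_commute)
    then show "a = b" by simp
  qed
  have contZ: "continuous_on B Z" using C1_continuous[OF CZ] BU continuous_on_subset by blast
  have op: "open (Z ` B)" by (rule invariance_of_domain[OF contZ BU(2) inj])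
  define g0 where "g0 = inv_into B Z"
  have g0: "g0 (Z \<xi>) = \<xi>" if "\<xi> \<in> B" for \<xi> using that inj by (simp add: g0_def)
  have dg0: "g0 differentiable (at z)" if z: "z \<in> Z ` B" for z
  proof -
    obtain \<xi> where \<xi>: "\<xi> \<in> B" "z = Z \<xi>" using z by blast
    let ?D = "\<lambda>v. \<Sum>i\<in>UNIV. v $ i *\<^sub>R pd i Z \<xi>"
    have D: "(Z has_derivative ?D) (at \<xi>)" using \<xi> BU by (intro has_derivative_pd pdZ) auto
    have "inj ?D" using imB[OF \<xi>(1)] unfolding immersed_at_def linear_injective_0[OF linear_sum_pd] .
    then obtain D' where D': "linear D'" "\<And>x. ?D (D' x) = x"
      using linear_injective_isomorphism[OF linear_sum_pd] by blast
    have "(g0 has_derivative D') (at (Z \<xi>))"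
      by (rule has_derivative_inverse_strong[OF BU(2) \<xi>(1) contZ g0 D]) (use D' in \<open>auto simp: fun_eq_iff\<close>)
    then show ?thesis unfolding \<xi> by (rule differentiableI)
  qed
  obtain T where T: "open T" "Y ` B = N \<inter> T"
    using patch_openin_image[OF p BU(2,1)] by (auto simp: openin_open)
  \<comment> \<open>T excludes other points of N whose projection falls into the same set, so that N
    and W meet only inside the image of B.\<close>
  define W where "W = \<pi> -` (Z ` B) \<inter> T"
  define g where "g y = g0 (\<pi> y)" for y
  show ?thesis
  proof (rule that[of W g])
    have c\<pi>: "continuous_on UNIV \<pi>" using bl by (rule linear_continuous_on)
    show "open W"
      unfolding W_def using open_vimage[OF op c\<pi>] T(1) by blast
    show "Y \<theta> \<in> W" using BU(3) T(2) by (auto simp: W_def Z_def)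
    show "g y \<in> U" if "y \<in> W" for y
    proof -
      from that obtain \<xi> where "\<xi> \<in> B" "\<pi> y = Z \<xi>" by (auto simp: W_def)
      then show ?thesis using subsetD[OF BU(1)] by (simp add: g_def g0)
    qed
    show "g differentiable_on W"
      unfolding differentiable_on_def
    proof (rule ballI, rule differentiable_at_withinI)
      fix y assume "y \<in> W"
      then have "g0 differentiable (at (\<pi> y))" using dg0 by (auto simp: W_def)
      moreover have "\<pi> differentiable (at y)"
        by (rule bounded_linear_imp_differentiable[OF bl])
      ultimately show "g differentiable (at y)"
        unfolding g_def[abs_def] using differentiable_chain_at[of \<pi> y g0] by (simp add: o_def)
    qed
    show "Y (g y) = y" if "y \<in> N \<inter> W" for y
    proof -
      from that T obtain \<xi> where "\<xi> \<in> B" "y = Y \<xi>" by (auto simp: W_def)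
      then show ?thesis using g0[of \<xi>] by (simp add: g_def Z_def)
    qed
  qed
qed

definition coord_grad :: "(real^'n \<Rightarrow> real^('n option)) \<Rightarrow> (real^'n \<Rightarrow> real) \<Rightarrow> real^'n \<Rightarrow> real^('n option)" where
  "coord_grad Y F \<theta> = (\<Sum>i\<in>UNIV. \<Sum>j\<in>UNIV. (matrix_inv (gram Y \<theta>) $ i $ j * pd i F \<theta>) *\<^sub>R pd j Y \<theta>)"

lemma coord_grad_inner_pd:
  assumes im: "immersed_at Y \<theta>"
  shows "coord_grad Y F \<theta> \<bullet> pd k Y \<theta> = pd k F \<theta>"
proof -
  have "coord_grad Y F \<theta> \<bullet> pd k Y \<theta> =
      (\<Sum>i\<in>UNIV. pd i F \<theta> * (\<Sum>j\<in>UNIV. matrix_inv (gram Y \<theta>) $ i $ j * gram Y \<theta> $ j $ k))"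
    by (simp add: coord_grad_def inner_sum_left gram_nth sum_distrib_left mult_ac)
  also have "\<dots> = (\<Sum>i\<in>UNIV. if i = k then pd i F \<theta> else 0)"
    by (rule sum.cong[OF refl]) (simp add: matrix_inv_mult_nth(2)[OF det_gram_nonzero[OF im]])
  finally show ?thesis by simp
qed

definition unit_normal_at :: "(real^('n::finite option) \<Rightarrow> real^('n option)) \<Rightarrow> (real^'n \<Rightarrow> real^('n option)) \<Rightarrow> real^'n \<Rightarrow> bool" where
  "unit_normal_at \<nu> Y \<theta> \<longleftrightarrow> norm (\<nu> (Y \<theta>)) = 1 \<and> (\<forall>i. \<nu> (Y \<theta>) \<bullet> pd i Y \<theta> = 0)"

text \<open>By the chain rule all admissible extensions have the same inner products with the
  tangent vectors, and the projected gradient is orthogonal to the normal, so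
  \<open>tangent_normal_eq_0\<close> gives uniqueness. Existence comes from extending f by way of
  the local retraction.\<close>

lemma tangential_gradient_patch:
  fixes N :: "(real^('n::finite option)) set"
  assumes p: "patch N U Y" and \<theta>: "\<theta> \<in> U" and \<nu>: "unit_normal_at \<nu> Y \<theta>"
    and f: "\<And>\<xi>. \<xi> \<in> U \<Longrightarrow> (\<lambda>\<xi>. f (Y \<xi>)) differentiable (at \<xi>)"
  shows "tangential_gradient N \<nu> f (Y \<theta>) = coord_grad Y (\<lambda>\<xi>. f (Y \<xi>)) \<theta>"
proof -
  note pD = patchD[OF p]
  let ?y = "Y \<theta>" and ?n = "\<nu> (Y \<theta>)"
  have nn: "?n \<bullet> ?n = 1" using \<nu> by (simp add: unit_normal_at_def norm_eq_sqrt_inner)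
  have no: "?n \<bullet> pd i Y \<theta> = 0" for i using \<nu> by (simp add: unit_normal_at_def)
  have uniq: "D - (?n \<bullet> D) *\<^sub>R ?n = coord_grad Y (\<lambda>\<xi>. f (Y \<xi>)) \<theta>"
    if W: "open W" "?y \<in> W" and F: "\<And>z. z \<in> N \<inter> W \<Longrightarrow> F z = f z" and D: "GDERIV F ?y :> D" for W F D
  proof -
    have dY: "Y differentiable (at \<theta>)" using pD(4) \<theta> unfolding Ck_on_1 by blast
    have "((\<lambda>\<xi>. F (Y \<xi>)) has_derivative (\<lambda>v. (\<Sum>i\<in>UNIV. v $ i *\<^sub>R pd i Y \<theta>) \<bullet> D)) (at \<theta>)"
      by (rule has_derivative_compose[OF has_derivative_pd[OF dY] D[unfolded gderiv_def]])
    from pd_eqI[OF this] have FY: "pd i (\<lambda>\<xi>. F (Y \<xi>)) \<theta> = pd i Y \<theta> \<bullet> D" for i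
      by (simp add: sum_axis_scaleR)
    have "open (U \<inter> Y -` W)" using continuous_open_preimage[OF pD(7,1) W(1)] .
    then have "eventually (\<lambda>\<xi>. \<xi> \<in> U \<inter> Y -` W) (nhds \<theta>)"
      by (rule eventually_nhds_in_open) (use \<theta> W in simp)
    then have "eventually (\<lambda>\<xi>. F (Y \<xi>) = f (Y \<xi>)) (nhds \<theta>)"
      by (rule eventually_mono) (use F pD(6) in blast)
    from pd_cong_nhds[OF this] FY have fY: "pd i (\<lambda>\<xi>. f (Y \<xi>)) \<theta> = D \<bullet> pd i Y \<theta>" for i
      by (simp add: inner_commute)
    let ?v = "D - (?n \<bullet> D) *\<^sub>R ?n - coord_grad Y (\<lambda>\<xi>. f (Y \<xi>)) \<theta>"
    have "?v = 0"
    proof (rule tangent_normal_eq_0[OF pD(5)[OF \<theta>]])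
      show "?n \<noteq> 0" using nn by auto
      show "?v \<bullet> pd i Y \<theta> = 0" for i
        by (simp add: inner_diff_left coord_grad_inner_pd[OF pD(5)[OF \<theta>]] fY no)
      have "?n \<bullet> coord_grad Y (\<lambda>\<xi>. f (Y \<xi>)) \<theta> = 0"
        by (simp add: coord_grad_def inner_sum_right no)
      then show "?v \<bullet> ?n = 0" by (simp add: inner_diff_left inner_diff_right nn inner_commute)
    qed (rule no)
    then show ?thesis by simp
  qed
  obtain W g where W: "open W" "?y \<in> W" "\<And>y. y \<in> W \<Longrightarrow> g y \<in> U" "g differentiable_on W"
    "\<And>y. y \<in> N \<inter> W \<Longrightarrow> Y (g y) = y"
    by (rule patch_local_retraction[OF p \<theta>]) (rule that; assumption)
  define F where "F y = f (Y (g y))" for y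
  have dF: "F differentiable (at y)" if "y \<in> W" for y
  proof -
    have "g differentiable (at y)" using W(4) that at_within_open[OF that W(1)] unfolding differentiable_on_def by force
    from differentiable_chain_at[OF this f[OF W(3)[OF that]]] show ?thesis by (simp add: F_def[abs_def] o_def)
  qed
  then have FW: "F differentiable_on W" by (simp add: differentiable_at_imp_differentiable_on)
  obtain F' where F': "(F has_derivative F') (at ?y)" using dF[OF W(2)] by (auto simp: differentiable_def)
  define D where "D = (\<Sum>b\<in>Basis. F' b *\<^sub>R b)"
  have F'D: "F' h = h \<bullet> D" for h
  proof -
    have lF: "linear F'" by (rule has_derivative_linear[OF F'])
    have "F' h = F' (\<Sum>b\<in>Basis. (h \<bullet> b) *\<^sub>R b)" by (simp add: euclidean_representation)
    then show ?thesis by (simp add: linear_sum[OF lF] linear_scale[OF lF] D_def inner_sum_right mult.commute)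
  qed
  have GD: "GDERIV F ?y :> D" using F' unfolding gderiv_def by (simp add: F'D[abs_def])
  have Ff: "F z = f z" if "z \<in> N \<inter> W" for z using W(5)[OF that] by (simp add: F_def)
  show ?thesis
    unfolding tangential_gradient_def
  proof (rule the_equality)
    show "\<exists>W F D. open W \<and> ?y \<in> W \<and> F differentiable_on W \<and> (\<forall>z\<in>N \<inter> W. F z = f z) \<and>
        GDERIV F ?y :> D \<and> coord_grad Y (\<lambda>\<xi>. f (Y \<xi>)) \<theta> = D - (?n \<bullet> D) *\<^sub>R ?n"
      using W(1,2) FW Ff GD uniq[OF W(1,2) Ff GD] by metis
  qed (use uniq in metis)
qed

lemma tgrad_patch:
  fixes N :: "(real^('n::finite option)) set"
  assumes p: "patch N U Y" and \<theta>: "\<theta> \<in> U" and \<nu>: "unit_normal_at \<nu> Y \<theta>"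
    and f: "\<And>\<xi>. \<xi> \<in> U \<Longrightarrow> (\<lambda>\<xi>. f (Y \<xi>)) differentiable (at \<xi>)"
  shows "tgrad N \<nu> f (Y \<theta>) = (\<chi> \<kappa> \<beta>. \<Sum>i\<in>UNIV. \<Sum>j\<in>UNIV. matrix_inv (gram Y \<theta>) $ i $ j * pd i (\<lambda>\<xi>. f (Y \<xi>)) \<theta> $ \<kappa> * pd j Y \<theta> $ \<beta>)"
proof -
  have "tangential_gradient N \<nu> (\<lambda>z. f z $ \<kappa>) (Y \<theta>) = coord_grad Y (\<lambda>\<xi>. f (Y \<xi>) $ \<kappa>) \<theta>" for \<kappa>
    by (rule tangential_gradient_patch[where \<nu>=\<nu>, OF p \<theta> \<nu>]) (rule differentiable_nth[OF f])
  then show ?thesis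
    by (simp add: tgrad_def coord_grad_def pd_nth[OF f[OF \<theta>]])
qed

lemma tgrad_patch_mult:
  fixes N :: "(real^('n::finite option)) set"
  assumes p: "patch N U Y" and \<theta>: "\<theta> \<in> U" and \<nu>: "unit_normal_at \<nu> Y \<theta>"
    and f: "\<And>\<xi>. \<xi> \<in> U \<Longrightarrow> (\<lambda>\<xi>. f (Y \<xi>)) differentiable (at \<xi>)"
  shows "tgrad N \<nu> f (Y \<theta>) *v x = (\<Sum>i\<in>UNIV. (\<Sum>j\<in>UNIV. matrix_inv (gram Y \<theta>) $ i $ j * (pd j Y \<theta> \<bullet> x)) *\<^sub>R pd i (\<lambda>\<xi>. f (Y \<xi>)) \<theta>)"
proof (rule vec_eq_iff[THEN iffD2], rule allI)
  fix \<kappa>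
  let ?I = "\<lambda>i j. matrix_inv (gram Y \<theta>) $ i $ j" and ?F = "\<lambda>i. pd i (\<lambda>\<xi>. f (Y \<xi>)) \<theta> $ \<kappa>"
  have "(tgrad N \<nu> f (Y \<theta>) *v x) $ \<kappa> = (\<Sum>\<beta>\<in>UNIV. \<Sum>i\<in>UNIV. \<Sum>j\<in>UNIV. ?I i j * ?F i * pd j Y \<theta> $ \<beta> * x $ \<beta>)"
    by (simp add: tgrad_patch[where \<nu>=\<nu> and f=f, OF assms] matrix_vector_mult_def sum_distrib_right)
  also have "\<dots> = (\<Sum>i\<in>UNIV. \<Sum>j\<in>UNIV. \<Sum>\<beta>\<in>UNIV. ?I i j * ?F i * pd j Y \<theta> $ \<beta> * x $ \<beta>)"
    by (subst sum.swap, intro sum.cong refl sum.swap)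
  also have "\<dots> = (\<Sum>i\<in>UNIV. (\<Sum>j\<in>UNIV. ?I i j * (pd j Y \<theta> \<bullet> x)) * ?F i)"
    by (simp add: inner_vec_def sum_distrib_left sum_distrib_right mult_ac)
  finally show "(tgrad N \<nu> f (Y \<theta>) *v x) $ \<kappa> = (\<Sum>i\<in>UNIV. (\<Sum>j\<in>UNIV. ?I i j * (pd j Y \<theta> \<bullet> x)) *\<^sub>R pd i (\<lambda>\<xi>. f (Y \<xi>)) \<theta>) $ \<kappa>"
    by simp
qed

text \<open>The values on a basis of the ambient space, which are the data that
  \<open>Hhat_solution\<close> asks for.\<close>

lemma tgrad_patch_pd:
  fixes N :: "(real^('n::finite option)) set"
  assumes p: "patch N U Y" and \<theta>: "\<theta> \<in> U" and \<nu>: "unit_normal_at \<nu> Y \<theta>"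
    and f: "\<And>\<xi>. \<xi> \<in> U \<Longrightarrow> (\<lambda>\<xi>. f (Y \<xi>)) differentiable (at \<xi>)"
  shows "tgrad N \<nu> f (Y \<theta>) *v pd k Y \<theta> = pd k (\<lambda>\<xi>. f (Y \<xi>)) \<theta>"
    and "tgrad N \<nu> f (Y \<theta>) *v \<nu> (Y \<theta>) = 0"
proof -
  have "(\<Sum>j\<in>UNIV. matrix_inv (gram Y \<theta>) $ i $ j * (pd j Y \<theta> \<bullet> pd k Y \<theta>)) = (if i = k then 1 else 0)" for i
    using matrix_inv_mult_nth(2)[OF det_gram_nonzero[OF patchD(5)[OF p \<theta>]], of i k] by (simp add: gram_nth)
  then show "tgrad N \<nu> f (Y \<theta>) *v pd k Y \<theta> = pd k (\<lambda>\<xi>. f (Y \<xi>)) \<theta>"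
    by (simp add: tgrad_patch_mult[where \<nu>=\<nu> and f=f, OF assms] if_distrib[of "\<lambda>c. c *\<^sub>R _"] cong: if_cong)
  show "tgrad N \<nu> f (Y \<theta>) *v \<nu> (Y \<theta>) = 0"
    using \<nu> by (simp add: unit_normal_at_def tgrad_patch_mult[where \<nu>=\<nu> and f=f, OF assms] inner_commute[of "pd _ Y \<theta>"])
qed

text \<open>Brings the product of two tangential gradients into the form of the Dirichlet integrand
  in \<open>integral_lap_parts\<close>.\<close>

lemma tgrad_patch_inner:
  fixes N :: "(real^('n::finite option)) set"
  assumes p: "patch N U Y" and \<theta>: "\<theta> \<in> U" and \<nu>: "unit_normal_at \<nu> Y \<theta>"
    and f: "\<And>\<xi>. \<xi> \<in> U \<Longrightarrow> (\<lambda>\<xi>. f (Y \<xi>)) differentiable (at \<xi>)"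
    and h: "\<And>\<xi>. \<xi> \<in> U \<Longrightarrow> (\<lambda>\<xi>. h (Y \<xi>)) differentiable (at \<xi>)"
  shows "tgrad N \<nu> f (Y \<theta>) \<bullet> tgrad N \<nu> h (Y \<theta>) =
    (\<Sum>i\<in>UNIV. \<Sum>j\<in>UNIV. matrix_inv (gram Y \<theta>) $ i $ j * (pd i (\<lambda>\<xi>. f (Y \<xi>)) \<theta> \<bullet> pd j (\<lambda>\<xi>. h (Y \<xi>)) \<theta>))"
proof -
  note im = patchD(5)[OF p \<theta>]
  have row: "tangential_gradient N \<nu> (\<lambda>z. f z $ \<kappa>) (Y \<theta>) = coord_grad Y (\<lambda>\<xi>. f (Y \<xi>) $ \<kappa>) \<theta>"
    "tangential_gradient N \<nu> (\<lambda>z. h z $ \<kappa>) (Y \<theta>) = coord_grad Y (\<lambda>\<xi>. h (Y \<xi>) $ \<kappa>) \<theta>" for \<kappa>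
    using tangential_gradient_patch[where \<nu>=\<nu> and f="\<lambda>z. f z $ \<kappa>", OF p \<theta> \<nu> differentiable_nth[OF f]]
      tangential_gradient_patch[where \<nu>=\<nu> and f="\<lambda>z. h z $ \<kappa>", OF p \<theta> \<nu> differentiable_nth[OF h]] by auto
  have "tgrad N \<nu> f (Y \<theta>) \<bullet> tgrad N \<nu> h (Y \<theta>) =
      (\<Sum>\<kappa>\<in>UNIV. coord_grad Y (\<lambda>\<xi>. h (Y \<xi>) $ \<kappa>) \<theta> \<bullet> coord_grad Y (\<lambda>\<xi>. f (Y \<xi>) $ \<kappa>) \<theta>)"
    by (simp add: tgrad_def inner_vec_def row mult.commute)
  also have "\<dots> = (\<Sum>\<kappa>\<in>UNIV. \<Sum>i\<in>UNIV. \<Sum>j\<in>UNIV. matrix_inv (gram Y \<theta>) $ i $ j * pd i (\<lambda>\<xi>. f (Y \<xi>)) \<theta> $ \<kappa> * pd j (\<lambda>\<xi>. h (Y \<xi>)) \<theta> $ \<kappa>)"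
    by (subst (2) coord_grad_def) (simp add: inner_sum_right coord_grad_inner_pd[OF im] pd_nth[OF f[OF \<theta>]] pd_nth[OF h[OF \<theta>]] mult_ac)
  also have "\<dots> = (\<Sum>i\<in>UNIV. \<Sum>j\<in>UNIV. \<Sum>\<kappa>\<in>UNIV. matrix_inv (gram Y \<theta>) $ i $ j * pd i (\<lambda>\<xi>. f (Y \<xi>)) \<theta> $ \<kappa> * pd j (\<lambda>\<xi>. h (Y \<xi>)) \<theta> $ \<kappa>)"
    by (subst sum.swap, intro sum.cong refl sum.swap)
  finally show ?thesis by (simp add: inner_vec_def sum_distrib_left mult_ac)
qed

section \<open>Integration by parts on a closed hypersurface\<close>

lemma C1_compose:
  fixes F :: "real^'m \<Rightarrow> 'b::real_normed_vector" and \<tau> :: "real^'n \<Rightarrow> real^'m"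
  assumes F: "Ck_on 1 F W" and \<tau>: "Ck_on 1 \<tau> U" and UW: "\<tau> ` U \<subseteq> W"
  shows "Ck_on 1 (\<lambda>\<xi>. F (\<tau> \<xi>)) U"
  unfolding Ck_on_1
proof (intro conjI ballI allI)
  have d: "\<tau> differentiable (at \<theta>)" "F differentiable (at (\<tau> \<theta>))" if "\<theta> \<in> U" for \<theta>
    using F \<tau> UW that unfolding Ck_on_1 by auto
  show "(\<lambda>\<xi>. F (\<tau> \<xi>)) differentiable at \<theta>" if "\<theta> \<in> U" for \<theta>
    by (rule pd_compose(2)[OF d[OF that]])
  fix i
  have "continuous_on U (\<lambda>\<theta>. pd a F (\<tau> \<theta>))" for a
    using F UW unfolding Ck_on_1 by (intro continuous_on_compose2[of W "pd a F" U \<tau>] C1_continuous[OF \<tau>]) auto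
  then have "continuous_on U (\<lambda>\<theta>. \<Sum>a\<in>UNIV. pd i \<tau> \<theta> $ a *\<^sub>R pd a F (\<tau> \<theta>))"
    using \<tau> unfolding Ck_on_1 by (intro continuous_intros) auto
  then show "continuous_on U (pd i (\<lambda>\<xi>. F (\<tau> \<xi>)))"
    by (rule continuous_on_eq) (simp add: pd_compose(1)[OF d])
qed

lemma C1_subset: "Ck_on 1 (F :: real^'n \<Rightarrow> 'b::real_normed_vector) W \<Longrightarrow> U \<subseteq> W \<Longrightarrow> Ck_on 1 F U"
  unfolding Ck_on_1 by (auto intro: continuous_on_subset)

lemma Ck_on_scaleR:
  fixes f :: "real^'n \<Rightarrow> real" and g :: "real^'n \<Rightarrow> 'b::real_normed_vector"
  shows "Ck_on 1 f U \<Longrightarrow> Ck_on 1 g U \<Longrightarrow> Ck_on 1 (\<lambda>\<xi>. f \<xi> *\<^sub>R g \<xi>) U"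
  by (rule C1_bilinear[OF bounded_bilinear_scaleR])

lemma C1_inverse:
  fixes f :: "real^'n \<Rightarrow> real"
  assumes f: "Ck_on 1 f U" and nz: "\<And>\<xi>. \<xi> \<in> U \<Longrightarrow> f \<xi> \<noteq> 0"
  shows "Ck_on 1 (\<lambda>\<xi>. inverse (f \<xi>)) U"
  unfolding Ck_on_1
proof (intro conjI ballI allI)
  have d: "f differentiable (at \<theta>)" if "\<theta> \<in> U" for \<theta>
    using f that unfolding Ck_on_1 by auto
  have D: "((\<lambda>\<xi>. inverse (f \<xi>)) has_derivative (\<lambda>v. - (inverse (f \<theta>) * frechet_derivative f (at \<theta>) v * inverse (f \<theta>)))) (at \<theta>)"
    if "\<theta> \<in> U" for \<theta>
    using d[OF that] nz[OF that] by - (rule Deriv.has_derivative_inverse, simp_all add: frechet_derivative_works)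
  show "(\<lambda>\<xi>. inverse (f \<xi>)) differentiable at \<theta>" if "\<theta> \<in> U" for \<theta>
    using D[OF that] by (rule differentiableI)
  fix i
  have "continuous_on U (\<lambda>\<theta>. - (inverse (f \<theta>) * pd i f \<theta> * inverse (f \<theta>)))"
    using f nz unfolding Ck_on_1 by (intro continuous_intros C1_continuous[OF f]) auto
  then show "continuous_on U (pd i (\<lambda>\<xi>. inverse (f \<xi>)))"
    by (rule continuous_on_eq) (simp add: pd_eqI[OF D] pd_def[of i f])
qed

text \<open>Squaring the positive part makes the function C1 across the sphere of radius r, so that
  products with C1 test maps remain C1.\<close>

definition bump :: "real^'m \<Rightarrow> real \<Rightarrow> real^'m \<Rightarrow> real" where
  "bump y r z = (max 0 (r\<^sup>2 - (norm (z - y))\<^sup>2))\<^sup>2"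

lemma has_real_derivative_max_square:
  "((\<lambda>s :: real. (max 0 s)\<^sup>2) has_real_derivative 2 * max 0 s) (at s)"
proof -
  consider "s > 0" | "s < 0" | "s = 0" by linarith
  then show ?thesis
  proof cases
    case 1
    have "((\<lambda>s :: real. s\<^sup>2) has_real_derivative 2 * s) (at s)"
      by (auto intro!: derivative_eq_intros)
    then have "((\<lambda>s :: real. (max 0 s)\<^sup>2) has_real_derivative 2 * s) (at s)"
      by (rule has_field_derivative_transform_within_open[of _ _ _ "{0<..}"]) (use 1 in auto)
    with 1 show ?thesis by simp
  next
    case 2
    have "((\<lambda>s :: real. (max 0 s)\<^sup>2) has_real_derivative 0) (at s)"
      by (rule has_field_derivative_transform_within_open[of "\<lambda>_. 0" _ _ "{..<0}"]) (use 2 in auto)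
    with 2 show ?thesis by simp
  next
    case 3
    have "((\<lambda>h :: real. max 0 h) \<longlongrightarrow> max 0 0) (at 0)" by (intro tendsto_intros)
    \<comment> \<open>At 0 the difference quotient of the squared positive part is the positive part
      itself, which tends to 0.\<close>
    moreover have "\<forall>\<^sub>F h :: real in at 0. max 0 h = (max 0 h)\<^sup>2 / h"
      by (auto simp: eventually_at_filter max_def power2_eq_square)
    ultimately have "((\<lambda>h :: real. (max 0 h)\<^sup>2 / h) \<longlongrightarrow> 0) (at 0)"
      using Lim_transform_eventually by fastforce
    with 3 show ?thesis by (simp add: DERIV_def)
  qed
qed

lemma C1_bump: "Ck_on 1 (bump y r) UNIV"
proof -
  let ?s = "\<lambda>z. r\<^sup>2 - (z - y) \<bullet> (z - y)"
  have eq: "bump y r z = (max 0 (?s z))\<^sup>2" for z by (simp add: bump_def power2_norm_eq_inner)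
  have D: "(bump y r has_derivative (\<lambda>v. 2 * max 0 (?s z) * (- (2 * ((z - y) \<bullet> v))))) (at z)" for z
  proof -
    have "(?s has_derivative (\<lambda>v. - (2 * ((z - y) \<bullet> v)))) (at z)"
      by (auto intro!: derivative_eq_intros simp: inner_commute)
    moreover have "((\<lambda>s. (max 0 s)\<^sup>2) has_derivative (\<lambda>h. 2 * max 0 (?s z) * h)) (at (?s z))"
      using has_real_derivative_max_square[of "?s z"] unfolding has_field_derivative_def .
    ultimately show ?thesis unfolding eq[abs_def] by (rule has_derivative_compose)
  qed
  show ?thesis
    unfolding Ck_on_1
  proof (intro conjI ballI allI)
    show "bump y r differentiable at z" for z using D by (rule differentiableI)
    fix i
    have "continuous_on UNIV (\<lambda>z. 2 * max 0 (?s z) * (- (2 * ((z - y) \<bullet> axis i 1))))"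
      by (intro continuous_intros)
    then show "continuous_on UNIV (pd i (bump y r))"
      by (rule continuous_on_eq) (simp add: pd_eqI[OF D])
  qed
qed

lemma bump_pos: "dist z y < r \<Longrightarrow> bump y r z > 0"
proof -
  assume "dist z y < r"
  then have "(norm (z - y))\<^sup>2 < r\<^sup>2" by (intro power_strict_mono) (auto simp: dist_norm)
  then show ?thesis by (simp add: bump_def)
qed

lemma bump_zero: "dist z y \<ge> r \<Longrightarrow> r > 0 \<Longrightarrow> bump y r z = 0"
proof -
  assume "dist z y \<ge> r" "r > 0"
  then have "r\<^sup>2 \<le> (norm (z - y))\<^sup>2" by (intro power_mono) (auto simp: dist_norm)
  then show ?thesis by (simp add: bump_def)
qed

lemma bump_nonneg: "bump y r z \<ge> 0" by (simp add: bump_def)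

text \<open>Abstracts \<open>\<Gamma> t\<close> at a fixed time. Regularity of functions on N is
  tested in the patches of P only, since it is known there from the charts of \<open>M\<close>.
  Additivity of the Hausdorff measure is assumed because the opposite case is settled
  separately.\<close>

locale c2_surface =
  fixes N :: "(real^('n::finite option)) set" and \<nu> :: "real^('n option) \<Rightarrow> real^('n option)"
    and P :: "((real^'n) set \<times> (real^'n \<Rightarrow> real^('n option))) set"
  assumes compact: "compact N"
    and patches: "(U, Y) \<in> P \<Longrightarrow> patch N U Y"
    and cover: "y \<in> N \<Longrightarrow> \<exists>U Y \<theta>. (U, Y) \<in> P \<and> \<theta> \<in> U \<and> y = Y \<theta>"
    and normal: "(U, Y) \<in> P \<Longrightarrow> \<theta> \<in> U \<Longrightarrow> unit_normal_at \<nu> Y \<theta>"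
    and ms: "measure_space UNIV (sets borel) (hausdorff_outer CARD('n) :: (real^('n option)) set \<Rightarrow> ennreal)"
begin

lemma closed: "closed N" using compact by (rule compact_imp_closed)

lemma N_borel: "N \<in> sets borel" using closed by simp

lemma finite_measure_N: "emeasure surface_measure N < \<infinity>"
proof (rule emeasure_hypersurface_finite[OF ms compact])
  fix y assume "y \<in> N"
  then show "\<exists>U Y. patch N U Y \<and> y \<in> Y ` U" using cover patches by blast
qed

text \<open>Patches are homeomorphisms onto relatively open sets, so continuity can be tested in the
  parameters.\<close>

lemma continuous_on_N:
  fixes h :: "real^('n option) \<Rightarrow> 'b::topological_space"
  assumes h: "\<And>U Y. (U, Y) \<in> P \<Longrightarrow> continuous_on U (\<lambda>\<theta>. h (Y \<theta>))"
  shows "continuous_on N h"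
  unfolding continuous_on_eq_continuous_within
proof
  fix y assume "y \<in> N"
  then obtain U Y \<theta> where p: "(U, Y) \<in> P" "\<theta> \<in> U" "y = Y \<theta>" using cover by blast
  note pp = patches[OF p(1)]
  obtain J where J: "homeomorphism U (Y ` U) Y J" using pp by (auto simp: patch_def)
  obtain T where T: "open T" "Y ` U = N \<inter> T" using patchD(2)[OF pp] by (auto simp: openin_open)
  have JU: "J ` Y ` U = U" using J by (simp add: homeomorphism_def)
  have "continuous_on (Y ` U) (\<lambda>y. h (Y (J y)))"
    by (rule continuous_on_compose2[OF h[OF p(1)] homeomorphism_cont2[OF J]]) (simp add: JU)
  then have "continuous_on (Y ` U) h"
    by (rule continuous_on_eq) (simp add: homeomorphism_apply2[OF J])
  then have "continuous (at y within N \<inter> T) h"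
    using p T by (auto simp: continuous_on_eq_continuous_within)
  moreover have "at y within N \<inter> T = at y within N"
    by (rule at_within_nhd[OF _ T(1)]) (use p T(2) in blast)+
  ultimately show "continuous (at y within N) h" by simp
qed

lemma bounded_continuous_N:
  fixes h :: "real^('n option) \<Rightarrow> 'b::real_normed_vector"
  assumes "continuous_on N h"
  obtains C where "C \<ge> 0" "\<And>y. y \<in> N \<Longrightarrow> norm (h y) \<le> C"
proof -
  have "bounded (h ` N)" by (intro compact_imp_bounded compact_continuous_image assms compact)
  then obtain C where "C > 0" "\<And>y. y \<in> N \<Longrightarrow> norm (h y) \<le> C" by (auto simp: bounded_pos)
  then show ?thesis using that[of C] by simp
qed

lemma integrable_continuous_N:
  fixes h :: "real^('n option) \<Rightarrow> real"
  assumes "continuous_on N h"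
  shows "set_integrable surface_measure N h"
proof -
  obtain C where C: "C \<ge> 0" "\<And>y. y \<in> N \<Longrightarrow> norm (h y) \<le> C" using bounded_continuous_N[OF assms] by blast
  have m: "(\<lambda>y. indicator N y *\<^sub>R h y) \<in> borel_measurable surface_measure"
    using borel_measurable_continuous_on_indicator[OF N_borel assms] by simp
  have "integrable surface_measure (\<lambda>y. C * indicator N y)"
    using N_borel finite_measure_N by (intro integrable_mult_right integrable_real_indicator) auto
  then show ?thesis unfolding set_integrable_def
    by (rule Bochner_Integration.integrable_bound) (use m C in \<open>auto split: split_indicator\<close>)
qed

lemma tgrad_continuous:
  assumes f: "\<And>U Y. (U, Y) \<in> P \<Longrightarrow> Ck_on 1 (\<lambda>\<theta>. f (Y \<theta>)) U"
  shows "continuous_on N (tgrad N \<nu> f)"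
proof (rule continuous_on_N)
  fix U Y assume p: "(U, Y) \<in> P"
  note pD = patchD[OF patches[OF p]]
  have d: "(\<lambda>\<xi>. f (Y \<xi>)) differentiable (at \<xi>)" if "\<xi> \<in> U" for \<xi> using f[OF p] that unfolding Ck_on_1 by blast
  have "continuous_on U (\<lambda>\<theta>. \<chi> \<kappa> \<beta>. \<Sum>i\<in>UNIV. \<Sum>j\<in>UNIV. matrix_inv (gram Y \<theta>) $ i $ j * pd i (\<lambda>\<xi>. f (Y \<xi>)) \<theta> $ \<kappa> * pd j Y \<theta> $ \<beta>)"
    using f[OF p] pD(4) unfolding Ck_on_1
    by (intro continuous_intros continuous_on_inverse_gram[OF pD(1,3,5)]) auto
  then show "continuous_on U (\<lambda>\<theta>. tgrad N \<nu> f (Y \<theta>))"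
    by (rule continuous_on_eq)
      (simp add: tgrad_patch[where f=f and \<nu>=\<nu>, OF patches[OF p] _ normal[OF p] d])
qed

context
  fixes f Lf :: "real^('n option) \<Rightarrow> real^('n option)"
  assumes f: "\<And>U Y. (U, Y) \<in> P \<Longrightarrow> Ck_on 2 (\<lambda>\<theta>. f (Y \<theta>)) U"
    and Lf: "\<And>U Y \<theta>. (U, Y) \<in> P \<Longrightarrow> \<theta> \<in> U \<Longrightarrow> Lf (Y \<theta>) = lap Y (\<lambda>\<theta>. f (Y \<theta>)) \<theta>"
begin

text \<open>The Christoffel symbols contain only first derivatives of the metric, which is C1 on a
  C2 patch.\<close>

lemma laplacian_continuous: "continuous_on N Lf"
proof (rule continuous_on_N)
  fix U Y assume p: "(U, Y) \<in> P"
  note pD = patchD[OF patches[OF p]]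
  note ci = continuous_on_inverse_gram[OF pD(1,3,5)]
  have cg: "continuous_on U (pd k (\<lambda>\<xi>. gram Y \<xi> $ a $ b))" for k a b
    using C1_gram[OF pD(1,3,5), of a b] unfolding Ck_on_1 by blast
  have "continuous_on U (\<lambda>\<theta>. lap Y (\<lambda>\<theta>. f (Y \<theta>)) \<theta>)"
    unfolding lap_def hess_def christoffel_def
    using Ck_on_2D(3,5)[OF f[OF p]]
    by (intro continuous_intros ci cg) auto
  then show "continuous_on U (\<lambda>\<theta>. Lf (Y \<theta>))"
    by (rule continuous_on_eq) (simp add: Lf[OF p])
qed

lemma tgrad_f_continuous: "continuous_on N (tgrad N \<nu> f)"
  by (rule tgrad_continuous) (rule Ck_on_2_imp_1[OF f])

text \<open>The integrand vanishes off C, so the integral lives on a single patch, where the area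
  formula leads to \<open>integral_lap_parts\<close> with the preimage of the compact set N \<inter>
  C as support.\<close>

lemma integral_parts_local:
  assumes \<phi>: "\<And>U Y. (U, Y) \<in> P \<Longrightarrow> Ck_on 1 (\<lambda>\<theta>. \<phi> (Y \<theta>)) U"
    and p: "(U, Y) \<in> P" and C: "closed C" "N \<inter> C \<subseteq> Y ` U" and z: "\<And>y. y \<in> N - C \<Longrightarrow> \<phi> y = 0"
  shows "(LINT y:N|surface_measure. Lf y \<bullet> \<phi> y + tgrad N \<nu> f y \<bullet> tgrad N \<nu> \<phi> y) = 0"
proof -
  note pp = patches[OF p]
  note pD = patchD[OF pp]
  let ?h = "\<lambda>y. Lf y \<bullet> \<phi> y + tgrad N \<nu> f y \<bullet> tgrad N \<nu> \<phi> y"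
  have form: "?h (Y \<theta>) = lap Y (\<lambda>\<theta>. f (Y \<theta>)) \<theta> \<bullet> \<phi> (Y \<theta>) +
      (\<Sum>i\<in>UNIV. \<Sum>j\<in>UNIV. matrix_inv (gram Y \<theta>) $ i $ j * (pd i (\<lambda>\<xi>. f (Y \<xi>)) \<theta> \<bullet> pd j (\<lambda>\<xi>. \<phi> (Y \<xi>)) \<theta>))"
    if q: "(U, Y) \<in> P" and \<theta>: "\<theta> \<in> U" for U Y \<theta>
  proof -
    have "(\<lambda>\<xi>. f (Y \<xi>)) differentiable (at \<xi>)" if "\<xi> \<in> U" for \<xi> by (rule Ck_on_2D(1)[OF f[OF q] that])
    moreover have "(\<lambda>\<xi>. \<phi> (Y \<xi>)) differentiable (at \<xi>)" if "\<xi> \<in> U" for \<xi>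
      using \<phi>[OF q] that unfolding Ck_on_1 by blast
    ultimately show ?thesis
      by (simp add: Lf[OF q \<theta>] tgrad_patch_inner[where f=f and h=\<phi> and \<nu>=\<nu>, OF patches[OF q] \<theta> normal[OF q \<theta>]])
  qed
  have c\<phi>: "continuous_on N \<phi>" by (rule continuous_on_N) (rule C1_continuous[OF \<phi>])
  have ch: "continuous_on N ?h"
    by (intro continuous_intros laplacian_continuous tgrad_f_continuous c\<phi> tgrad_continuous \<phi>)
  have hz: "?h y = 0" if y: "y \<in> N - C" for y
  proof -
    obtain U' Y' \<theta> where q: "(U', Y') \<in> P" and \<theta>: "\<theta> \<in> U'" "y = Y' \<theta>" using cover y by blast
    note qD = patchD[OF patches[OF q]]
    \<comment> \<open>Outside the closed set C the map vanishes on a whole neighbourhood in the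
      parameters, hence so do its derivatives.\<close>
    have "open (U' \<inter> Y' -` (- C))" using continuous_open_preimage[OF qD(7,1)] C(1) by (simp add: open_Compl)
    then have "eventually (\<lambda>\<xi>. \<xi> \<in> U' \<inter> Y' -` (- C)) (nhds \<theta>)"
      by (rule eventually_nhds_in_open) (use \<theta> y in simp)
    then have "eventually (\<lambda>\<xi>. \<phi> (Y' \<xi>) = 0) (nhds \<theta>)"
      by (rule eventually_mono) (use qD(6) in \<open>auto intro!: z\<close>)
    from pd_cong_nhds[OF this] have "pd j (\<lambda>\<xi>. \<phi> (Y' \<xi>)) \<theta> = 0" for j by simp
    then show ?thesis using z[OF y] form[OF q \<theta>(1)] \<theta>(2) by simp
  qed
  obtain J where J: "homeomorphism U (Y ` U) Y J" using pp by (auto simp: patch_def)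
  define K where "K = J ` (N \<inter> C)"
  have K: "compact K" "K \<subseteq> U"
  proof -
    show "compact K"
      unfolding K_def
      by (rule compact_continuous_image[OF continuous_on_subset[OF homeomorphism_cont2[OF J] C(2)]
            compact_Int_closed[OF compact C(1)]])
    show "K \<subseteq> U" using image_mono[OF C(2), of J] J by (simp add: K_def homeomorphism_def)
  qed
  have \<Phi>z: "\<phi> (Y \<theta>) = 0" if \<theta>: "\<theta> \<in> U - K" for \<theta>
  proof (rule z)
    have "Y \<theta> \<notin> C"
    proof
      assume "Y \<theta> \<in> C"
      then have "J (Y \<theta>) \<in> K" using \<theta> pD(6) by (auto simp: K_def)
      then show False using \<theta> homeomorphism_apply1[OF J] by auto
    qed
    then show "Y \<theta> \<in> N - C" using \<theta> pD(6) by blast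
  qed
  have "(LINT y:N|surface_measure. ?h y) = (LINT y:Y ` U|surface_measure. ?h y)"
    unfolding set_lebesgue_integral_def
    by (intro Bochner_Integration.integral_cong) (use hz C(2) pD(6) in \<open>auto split: split_indicator\<close>)
  \<comment> \<open>The undetermined constant multiplies an integral that turns out to be 0.\<close>
  also have "\<dots> = flat_const TYPE('n) * (LINT \<theta>:U|lborel. area_density Y \<theta> * ?h (Y \<theta>))"
    by (rule integral_over_patch[OF ms pp closed])
      (rule continuous_on_compose2[OF ch pD(7)], use pD(6) in blast)
  also have "(LINT \<theta>:U|lborel. area_density Y \<theta> * ?h (Y \<theta>)) = (LINT \<theta>:U|lborel. area_density Y \<theta> *
     (lap Y (\<lambda>\<theta>. f (Y \<theta>)) \<theta> \<bullet> \<phi> (Y \<theta>) +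
      (\<Sum>i\<in>UNIV. \<Sum>j\<in>UNIV. matrix_inv (gram Y \<theta>) $ i $ j * (pd i (\<lambda>\<xi>. f (Y \<xi>)) \<theta> \<bullet> pd j (\<lambda>\<xi>. \<phi> (Y \<xi>)) \<theta>))))"
    unfolding set_lebesgue_integral_def
    by (intro Bochner_Integration.integral_cong refl) (simp add: form[OF p] split: split_indicator)
  also have "\<dots> = 0"
    by (rule integral_lap_parts[OF pD(1,3,5) f[OF p] \<phi>[OF p] K \<Phi>z])
  finally show ?thesis by simp
qed

text \<open>Bumps divided by their sum S split the test map into finitely many pieces, each
  vanishing outside a closed ball whose part in N lies in one patch. The integrand is linear in the
  test map.\<close>

theorem integral_parts_C1:
  assumes W: "open W" "N \<subseteq> W" and \<phi>: "Ck_on 1 \<phi> W"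
  shows "(LINT y:N|surface_measure. Lf y \<bullet> \<phi> y + tgrad N \<nu> f y \<bullet> tgrad N \<nu> \<phi> y) = 0"
proof -
  have "\<exists>r U Y. r > 0 \<and> (U, Y) \<in> P \<and> N \<inter> cball y r \<subseteq> Y ` U" if y: "y \<in> N" for y
  proof -
    obtain U Y \<theta> where p: "(U, Y) \<in> P" "\<theta> \<in> U" "y = Y \<theta>" using cover[OF y] by blast
    obtain T where T: "open T" "Y ` U = N \<inter> T" using patchD(2)[OF patches[OF p(1)]] by (auto simp: openin_open)
    have "y \<in> T" using p T by blast
    then obtain r where "r > 0" "cball y r \<subseteq> T" using T(1) open_contains_cball by blast
    then show ?thesis using p(1) T(2) by blast
  qed
  then obtain r U Y where r: "\<And>y. y \<in> N \<Longrightarrow> r y > 0" "\<And>y. y \<in> N \<Longrightarrow> (U y, Y y) \<in> P"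
    "\<And>y. y \<in> N \<Longrightarrow> N \<inter> cball y (r y) \<subseteq> Y y ` U y" by metis
  obtain F where F: "F \<subseteq> N" "finite F" "N \<subseteq> (\<Union>y\<in>F. ball y (r y))"
  proof (rule compactE_image[OF compact, of N "\<lambda>y. ball y (r y)"])
    show "N \<subseteq> (\<Union>y\<in>N. ball y (r y))" using r(1) by auto
  qed (auto intro: that)
  define S where "S z = (\<Sum>y\<in>F. bump y (r y) z)" for z
  have CS: "Ck_on 1 S UNIV" unfolding S_def by (intro C1_sum C1_bump)
  have Spos: "S z > 0" if "z \<in> N" for z
  proof -
    from F(3) that obtain y where y: "y \<in> F" "dist y z < r y" by (auto dest!: subsetD)
    have "0 < bump y (r y) z" by (rule bump_pos) (use y in \<open>simp add: dist_commute\<close>)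
    then show ?thesis unfolding S_def by (intro sum_pos2[OF F(2) y(1)]) (auto simp: bump_nonneg)
  qed
  \<comment> \<open>S is positive on N but may vanish elsewhere in W; the quotients are used only
    where it is positive.\<close>
  define W' where "W' = W \<inter> {z. S z > 0}"
  have W': "N \<subseteq> W'" using W Spos by (auto simp: W'_def)
  define \<phi>' where "\<phi>' y z = (bump y (r y) z * inverse (S z)) *\<^sub>R \<phi> z" for y z
  have C\<phi>': "Ck_on 1 (\<phi>' y) W'" for y
    unfolding \<phi>'_def
    by (intro Ck_on_scaleR C1_mult C1_inverse C1_subset[OF C1_bump] C1_subset[OF CS] C1_subset[OF \<phi>])
      (auto simp: W'_def)
  have C\<phi>P: "Ck_on 1 (\<lambda>\<theta>. \<phi>' y (Y \<theta>)) U" if "(U, Y) \<in> P" for y U Y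
    using patchD(4,6)[OF patches[OF that]] W' by (intro C1_compose[OF C\<phi>']) auto
  have sum\<phi>: "(\<Sum>y\<in>F. \<phi>' y z) = \<phi> z" if "z \<in> N" for z
    using Spos[OF that] by (simp add: \<phi>'_def scaleR_sum_left[symmetric] sum_distrib_right[symmetric] S_def[symmetric])
  let ?h = "\<lambda>\<phi> y. Lf y \<bullet> \<phi> y + tgrad N \<nu> f y \<bullet> tgrad N \<nu> \<phi> y"
  have hsum: "?h \<phi> z = (\<Sum>y\<in>F. ?h (\<phi>' y) z)" if z: "z \<in> N" for z
  proof -
    obtain U Y \<theta> where q: "(U, Y) \<in> P" "\<theta> \<in> U" "z = Y \<theta>" using cover[OF z] by blast
    note qD = patchD[OF patches[OF q(1)]]
    have d: "(\<lambda>\<xi>. \<phi>' y (Y \<xi>)) differentiable (at \<xi>)" if "\<xi> \<in> U" for \<xi> y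
      using C\<phi>P[OF q(1)] that unfolding Ck_on_1 by blast
    have ev: "eventually (\<lambda>\<xi>. \<phi> (Y \<xi>) = (\<Sum>y\<in>F. \<phi>' y (Y \<xi>))) (nhds \<xi>)" if "\<xi> \<in> U" for \<xi>
      using eventually_nhds_in_open[OF qD(1) that] by (rule eventually_mono) (use sum\<phi> qD(6) in auto)
    have d\<phi>: "(\<lambda>\<xi>. \<phi> (Y \<xi>)) differentiable (at \<xi>)" if "\<xi> \<in> U" for \<xi>
      using pd_sum(2)[of F "\<lambda>y \<xi>. \<phi>' y (Y \<xi>)" \<xi>] d[OF that] differentiable_cong_nhds[OF ev[OF that]] by blast
    have p\<phi>: "pd i (\<lambda>\<xi>. \<phi> (Y \<xi>)) \<theta> = (\<Sum>y\<in>F. pd i (\<lambda>\<xi>. \<phi>' y (Y \<xi>)) \<theta>)" for i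
      using pd_cong_nhds[OF ev[OF q(2)]] pd_sum(1)[of F "\<lambda>y \<xi>. \<phi>' y (Y \<xi>)" \<theta>] d[OF q(2)] by simp
    note tp = tgrad_patch[where \<nu>=\<nu>, OF patches[OF q(1)] q(2) normal[OF q(1,2)]]
    have t: "tgrad N \<nu> g (Y \<theta>) $ \<kappa> $ \<beta> = (\<Sum>i\<in>UNIV. \<Sum>j\<in>UNIV. matrix_inv (gram Y \<theta>) $ i $ j * pd i (\<lambda>\<xi>. g (Y \<xi>)) \<theta> $ \<kappa> * pd j Y \<theta> $ \<beta>)"
      if "\<And>\<xi>. \<xi> \<in> U \<Longrightarrow> (\<lambda>\<xi>. g (Y \<xi>)) differentiable (at \<xi>)" for g \<kappa> \<beta>
      by (simp add: tp[where f=g, OF that])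
    \<comment> \<open>Additivity is read off the coordinate formula, because a definition by unique
      description does not show it.\<close>
    have "tgrad N \<nu> \<phi> z $ \<kappa> $ \<beta> = (\<Sum>y\<in>F. tgrad N \<nu> (\<phi>' y) z $ \<kappa> $ \<beta>)" for \<kappa> \<beta>
      unfolding q(3)
      by (subst t, rule d\<phi>, assumption, subst t, rule d, assumption)
        (simp add: p\<phi> sum_distrib_left sum_distrib_right sum.swap[of _ F])
    then have "tgrad N \<nu> \<phi> z = (\<Sum>y\<in>F. tgrad N \<nu> (\<phi>' y) z)" by (simp add: vec_eq_iff)
    then show ?thesis
      by (simp add: sum\<phi>[OF z, symmetric] inner_sum_right sum.distrib)
  qed
  have int: "set_integrable surface_measure N (?h (\<phi>' y))" for y
    by (intro integrable_continuous_N continuous_intros laplacian_continuous tgrad_f_continuous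
        tgrad_continuous continuous_on_N C\<phi>P C1_continuous)
  have "(LINT z:N|surface_measure. ?h \<phi> z) = (LINT z:N|surface_measure. (\<Sum>y\<in>F. ?h (\<phi>' y) z))"
    unfolding set_lebesgue_integral_def
    by (intro Bochner_Integration.integral_cong refl) (simp add: hsum split: split_indicator)
  also have "\<dots> = (\<Sum>y\<in>F. LINT z:N|surface_measure. ?h (\<phi>' y) z)"
    using int unfolding set_lebesgue_integral_def set_integrable_def
    by (simp add: sum_distrib_left Bochner_Integration.integral_sum)
  also have "\<dots> = 0"
  proof (rule sum.neutral, rule ballI)
    fix y assume "y \<in> F"
    then have y: "y \<in> N" using F(1) by blast
    show "(LINT z:N|surface_measure. ?h (\<phi>' y) z) = 0"
    proof (rule integral_parts_local[OF _ r(2)[OF y] _ r(3)[OF y]])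
      show "\<phi>' y z = 0" if "z \<in> N - cball y (r y)" for z
        using bump_zero[of "r y" z y] r(1)[OF y] that by (simp add: \<phi>'_def dist_commute)
    qed (rule C\<phi>P closed_cball, assumption?)+
  qed
  finally show ?thesis .
qed

end

end

section \<open>Square integrable test maps\<close>

context c2_surface
begin

lemma L2_measurable:
  fixes \<eta> :: "real^('n option) \<Rightarrow> 'b::euclidean_space"
  assumes "\<eta> \<in> L2_on surface_measure N"
  shows "(\<lambda>y. indicator N y *\<^sub>R \<eta> y) \<in> borel_measurable surface_measure"
  using assms by (simp add: L2_on_def set_borel_measurable_def)

lemma continuous_measurable:
  fixes h :: "real^('n option) \<Rightarrow> 'b::euclidean_space"
  assumes "continuous_on N h"
  shows "(\<lambda>y. indicator N y *\<^sub>R h y) \<in> borel_measurable surface_measure"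
  using borel_measurable_continuous_on_indicator[OF N_borel assms] by simp

lemma inner_measurable:
  fixes a \<eta> :: "real^('n option) \<Rightarrow> 'b::euclidean_space"
  assumes "continuous_on N a" "(\<lambda>y. indicator N y *\<^sub>R \<eta> y) \<in> borel_measurable surface_measure"
  shows "(\<lambda>y. indicator N y *\<^sub>R (a y \<bullet> \<eta> y)) \<in> borel_measurable surface_measure"
proof -
  have "(\<lambda>y. (indicator N y *\<^sub>R a y) \<bullet> (indicator N y *\<^sub>R \<eta> y)) \<in> borel_measurable surface_measure"
    using continuous_measurable[OF assms(1)] assms(2) by (rule borel_measurable_inner)
  moreover have "(\<lambda>y. (indicator N y *\<^sub>R a y) \<bullet> (indicator N y *\<^sub>R \<eta> y)) = (\<lambda>y. indicator N y *\<^sub>R (a y \<bullet> \<eta> y))"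
    by (auto simp: fun_eq_iff split: split_indicator)
  ultimately show ?thesis by simp
qed

text \<open>The integrand is bounded by a constant times 1 + |\<eta>|^2, which is integrable since N
  has finite area.\<close>

lemma integrable_inner_L2:
  fixes a \<eta> :: "real^('n option) \<Rightarrow> 'b::euclidean_space"
  assumes a: "continuous_on N a" and \<eta>: "\<eta> \<in> L2_on surface_measure N"
  shows "set_integrable surface_measure N (\<lambda>y. a y \<bullet> \<eta> y)"
proof -
  obtain C where C: "C \<ge> 0" "\<And>y. y \<in> N \<Longrightarrow> norm (a y) \<le> C" using bounded_continuous_N[OF a] by blast
  let ?q = "\<lambda>y. indicator N y * (norm (\<eta> y))\<^sup>2"
  have qeq: "?q = (\<lambda>y. (norm (indicator N y *\<^sub>R \<eta> y))\<^sup>2)"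
    by (auto simp: fun_eq_iff split: split_indicator)
  have q: "integrable surface_measure ?q"
  proof (rule integrableI_nonneg)
    show "?q \<in> borel_measurable surface_measure"
      unfolding qeq using L2_measurable[OF \<eta>] by measurable
    have "(\<integral>\<^sup>+y. ennreal (?q y) \<partial>surface_measure) = (\<integral>\<^sup>+y\<in>N. ennreal ((norm (\<eta> y))\<^sup>2) \<partial>surface_measure)"
      by (intro nn_integral_cong) (auto split: split_indicator)
    also have "\<dots> < \<infinity>" using \<eta> by (simp add: L2_on_def)
    finally show "(\<integral>\<^sup>+y. ennreal (?q y) \<partial>surface_measure) < \<infinity>" .
  qed simp
  have one: "integrable surface_measure (\<lambda>y. indicator N y :: real)"
    using N_borel finite_measure_N by (intro integrable_real_indicator) auto
  show ?thesis
    unfolding set_integrable_def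
  proof (rule Bochner_Integration.integrable_bound)
    show "integrable surface_measure (\<lambda>y. C * (indicator N y + ?q y))"
      using q one by simp
    show "(\<lambda>y. indicator N y *\<^sub>R (a y \<bullet> \<eta> y)) \<in> borel_measurable surface_measure"
      by (rule inner_measurable[OF a L2_measurable[OF \<eta>]])
    have "\<bar>a y \<bullet> \<eta> y\<bar> \<le> C * (1 + (norm (\<eta> y))\<^sup>2)" if "y \<in> N" for y
    proof -
      have "\<bar>a y \<bullet> \<eta> y\<bar> \<le> norm (a y) * norm (\<eta> y)" by (rule Cauchy_Schwarz_ineq2)
      also have "\<dots> \<le> C * norm (\<eta> y)" using C(2)[OF that] by (intro mult_right_mono) auto
      also have "norm (\<eta> y) \<le> 1 + (norm (\<eta> y))\<^sup>2"
      proof -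
        have "0 \<le> (norm (\<eta> y) - 1/2)\<^sup>2" by simp
        then show ?thesis by (simp add: power2_eq_square algebra_simps)
      qed
      finally show ?thesis using C(1) by (simp add: mult_left_mono)
    qed
    then show "AE y in surface_measure. norm (indicator N y *\<^sub>R (a y \<bullet> \<eta> y)) \<le> norm (C * (indicator N y + ?q y))"
      using C(1) by (auto split: split_indicator)
  qed
qed

text \<open>By Cauchy-Schwarz the squared error is at most C^2 times the area of N times the squared
  L2 distance.\<close>

lemma integral_inner_L2_limit:
  fixes a \<eta> :: "real^('n option) \<Rightarrow> 'b::euclidean_space"
  assumes a: "continuous_on N a" and \<eta>: "\<eta> \<in> L2_on surface_measure N" and \<phi>: "\<And>k. continuous_on N (\<phi> k)"
    and lim: "(\<lambda>k. \<integral>\<^sup>+y\<in>N. ennreal ((norm (\<phi> k y - \<eta> y))\<^sup>2) \<partial>surface_measure) \<longlonglongrightarrow> 0"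
  shows "(\<lambda>k. LINT y:N|surface_measure. a y \<bullet> \<phi> k y) \<longlonglongrightarrow> (LINT y:N|surface_measure. a y \<bullet> \<eta> y)"
proof -
  obtain C where C: "C \<ge> 0" "\<And>y. y \<in> N \<Longrightarrow> norm (a y) \<le> C" using bounded_continuous_N[OF a] by blast
  let ?d = "\<lambda>k. \<integral>\<^sup>+y\<in>N. ennreal ((norm (\<phi> k y - \<eta> y))\<^sup>2) \<partial>surface_measure"
  define e where "e k = (LINT y:N|surface_measure. a y \<bullet> \<phi> k y) - (LINT y:N|surface_measure. a y \<bullet> \<eta> y)" for k
  have m: "(\<lambda>y. indicator N y *\<^sub>R (\<phi> k y - \<eta> y)) \<in> borel_measurable surface_measure" for k
    using continuous_measurable[OF \<phi>[of k]] L2_measurable[OF \<eta>] by (simp add: scaleR_diff_right)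
  have i1: "set_integrable surface_measure N (\<lambda>y. a y \<bullet> \<phi> k y)" for k
    by (intro integrable_continuous_N continuous_intros a \<phi>)
  note i2 = integrable_inner_L2[OF a \<eta>]
  have bound: "ennreal ((e k)\<^sup>2) \<le> (ennreal (C\<^sup>2) * emeasure surface_measure N) * ?d k" for k
  proof -
    have ek: "e k = (LINT y:N|surface_measure. a y \<bullet> (\<phi> k y - \<eta> y))"
      unfolding e_def by (subst set_integral_diff(2)[OF i1 i2, symmetric]) (simp add: inner_diff_right)
    have i3: "integrable surface_measure (\<lambda>y. indicator N y *\<^sub>R (a y \<bullet> (\<phi> k y - \<eta> y)))"
      using set_integral_diff(1)[OF i1 i2] by (simp add: inner_diff_right set_integrable_def)
    let ?g = "\<lambda>y. ennreal (norm (indicator N y *\<^sub>R (\<phi> k y - \<eta> y)))"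
    let ?f = "\<lambda>y. ennreal C * indicator N y"
    have mf: "?f \<in> borel_measurable surface_measure" using N_borel by simp
    have mg: "?g \<in> borel_measurable surface_measure" using m[of k] by measurable
    have "ennreal \<bar>e k\<bar> \<le> (\<integral>\<^sup>+y. ennreal (norm (indicator N y *\<^sub>R (a y \<bullet> (\<phi> k y - \<eta> y)))) \<partial>surface_measure)"
      unfolding ek set_lebesgue_integral_def using integral_norm_bound_ennreal[OF i3] by simp
    also have "\<dots> \<le> (\<integral>\<^sup>+y. ?f y * ?g y \<partial>surface_measure)"
    proof (rule nn_integral_mono)
      fix y
      have "\<bar>a y \<bullet> (\<phi> k y - \<eta> y)\<bar> \<le> C * norm (\<phi> k y - \<eta> y)" if "y \<in> N"
        using Cauchy_Schwarz_ineq2[of "a y" "\<phi> k y - \<eta> y"] mult_right_mono[OF C(2)[OF that], of "norm (\<phi> k y - \<eta> y)"]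
        by simp
      then show "ennreal (norm (indicator N y *\<^sub>R (a y \<bullet> (\<phi> k y - \<eta> y)))) \<le> ?f y * ?g y"
        using C(1) by (auto split: split_indicator simp: ennreal_mult'[symmetric] intro!: ennreal_leI)
    qed
    finally have "(ennreal \<bar>e k\<bar>)\<^sup>2 \<le> (\<integral>\<^sup>+y. ?f y * ?g y \<partial>surface_measure)\<^sup>2" by (intro power_mono) auto
    also have "\<dots> \<le> (\<integral>\<^sup>+y. (?f y)\<^sup>2 \<partial>surface_measure) * (\<integral>\<^sup>+y. (?g y)\<^sup>2 \<partial>surface_measure)"
      by (rule Cauchy_Schwarz_nn_integral[OF mf mg])
    also have "(\<integral>\<^sup>+y. (?f y)\<^sup>2 \<partial>surface_measure) = (\<integral>\<^sup>+y. ennreal (C\<^sup>2) * indicator N y \<partial>surface_measure)"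
      using C(1) by (intro nn_integral_cong) (auto split: split_indicator simp: ennreal_power)
    also have "\<dots> = ennreal (C\<^sup>2) * emeasure surface_measure N"
      using N_borel by (intro nn_integral_cmult_indicator) simp
    also have "(\<integral>\<^sup>+y. (?g y)\<^sup>2 \<partial>surface_measure) = ?d k"
      by (intro nn_integral_cong) (auto split: split_indicator simp: ennreal_power)
    finally show ?thesis by (simp add: ennreal_power)
  qed
  have fin: "ennreal (C\<^sup>2) * emeasure surface_measure N < \<infinity>"
    using finite_measure_N by (simp add: ennreal_mult_less_top)
  have "(\<lambda>k. (ennreal (C\<^sup>2) * emeasure surface_measure N) * ?d k) \<longlonglongrightarrow> (ennreal (C\<^sup>2) * emeasure surface_measure N) * 0"
    by (rule tendsto_mult_ennreal[OF tendsto_const lim]) (use fin in simp)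
  then have "(\<lambda>k. (ennreal (C\<^sup>2) * emeasure surface_measure N) * ?d k) \<longlonglongrightarrow> 0"
    by simp
  then have "(\<lambda>k. ennreal ((e k)\<^sup>2)) \<longlonglongrightarrow> ennreal 0"
    unfolding ennreal_0
    by (rule tendsto_sandwich[OF _ _ tendsto_const, rotated 2]) (simp_all add: bound)
  then have "(\<lambda>k. (e k)\<^sup>2) \<longlonglongrightarrow> 0" by (rule tendsto_ennrealD) auto
  from tendsto_real_sqrt[OF this] have "(\<lambda>k. \<bar>e k\<bar>) \<longlonglongrightarrow> 0" by simp
  then have "e \<longlonglongrightarrow> 0" by (rule tendsto_rabs_zero_cancel)
  then show ?thesis unfolding e_def[abs_def] by (rule LIM_zero_cancel)
qed

text \<open>Both integrals pair a continuous field with an L2 map, so the identity for C1 maps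
  passes to the limit along an approximating sequence.\<close>

theorem integral_parts_H12:
  assumes f: "\<And>U Y. (U, Y) \<in> P \<Longrightarrow> Ck_on 2 (\<lambda>\<theta>. f (Y \<theta>)) U"
    and Lf: "\<And>U Y \<theta>. (U, Y) \<in> P \<Longrightarrow> \<theta> \<in> U \<Longrightarrow> Lf (Y \<theta>) = lap Y (\<lambda>\<theta>. f (Y \<theta>)) \<theta>"
    and \<eta>: "weak_tgrad N \<nu> \<eta> D"
  shows "(LINT y:N|surface_measure. Lf y \<bullet> \<eta> y) + (LINT y:N|surface_measure. tgrad N \<nu> f y \<bullet> D y) = 0"
proof -
  obtain \<phi> where L2: "\<eta> \<in> L2_on surface_measure N" "D \<in> L2_on surface_measure N"
    and \<phi>: "\<And>k. \<exists>W. open W \<and> N \<subseteq> W \<and> Ck_on 1 (\<phi> k) W"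
    and l1: "(\<lambda>k. \<integral>\<^sup>+y\<in>N. ennreal ((norm (\<phi> k y - \<eta> y))\<^sup>2) \<partial>surface_measure) \<longlonglongrightarrow> 0"
    and l2: "(\<lambda>k. \<integral>\<^sup>+y\<in>N. ennreal ((norm (tgrad N \<nu> (\<phi> k) y - D y))\<^sup>2) \<partial>surface_measure) \<longlonglongrightarrow> 0"
    using \<eta> unfolding weak_tgrad_def by blast
  have c1: "continuous_on N Lf" by (rule laplacian_continuous[where f=f, OF f Lf])
  have c2: "continuous_on N (tgrad N \<nu> f)" by (rule tgrad_continuous) (rule Ck_on_2_imp_1[OF f])
  have cp: "continuous_on N (\<phi> k)" and ct: "continuous_on N (tgrad N \<nu> (\<phi> k))"
    and eq: "(LINT y:N|surface_measure. Lf y \<bullet> \<phi> k y + tgrad N \<nu> f y \<bullet> tgrad N \<nu> (\<phi> k) y) = 0" for k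
  proof -
    obtain W where W: "open W" "N \<subseteq> W" "Ck_on 1 (\<phi> k) W" using \<phi> by blast
    show "continuous_on N (\<phi> k)" using C1_continuous[OF W(3)] W(2) continuous_on_subset by blast
    show "continuous_on N (tgrad N \<nu> (\<phi> k))"
    proof (rule tgrad_continuous)
      fix U Y assume "(U, Y) \<in> P"
      note pD = patchD[OF patches[OF this]]
      show "Ck_on 1 (\<lambda>\<theta>. \<phi> k (Y \<theta>)) U" using pD(6) W(2) by (intro C1_compose[OF W(3) pD(4)]) blast
    qed
    show "(LINT y:N|surface_measure. Lf y \<bullet> \<phi> k y + tgrad N \<nu> f y \<bullet> tgrad N \<nu> (\<phi> k) y) = 0"
      by (rule integral_parts_C1[where f=f, OF f Lf W])
  qed
  have "(\<lambda>k. (LINT y:N|surface_measure. Lf y \<bullet> \<phi> k y) + (LINT y:N|surface_measure. tgrad N \<nu> f y \<bullet> tgrad N \<nu> (\<phi> k) y))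
     \<longlonglongrightarrow> (LINT y:N|surface_measure. Lf y \<bullet> \<eta> y) + (LINT y:N|surface_measure. tgrad N \<nu> f y \<bullet> D y)"
    by (intro tendsto_add integral_inner_L2_limit c1 c2 L2 cp ct l1 l2)
  moreover have "(LINT y:N|surface_measure. Lf y \<bullet> \<phi> k y) + (LINT y:N|surface_measure. tgrad N \<nu> f y \<bullet> tgrad N \<nu> (\<phi> k) y) = 0" for k
    using eq[of k]
    by (subst set_integral_add(2)[symmetric]) (auto intro!: integrable_continuous_N continuous_intros c1 c2 cp ct)
  ultimately show ?thesis by (simp add: LIMSEQ_const_iff)
qed

text \<open>Since W is normal and Z tangential,
  \<open>(v y \<bullet> \<nu> y) * (\<nu> y \<bullet> \<eta> y)\<close> is just
  \<open>W y \<bullet> \<eta> y\<close>. The weights \<open>\<alpha>\<close> and 1 -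
  \<open>\<alpha>\<close> add up to 1 in front of W, and the factor \<open>\<alpha>\<close> cancels
  1/\<open>\<alpha>\<close> in front of Z.\<close>

lemma velocity_integral:
  assumes \<alpha>: "\<alpha> \<noteq> 0" and c: "continuous_on N W" "continuous_on N Z" and \<eta>: "\<eta> \<in> L2_on surface_measure N"
    and v: "\<And>y. y \<in> N \<Longrightarrow> v y = W y - (1/\<alpha>) *\<^sub>R Z y" and W: "\<And>y. y \<in> N \<Longrightarrow> W y = m y *\<^sub>R \<nu> y"
    and Z: "\<And>y. y \<in> N \<Longrightarrow> Z y \<bullet> \<nu> y = 0"
  shows "\<alpha> * (LINT y:N|surface_measure. v y \<bullet> \<eta> y)
      + (1 - \<alpha>) * (LINT y:N|surface_measure. (v y \<bullet> \<nu> y) * (\<nu> y \<bullet> \<eta> y))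
    = (LINT y:N|surface_measure. W y \<bullet> \<eta> y) - (LINT y:N|surface_measure. Z y \<bullet> \<eta> y)"
proof -
  have cong: "(LINT y:N|surface_measure. g y) = (LINT y:N|surface_measure. h y)"
    if "\<And>y. y \<in> N \<Longrightarrow> g y = h y" for g h :: "real^('n option) \<Rightarrow> real"
    unfolding set_lebesgue_integral_def using that
    by (intro Bochner_Integration.integral_cong) (auto split: split_indicator)
  have nn: "\<nu> y \<bullet> \<nu> y = 1" if "y \<in> N" for y
    using cover[OF that] normal by (auto simp: unit_normal_at_def norm_eq_sqrt_inner)
  note i = integrable_inner_L2[OF c(1) \<eta>] integrable_inner_L2[OF c(2) \<eta>]
  have "(LINT y:N|surface_measure. v y \<bullet> \<eta> y) = (LINT y:N|surface_measure. W y \<bullet> \<eta> y - (1/\<alpha>) * (Z y \<bullet> \<eta> y))"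
    by (rule cong) (simp add: v inner_diff_left)
  also have "\<dots> = (LINT y:N|surface_measure. W y \<bullet> \<eta> y) - (1/\<alpha>) * (LINT y:N|surface_measure. Z y \<bullet> \<eta> y)"
    by (simp only: set_integral_diff(2)[OF i(1) set_integrable_mult_right[OF i(2)]] set_integral_mult_right)
  finally have 1: "(LINT y:N|surface_measure. v y \<bullet> \<eta> y)
    = (LINT y:N|surface_measure. W y \<bullet> \<eta> y) - (1/\<alpha>) * (LINT y:N|surface_measure. Z y \<bullet> \<eta> y)" .
  have 2: "(LINT y:N|surface_measure. (v y \<bullet> \<nu> y) * (\<nu> y \<bullet> \<eta> y)) = (LINT y:N|surface_measure. W y \<bullet> \<eta> y)"
    by (rule cong) (simp add: v W Z nn inner_diff_left)
  show ?thesis unfolding 1 2 using \<alpha> by (simp add: field_simps)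
qed

end

section \<open>Changing charts\<close>

text \<open>Recovers differentiability of a continuous h from that of F after h, when the
  differential of F has a left inverse. Derivatives are taken within sets so that the lemma covers
  transition maps as well as one-sided time derivatives.\<close>

lemma has_derivative_left_inverse:
  fixes F :: "'b::real_normed_vector \<Rightarrow> 'c::real_normed_vector" and h :: "'a::real_normed_vector \<Rightarrow> 'b"
  assumes F: "(F has_derivative F') (at (h x) within S')" and L: "bounded_linear L" "\<And>v. L (F' v) = v"
    and h: "(h \<longlongrightarrow> h x) (at x within S)" "\<And>s. s \<in> S \<Longrightarrow> h s \<in> S'"
    and G: "((\<lambda>s. F (h s)) has_derivative G) (at x within S)"
  shows "(h has_derivative (\<lambda>v. L (G v))) (at x within S)"
proof -
  obtain B where B: "B > 0" "\<And>v. norm (L v) \<le> norm v * B" using bounded_linear.pos_bounded[OF L(1)] by blast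
  have bG: "bounded_linear G" using G by (rule has_derivative_bounded_linear)
  have bLG: "bounded_linear (\<lambda>v. L (G v))" by (rule bounded_linear_compose[OF L(1) bG])
  obtain C where C: "C > 0" "\<And>v. norm (L (G v)) \<le> norm v * C" using bounded_linear.pos_bounded[OF bLG] by blast
  \<comment> \<open>The expansions of F and of the composite are compared after applying L; this
    bounds the error of the candidate linearization, up to a term in the still uncontrolled
    \<open>norm (h y - h x)\<close>.\<close>
  have key: "\<exists>d>0. \<forall>y\<in>S. norm (y - x) < d \<longrightarrow> norm (h y - h x - L (G (y - x))) \<le> B * e * norm (h y - h x) + B * e * norm (y - x)"
    if e: "e > 0" for e
  proof -
    obtain d1 where d1: "d1 > 0" "\<And>z. z \<in> S' \<Longrightarrow> norm (z - h x) < d1 \<Longrightarrow> norm (F z - F (h x) - F' (z - h x)) \<le> e * norm (z - h x)"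
      using F e unfolding has_derivative_within_alt by blast
    obtain d2 where d2: "d2 > 0" "\<And>y. y \<in> S \<Longrightarrow> norm (y - x) < d2 \<Longrightarrow> norm (F (h y) - F (h x) - G (y - x)) \<le> e * norm (y - x)"
      using G e unfolding has_derivative_within_alt by blast
    obtain d3 where d3: "d3 > 0" "\<And>y. y \<in> S \<Longrightarrow> y \<noteq> x \<Longrightarrow> dist y x < d3 \<Longrightarrow> dist (h y) (h x) < d1"
      using tendstoD[OF h(1) d1(1)] unfolding eventually_at by blast
    show ?thesis
    proof (intro exI[of _ "min d2 d3"] conjI ballI impI)
      show "min d2 d3 > 0" using d2 d3 by simp
      fix y assume y: "y \<in> S" "norm (y - x) < min d2 d3"
      have "norm (h y - h x) < d1"
        using d3(2)[OF y(1)] y(2) d1(1) by (cases "y = x") (auto simp: dist_norm)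
      note n1 = d1(2)[OF h(2)[OF y(1)] this]
      have n2: "norm (F (h y) - F (h x) - G (y - x)) \<le> e * norm (y - x)" using d2(2) y by simp
      have "h y - h x - L (G (y - x)) = L ((F (h y) - F (h x) - G (y - x)) - (F (h y) - F (h x) - F' (h y - h x)))"
        using L(2)[of "h y - h x"] by (simp add: linear_diff[OF bounded_linear.linear[OF L(1)]])
      also have "norm \<dots> \<le> norm ((F (h y) - F (h x) - G (y - x)) - (F (h y) - F (h x) - F' (h y - h x))) * B"
        by (rule B(2))
      also have "\<dots> \<le> (e * norm (y - x) + e * norm (h y - h x)) * B"
        by (intro mult_right_mono norm_triangle_le_diff add_mono n1 n2) (use B in simp)
      finally show "norm (h y - h x - L (G (y - x))) \<le> B * e * norm (h y - h x) + B * e * norm (y - x)"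
        by (simp add: algebra_simps)
    qed
  qed
  show ?thesis
    unfolding has_derivative_within_alt
  proof (intro conjI allI impI bLG)
    fix e :: real assume e: "e > 0"
    \<comment> \<open>The first bound gives B e' \<le> 1/2, which absorbs
      \<open>norm (h y - h x)\<close> and yields the Lipschitz constant 2C + 1. The second makes the
      total error B e' (2C + 1) + B e' at most e.\<close>
    define e' where "e' = min (1 / (2 * B)) (e / (B * (2 * C + 2)))"
    have e': "e' > 0" "B * e' \<le> 1/2" "B * e' * (2 * C + 2) \<le> e"
    proof -
      show "e' > 0" using e B C by (simp add: e'_def)
      have "B * e' \<le> B * (1 / (2 * B))" using B by (intro mult_left_mono) (auto simp: e'_def)
      then show "B * e' \<le> 1/2" using B by simp
      have "e' * (B * (2 * C + 2)) \<le> e / (B * (2 * C + 2)) * (B * (2 * C + 2))"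
        using B C by (intro mult_right_mono) (auto simp: e'_def)
      then show "B * e' * (2 * C + 2) \<le> e" using B C by (simp add: mult_ac)
    qed
    obtain d where d: "d > 0" "\<And>y. y \<in> S \<Longrightarrow> norm (y - x) < d \<Longrightarrow>
        norm (h y - h x - L (G (y - x))) \<le> B * e' * norm (h y - h x) + B * e' * norm (y - x)"
      using key[OF e'(1)] by blast
    show "\<exists>d>0. \<forall>y\<in>S. norm (y - x) < d \<longrightarrow> norm (h y - h x - L (G (y - x))) \<le> e * norm (y - x)"
    proof (intro exI[of _ d] conjI ballI impI d(1))
      fix y assume y: "y \<in> S" "norm (y - x) < d"
      let ?k = "norm (h y - h x)" and ?n = "norm (y - x)"
      have "?k \<le> norm (h y - h x - L (G (y - x))) + norm (L (G (y - x)))"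
        using norm_triangle_ineq[of "h y - h x - L (G (y - x))" "L (G (y - x))"] by simp
      also have "\<dots> \<le> (B * e' * ?k + B * e' * ?n) + ?n * C" by (intro add_mono d(2) y C(2))
      also have "\<dots> \<le> 1/2 * ?k + 1/2 * ?n + ?n * C"
        using mult_right_mono[OF e'(2), of ?k] mult_right_mono[OF e'(2), of ?n] by simp
      finally have k: "?k \<le> (2 * C + 1) * ?n" by (simp add: algebra_simps)
      have "norm (h y - h x - L (G (y - x))) \<le> B * e' * ?k + B * e' * ?n" by (rule d(2)[OF y])
      also have "\<dots> \<le> B * e' * ((2 * C + 1) * ?n) + B * e' * ?n"
        using k B e' by (intro add_mono mult_left_mono) auto
      also have "\<dots> = B * e' * (2 * C + 2) * ?n" by (simp add: algebra_simps)
      also have "\<dots> \<le> e * ?n" using e'(3) by (rule mult_right_mono) simp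
      finally show "norm (h y - h x - L (G (y - x))) \<le> e * ?n" .
    qed
  qed
qed

lemma immersed_left_inverse:
  fixes Y :: "real^'n \<Rightarrow> 'b::euclidean_space"
  assumes "immersed_at Y \<theta>"
  obtains L where "bounded_linear L" "\<And>v. L (\<Sum>i\<in>UNIV. v $ i *\<^sub>R pd i Y \<theta>) = v"
proof -
  have l: "linear (\<lambda>v. \<Sum>i\<in>UNIV. v $ i *\<^sub>R pd i Y \<theta>)"
    by (rule linearI) (simp_all add: sum.distrib scaleR_add_left scaleR_sum_right)
  have "inj (\<lambda>v. \<Sum>i\<in>UNIV. v $ i *\<^sub>R pd i Y \<theta>)"
    using assms unfolding immersed_at_def linear_injective_0[OF l] .
  then obtain L where L: "linear L" "L \<circ> (\<lambda>v. \<Sum>i\<in>UNIV. v $ i *\<^sub>R pd i Y \<theta>) = id"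
    using linear_injective_left_inverse[OF l] by blast
  have "L (\<Sum>i\<in>UNIV. v $ i *\<^sub>R pd i Y \<theta>) = v" for v
    using fun_cong[OF L(2), of v] by simp
  then show ?thesis using that[of L] L(1) by (simp add: linear_conv_bounded_linear)
qed

lemma local_parametrizationD:
  assumes "local_parametrization M U X"
  shows "patch M U X"
proof -
  have "Ck_on 2 X U" using assms smooth_on_Ck by (auto simp: local_parametrization_def)
  moreover have "immersed_at X \<theta>" if "\<theta> \<in> U" for \<theta>
    using immersed_at_iff_inj[OF Ck_on_2D(1)[OF \<open>Ck_on 2 X U\<close> that]] assms that
    by (auto simp: local_parametrization_def immersion_on_def)
  ultimately show ?thesis using assms by (auto simp: patch_def local_parametrization_def)
qed

lemma patch_inverse_continuous:
  assumes "patch M U X"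
  shows "continuous_on (X ` U) (inv_into U X)"
proof -
  obtain J where J: "homeomorphism U (X ` U) X J" using assms by (auto simp: patch_def)
  show ?thesis
  proof (rule continuous_on_eq[OF homeomorphism_cont2[OF J]])
    fix y assume "y \<in> X ` U"
    then obtain \<theta> where "\<theta> \<in> U" "y = X \<theta>" by blast
    then show "J y = inv_into U X y"
      using homeomorphism_apply1[OF J] patchD(8)[OF assms] by simp
  qed
qed

text \<open>By the chain rule the kernel of the differential of \<open>\<tau>\<close> lies in that
  of b.\<close>

lemma immersed_at_factor:
  fixes \<tau> :: "real^'n \<Rightarrow> real^'m" and Z :: "real^'m \<Rightarrow> 'b::real_normed_vector"
  assumes im: "immersed_at b \<theta>" and eq: "eventually (\<lambda>\<xi>. b \<xi> = Z (\<tau> \<xi>)) (nhds \<theta>)"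
    and d: "\<tau> differentiable (at \<theta>)" "Z differentiable (at (\<tau> \<theta>))"
  shows "immersed_at \<tau> \<theta>"
  unfolding immersed_at_def
proof (intro allI impI)
  fix v assume v: "(\<Sum>i\<in>UNIV. v $ i *\<^sub>R pd i \<tau> \<theta>) = 0"
  have "(\<Sum>i\<in>UNIV. v $ i *\<^sub>R pd i b \<theta>) = (\<Sum>a\<in>UNIV. (\<Sum>i\<in>UNIV. v $ i *\<^sub>R pd i \<tau> \<theta>) $ a *\<^sub>R pd a Z (\<tau> \<theta>))"
    unfolding pd_cong_nhds[OF eq] pd_compose(1)[OF d]
    by (simp add: scaleR_sum_right scaleR_sum_left) (rule sum.swap)
  also have "\<dots> = 0" unfolding v by simp
  finally show "v = 0" using im unfolding immersed_at_def by blast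
qed

text \<open>Composition with X gives back the map a, so \<open>has_derivative_left_inverse\<close>
  yields the first derivatives of \<open>\<tau>\<close>. Second derivatives come from an explicit
  formula for the first, and their symmetry from the symmetry for a and for X together with
  injectivity of the differential of X.\<close>

lemma factor_through_patch:
  assumes X: "patch M U X" and V: "open V" and a: "Ck_on 2 a V" "a ` V \<subseteq> M" and \<theta>: "\<theta> \<in> V" "a \<theta> \<in> X ` U"
  defines "\<tau> \<equiv> \<lambda>\<xi>. inv_into U X (a \<xi>)"
  shows "eventually (\<lambda>\<xi>. \<tau> \<xi> \<in> U \<and> X (\<tau> \<xi>) = a \<xi>) (nhds \<theta>)"
    and "twice_differentiable_at \<tau> \<theta>"
    and "pd i (pd j \<tau>) \<theta> = pd j (pd i \<tau>) \<theta>"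
proof -
  note XD = patchD[OF X]
  obtain T where T: "open T" "X ` U = M \<inter> T" using XD(2) by (auto simp: openin_open)
  define V' where "V' = V \<inter> a -` T"
  have V': "open V'" unfolding V'_def using Ck_on_2D(4)[OF a(1)] V T(1) by (rule continuous_open_preimage)
  have \<theta>': "\<theta> \<in> V'" using \<theta> T by (auto simp: V'_def)
  have aX: "a \<xi> \<in> X ` U" if "\<xi> \<in> V'" for \<xi> using that a(2) T by (auto simp: V'_def)
  have \<tau>: "\<tau> \<xi> \<in> U" "X (\<tau> \<xi>) = a \<xi>" if "\<xi> \<in> V'" for \<xi>
    using aX[OF that] by (simp_all add: \<tau>_def inv_into_into f_inv_into_f)
  show ev: "eventually (\<lambda>\<xi>. \<tau> \<xi> \<in> U \<and> X (\<tau> \<xi>) = a \<xi>) (nhds \<theta>)"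
    using eventually_nhds_in_open[OF V' \<theta>'] by (rule eventually_mono) (simp add: \<tau>)
  have c\<tau>: "continuous_on V' \<tau>"
    unfolding \<tau>_def
  proof (rule continuous_on_compose2[OF patch_inverse_continuous[OF X]])
    show "continuous_on V' a" by (rule continuous_on_subset[OF Ck_on_2D(4)[OF a(1)]]) (auto simp: V'_def)
  qed (use aX in blast)
  have da: "a differentiable (at \<xi>)" "pd i a differentiable (at \<xi>)" if "\<xi> \<in> V'" for \<xi> i
    using Ck_on_2D(1,2)[OF a(1)] that by (auto simp: V'_def)
  have d\<tau>: "\<tau> differentiable (at \<xi>)" if \<xi>: "\<xi> \<in> V'" for \<xi>
  proof -
    obtain L where L: "bounded_linear L" "\<And>v. L (\<Sum>i\<in>UNIV. v $ i *\<^sub>R pd i X (\<tau> \<xi>)) = v"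
      by (rule immersed_left_inverse[OF XD(5)[OF \<tau>(1)[OF \<xi>]]]) (rule that; assumption)
    have "(\<tau> has_derivative (\<lambda>v. L (\<Sum>i\<in>UNIV. v $ i *\<^sub>R pd i a \<xi>))) (at \<xi> within V')"
    proof (rule has_derivative_left_inverse[where F=X and S'=UNIV, OF _ L])
      show "(X has_derivative (\<lambda>v. \<Sum>i\<in>UNIV. v $ i *\<^sub>R pd i X (\<tau> \<xi>))) (at (\<tau> \<xi>) within UNIV)"
        using has_derivative_pd Ck_on_2D(1)[OF XD(3) \<tau>(1)[OF \<xi>]] by blast
      show "(\<tau> \<longlongrightarrow> \<tau> \<xi>) (at \<xi> within V')" using c\<tau> \<xi> by (simp add: continuous_on)
      have "(a has_derivative (\<lambda>v. \<Sum>i\<in>UNIV. v $ i *\<^sub>R pd i a \<xi>)) (at \<xi> within V')"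
        by (rule has_derivative_at_withinI[OF has_derivative_pd[OF da(1)[OF \<xi>]]])
      then show "((\<lambda>s. X (\<tau> s)) has_derivative (\<lambda>v. \<Sum>i\<in>UNIV. v $ i *\<^sub>R pd i a \<xi>)) (at \<xi> within V')"
        by (rule has_derivative_transform[OF \<xi>, rotated]) (rule \<tau>(2))
    qed simp
    then show ?thesis using at_within_open[OF \<xi> V'] by (auto simp: differentiable_def)
  qed
  note tX = Ck_on_2_imp_twice_differentiable[OF XD(3,1)]
  have pa: "pd i a \<xi> = (\<Sum>k\<in>UNIV. pd i \<tau> \<xi> $ k *\<^sub>R pd k X (\<tau> \<xi>))" if \<xi>: "\<xi> \<in> V'" for i \<xi>
  proof -
    have "eventually (\<lambda>\<xi>. a \<xi> = X (\<tau> \<xi>)) (nhds \<xi>)"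
      using eventually_nhds_in_open[OF V' \<xi>] by (rule eventually_mono) (simp add: \<tau>)
    from pd_cong_nhds[OF this] show ?thesis
      using pd_compose(1)[OF d\<tau>[OF \<xi>] Ck_on_2D(1)[OF XD(3) \<tau>(1)[OF \<xi>]]] by simp
  qed
  let ?I = "\<lambda>\<xi> k l. matrix_inv (gram X (\<tau> \<xi>)) $ k $ l"
  \<comment> \<open>Solving \<open>pa\<close> by the inverse Gram matrix expresses the derivatives
    of \<open>\<tau>\<close> through quantities that are visibly differentiable.\<close>
  have p\<tau>: "pd i \<tau> \<xi> $ k = (\<Sum>l\<in>UNIV. ?I \<xi> k l * (pd l X (\<tau> \<xi>) \<bullet> pd i a \<xi>))" if \<xi>: "\<xi> \<in> V'" for i k \<xi>
  proof -
    have "(\<Sum>l\<in>UNIV. ?I \<xi> k l * (pd l X (\<tau> \<xi>) \<bullet> pd i a \<xi>)) =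
       (\<Sum>l\<in>UNIV. \<Sum>m\<in>UNIV. ?I \<xi> k l * gram X (\<tau> \<xi>) $ l $ m * pd i \<tau> \<xi> $ m)"
      by (simp add: pa[OF \<xi>] inner_sum_right gram_nth sum_distrib_left mult_ac)
    also have "\<dots> = (\<Sum>m\<in>UNIV. (\<Sum>l\<in>UNIV. ?I \<xi> k l * gram X (\<tau> \<xi>) $ l $ m) * pd i \<tau> \<xi> $ m)"
      by (subst sum.swap) (simp add: sum_distrib_right)
    also have "\<dots> = (\<Sum>m\<in>UNIV. if k = m then pd i \<tau> \<xi> $ m else 0)"
      by (rule sum.cong[OF refl]) (simp add: matrix_inv_mult_nth(2)[OF det_gram_nonzero[OF XD(5)[OF \<tau>(1)[OF \<xi>]]]])
    finally show ?thesis by simp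
  qed
  have dp: "pd i \<tau> differentiable (at \<theta>)" for i
  proof (rule differentiable_vec)
    fix k
    have dg: "(\<lambda>\<xi>. gram X (\<tau> \<xi>) $ r $ c) differentiable (at \<theta>)" for r c
      by (rule pd_compose(2)[OF d\<tau>[OF \<theta>'] pd_gram(2)[OF tX[OF \<tau>(1)[OF \<theta>']]]])
    have "(\<lambda>\<xi>. \<Sum>l\<in>UNIV. ?I \<xi> k l * (pd l X (\<tau> \<xi>) \<bullet> pd i a \<xi>)) differentiable (at \<theta>)"
      by (intro pd_sum(2) differentiable_mult' differentiable_inner' da(2)[OF \<theta>']
          differentiable_matrix_inv(1)[OF dg det_gram_nonzero[OF XD(5)[OF \<tau>(1)[OF \<theta>']]]]
          pd_compose(2)[OF d\<tau>[OF \<theta>'] Ck_on_2D(2)[OF XD(3) \<tau>(1)[OF \<theta>']]])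
    moreover have "eventually (\<lambda>\<xi>. pd i \<tau> \<xi> $ k = (\<Sum>l\<in>UNIV. ?I \<xi> k l * (pd l X (\<tau> \<xi>) \<bullet> pd i a \<xi>))) (nhds \<theta>)"
      using eventually_nhds_in_open[OF V' \<theta>'] by (rule eventually_mono) (rule p\<tau>)
    ultimately show "(\<lambda>\<xi>. pd i \<tau> \<xi> $ k) differentiable (at \<theta>)"
      by (simp add: differentiable_cong_nhds)
  qed
  show t\<tau>: "twice_differentiable_at \<tau> \<theta>"
    unfolding twice_differentiable_at_def
  proof (intro conjI allI dp)
    show "eventually (\<lambda>\<xi>. \<tau> differentiable (at \<xi>)) (nhds \<theta>)"
      using eventually_nhds_in_open[OF V' \<theta>'] by (rule eventually_mono) (rule d\<tau>)
  qed
  have p2: "pd i (pd j a) \<theta> = (\<Sum>k\<in>UNIV. pd i (pd j \<tau>) \<theta> $ k *\<^sub>R pd k X (\<tau> \<theta>)) +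
      (\<Sum>k\<in>UNIV. \<Sum>b\<in>UNIV. (pd j \<tau> \<theta> $ k * pd i \<tau> \<theta> $ b) *\<^sub>R pd b (pd k X) (\<tau> \<theta>))" for i j
  proof -
    have "eventually (\<lambda>\<xi>. a \<xi> = X (\<tau> \<xi>)) (nhds \<theta>)"
      using eventually_nhds_in_open[OF V' \<theta>'] by (rule eventually_mono) (simp add: \<tau>)
    from pd2_cong_nhds[OF this] show ?thesis
      using pd2_compose(1)[OF t\<tau> tX[OF \<tau>(1)[OF \<theta>']]] by simp
  qed
  have s2: "(\<Sum>k\<in>UNIV. \<Sum>b\<in>UNIV. (pd j \<tau> \<theta> $ k * pd i \<tau> \<theta> $ b) *\<^sub>R pd b (pd k X) (\<tau> \<theta>)) =
      (\<Sum>k\<in>UNIV. \<Sum>b\<in>UNIV. (pd i \<tau> \<theta> $ k * pd j \<tau> \<theta> $ b) *\<^sub>R pd b (pd k X) (\<tau> \<theta>))"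
    by (subst sum.swap, subst Ck_on_2_pd_commute[OF XD(3,1) \<tau>(1)[OF \<theta>']]) (simp add: mult.commute)
  have "pd i (pd j a) \<theta> = pd j (pd i a) \<theta>" by (rule Ck_on_2_pd_commute[OF a(1) V \<theta>(1)])
  then have "(\<Sum>k\<in>UNIV. (pd i (pd j \<tau>) \<theta> - pd j (pd i \<tau>) \<theta>) $ k *\<^sub>R pd k X (\<tau> \<theta>)) = 0"
    unfolding p2 s2 by (simp add: scaleR_diff_left sum_subtractf)
  then have "pd i (pd j \<tau>) \<theta> - pd j (pd i \<tau>) \<theta> = 0"
    using XD(5)[OF \<tau>(1)[OF \<theta>']] unfolding immersed_at_def by blast
  then show "pd i (pd j \<tau>) \<theta> = pd j (pd i \<tau>) \<theta>" by simp
qed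

lemma lap_cong_nhds:
  assumes Y: "eventually (\<lambda>\<xi>. Y \<xi> = Y' \<xi>) (nhds \<theta>)" and F: "eventually (\<lambda>\<xi>. F \<xi> = F' \<xi>) (nhds \<theta>)"
  shows "lap Y F \<theta> = lap Y' F' \<theta>"
proof -
  have ev: "eventually (\<lambda>\<xi>. gram Y \<xi> = gram Y' \<xi>) (nhds \<theta>)"
  proof -
    have "eventually (\<lambda>\<xi>. eventually (\<lambda>\<xi>. Y \<xi> = Y' \<xi>) (nhds \<xi>)) (nhds \<theta>)"
      using Y by (simp add: eventually_eventually)
    then show ?thesis
      by (rule eventually_mono) (simp add: gram_def pd_cong_nhds)
  qed
  have g: "gram Y \<theta> = gram Y' \<theta>" using ev by (rule eventually_nhds_x_imp_x)
  have pg: "pd i (\<lambda>\<xi>. gram Y \<xi> $ a $ b) \<theta> = pd i (\<lambda>\<xi>. gram Y' \<xi> $ a $ b) \<theta>" for i a b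
    by (rule pd_cong_nhds, rule eventually_mono[OF ev]) simp
  show ?thesis
    unfolding lap_def hess_def christoffel_def g pg pd_cong_nhds[OF F] pd2_cong_nhds[OF F] ..
qed

text \<open>The map G serves as a witness that the transition is immersed: G after a is immersed and
  factors through the transition. This allows a to be something other than a chart, such as a chart
  followed by an inverse diffeomorphism.\<close>

lemma lap_change_chart:
  fixes f :: "real^('n::finite option) \<Rightarrow> real^('n option)" and F :: "real^('n option) \<Rightarrow> 'b::real_normed_vector"
    and a :: "real^'n \<Rightarrow> real^('n option)"
  assumes X: "patch M U X" and \<theta>: "\<theta> \<in> U" and V: "open V" and a: "Ck_on 2 a V" "a ` V \<subseteq> M" and \<theta>': "\<theta>' \<in> V" "a \<theta>' = X \<theta>"
    and f: "Ck_on 2 (\<lambda>\<xi>. f (X \<xi>)) U" "immersed_at (\<lambda>\<xi>. f (X \<xi>)) \<theta>" and F: "Ck_on 2 (\<lambda>\<xi>. F (X \<xi>)) U"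
    and G: "immersed_at (\<lambda>\<xi>. G (a \<xi>)) \<theta>'" "(\<lambda>\<xi>. G (X \<xi>)) differentiable (at \<theta>)"
  shows "lap (\<lambda>\<xi>. f (a \<xi>)) (\<lambda>\<xi>. F (a \<xi>)) \<theta>' = lap (\<lambda>\<xi>. f (X \<xi>)) (\<lambda>\<xi>. F (X \<xi>)) \<theta>"
proof -
  define \<tau> where "\<tau> = (\<lambda>\<xi>. inv_into U X (a \<xi>))"
  have "a \<theta>' \<in> X ` U" using \<theta> \<theta>' by simp
  note fac = factor_through_patch[OF X V a \<theta>'(1) this, folded \<tau>_def]
  have \<tau>\<theta>: "\<tau> \<theta>' = \<theta>" using \<theta> \<theta>'(2) patchD(8)[OF X] by (simp add: \<tau>_def)
  have ev: "eventually (\<lambda>\<xi>. g (a \<xi>) = g (X (\<tau> \<xi>))) (nhds \<theta>')" for g :: "real^('n option) \<Rightarrow> 'd"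
    using fac(1) by (rule eventually_mono) (simp add: \<tau>_def)
  note U = patchD(1)[OF X]
  have im: "immersed_at \<tau> \<theta>'"
    by (rule immersed_at_factor[where Z="\<lambda>\<xi>. G (X \<xi>)", OF G(1) ev twice_differentiable_atD(1)[OF fac(2)]])
      (simp add: \<tau>\<theta> G(2))
  have "lap (\<lambda>\<xi>. f (a \<xi>)) (\<lambda>\<xi>. F (a \<xi>)) \<theta>' = lap (\<lambda>\<xi>. f (X (\<tau> \<xi>))) (\<lambda>\<xi>. F (X (\<tau> \<xi>))) \<theta>'"
    by (rule lap_cong_nhds[OF ev ev])
  also have "\<dots> = lap (\<lambda>\<xi>. f (X \<xi>)) (\<lambda>\<xi>. F (X \<xi>)) (\<tau> \<theta>')"
    by (rule lap_compose[OF fac(2) im fac(3), of "\<lambda>\<xi>. f (X \<xi>)" "\<lambda>\<xi>. F (X \<xi>)"])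
      (simp_all add: \<tau>\<theta> f(2) Ck_on_2_imp_twice_differentiable[OF f(1) U \<theta>] Ck_on_2_pd_commute[OF f(1) U \<theta>]
         Ck_on_2_imp_twice_differentiable[OF F U \<theta>])
  finally show ?thesis by (simp add: \<tau>\<theta>)
qed

section \<open>The map Laplacian as a tangential projection\<close>

text \<open>In the second derivatives of \<open>X2 \<circ> \<Psi>\<close> the tangential part of the
  second derivatives of X2 is the target Christoffel term of the map Laplacian. What is left after
  subtraction is a contraction of \<open>hess X2 X2\<close>, which is normal.\<close>

lemma map_laplacian_coordinates:
  fixes Y :: "real^'n \<Rightarrow> 'v::real_inner" and X2 :: "real^'n \<Rightarrow> 'w::real_inner" and \<Psi> :: "real^'n \<Rightarrow> real^'n"
  assumes \<Psi>: "twice_differentiable_at \<Psi> \<theta>" and X2: "twice_differentiable_at X2 (\<Psi> \<theta>)"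
      "\<And>i j. pd i (pd j X2) (\<Psi> \<theta>) = pd j (pd i X2) (\<Psi> \<theta>)" "immersed_at X2 (\<Psi> \<theta>)"
  defines "L \<equiv> \<lambda>q. \<Sum>i\<in>UNIV. \<Sum>j\<in>UNIV. matrix_inv (gram Y \<theta>) $ i $ j *
                (pd i (pd j (\<lambda>\<xi>. \<Psi> \<xi> $ q)) \<theta>
                 - (\<Sum>k\<in>UNIV. christoffel (gram Y) \<theta> k i j * pd k (\<lambda>\<xi>. \<Psi> \<xi> $ q) \<theta>)
                 + (\<Sum>m\<in>UNIV. \<Sum>n\<in>UNIV. christoffel (gram X2) (\<Psi> \<theta>) q m n *
                      pd i (\<lambda>\<xi>. \<Psi> \<xi> $ m) \<theta> * pd j (\<lambda>\<xi>. \<Psi> \<xi> $ n) \<theta>))"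
  shows "(lap Y (\<lambda>\<xi>. X2 (\<Psi> \<xi>)) \<theta> - (\<Sum>q\<in>UNIV. L q *\<^sub>R pd q X2 (\<Psi> \<theta>))) \<bullet> pd l X2 (\<Psi> \<theta>) = 0"
proof -
  let ?I = "\<lambda>i j. matrix_inv (gram Y \<theta>) $ i $ j" and ?X = "\<lambda>q. pd q X2 (\<Psi> \<theta>)"
  let ?P = "\<lambda>i m. pd i \<Psi> \<theta> $ m" and ?\<Gamma> = "christoffel (gram Y) \<theta>" and ?H = "christoffel (gram X2) (\<Psi> \<theta>)"
  note d = twice_differentiable_atD(1,2)[OF \<Psi>]
  have p1: "pd i (\<lambda>\<xi>. \<Psi> \<xi> $ q) \<theta> = ?P i q" for i q by (rule pd_nth[OF d(1)])
  have p2: "pd i (pd j (\<lambda>\<xi>. \<Psi> \<xi> $ q)) \<theta> = pd i (pd j \<Psi>) \<theta> $ q" for i j q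
  proof -
    have "eventually (\<lambda>\<xi>. pd j (\<lambda>\<xi>. \<Psi> \<xi> $ q) \<xi> = pd j \<Psi> \<xi> $ q) (nhds \<theta>)"
      using twice_differentiable_atD(3)[OF \<Psi>] by (rule eventually_mono) (rule pd_nth)
    from pd_cong_nhds[OF this] show ?thesis using pd_nth[OF d(2)] by simp
  qed
  have Lq: "(\<Sum>q\<in>UNIV. L q *\<^sub>R ?X q) = (\<Sum>i\<in>UNIV. \<Sum>j\<in>UNIV. ?I i j *\<^sub>R (\<Sum>q\<in>UNIV.
     (pd i (pd j \<Psi>) \<theta> $ q - (\<Sum>k\<in>UNIV. ?\<Gamma> k i j * ?P k q) + (\<Sum>m\<in>UNIV. \<Sum>n\<in>UNIV. ?H q m n * ?P i m * ?P j n)) *\<^sub>R ?X q))"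
  proof -
    have "(\<Sum>q\<in>UNIV. L q *\<^sub>R ?X q) = (\<Sum>q\<in>UNIV. \<Sum>i\<in>UNIV. \<Sum>j\<in>UNIV. ?I i j *\<^sub>R (
     (pd i (pd j \<Psi>) \<theta> $ q - (\<Sum>k\<in>UNIV. ?\<Gamma> k i j * ?P k q) + (\<Sum>m\<in>UNIV. \<Sum>n\<in>UNIV. ?H q m n * ?P i m * ?P j n)) *\<^sub>R ?X q))"
      unfolding L_def p1 p2 by (simp only: scaleR_sum_left scaleR_scaleR)
    also have "\<dots> = (\<Sum>i\<in>UNIV. \<Sum>j\<in>UNIV. \<Sum>q\<in>UNIV. ?I i j *\<^sub>R (
     (pd i (pd j \<Psi>) \<theta> $ q - (\<Sum>k\<in>UNIV. ?\<Gamma> k i j * ?P k q) + (\<Sum>m\<in>UNIV. \<Sum>n\<in>UNIV. ?H q m n * ?P i m * ?P j n)) *\<^sub>R ?X q))"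
      by (subst sum.swap, intro sum.cong refl sum.swap)
    finally show ?thesis by (simp only: scaleR_sum_right)
  qed
  have key: "hess Y (\<lambda>\<xi>. X2 (\<Psi> \<xi>)) \<theta> i j - (\<Sum>q\<in>UNIV.
     (pd i (pd j \<Psi>) \<theta> $ q - (\<Sum>k\<in>UNIV. ?\<Gamma> k i j * ?P k q) + (\<Sum>m\<in>UNIV. \<Sum>n\<in>UNIV. ?H q m n * ?P i m * ?P j n)) *\<^sub>R ?X q)
     = (\<Sum>m\<in>UNIV. \<Sum>n\<in>UNIV. (?P i m * ?P j n) *\<^sub>R hess X2 X2 (\<Psi> \<theta>) m n)" for i j
  proof -
    have e1: "(\<Sum>k\<in>UNIV. ?\<Gamma> k i j *\<^sub>R pd k (\<lambda>\<xi>. X2 (\<Psi> \<xi>)) \<theta>) = (\<Sum>q\<in>UNIV. (\<Sum>k\<in>UNIV. ?\<Gamma> k i j * ?P k q) *\<^sub>R ?X q)"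
      unfolding pd_compose(1)[OF d(1) twice_differentiable_atD(1)[OF X2(1)]]
      by (simp add: scaleR_sum_right scaleR_sum_left) (rule sum.swap)
    have e2: "(\<Sum>q\<in>UNIV. (\<Sum>m\<in>UNIV. \<Sum>n\<in>UNIV. ?H q m n * ?P i m * ?P j n) *\<^sub>R ?X q) =
       (\<Sum>m\<in>UNIV. \<Sum>n\<in>UNIV. (?P i m * ?P j n) *\<^sub>R (\<Sum>q\<in>UNIV. ?H q m n *\<^sub>R ?X q))"
    proof -
      have "(\<Sum>q\<in>UNIV. (\<Sum>m\<in>UNIV. \<Sum>n\<in>UNIV. ?H q m n * ?P i m * ?P j n) *\<^sub>R ?X q) =
         (\<Sum>q\<in>UNIV. \<Sum>m\<in>UNIV. \<Sum>n\<in>UNIV. (?H q m n * ?P i m * ?P j n) *\<^sub>R ?X q)"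
        by (simp only: scaleR_sum_left)
      also have "\<dots> = (\<Sum>m\<in>UNIV. \<Sum>n\<in>UNIV. \<Sum>q\<in>UNIV. (?H q m n * ?P i m * ?P j n) *\<^sub>R ?X q)"
        by (subst sum.swap, intro sum.cong refl sum.swap)
      finally show ?thesis by (simp add: scaleR_sum_right mult_ac)
    qed
    have e3: "(\<Sum>a\<in>UNIV. \<Sum>b\<in>UNIV. (?P j a * ?P i b) *\<^sub>R pd b (pd a X2) (\<Psi> \<theta>)) =
       (\<Sum>m\<in>UNIV. \<Sum>n\<in>UNIV. (?P i m * ?P j n) *\<^sub>R pd m (pd n X2) (\<Psi> \<theta>))"
      by (subst sum.swap) (simp add: mult.commute)
    show ?thesis
      unfolding hess_def[of Y] e1 pd2_compose(1)[OF \<Psi> X2(1)] e3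
      by (simp add: scaleR_add_left scaleR_diff_left sum.distrib sum_subtractf e2 hess_def scaleR_diff_right)
  qed
  have "lap Y (\<lambda>\<xi>. X2 (\<Psi> \<xi>)) \<theta> - (\<Sum>q\<in>UNIV. L q *\<^sub>R ?X q) =
     (\<Sum>i\<in>UNIV. \<Sum>j\<in>UNIV. ?I i j *\<^sub>R (\<Sum>m\<in>UNIV. \<Sum>n\<in>UNIV. (?P i m * ?P j n) *\<^sub>R hess X2 X2 (\<Psi> \<theta>) m n))"
    unfolding Lq lap_def key[symmetric] by (simp add: sum_subtractf scaleR_diff_right)
  then show ?thesis
    by (simp add: inner_sum_left hess_self_normal[OF X2])
qed

section \<open>The algebra of the operator \<open>Hhat\<close>\<close>

text \<open>The inverse Gram matrix gives the tangential coefficients; the remainder is orthogonal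
  to a spanning set.\<close>

lemma tangent_normal_decomposition:
  fixes Y :: "real^'n \<Rightarrow> real^('n option)"
  assumes im: "immersed_at Y \<theta>" and \<nu>: "norm \<nu> = 1" "\<And>i. \<nu> \<bullet> pd i Y \<theta> = 0"
  obtains a where "v = (\<Sum>i\<in>UNIV. a $ i *\<^sub>R pd i Y \<theta>) + (\<nu> \<bullet> v) *\<^sub>R \<nu>"
proof -
  let ?a = "\<chi> i. \<Sum>l\<in>UNIV. matrix_inv (gram Y \<theta>) $ i $ l * (pd l Y \<theta> \<bullet> v)"
  let ?w = "v - (\<Sum>i\<in>UNIV. ?a $ i *\<^sub>R pd i Y \<theta>) - (\<nu> \<bullet> v) *\<^sub>R \<nu>"
  have nn: "\<nu> \<bullet> \<nu> = 1" using \<nu>(1) by (simp add: norm_eq_sqrt_inner)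
  have "?w = 0"
  proof (rule tangent_normal_eq_0[OF im])
    show "\<nu> \<noteq> 0" using nn by auto
    show "?w \<bullet> pd k Y \<theta> = 0" for k
    proof -
      have "(\<Sum>i\<in>UNIV. ?a $ i *\<^sub>R pd i Y \<theta>) \<bullet> pd k Y \<theta> =
         (\<Sum>i\<in>UNIV. \<Sum>l\<in>UNIV. matrix_inv (gram Y \<theta>) $ i $ l * (pd l Y \<theta> \<bullet> v) * gram Y \<theta> $ i $ k)"
        by (simp add: inner_sum_left gram_nth sum_distrib_right)
      also have "\<dots> = (\<Sum>l\<in>UNIV. (pd l Y \<theta> \<bullet> v) * (\<Sum>i\<in>UNIV. matrix_inv (gram Y \<theta>) $ l $ i * gram Y \<theta> $ i $ k))"
        by (subst sum.swap) (simp add: sum_distrib_left mult_ac matrix_inv_gram_symmetric[OF im])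
      also have "\<dots> = (\<Sum>l\<in>UNIV. if l = k then pd l Y \<theta> \<bullet> v else 0)"
        by (rule sum.cong[OF refl]) (simp add: matrix_inv_mult_nth(2)[OF det_gram_nonzero[OF im]])
      finally have e: "(\<Sum>i\<in>UNIV. ?a $ i *\<^sub>R pd i Y \<theta>) \<bullet> pd k Y \<theta> = pd k Y \<theta> \<bullet> v" by simp
      show ?thesis unfolding inner_diff_left e by (simp add: \<nu>(2) inner_commute)
    qed
    have "\<nu> \<bullet> ?w = 0" by (simp add: inner_diff_right inner_sum_right \<nu>(2) nn)
    then show "?w \<bullet> \<nu> = 0" by (simp only: inner_commute)
  qed (rule \<nu>(2))
  then show ?thesis by (intro that[of ?a]) (simp add: algebra_simps)
qed

text \<open>The quadratic form of H is |Bv|^2 + (\<nu> \<bullet> v)^2, which is definite because B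
  is injective on tangent vectors. The error w - Bz is orthogonal to all \<open>A k\<close>, hence
  to the range of B, so H z = B^T B z = B^T w. The last claim follows from symmetry of H.\<close>

lemma Hhat_solution:
  fixes Y :: "real^'n \<Rightarrow> real^('n option)" and B :: "real^('n option)^('n option)"
  assumes im: "immersed_at Y \<theta>" and \<nu>: "norm \<nu> = 1" "\<And>i. \<nu> \<bullet> pd i Y \<theta> = 0"
    and B: "\<And>k. B *v pd k Y \<theta> = A k" "B *v \<nu> = 0"
    and A: "\<And>c. (\<Sum>k\<in>UNIV. c $ k *\<^sub>R A k) = 0 \<Longrightarrow> c = 0"
    and c: "\<And>k. (w - (\<Sum>k\<in>UNIV. c $ k *\<^sub>R A k)) \<bullet> A k = 0"
  defines "H \<equiv> transpose B ** B + outer \<nu> \<nu>" and "z \<equiv> \<Sum>k\<in>UNIV. c $ k *\<^sub>R pd k Y \<theta>"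
  shows "det H \<noteq> 0" "matrix_inv H *v (transpose B *v w) = z"
    "w \<bullet> (B *v (matrix_inv H *v \<eta>)) = z \<bullet> \<eta>"
proof -
  have nn: "\<nu> \<bullet> \<nu> = 1" using \<nu>(1) by (simp add: norm_eq_sqrt_inner)
  have Bs: "B *v (\<Sum>k\<in>UNIV. a $ k *\<^sub>R pd k Y \<theta>) = (\<Sum>k\<in>UNIV. a $ k *\<^sub>R A k)" for a
    using linear_sum[OF matrix_vector_mul_linear, of B "\<lambda>k. a $ k *\<^sub>R pd k Y \<theta>" UNIV]
    by (simp add: linear_scale[OF matrix_vector_mul_linear] B(1))
  have out: "outer \<nu> \<nu> *v v = (\<nu> \<bullet> v) *\<^sub>R \<nu>" for v
    by (simp add: outer_def matrix_vector_mult_def inner_vec_def vec_eq_iff sum_distrib_left sum_distrib_right mult_ac)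
  have adj: "(transpose B *v u) \<bullet> v = u \<bullet> (B *v v)" for u v :: "real^('n option)"
    by (metis dot_lmul_matrix inner_commute transpose_matrix_vector)
  have Hv: "H *v v = transpose B *v (B *v v) + (\<nu> \<bullet> v) *\<^sub>R \<nu>" for v
    by (simp add: H_def matrix_vector_mult_add_rdistrib out matrix_vector_mul_assoc)
  have quad: "u \<bullet> (H *v v) = (B *v u) \<bullet> (B *v v) + (\<nu> \<bullet> u) * (\<nu> \<bullet> v)" for u v
    using adj[of "B *v v" u] by (simp add: Hv inner_add_right inner_commute mult.commute)
  have "v = 0" if v: "H *v v = 0" for v
  proof -
    have "(B *v v) \<bullet> (B *v v) + (\<nu> \<bullet> v) * (\<nu> \<bullet> v) = 0" using quad[of v v] v by simp
    then have Bv: "B *v v = 0" "\<nu> \<bullet> v = 0"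
      by (simp_all add: add_nonneg_eq_0_iff)
    obtain a where a: "v = (\<Sum>i\<in>UNIV. a $ i *\<^sub>R pd i Y \<theta>) + (\<nu> \<bullet> v) *\<^sub>R \<nu>"
      by (rule tangent_normal_decomposition[OF im \<nu>]) (rule that; assumption)
    then have v': "v = (\<Sum>i\<in>UNIV. a $ i *\<^sub>R pd i Y \<theta>)" using Bv(2) by simp
    then have "a = 0" using Bv(1) Bs A by simp
    then show ?thesis using v' by simp
  qed
  then have "inj ((*v) H)" using linear_injective_0[OF matrix_vector_mul_linear] by blast
  then show dH: "det H \<noteq> 0" using det_nz_iff_inj[OF matrix_vector_mul_linear, of H] by simp
  then have inv: "invertible H" by (simp add: invertible_det_nz)
  have Bz: "B *v z = (\<Sum>k\<in>UNIV. c $ k *\<^sub>R A k)" unfolding z_def by (rule Bs)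
  have \<nu>z: "\<nu> \<bullet> z = 0" by (simp add: z_def inner_sum_right \<nu>(2))
  have "transpose B *v (w - B *v z) = 0"
  proof -
    have "(transpose B *v (w - B *v z)) \<bullet> v = 0" for v
    proof -
      obtain a where a: "v = (\<Sum>i\<in>UNIV. a $ i *\<^sub>R pd i Y \<theta>) + (\<nu> \<bullet> v) *\<^sub>R \<nu>"
        by (rule tangent_normal_decomposition[OF im \<nu>]) (rule that; assumption)
      have "B *v v = (\<Sum>k\<in>UNIV. a $ k *\<^sub>R A k)"
        by (subst a) (simp add: matrix_vector_right_distrib Bs linear_scale[OF matrix_vector_mul_linear] B(2))
      then show ?thesis unfolding adj Bz by (simp add: inner_sum_right c)
    qed
    then show ?thesis by (metis inner_eq_zero_iff)
  qed
  then have Hz: "H *v z = transpose B *v w"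
    by (simp add: Hv \<nu>z linear_diff[OF matrix_vector_mul_linear])
  show "matrix_inv H *v (transpose B *v w) = z"
    unfolding Hz[symmetric] matrix_vector_mul_assoc matrix_inv_left[OF inv] by simp
  have "w \<bullet> (B *v (matrix_inv H *v \<eta>)) = (matrix_inv H *v \<eta>) \<bullet> (H *v z)"
    unfolding Hz adj[symmetric] by (simp add: inner_commute)
  also have "\<dots> = z \<bullet> (H *v (matrix_inv H *v \<eta>))" unfolding quad by (simp add: inner_commute mult.commute)
  also have "H *v (matrix_inv H *v \<eta>) = \<eta>" unfolding matrix_vector_mul_assoc matrix_inv_right[OF inv] by simp
  finally show "w \<bullet> (B *v (matrix_inv H *v \<eta>)) = z \<bullet> \<eta>" .
qed

section \<open>Geometry of the flow at a fixed time\<close>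

lemma param_at_cases:
  assumes M: "smooth_closed_connected_hypersurface M" and p: "p \<in> M"
  obtains U X \<theta> where "param_at M p = (U, X)" "local_parametrization M U X" "\<theta> \<in> U" "X \<theta> = p" "inv_into U X p = \<theta>"
proof -
  obtain U X where UX: "param_at M p = (U, X)" by (cases "param_at M p")
  have "\<exists>c. (case c of (U, X) \<Rightarrow> local_parametrization M U X \<and> p \<in> X ` U)"
    using M p by (auto simp: smooth_closed_connected_hypersurface_def)
  from someI_ex[OF this] have lp: "local_parametrization M U X" "p \<in> X ` U"
    using UX by (simp_all add: param_at_def)
  show ?thesis
    by (rule that[of U X "inv_into U X p"]) (use UX lp in \<open>simp_all add: inv_into_into f_inv_into_f\<close>)
qed

lemma laplacian_coordinates:
  assumes "param_at M p = (U, X)" "inv_into U X p = \<theta>"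
  shows "laplacian M (pullback_metric f) F p = lap (\<lambda>\<xi>. f (X \<xi>)) (\<lambda>\<xi>. F (X \<xi>)) \<theta>"
  using assms by (simp add: laplacian_def lap_def hess_def pullback_metric_eq_gram o_def Let_def)

lemma patch_embedding:
  assumes f: "C2_embedding M f" and X: "local_parametrization M U X"
  shows "patch (f ` M) U (\<lambda>\<xi>. f (X \<xi>))"
proof -
  note p = local_parametrizationD[OF X]
  obtain g where g: "homeomorphism M (f ` M) f g" using f by (auto simp: C2_embedding_def)
  obtain J where J: "homeomorphism U (X ` U) X J" using X by (auto simp: local_parametrization_def)
  have XM: "X ` U \<subseteq> M" by (rule patchD(6)[OF p])
  have C: "Ck_on 2 (\<lambda>\<xi>. f (X \<xi>)) U" using f X by (simp add: C2_embedding_def C2_map_def o_def)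
  have "homeomorphism (X ` U) (f ` X ` U) f g"
    by (rule homeomorphism_of_subsets[OF g XM]) (use XM in auto)
  from homeomorphism_compose[OF J this]
  have h: "homeomorphism U ((\<lambda>\<xi>. f (X \<xi>)) ` U) (\<lambda>\<xi>. f (X \<xi>)) (J \<circ> g)" by (simp add: o_def image_image)
  have "openin (top_of_set (f ` M)) (f ` X ` U)"
    by (rule homeomorphism_imp_open_map[OF g patchD(2)[OF p]])
  then have o: "openin (top_of_set (f ` M)) ((\<lambda>\<xi>. f (X \<xi>)) ` U)" by (simp add: image_image)
  have "immersed_at (\<lambda>\<xi>. f (X \<xi>)) \<theta>" if "\<theta> \<in> U" for \<theta>
    using immersed_at_iff_inj[OF Ck_on_2D(1)[OF C that]] f X that
    by (simp add: C2_embedding_def immersion_on_def o_def)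
  with h o C patchD(1)[OF p] show ?thesis unfolding patch_def by blast
qed

text \<open>With \<open>f = x t\<close> these patches cover \<open>\<Gamma> t\<close>, and the
  inverse of \<open>xhat t\<close> is represented in them by
  \<open>\<psi> t \<circ> X\<close>.\<close>

definition flow_patches :: "(real^('n::finite option)) set \<Rightarrow> (real^('n option) \<Rightarrow> real^('n option)) \<Rightarrow>
    ((real^'n) set \<times> (real^'n \<Rightarrow> real^('n option))) set" where
  "flow_patches M f = {(U, \<lambda>\<xi>. f (X \<xi>)) | U X. local_parametrization M U X}"

context
  fixes M :: "(real^('n::finite option)) set" and f \<psi> \<nu> :: "real^('n option) \<Rightarrow> real^('n option)"
  assumes M: "smooth_closed_connected_hypersurface M" and f: "C2_embedding M f"
    and \<nu>: "unit_normal_field M f \<nu>" and \<psi>: "C2_diffeomorphism M \<psi>"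
begin

lemma unit_normal_at_embedding:
  assumes X: "local_parametrization M U X" and \<theta>: "\<theta> \<in> U"
  shows "unit_normal_at \<nu> (\<lambda>\<xi>. f (X \<xi>)) \<theta>"
  using \<nu> X \<theta> patchD(6)[OF local_parametrizationD[OF X]]
  by (auto simp: unit_normal_at_def unit_normal_field_def o_def)

lemma c2_surface_flow:
  assumes ms: "measure_space UNIV (sets borel) (hausdorff_outer CARD('n) :: (real^('n option)) set \<Rightarrow> ennreal)"
  shows "c2_surface (f ` M) \<nu> (flow_patches M f)"
proof
  have "continuous_on M f" using f by (auto simp: C2_embedding_def homeomorphism_def)
  then show "compact (f ` M)"
    using M by (intro compact_continuous_image) (auto simp: smooth_closed_connected_hypersurface_def)
  fix U Y assume "(U, Y) \<in> flow_patches M f"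
  then obtain X where X: "local_parametrization M U X" "Y = (\<lambda>\<xi>. f (X \<xi>))" by (auto simp: flow_patches_def)
  show "patch (f ` M) U Y" unfolding X(2) by (rule patch_embedding[OF f X(1)])
  show "unit_normal_at \<nu> Y \<theta>" if "\<theta> \<in> U" for \<theta> unfolding X(2) by (rule unit_normal_at_embedding[OF X(1) that])
next
  fix y assume "y \<in> f ` M"
  then obtain p where p: "p \<in> M" "y = f p" by blast
  obtain U X \<theta> where X: "local_parametrization M U X" "\<theta> \<in> U" "X \<theta> = p"
    by (rule param_at_cases[OF M p(1)]) (rule that; assumption)
  then show "\<exists>U Y \<theta>. (U, Y) \<in> flow_patches M f \<and> \<theta> \<in> U \<and> y = Y \<theta>"
    unfolding flow_patches_def using p(2) by blast
qed (rule ms)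

lemma f_inj: "inj_on f M"
proof -
  obtain g where "homeomorphism M (f ` M) f g" using f by (auto simp: C2_embedding_def)
  then show ?thesis by (intro inj_on_inverseI[of _ g]) (rule homeomorphism_apply1)
qed

lemma psi_bij: "bij_betw \<psi> M M" using \<psi> by (simp add: C2_diffeomorphism_def)

lemma psi_inv: "p \<in> M \<Longrightarrow> inv_into M \<psi> (\<psi> p) = p" "q \<in> M \<Longrightarrow> \<psi> (inv_into M \<psi> q) = q"
  "p \<in> M \<Longrightarrow> \<psi> p \<in> M" "q \<in> M \<Longrightarrow> inv_into M \<psi> q \<in> M"
  using psi_bij by (auto simp: bij_betw_def f_inv_into_f inv_into_into)

lemma inv_psi_bij: "bij_betw (inv_into M \<psi>) M M" by (rule bij_betw_inv_into[OF psi_bij])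

lemma xhat_image: "(f \<circ> inv_into M \<psi>) ` M = f ` M"
  unfolding image_comp[symmetric] using inv_psi_bij by (simp add: bij_betw_def)

lemma xhat_inverse:
  assumes p: "p \<in> M"
  shows "inv_into M (f \<circ> inv_into M \<psi>) (f p) = \<psi> p"
proof (rule inv_into_f_eq)
  show "inj_on (f \<circ> inv_into M \<psi>) M"
    using inv_psi_bij f_inj by (intro comp_inj_on) (auto simp: bij_betw_def)
qed (use p psi_inv in auto)

lemma C2_chart:
  assumes "local_parametrization M U X"
  shows "Ck_on 2 (\<lambda>\<xi>. f (X \<xi>)) U" "Ck_on 2 (\<lambda>\<xi>. \<psi> (X \<xi>)) U" "Ck_on 2 (\<lambda>\<xi>. inv_into M \<psi> (X \<xi>)) U" "Ck_on 2 X U"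
  using f \<psi> assms patchD(3)[OF local_parametrizationD[OF assms]]
  by (simp_all add: C2_embedding_def C2_diffeomorphism_def C2_map_def o_def)

text \<open>The chart X is recovered from \<open>\<Psi>\<close> through the C2 inverse of
  \<open>\<psi>\<close>, so \<open>\<Psi>\<close> is immersed by \<open>immersed_at_factor\<close>;
  composing with X2 carries this over to \<open>\<psi> \<circ> X\<close>.\<close>

lemma psi_in_chart:
  assumes X: "local_parametrization M U X" "\<theta> \<in> U" and X2: "local_parametrization M U2 X2" "\<psi> (X \<theta>) \<in> X2 ` U2"
  defines "\<Psi> \<equiv> \<lambda>\<xi>. inv_into U2 X2 (\<psi> (X \<xi>))"
  shows "eventually (\<lambda>\<xi>. \<Psi> \<xi> \<in> U2 \<and> X2 (\<Psi> \<xi>) = \<psi> (X \<xi>)) (nhds \<theta>)" "twice_differentiable_at \<Psi> \<theta>"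
    "immersed_at \<Psi> \<theta>" "immersed_at (\<lambda>\<xi>. \<psi> (X \<xi>)) \<theta>"
proof -
  note p = local_parametrizationD[OF X(1)] and p2 = local_parametrizationD[OF X2(1)]
  have im: "(\<lambda>\<xi>. \<psi> (X \<xi>)) ` U \<subseteq> M" using patchD(6)[OF p] psi_inv(3) by blast
  note fac = factor_through_patch[OF p2 patchD(1)[OF p] C2_chart(2)[OF X(1)] im X(2) X2(2), folded \<Psi>_def]
  from fac(1) show ev: "eventually (\<lambda>\<xi>. \<Psi> \<xi> \<in> U2 \<and> X2 (\<Psi> \<xi>) = \<psi> (X \<xi>)) (nhds \<theta>)" by (simp add: \<Psi>_def)
  show t: "twice_differentiable_at \<Psi> \<theta>" by (rule fac(2))
  have \<Psi>: "\<Psi> \<theta> \<in> U2" using eventually_nhds_x_imp_x[OF ev] by simp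
  have "eventually (\<lambda>\<xi>. \<xi> \<in> U) (nhds \<theta>)" by (rule eventually_nhds_in_open[OF patchD(1)[OF p] X(2)])
  with ev have "eventually (\<lambda>\<xi>. X \<xi> = inv_into M \<psi> (X2 (\<Psi> \<xi>))) (nhds \<theta>)"
  proof eventually_elim
    case (elim \<xi>)
    then have "X \<xi> \<in> M" using patchD(6)[OF p] by blast
    then show ?case using elim psi_inv(1) by simp
  qed
  then show imP: "immersed_at \<Psi> \<theta>"
    by (rule immersed_at_factor[where Z="\<lambda>\<xi>. inv_into M \<psi> (X2 \<xi>)", OF patchD(5)[OF p X(2)] _ twice_differentiable_atD(1)[OF t]])
      (rule Ck_on_2D(1)[OF C2_chart(3)[OF X2(1)] \<Psi>])
  have "immersed_at (\<lambda>\<xi>. X2 (\<Psi> \<xi>)) \<theta>"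
    by (rule matrix_inv_gram_change(1)[OF twice_differentiable_atD(1)[OF t] imP Ck_on_2D(1)[OF patchD(3)[OF p2] \<Psi>] patchD(5)[OF p2 \<Psi>]])
  moreover have "pd i (\<lambda>\<xi>. X2 (\<Psi> \<xi>)) \<theta> = pd i (\<lambda>\<xi>. \<psi> (X \<xi>)) \<theta>" for i
    by (rule pd_cong_nhds, rule eventually_mono[OF ev]) simp
  ultimately show "immersed_at (\<lambda>\<xi>. \<psi> (X \<xi>)) \<theta>" by (simp add: immersed_at_def)
qed

lemma psi_immersed:
  assumes X: "local_parametrization M U X" "\<theta> \<in> U"
  shows "immersed_at (\<lambda>\<xi>. \<psi> (X \<xi>)) \<theta>"
proof -
  have "\<psi> (X \<theta>) \<in> M" using patchD(6)[OF local_parametrizationD[OF X(1)]] X(2) psi_inv(3) by blast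
  then obtain U2 X2 \<theta>2 where X2: "local_parametrization M U2 X2" "\<theta>2 \<in> U2" "X2 \<theta>2 = \<psi> (X \<theta>)"
    by (rule param_at_cases[OF M]) (rule that; assumption)
  then have "\<psi> (X \<theta>) \<in> X2 ` U2" by force
  from psi_in_chart(4)[OF X X2(1) this] show ?thesis .
qed

text \<open>The Laplacian of the position is normal, and in its normal component the Christoffel
  terms drop out, leaving the formula that defines \<open>mean_curvature\<close>. That formula uses
  the chosen chart, hence the change of chart at the end.\<close>

lemma mean_curvature_vector:
  assumes X: "local_parametrization M U X" and \<theta>: "\<theta> \<in> U"
  shows "- (mean_curvature M f \<nu> (f (X \<theta>)) *\<^sub>R \<nu> (f (X \<theta>))) = lap (\<lambda>\<xi>. f (X \<xi>)) (\<lambda>\<xi>. f (X \<xi>)) \<theta>"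
proof -
  note p = local_parametrizationD[OF X]
  have XM: "X \<theta> \<in> M" using patchD(6)[OF p] \<theta> by blast
  obtain V a \<theta>' where a: "param_at M (X \<theta>) = (V, a)" "local_parametrization M V a" "\<theta>' \<in> V" "a \<theta>' = X \<theta>" "inv_into V a (X \<theta>) = \<theta>'"
    by (rule param_at_cases[OF M XM]) (rule that; assumption)
  note pa = local_parametrizationD[OF a(2)]
  let ?Y = "\<lambda>\<xi>. f (a \<xi>)" and ?n = "\<nu> (f (X \<theta>))"
  note pY = patch_embedding[OF f a(2)]
  note tY = Ck_on_2_imp_twice_differentiable[OF C2_chart(1)[OF a(2)] patchD(1)[OF pa] a(3)]
    and cY = Ck_on_2_pd_commute[OF C2_chart(1)[OF a(2)] patchD(1)[OF pa] a(3)] and iY = patchD(5)[OF pY a(3)]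
  have un: "norm ?n = 1" "\<And>i. ?n \<bullet> pd i ?Y \<theta>' = 0"
    using unit_normal_at_embedding[OF a(2,3)] a(4) by (auto simp: unit_normal_at_def)
  have nn: "?n \<bullet> ?n = 1" using un(1) by (simp add: norm_eq_sqrt_inner)
  have mc: "mean_curvature M f \<nu> (f (X \<theta>)) = - (lap ?Y ?Y \<theta>' \<bullet> ?n)"
  proof -
    have "?n \<bullet> hess ?Y ?Y \<theta>' i j = ?n \<bullet> pd i (pd j ?Y) \<theta>'" for i j
      by (simp add: hess_def inner_diff_right inner_sum_right un(2))
    then have "hess ?Y ?Y \<theta>' i j \<bullet> ?n = pd i (pd j ?Y) \<theta>' \<bullet> ?n" for i j
      by (simp only: inner_commute)
    then show ?thesis
      using f_inj XM a(1,5) by (simp add: mean_curvature_def lap_def inner_sum_left pullback_metric_eq_gram o_def)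
  qed
  have "lap ?Y ?Y \<theta>' - (lap ?Y ?Y \<theta>' \<bullet> ?n) *\<^sub>R ?n = 0"
  proof (rule tangent_normal_eq_0[OF iY])
    show "?n \<noteq> 0" using nn by auto
    show "(lap ?Y ?Y \<theta>' - (lap ?Y ?Y \<theta>' \<bullet> ?n) *\<^sub>R ?n) \<bullet> pd i ?Y \<theta>' = 0" for i
      by (simp add: inner_diff_left lap_self_normal[OF tY cY iY] un(2))
    show "(lap ?Y ?Y \<theta>' - (lap ?Y ?Y \<theta>' \<bullet> ?n) *\<^sub>R ?n) \<bullet> ?n = 0"
      by (simp add: inner_diff_left nn)
  qed (rule un(2))
  then have "- (mean_curvature M f \<nu> (f (X \<theta>)) *\<^sub>R ?n) = lap ?Y ?Y \<theta>'" by (simp add: mc)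
  also have "\<dots> = lap (\<lambda>\<xi>. f (X \<xi>)) (\<lambda>\<xi>. f (X \<xi>)) \<theta>"
    by (rule lap_change_chart[where G=id, OF p \<theta> patchD(1)[OF pa] patchD(3)[OF pa] patchD(6)[OF pa] a(3,4) C2_chart(1)[OF X]
          patchD(5)[OF patch_embedding[OF f X] \<theta>] C2_chart(1)[OF X]])
      (simp_all add: patchD(5)[OF pa a(3)] Ck_on_2D(1)[OF patchD(3)[OF p] \<theta>])
  finally show ?thesis .
qed

text \<open>In the chosen chart Z at \<open>\<psi> (X \<theta>)\<close> put
  \<open>a = inv_into M \<psi> \<circ> Z\<close>. The immersion is then \<open>f \<circ> a\<close>
  and the identity reads \<open>\<psi> \<circ> a\<close>, so the claim is a change from a to X, with
  G = \<open>\<psi>\<close> since \<open>\<psi> \<circ> a\<close> is the immersed Z.\<close>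

lemma laplacian_identity:
  assumes X: "local_parametrization M U X" and \<theta>: "\<theta> \<in> U"
  shows "laplacian M (pullback_metric (f \<circ> inv_into M \<psi>)) id (\<psi> (X \<theta>)) = lap (\<lambda>\<xi>. f (X \<xi>)) (\<lambda>\<xi>. \<psi> (X \<xi>)) \<theta>"
proof -
  note p = local_parametrizationD[OF X]
  have XM: "X \<theta> \<in> M" using patchD(6)[OF p] \<theta> by blast
  obtain V Z \<theta>' where a: "param_at M (\<psi> (X \<theta>)) = (V, Z)" "local_parametrization M V Z" "\<theta>' \<in> V" "Z \<theta>' = \<psi> (X \<theta>)" "inv_into V Z (\<psi> (X \<theta>)) = \<theta>'"
    by (rule param_at_cases[OF M psi_inv(3)[OF XM]]) (rule that; assumption)
  note pa = local_parametrizationD[OF a(2)]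
  define a where "a \<xi> = inv_into M \<psi> (Z \<xi>)" for \<xi>
  have ZM: "Z \<xi> \<in> M" if "\<xi> \<in> V" for \<xi> using patchD(6)[OF pa] that by blast
  have ev: "eventually (\<lambda>\<xi>. Z \<xi> = \<psi> (a \<xi>)) (nhds \<theta>')"
    using eventually_nhds_in_open[OF patchD(1)[OF pa] a(3)] by (rule eventually_mono) (simp add: a_def psi_inv ZM)
  have "laplacian M (pullback_metric (f \<circ> inv_into M \<psi>)) id (\<psi> (X \<theta>)) = lap (\<lambda>\<xi>. f (a \<xi>)) Z \<theta>'"
    by (simp add: laplacian_coordinates[OF a(1,5)] a_def)
  also have "\<dots> = lap (\<lambda>\<xi>. f (a \<xi>)) (\<lambda>\<xi>. \<psi> (a \<xi>)) \<theta>'"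
    by (rule lap_cong_nhds[OF _ ev]) simp
  also have "\<dots> = lap (\<lambda>\<xi>. f (X \<xi>)) (\<lambda>\<xi>. \<psi> (X \<xi>)) \<theta>"
  proof (rule lap_change_chart[where G=\<psi>, OF p \<theta> patchD(1)[OF pa] _ _ a(3) _ C2_chart(1)[OF X]
        patchD(5)[OF patch_embedding[OF f X] \<theta>] C2_chart(2)[OF X] _ Ck_on_2D(1)[OF C2_chart(2)[OF X] \<theta>]])
    show "Ck_on 2 a V" unfolding a_def[abs_def] by (rule C2_chart(3)[OF a(2)])
    show "a ` V \<subseteq> M" using ZM psi_inv(4) by (auto simp: a_def)
    show "a \<theta>' = X \<theta>" by (simp add: a_def a(4) psi_inv XM)
    have "immersed_at Z \<theta>'" by (rule patchD(5)[OF pa a(3)])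
    then show "immersed_at (\<lambda>\<xi>. \<psi> (a \<xi>)) \<theta>'"
      using pd_cong_nhds[OF ev] by (simp add: immersed_at_def)
  qed
  finally show ?thesis .
qed

text \<open>The defining components refer to the chosen chart at \<open>\<psi> p\<close>. They are
  rewritten in the basis of the \<open>pd k (\<lambda>\<xi>. \<psi> (X \<xi>)) \<theta>\<close>,
  because these vectors are the images of the tangent vectors of \<open>\<Gamma> t\<close> under the
  gradient of the inverse of \<open>xhat t\<close>.\<close>

lemma map_laplacian_tangential:
  assumes p: "param_at M p = (U, X)" "local_parametrization M U X" "\<theta> \<in> U" "X \<theta> = p" "inv_into U X p = \<theta>"
  defines "mlap \<equiv> map_laplacian M (pullback_metric f) (pullback_metric id) \<psi> p"
    and "A \<equiv> \<lambda>k. pd k (\<lambda>\<xi>. \<psi> (X \<xi>)) \<theta>"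
  obtains c where "mlap = (\<Sum>k\<in>UNIV. c $ k *\<^sub>R A k)"
    "\<And>k. (lap (\<lambda>\<xi>. f (X \<xi>)) (\<lambda>\<xi>. \<psi> (X \<xi>)) \<theta> - mlap) \<bullet> A k = 0"
proof -
  note pX = local_parametrizationD[OF p(2)]
  have pM: "p \<in> M" using patchD(6)[OF pX] p(3,4) by blast
  obtain V Z \<theta>' where a: "param_at M (\<psi> p) = (V, Z)" "local_parametrization M V Z" "\<theta>' \<in> V" "Z \<theta>' = \<psi> p" "inv_into V Z (\<psi> p) = \<theta>'"
    by (rule param_at_cases[OF M psi_inv(3)[OF pM]]) (rule that; assumption)
  note pZ = local_parametrizationD[OF a(2)]
  have "\<psi> (X \<theta>) \<in> Z ` V" using a(3,4) p(4) by force
  note ch = psi_in_chart[OF p(2,3) a(2) this]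
  let ?\<Psi> = "\<lambda>\<xi>. inv_into V Z (\<psi> (X \<xi>))"
  have \<Psi>\<theta>: "?\<Psi> \<theta> = \<theta>'" by (simp add: p(4) a(5))
  have ev: "eventually (\<lambda>\<xi>. \<psi> (X \<xi>) = Z (?\<Psi> \<xi>)) (nhds \<theta>)" using ch(1) by (rule eventually_mono) simp
  note tZ = Ck_on_2_imp_twice_differentiable[OF patchD(3)[OF pZ] patchD(1)[OF pZ] a(3)]
    and cZ = Ck_on_2_pd_commute[OF patchD(3)[OF pZ] patchD(1)[OF pZ] a(3)] and iZ = patchD(5)[OF pZ a(3)]
  define L where "L = (\<lambda>q. \<Sum>i\<in>UNIV. \<Sum>j\<in>UNIV. matrix_inv (gram (\<lambda>\<xi>. f (X \<xi>)) \<theta>) $ i $ j *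
                (pd i (pd j (\<lambda>\<xi>. ?\<Psi> \<xi> $ q)) \<theta>
                 - (\<Sum>k\<in>UNIV. christoffel (gram (\<lambda>\<xi>. f (X \<xi>))) \<theta> k i j * pd k (\<lambda>\<xi>. ?\<Psi> \<xi> $ q) \<theta>)
                 + (\<Sum>m\<in>UNIV. \<Sum>n\<in>UNIV. christoffel (gram Z) (?\<Psi> \<theta>) q m n *
                      pd i (\<lambda>\<xi>. ?\<Psi> \<xi> $ m) \<theta> * pd j (\<lambda>\<xi>. ?\<Psi> \<xi> $ n) \<theta>)))"
  have mlap: "mlap = (\<Sum>q\<in>UNIV. L q *\<^sub>R pd q Z (?\<Psi> \<theta>))"
    unfolding mlap_def map_laplacian_def p(1) a(1) L_def
    by (simp add: Let_def p(5) pullback_metric_eq_gram o_def)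
  have pdA: "A k = (\<Sum>q\<in>UNIV. pd k ?\<Psi> \<theta> $ q *\<^sub>R pd q Z \<theta>')" for k
    unfolding A_def pd_cong_nhds[OF ev]
    using pd_compose(1)[OF twice_differentiable_atD(1)[OF ch(2)], of Z] twice_differentiable_atD(1)[OF tZ]
    by (simp add: \<Psi>\<theta>)
  obtain c where c: "(\<Sum>k\<in>UNIV. c $ k *\<^sub>R pd k ?\<Psi> \<theta>) = (\<chi> q. L q)"
    by (rule immersed_at_surj[OF ch(3)]) (rule that; assumption)
  have "(\<Sum>k\<in>UNIV. c $ k *\<^sub>R A k) = (\<Sum>q\<in>UNIV. (\<Sum>k\<in>UNIV. c $ k *\<^sub>R pd k ?\<Psi> \<theta>) $ q *\<^sub>R pd q Z \<theta>')"
    unfolding pdA by (simp add: scaleR_sum_right scaleR_sum_left) (rule sum.swap)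
  then have mlapc: "mlap = (\<Sum>k\<in>UNIV. c $ k *\<^sub>R A k)" unfolding mlap c by (simp add: \<Psi>\<theta>)
  have "(lap (\<lambda>\<xi>. f (X \<xi>)) (\<lambda>\<xi>. Z (?\<Psi> \<xi>)) \<theta> - (\<Sum>q\<in>UNIV. L q *\<^sub>R pd q Z (?\<Psi> \<theta>))) \<bullet> pd l Z (?\<Psi> \<theta>) = 0" for l
    unfolding L_def by (rule map_laplacian_coordinates[OF ch(2)]) (simp_all only: \<Psi>\<theta> tZ iZ, rule cZ)
  moreover have "lap (\<lambda>\<xi>. f (X \<xi>)) (\<lambda>\<xi>. \<psi> (X \<xi>)) \<theta> = lap (\<lambda>\<xi>. f (X \<xi>)) (\<lambda>\<xi>. Z (?\<Psi> \<xi>)) \<theta>"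
    by (rule lap_cong_nhds[OF _ ev]) simp
  ultimately have "(lap (\<lambda>\<xi>. f (X \<xi>)) (\<lambda>\<xi>. \<psi> (X \<xi>)) \<theta> - mlap) \<bullet> pd l Z \<theta>' = 0" for l
    by (simp add: mlap \<Psi>\<theta>)
  then have "(lap (\<lambda>\<xi>. f (X \<xi>)) (\<lambda>\<xi>. \<psi> (X \<xi>)) \<theta> - mlap) \<bullet> A k = 0" for k
    by (simp add: pdA inner_sum_right)
  with mlapc show ?thesis by (rule that)
qed

end

section \<open>The velocity of the reparametrized flow\<close>

text \<open>A time derivative at the single point together with jointly continuous space derivatives
  suffices; the ball provides a convex set of parameters.\<close>

lemma joint_has_derivative:
  fixes M :: "(real^('n::finite option)) set"
  assumes g: "C2_space_C1_time M T g" and X: "local_parametrization M U X" and t: "t \<in> {0..<T}"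
    and r: "r > 0" "ball \<theta> r \<subseteq> U" and d: "((\<lambda>s. g s (X \<theta>)) has_vector_derivative d) (at t within {0..<T})"
  shows "((\<lambda>(s, \<xi>). g s (X \<xi>)) has_derivative (\<lambda>(h, v). h *\<^sub>R d + (\<Sum>i\<in>UNIV. v $ i *\<^sub>R pd i (\<lambda>\<xi>. g t (X \<xi>)) \<theta>)))
     (at (t, \<theta>) within {0..<T} \<times> ball \<theta> r)"
proof -
  let ?S = "{0..<T}"
  define D where "D s \<xi> v = (\<Sum>i\<in>UNIV. v $ i *\<^sub>R pd i (\<lambda>\<xi>. g s (X \<xi>)) \<xi>)" for s \<xi> and v :: "real^'n"
  have bl: "bounded_linear (D s \<xi>)" for s \<xi>
    unfolding D_def[abs_def] by (intro bounded_linear_sum bounded_linear_scaleR_const bounded_linear_vec_nth)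
  have ap: "blinfun_apply (Blinfun (D s \<xi>)) = D s \<xi>" for s \<xi> by (rule bounded_linear_Blinfun_apply[OF bl])
  have "((\<lambda>(s, \<xi>). g s (X \<xi>)) has_derivative (\<lambda>(h, v). (\<lambda>h. h *\<^sub>R d) h + blinfun_apply (Blinfun (D t \<theta>)) v))
     (at (t, \<theta>) within ?S \<times> ball \<theta> r)"
  proof (rule has_derivative_partialsI)
    show "((\<lambda>s. g s (X \<theta>)) has_derivative (\<lambda>h. h *\<^sub>R d)) (at t within ?S)"
      using d by (simp add: has_vector_derivative_def)
    show "((\<lambda>\<xi>. g s (X \<xi>)) has_derivative blinfun_apply (Blinfun (D s \<xi>))) (at \<xi> within ball \<theta> r)"
      if "s \<in> ?S" "\<xi> \<in> ball \<theta> r" for s \<xi>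
    proof -
      have C: "Ck_on 2 (\<lambda>\<xi>. g s (X \<xi>)) U"
        using g X that(1) by (simp add: C2_space_C1_time_def o_def)
      have "\<xi> \<in> U" using that(2) r(2) by blast
      have "((\<lambda>\<xi>. g s (X \<xi>)) has_derivative D s \<xi>) (at \<xi>)"
        unfolding D_def[abs_def] by (rule has_derivative_pd[OF Ck_on_2D(1)[OF C \<open>\<xi> \<in> U\<close>]])
      then show ?thesis unfolding ap by (rule has_derivative_at_withinI)
    qed
    have "continuous_on (?S \<times> U) (\<lambda>(s, \<xi>). pd i (\<lambda>\<xi>. g s (X \<xi>)) \<xi>)" for i
      using g X by (simp add: C2_space_C1_time_def o_def)
    moreover have "(t, \<theta>) \<in> ?S \<times> U" using t r by auto
    ultimately have "continuous (at (t, \<theta>) within ?S \<times> U) (\<lambda>(s, \<xi>). pd i (\<lambda>\<xi>. g s (X \<xi>)) \<xi>)" for i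
      unfolding continuous_on_eq_continuous_within by blast
    then have ci: "continuous (at (t, \<theta>) within ?S \<times> ball \<theta> r) (\<lambda>(s, \<xi>). pd i (\<lambda>\<xi>. g s (X \<xi>)) \<xi>)" for i
      by (rule continuous_within_subset) (use r(2) in auto)
    show "continuous (at (t, \<theta>) within ?S \<times> ball \<theta> r) (\<lambda>(s, \<xi>). Blinfun (D s \<xi>))"
    proof (rule continuous_blinfun_componentwiseI1)
      fix b :: "real^'n" assume "b \<in> Basis"
      have "continuous (at (t, \<theta>) within ?S \<times> ball \<theta> r) (\<lambda>q. \<Sum>i\<in>UNIV. b $ i *\<^sub>R (case q of (s, \<xi>) \<Rightarrow> pd i (\<lambda>\<xi>. g s (X \<xi>)) \<xi>))"
        by (intro continuous_intros ci)
      then show "continuous (at (t, \<theta>) within ?S \<times> ball \<theta> r) (\<lambda>q. blinfun_apply (case q of (s, \<xi>) \<Rightarrow> Blinfun (D s \<xi>)) b)"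
        by (simp add: case_prod_unfold ap D_def)
    qed
  qed (use r in auto)
  then show ?thesis by (simp add: ap D_def)
qed

text \<open>Points of \<open>M\<close> converging to p eventually lie in one chart around p, where
  joint continuity is part of the hypothesis.\<close>

lemma space_time_sequentially_continuous:
  fixes M :: "(real^('n::finite option)) set"
  assumes M: "smooth_closed_connected_hypersurface M" and g: "C2_space_C1_time M T g"
    and s: "\<And>n. s n \<in> {0..<T}" "s \<longlonglongrightarrow> t" "t \<in> {0..<T}" and m: "\<And>n. m n \<in> M" "m \<longlonglongrightarrow> p" "p \<in> M"
  shows "(\<lambda>n. g (s n) (m n)) \<longlonglongrightarrow> g t p"
proof -
  obtain U X \<theta> where X: "local_parametrization M U X" "\<theta> \<in> U" "X \<theta> = p" "inv_into U X p = \<theta>"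
    by (rule param_at_cases[OF M m(3)]) (rule that; assumption)
  note pX = local_parametrizationD[OF X(1)]
  let ?J = "inv_into U X"
  obtain O' where O': "open O'" "X ` U = M \<inter> O'" using patchD(2)[OF pX] by (auto simp: openin_open)
  have pU: "p \<in> X ` U" using X by blast
  have ev: "eventually (\<lambda>n. m n \<in> X ` U) sequentially"
    using topological_tendstoD[OF m(2) O'(1)] pU O'(2) m(1) by (auto elim: eventually_mono)
  have J: "(\<lambda>n. ?J (m n)) \<longlonglongrightarrow> \<theta>"
    using continuous_on_tendsto_compose[OF patch_inverse_continuous[OF pX] m(2) pU ev] X(4) by simp
  have c: "continuous_on ({0..<T} \<times> U) (\<lambda>(t, \<theta>). g t (X \<theta>))" using g X(1) by (simp add: C2_space_C1_time_def)
  have "(\<lambda>n. (\<lambda>(t, \<theta>). g t (X \<theta>)) (s n, ?J (m n))) \<longlonglongrightarrow> (\<lambda>(t, \<theta>). g t (X \<theta>)) (t, \<theta>)"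
  proof (rule continuous_on_tendsto_compose[OF c tendsto_Pair[OF s(2) J]])
    show "(t, \<theta>) \<in> {0..<T} \<times> U" using s(3) X(2) by simp
    show "eventually (\<lambda>n. (s n, ?J (m n)) \<in> {0..<T} \<times> U) sequentially"
      using ev by (rule eventually_mono) (simp add: s(1)[simplified] inv_into_into)
  qed
  then have "(\<lambda>n. g (s n) (X (?J (m n)))) \<longlonglongrightarrow> g t p" using X(3) by simp
  then show ?thesis
    by (rule Lim_transform_eventually) (use ev in \<open>auto elim!: eventually_mono simp: f_inv_into_f\<close>)
qed

text \<open>If preimages of q stayed away from the preimage at time t, compactness of
  \<open>M\<close> would give a limit point l of them. Joint continuity yields
  \<open>\<psi> t l = q\<close>, and injectivity makes l the preimage at time t.\<close>

lemma inverse_diffeomorphism_continuous: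
  fixes M :: "(real^('n::finite option)) set"
  assumes M: "smooth_closed_connected_hypersurface M" and \<psi>: "C2_space_C1_time M T \<psi>"
    and b: "\<And>s. s \<in> {0..<T} \<Longrightarrow> C2_diffeomorphism M (\<psi> s)" and t: "t \<in> {0..<T}" and q: "q \<in> M"
  shows "((\<lambda>s. inv_into M (\<psi> s) q) \<longlongrightarrow> inv_into M (\<psi> t) q) (at t within {0..<T})"
proof (rule ccontr)
  let ?p = "\<lambda>s. inv_into M (\<psi> s) q"
  assume "\<not> ?thesis"
  then obtain e where e: "e > 0" "\<not> eventually (\<lambda>s. dist (?p s) (?p t) < e) (at t within {0..<T})"
    unfolding tendsto_iff by blast
  have "\<exists>s\<in>{0..<T}. dist s t < inverse (real (Suc n)) \<and> \<not> dist (?p s) (?p t) < e" for n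
    using e(2) unfolding eventually_at by (metis inverse_positive_iff_positive of_nat_0_less_iff zero_less_Suc)
  then obtain s where s: "\<And>n. s n \<in> {0..<T}" "\<And>n. dist (s n) t < inverse (real (Suc n))"
    "\<And>n. \<not> dist (?p (s n)) (?p t) < e" by metis
  have st: "s \<longlonglongrightarrow> t"
  proof (rule metric_LIMSEQ_I)
    fix r :: real assume "r > 0"
    then obtain N where "inverse (real (Suc N)) < r" using reals_Archimedean by blast
    moreover have "inverse (real (Suc n)) \<le> inverse (real (Suc N))" if "n \<ge> N" for n
      using that by (intro le_imp_inverse_le) auto
    ultimately have "dist (s n) t < r" if "n \<ge> N" for n
      using s(2)[of n] that by (meson less_le_trans less_trans)
    then show "\<exists>N. \<forall>n\<ge>N. dist (s n) t < r" by blast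
  qed
  have pM: "?p r \<in> M" "\<psi> r (?p r) = q" if "r \<in> {0..<T}" for r
    using b[OF that] q by (auto simp: C2_diffeomorphism_def bij_betw_def f_inv_into_f inv_into_into)
  have "compact M" using M by (simp add: smooth_closed_connected_hypersurface_def)
  then have "\<forall>f. (\<forall>n. f n \<in> M) \<longrightarrow> (\<exists>l\<in>M. \<exists>r. strict_mono (r::nat \<Rightarrow> nat) \<and> (f \<circ> r) \<longlonglongrightarrow> l)"
    unfolding compact_def .
  from this[rule_format, of "\<lambda>n. ?p (s n)", OF pM(1)[OF s(1)]]
  obtain l \<sigma> where l: "l \<in> M" "strict_mono \<sigma>" "((\<lambda>n. ?p (s n)) \<circ> \<sigma>) \<longlonglongrightarrow> l"
    by blast
  have "(\<lambda>n. \<psi> (s (\<sigma> n)) (?p (s (\<sigma> n)))) \<longlonglongrightarrow> \<psi> t l"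
    by (rule space_time_sequentially_continuous[OF M \<psi> s(1) _ t pM(1)[OF s(1)] _ l(1)])
      (use LIMSEQ_subseq_LIMSEQ[OF st l(2)] l(3) in \<open>simp_all add: o_def\<close>)
  then have "\<psi> t l = q" using pM(2)[OF s(1)] by (simp add: LIMSEQ_const_iff)
  then have "l = ?p t"
    using b[OF t] l(1) by (auto simp: C2_diffeomorphism_def bij_betw_def)
  moreover have "(\<lambda>n. dist (?p (s (\<sigma> n))) (?p t)) \<longlonglongrightarrow> dist l (?p t)"
    using l(3) by (intro tendsto_intros) (simp add: o_def)
  then have "e \<le> dist l (?p t)"
    by (rule LIMSEQ_le_const) (use s(3) in \<open>auto simp: not_less\<close>)
  ultimately show False using e(1) by simp
qed

text \<open>The preimage of the fixed point q has chart coordinates h(s) with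
  \<open>\<psi> s (X (h s)) = q\<close>. Implicit differentiation gives h' = -c, and the chain rule
  for \<open>x s (X (h s))\<close> adds the transport term to e.\<close>

lemma reparametrized_velocity:
  fixes M :: "(real^('n::finite option)) set"
  assumes M: "smooth_closed_connected_hypersurface M"
    and x: "C2_space_C1_time M T x" and \<psi>: "C2_space_C1_time M T \<psi>"
    and b: "\<And>s. s \<in> {0..<T} \<Longrightarrow> C2_diffeomorphism M (\<psi> s)" and t: "t \<in> {0..<T}"
    and X: "local_parametrization M U X" and \<theta>: "\<theta> \<in> U" and q: "q = \<psi> t (X \<theta>)"
    and im: "immersed_at (\<lambda>\<xi>. \<psi> t (X \<xi>)) \<theta>"
    and d: "((\<lambda>s. \<psi> s (X \<theta>)) has_vector_derivative (\<Sum>k\<in>UNIV. c $ k *\<^sub>R pd k (\<lambda>\<xi>. \<psi> t (X \<xi>)) \<theta>)) (at t within {0..<T})"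
    and e: "((\<lambda>s. x s (X \<theta>)) has_vector_derivative e) (at t within {0..<T})"
  shows "((\<lambda>s. x s (inv_into M (\<psi> s) q)) has_vector_derivative
     (e - (\<Sum>k\<in>UNIV. c $ k *\<^sub>R pd k (\<lambda>\<xi>. x t (X \<xi>)) \<theta>))) (at t within {0..<T})"
proof -
  let ?S = "{0..<T}" and ?p = "\<lambda>s. inv_into M (\<psi> s) q" and ?J = "inv_into U X"
  let ?A = "\<lambda>v. \<Sum>k\<in>UNIV. v $ k *\<^sub>R pd k (\<lambda>\<xi>. \<psi> t (X \<xi>)) \<theta>" and ?Ax = "\<lambda>v. \<Sum>k\<in>UNIV. v $ k *\<^sub>R pd k (\<lambda>\<xi>. x t (X \<xi>)) \<theta>"
  note pX = local_parametrizationD[OF X]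
  have XM: "X \<theta> \<in> M" using patchD(6)[OF pX] \<theta> by blast
  have bij: "bij_betw (\<psi> s) M M" if "s \<in> ?S" for s using b[OF that] by (simp add: C2_diffeomorphism_def)
  have qM: "q \<in> M" using bij[OF t] XM unfolding q bij_betw_def by blast
  have pM: "?p s \<in> M" "\<psi> s (?p s) = q" if "s \<in> ?S" for s
    using bij[OF that] qM by (auto simp: bij_betw_def f_inv_into_f inv_into_into)
  have pt: "?p t = X \<theta>" using bij[OF t] XM by (simp add: q bij_betw_def)
  obtain O' where O': "open O'" "X ` U = M \<inter> O'" using patchD(2)[OF pX] by (auto simp: openin_open)
  have limp: "(?p \<longlongrightarrow> X \<theta>) (at t within ?S)"
    using inverse_diffeomorphism_continuous[OF M \<psi> b t qM] pt by simp
  have evU: "eventually (\<lambda>s. ?p s \<in> X ` U) (at t within ?S)"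
  proof -
    have "X \<theta> \<in> O'" using O' \<theta> by blast
    from topological_tendstoD[OF limp O'(1) this] show ?thesis
      by (auto simp: eventually_at_filter O'(2) pM(1)[simplified] elim!: eventually_mono)
  qed
  define h where "h s = ?J (?p s)" for s
  have ht: "h t = \<theta>" using pt \<theta> patchD(8)[OF pX] by (simp add: h_def)
  have limh: "(h \<longlongrightarrow> \<theta>) (at t within ?S)"
    using continuous_on_tendsto_compose[OF patch_inverse_continuous[OF pX] limp _ evU] \<theta> patchD(8)[OF pX]
    by (simp add: h_def[abs_def])
  obtain r where r: "r > 0" "ball \<theta> r \<subseteq> U" using patchD(1)[OF pX] \<theta> openE by blast
  have "eventually (\<lambda>s. dist (h s) \<theta> < r \<and> ?p s \<in> X ` U) (at t within ?S)"
    using tendstoD[OF limh r(1)] evU by (rule eventually_conj)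
  then obtain \<delta> where \<delta>: "\<delta> > 0" "\<And>s. s \<in> ?S \<Longrightarrow> s \<noteq> t \<Longrightarrow> dist s t < \<delta> \<Longrightarrow> dist (h s) \<theta> < r \<and> ?p s \<in> X ` U"
    unfolding eventually_at by blast
  \<comment> \<open>On this shorter time set the moving preimage stays in the chart, with parameters
    in the ball; derivatives within it and within the whole interval coincide.\<close>
  define S' where "S' = ?S \<inter> ball t \<delta>"
  have S': "at t within S' = at t within ?S"
    by (rule at_within_nhd[of t "ball t \<delta>"]) (use \<delta>(1) in \<open>auto simp: S'_def\<close>)
  have tS': "t \<in> S'" using t \<delta>(1) by (simp add: S'_def)
  have hS': "h s \<in> ball \<theta> r" "X (h s) = ?p s" "s \<in> ?S" if "s \<in> S'" for s
  proof -
    have "dist (h s) \<theta> < r \<and> ?p s \<in> X ` U \<and> s \<in> ?S"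
    proof (cases "s = t")
      case True
      then show ?thesis using ht r(1) pt \<theta> t by simp
    next
      case False
      then show ?thesis using \<delta>(2)[of s] that by (simp add: S'_def dist_commute)
    qed
    then show "h s \<in> ball \<theta> r" "X (h s) = ?p s" "s \<in> ?S"
      by (auto simp: dist_commute h_def f_inv_into_f)
  qed
  obtain L where L: "bounded_linear L" "\<And>v. L (?A v) = v"
    by (rule immersed_left_inverse[OF im]) (rule that; assumption)
  \<comment> \<open>Keeping time as a first component makes the differential left invertible:
    \<open>?L\<close> removes the contribution of time before applying L. The composite
    \<open>?F (?k s)\<close> is the trivial curve (s, q).\<close>
  let ?F = "\<lambda>z. (fst z, (\<lambda>(s, \<xi>). \<psi> s (X \<xi>)) z)" and ?k = "\<lambda>s. (s, h s)"
  let ?DF = "\<lambda>z. (fst z, (\<lambda>(h, v). h *\<^sub>R ?A c + ?A v) z)"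
  let ?L = "\<lambda>w. (fst w, L (snd w - fst w *\<^sub>R ?A c))"
  have "(?k has_derivative (\<lambda>v. ?L ((\<lambda>v. (v, 0)) v))) (at t within S')"
  proof (rule has_derivative_left_inverse[where F="?F" and F'="?DF" and S'="?S \<times> ball \<theta> r"])
    have "((\<lambda>(s, \<xi>). \<psi> s (X \<xi>)) has_derivative (\<lambda>(h, v). h *\<^sub>R ?A c + ?A v)) (at (t, \<theta>) within ?S \<times> ball \<theta> r)"
      by (rule joint_has_derivative[OF \<psi> X t r d])
    then show "(?F has_derivative ?DF) (at (?k t) within ?S \<times> ball \<theta> r)"
      unfolding ht by (intro has_derivative_Pair has_derivative_fst has_derivative_ident)
    show "bounded_linear ?L"
      by (intro bounded_linear_Pair bounded_linear_fst bounded_linear_compose[OF L(1)] bounded_linear_sub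
          bounded_linear_snd bounded_linear_scaleR_const)
    show "?L (?DF v) = v" for v by (cases v) (simp add: L(2))
    show "(?k \<longlongrightarrow> ?k t) (at t within S')"
      unfolding S' ht using limh by (intro tendsto_Pair tendsto_ident_at)
    show "?k s \<in> ?S \<times> ball \<theta> r" if "s \<in> S'" for s using hS'[OF that] by simp
    have "((\<lambda>s. (s, q)) has_derivative (\<lambda>v. (v, 0))) (at t within S')"
      by (intro has_derivative_Pair has_derivative_ident has_derivative_const)
    then show "((\<lambda>s. ?F (?k s)) has_derivative (\<lambda>v. (v, 0))) (at t within S')"
      by (rule has_derivative_transform[OF tS', rotated]) (simp add: hS'(2) pM(2)[OF hS'(3)])
  qed
  moreover have "L (- (v *\<^sub>R ?A c)) = - (v *\<^sub>R c)" for v :: real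
    using L(2)[of c] by (simp add: linear_neg[OF bounded_linear.linear[OF L(1)]] linear_scale[OF bounded_linear.linear[OF L(1)]])
  ultimately have k: "(?k has_derivative (\<lambda>v. (v, - (v *\<^sub>R c)))) (at t within S')" by simp
  have "((\<lambda>(s, \<xi>). x s (X \<xi>)) has_derivative (\<lambda>(h, v). h *\<^sub>R e + ?Ax v)) (at (?k t) within ?S \<times> ball \<theta> r)"
    unfolding ht by (rule joint_has_derivative[OF x X t r e])
  then have "((\<lambda>(s, \<xi>). x s (X \<xi>)) has_derivative (\<lambda>(h, v). h *\<^sub>R e + ?Ax v)) (at (?k t) within ?k ` S')"
    by (rule has_derivative_subset) (use hS' in auto)
  from has_derivative_in_compose[OF k this]
  have "((\<lambda>s. x s (X (h s))) has_derivative (\<lambda>v. v *\<^sub>R e + ?Ax (- (v *\<^sub>R c)))) (at t within S')" by simp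
  moreover have "(\<lambda>v. v *\<^sub>R e + ?Ax (- (v *\<^sub>R c))) = (\<lambda>v. v *\<^sub>R (e - ?Ax c))"
    by (simp add: fun_eq_iff scaleR_diff_right scaleR_sum_right sum_negf)
  ultimately have "((\<lambda>s. x s (X (h s))) has_vector_derivative (e - ?Ax c)) (at t within S')"
    by (simp add: has_vector_derivative_def)
  then have "((\<lambda>s. x s (?p s)) has_vector_derivative (e - ?Ax c)) (at t within S')"
    unfolding has_vector_derivative_def
    by (rule has_derivative_transform[OF tS', rotated]) (simp add: hS')
  then show ?thesis unfolding S' .
qed

section \<open>The weak formulation\<close>

text \<open>Makes the derivative within the interval unique, also at t = 0, so that
  \<open>vector_derivative\<close> returns it.\<close>

lemma at_within_half_open_nontrivial:
  fixes t T :: real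
  assumes "t \<in> {0..<T}"
  shows "at t within {0..<T} \<noteq> bot"
proof -
  have "t islimpt {t<..<T}" using assms by (intro islimpt_greaterThanLessThan1) simp
  then have "t islimpt {0..<T}" by (rule islimpt_subset) (use assms in auto)
  then show ?thesis by (simp add: trivial_limit_within)
qed

context
  fixes M :: "(real^('n::finite option)) set" and f \<psi> \<nu> :: "real^('n option) \<Rightarrow> real^('n option)"
  assumes M: "smooth_closed_connected_hypersurface M" and f: "C2_embedding M f"
    and \<nu>: "unit_normal_field M f \<nu>" and \<psi>: "C2_diffeomorphism M \<psi>"
begin

private abbreviation (input) "inverse_xhat \<equiv> inv_into M (f \<circ> inv_into M \<psi>)"

lemma inverse_xhat_patch:
  assumes X: "local_parametrization M U X"
  shows "\<theta> \<in> U \<Longrightarrow> inverse_xhat (f (X \<theta>)) = \<psi> (X \<theta>)"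
    and "\<theta> \<in> U \<Longrightarrow> eventually (\<lambda>\<xi>. inverse_xhat (f (X \<xi>)) = \<psi> (X \<xi>)) (nhds \<theta>)"
    and "Ck_on 2 (\<lambda>\<xi>. inverse_xhat (f (X \<xi>))) U"
proof -
  note p = local_parametrizationD[OF X]
  have eq: "inverse_xhat (f (X \<xi>)) = \<psi> (X \<xi>)" if "\<xi> \<in> U" for \<xi>
    by (rule xhat_inverse[OF M f \<nu> \<psi>]) (use patchD(6)[OF p] that in blast)
  show "\<theta> \<in> U \<Longrightarrow> inverse_xhat (f (X \<theta>)) = \<psi> (X \<theta>)" by (rule eq)
  show "eventually (\<lambda>\<xi>. inverse_xhat (f (X \<xi>)) = \<psi> (X \<xi>)) (nhds \<theta>)" if "\<theta> \<in> U"
    using eventually_nhds_in_open[OF patchD(1)[OF p] that] by (rule eventually_mono) (rule eq)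
  show "Ck_on 2 (\<lambda>\<xi>. inverse_xhat (f (X \<xi>))) U"
    by (rule Ck_on_cong[OF patchD(1)[OF p] eq[symmetric] C2_chart(2)[OF M f \<nu> \<psi> X]])
qed

lemma laplacian_inverse_xhat:
  assumes X: "local_parametrization M U X" and \<theta>: "\<theta> \<in> U"
  shows "laplacian M (pullback_metric (f \<circ> inv_into M \<psi>)) id (inverse_xhat (f (X \<theta>)))
    = lap (\<lambda>\<xi>. f (X \<xi>)) (\<lambda>\<xi>. inverse_xhat (f (X \<xi>))) \<theta>"
  unfolding inverse_xhat_patch(1)[OF X \<theta>] laplacian_identity[OF M f \<nu> \<psi> X \<theta>]
  by (rule lap_cong_nhds[OF _ eventually_mono[OF inverse_xhat_patch(2)[OF X \<theta>]]]) simp_all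

end

text \<open>Everything is computed at one point in the chart \<open>param_at M p\<close>, since the
  map Laplacian is defined in it. The coefficients c of the map Laplacian are at once those of Z in
  the basis of the \<open>pd k ?Y \<theta>\<close>, which links the DeTurck velocity to the operator
  H.\<close>

lemma deturck_velocity:
  fixes M :: "(real^('n::finite option)) set"
  assumes M: "smooth_closed_connected_hypersurface M"
    and x: "mean_curvature_flow M T x0 \<nu> x" and \<psi>: "deturck_diffeomorphisms M \<alpha> T x \<psi>"
    and t: "t \<in> {0..<T}" and y: "y \<in> x t ` M"
  defines "xinv \<equiv> inv_into M (x t \<circ> inv_into M (\<psi> t))"
  defines "B \<equiv> tgrad (x t ` M) (\<nu> t) xinv y"
    and "w \<equiv> laplacian M (pullback_metric (x t \<circ> inv_into M (\<psi> t))) id (xinv y)"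
  defines "H \<equiv> transpose B ** B + outer (\<nu> t y) (\<nu> t y)"
  defines "Z \<equiv> matrix_inv H *v (transpose B *v w)"
  shows "det H \<noteq> 0" "Z \<bullet> \<nu> t y = 0" "w \<bullet> (B *v (matrix_inv H *v \<eta>)) = Z \<bullet> \<eta>"
    "material_derivative M T (\<lambda>s. x s \<circ> inv_into M (\<psi> s)) (\<lambda>s y. y) t y
      = - (mean_curvature M (x t) (\<nu> t) y *\<^sub>R \<nu> t y) - (1/\<alpha>) *\<^sub>R Z"
proof -
  have f: "C2_embedding M (x t)" and n: "unit_normal_field M (x t) (\<nu> t)" and x1: "C2_space_C1_time M T x"
    using x t by (simp_all add: mean_curvature_flow_def)
  have b: "\<And>s. s \<in> {0..<T} \<Longrightarrow> C2_diffeomorphism M (\<psi> s)" and \<psi>1: "C2_space_C1_time M T \<psi>"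
    using \<psi> by (simp_all add: deturck_diffeomorphisms_def)
  note bt = b[OF t]
  note prem = M f n bt
  obtain p where p: "p \<in> M" "y = x t p" using y by blast
  obtain U X \<theta> where X: "param_at M p = (U, X)" "local_parametrization M U X" "\<theta> \<in> U" "X \<theta> = p" "inv_into U X p = \<theta>"
    by (rule param_at_cases[OF M p(1)]) (rule that; assumption)
  let ?Y = "\<lambda>\<xi>. x t (X \<xi>)" and ?A = "\<lambda>k. pd k (\<lambda>\<xi>. \<psi> t (X \<xi>)) \<theta>"
  let ?mlap = "map_laplacian M (pullback_metric (x t)) (pullback_metric id) (\<psi> t) p"
  have yY: "y = ?Y \<theta>" using p X(4) by simp
  note pY = patch_embedding[OF f X(2)] and un = unit_normal_at_embedding[OF prem X(2,3)]
  note ix = inverse_xhat_patch[OF prem X(2), folded xinv_def]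
  have w: "w = lap ?Y (\<lambda>\<xi>. \<psi> t (X \<xi>)) \<theta>"
    unfolding w_def yY ix(1)[OF X(3)] by (rule laplacian_identity[OF prem X(2,3)])
  have im: "immersed_at (\<lambda>\<xi>. \<psi> t (X \<xi>)) \<theta>" by (rule psi_immersed[OF prem X(2,3)])
  obtain c where c: "?mlap = (\<Sum>k\<in>UNIV. c $ k *\<^sub>R ?A k)" "\<And>k. (w - ?mlap) \<bullet> ?A k = 0"
    by (rule map_laplacian_tangential[OF prem X, folded w]) (rule that; assumption)
  have dx: "(\<lambda>\<xi>. xinv (?Y \<xi>)) differentiable (at \<xi>)" if "\<xi> \<in> U" for \<xi>
    by (rule Ck_on_2D(1)[OF ix(3) that])
  note gp = tgrad_patch_pd[where \<nu>="\<nu> t" and f=xinv, OF pY X(3) un dx]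
  have B1: "B *v pd k ?Y \<theta> = ?A k" for k
  proof -
    have "B *v pd k ?Y \<theta> = pd k (\<lambda>\<xi>. xinv (?Y \<xi>)) \<theta>" unfolding B_def yY by (rule gp(1))
    then show ?thesis using pd_cong_nhds[OF ix(2)[OF X(3)]] by simp
  qed
  have B2: "B *v \<nu> t y = 0" unfolding B_def yY by (rule gp(2))
  have n1: "norm (\<nu> t y) = 1" "\<And>i. \<nu> t y \<bullet> pd i ?Y \<theta> = 0"
    using un unfolding unit_normal_at_def yY by auto
  have A: "v = 0" if "(\<Sum>k\<in>UNIV. v $ k *\<^sub>R ?A k) = 0" for v
    using im that unfolding immersed_at_def by blast
  note sol = Hhat_solution[OF patchD(5)[OF pY X(3)] n1 B1 B2 A c(2)[unfolded c(1)], folded H_def]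
  have Z: "Z = (\<Sum>k\<in>UNIV. c $ k *\<^sub>R pd k ?Y \<theta>)" unfolding Z_def by (rule sol(2))
  show "det H \<noteq> 0" by (rule sol(1))
  show "Z \<bullet> \<nu> t y = 0" unfolding Z by (simp add: inner_commute[of _ "\<nu> t y"] inner_sum_right n1(2))
  show "w \<bullet> (B *v (matrix_inv H *v \<eta>)) = Z \<bullet> \<eta>" unfolding Z by (rule sol(3))
  let ?q = "\<psi> t p" and ?e = "- (mean_curvature M (x t) (\<nu> t) y *\<^sub>R \<nu> t y)"
  have d: "((\<lambda>s. \<psi> s (X \<theta>)) has_vector_derivative (\<Sum>k\<in>UNIV. ((1/\<alpha>) *\<^sub>R c) $ k *\<^sub>R ?A k)) (at t within {0..<T})"
  proof -
    have "((\<lambda>s. \<psi> s p) has_vector_derivative (1/\<alpha>) *\<^sub>R ?mlap) (at t within {0..<T})"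
      using \<psi> p(1) t unfolding deturck_diffeomorphisms_def by blast
    then show ?thesis unfolding c(1) X(4) by (simp add: scaleR_sum_right)
  qed
  have e: "((\<lambda>s. x s (X \<theta>)) has_vector_derivative ?e) (at t within {0..<T})"
    using x p(1) t unfolding mean_curvature_flow_def X(4) p(2) by blast
  have "((\<lambda>s. x s (inv_into M (\<psi> s) ?q)) has_vector_derivative
     (?e - (\<Sum>k\<in>UNIV. ((1/\<alpha>) *\<^sub>R c) $ k *\<^sub>R pd k ?Y \<theta>))) (at t within {0..<T})"
    by (rule reparametrized_velocity[OF M x1 \<psi>1 b t X(2,3) _ im d e]) (simp_all add: X(4))
  then have "((\<lambda>s. x s (inv_into M (\<psi> s) ?q)) has_vector_derivative (?e - (1/\<alpha>) *\<^sub>R Z)) (at t within {0..<T})"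
    by (simp add: Z scaleR_sum_right)
  from vector_derivative_within[OF at_within_half_open_nontrivial[OF t] this]
  show "material_derivative M T (\<lambda>s. x s \<circ> inv_into M (\<psi> s)) (\<lambda>s y. y) t y = ?e - (1/\<alpha>) *\<^sub>R Z"
    by (simp add: material_derivative_def p(2) xhat_inverse[OF prem p(1)])
qed

text \<open>Letting \<open>D\<eta>\<close> and \<open>D\<zeta>\<close> range over all weak gradients
  covers the freedom of changing a weak gradient on null sets.\<close>

theorem theorem3:
  fixes M :: "(real^('n::finite option)) set"
    and \<alpha> T :: real
    and x0 :: "real^('n option) \<Rightarrow> real^('n option)"
    and x \<psi> xhat \<nu> :: "real \<Rightarrow> real^('n option) \<Rightarrow> real^('n option)"
    and xinv w :: "real \<Rightarrow> real^('n option) \<Rightarrow> real^('n option)"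
    and \<Gamma> :: "real \<Rightarrow> (real^('n option)) set"
    and Hhat :: "real \<Rightarrow> real^('n option) \<Rightarrow> real^('n option)^('n option)"
    and u :: "real \<Rightarrow> real^('n option) \<Rightarrow> real^('n option)"
  assumes \<alpha>: "0 < \<alpha>" and T: "0 < T"
    and M: "smooth_closed_connected_hypersurface M"
    and x: "mean_curvature_flow M T x0 \<nu> x"
    and \<psi>: "deturck_diffeomorphisms M \<alpha> T x \<psi>"
    and xhat: "\<And>t. xhat t = x t \<circ> inv_into M (\<psi> t)"
    and xinv: "\<And>t. xinv t = inv_into M (xhat t)"
    and \<Gamma>: "\<And>t. \<Gamma> t = xhat t ` M"
    and w: "\<And>t. w t = laplacian M (pullback_metric (xhat t)) id \<circ> xinv t"
    and Hhat: "\<And>t y. Hhat t y =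
      transpose (tgrad (\<Gamma> t) (\<nu> t) (xinv t) y) ** tgrad (\<Gamma> t) (\<nu> t) (xinv t) y
        + outer (\<nu> t y) (\<nu> t y)"
    and u: "\<And>t y. u t y = y"
  shows "\<forall>t\<in>{0..<T}.
    (\<forall>\<eta>\<in>H12 (\<Gamma> t) (\<nu> t). \<forall>D\<eta>. weak_tgrad (\<Gamma> t) (\<nu> t) \<eta> D\<eta> \<longrightarrow>
      0 = \<alpha> * (LINT y:\<Gamma> t|surface_measure. material_derivative M T xhat u t y \<bullet> \<eta> y)
        + (1 - \<alpha>) * (LINT y:\<Gamma> t|surface_measure.
            (material_derivative M T xhat u t y \<bullet> \<nu> t y) * (\<nu> t y \<bullet> \<eta> y))
        + (LINT y:\<Gamma> t|surface_measure. tgrad (\<Gamma> t) (\<nu> t) (u t) y \<bullet> D\<eta> y)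
        + (LINT y:\<Gamma> t|surface_measure.
            w t y \<bullet> (tgrad (\<Gamma> t) (\<nu> t) (xinv t) y *v (matrix_inv (Hhat t y) *v \<eta> y)))) \<and>
    (\<forall>\<zeta>\<in>H12 (\<Gamma> t) (\<nu> t). \<forall>D\<zeta>. weak_tgrad (\<Gamma> t) (\<nu> t) \<zeta> D\<zeta> \<longrightarrow>
      0 = (LINT y:\<Gamma> t|surface_measure. w t y \<bullet> \<zeta> y)
        + (LINT y:\<Gamma> t|surface_measure. tgrad (\<Gamma> t) (\<nu> t) (xinv t) y \<bullet> D\<zeta> y))"
proof (intro ballI)
  fix t assume t: "t \<in> {0..<T}"
  let ?P = "flow_patches M (x t)" and ?v = "material_derivative M T xhat u t"
  let ?B = "tgrad (\<Gamma> t) (\<nu> t) (xinv t)"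
  define W where "W y = - (mean_curvature M (x t) (\<nu> t) y *\<^sub>R \<nu> t y)" for y
  define Z where "Z y = matrix_inv (Hhat t y) *v (transpose (?B y) *v w t y)" for y
  have f: "C2_embedding M (x t)" and n: "unit_normal_field M (x t) (\<nu> t)"
    using x t by (simp_all add: mean_curvature_flow_def)
  have b: "C2_diffeomorphism M (\<psi> t)" using \<psi> t by (simp add: deturck_diffeomorphisms_def)
  note prem = M f n b
  have \<Gamma>t: "\<Gamma> t = x t ` M" unfolding \<Gamma> xhat by (rule xhat_image[OF prem])
  have xi: "xinv t = inv_into M (x t \<circ> inv_into M (\<psi> t))" unfolding xinv xhat ..
  have wt: "w t y = laplacian M (pullback_metric (x t \<circ> inv_into M (\<psi> t))) id (xinv t y)" for y
    by (simp add: w xhat)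
  have Ht: "Hhat t y = transpose (?B y) ** ?B y + outer (\<nu> t y) (\<nu> t y)" for y by (rule Hhat)
  have xh: "xhat = (\<lambda>s. x s \<circ> inv_into M (\<psi> s))" and uu: "u = (\<lambda>s y. y)" by (simp_all add: fun_eq_iff xhat u)
  have pw: "det (Hhat t y) \<noteq> 0" "Z y \<bullet> \<nu> t y = 0" "w t y \<bullet> (?B y *v (matrix_inv (Hhat t y) *v e)) = Z y \<bullet> e"
    "?v y = W y - (1/\<alpha>) *\<^sub>R Z y" if y: "y \<in> \<Gamma> t" for y e
    using deturck_velocity[OF M x \<psi> t y[unfolded \<Gamma>t]]
    unfolding Z_def W_def Ht wt \<Gamma>t xi xh uu by blast+
  show "(\<forall>\<eta>\<in>H12 (\<Gamma> t) (\<nu> t). \<forall>D\<eta>. weak_tgrad (\<Gamma> t) (\<nu> t) \<eta> D\<eta> \<longrightarrow>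
      0 = \<alpha> * (LINT y:\<Gamma> t|surface_measure. ?v y \<bullet> \<eta> y)
        + (1 - \<alpha>) * (LINT y:\<Gamma> t|surface_measure. (?v y \<bullet> \<nu> t y) * (\<nu> t y \<bullet> \<eta> y))
        + (LINT y:\<Gamma> t|surface_measure. tgrad (\<Gamma> t) (\<nu> t) (u t) y \<bullet> D\<eta> y)
        + (LINT y:\<Gamma> t|surface_measure. w t y \<bullet> (?B y *v (matrix_inv (Hhat t y) *v \<eta> y)))) \<and>
    (\<forall>\<zeta>\<in>H12 (\<Gamma> t) (\<nu> t). \<forall>D\<zeta>. weak_tgrad (\<Gamma> t) (\<nu> t) \<zeta> D\<zeta> \<longrightarrow>
      0 = (LINT y:\<Gamma> t|surface_measure. w t y \<bullet> \<zeta> y)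
        + (LINT y:\<Gamma> t|surface_measure. ?B y \<bullet> D\<zeta> y))"
  proof (cases "measure_space UNIV (sets borel) (hausdorff_outer CARD('n) :: (real^('n option)) set \<Rightarrow> ennreal)")
    case False
    then show ?thesis by (simp add: set_lebesgue_integral_def surface_measure_null)
  next
    case True
    interpret c2_surface "\<Gamma> t" "\<nu> t" ?P unfolding \<Gamma>t by (rule c2_surface_flow[OF prem True])
    have PE: thesis if "(U, Y) \<in> ?P" "\<And>X. local_parametrization M U X \<Longrightarrow> Y = (\<lambda>\<xi>. x t (X \<xi>)) \<Longrightarrow> thesis" for U Y thesis
      using that unfolding flow_patches_def by blast
    have Cu: "Ck_on 2 (\<lambda>\<theta>. u t (Y \<theta>)) U" if "(U, Y) \<in> ?P" for U Y
      using patchD(3)[OF patches[OF that]] by (simp add: u)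
    have Lu: "W (Y \<theta>) = lap Y (\<lambda>\<theta>. u t (Y \<theta>)) \<theta>" if UY: "(U, Y) \<in> ?P" and \<theta>: "\<theta> \<in> U" for U Y \<theta>
    proof (rule PE[OF UY])
      fix X assume X: "local_parametrization M U X" "Y = (\<lambda>\<xi>. x t (X \<xi>))"
      show ?thesis unfolding W_def u X(2) by (rule mean_curvature_vector[OF prem X(1) \<theta>])
    qed
    have Cx: "Ck_on 2 (\<lambda>\<theta>. xinv t (Y \<theta>)) U" if UY: "(U, Y) \<in> ?P" for U Y
    proof (rule PE[OF UY])
      fix X assume X: "local_parametrization M U X" "Y = (\<lambda>\<xi>. x t (X \<xi>))"
      show ?thesis unfolding X(2) xi by (rule inverse_xhat_patch(3)[OF prem X(1)])
    qed
    have Lx: "w t (Y \<theta>) = lap Y (\<lambda>\<theta>. xinv t (Y \<theta>)) \<theta>" if UY: "(U, Y) \<in> ?P" and \<theta>: "\<theta> \<in> U" for U Y \<theta>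
    proof (rule PE[OF UY])
      fix X assume X: "local_parametrization M U X" "Y = (\<lambda>\<xi>. x t (X \<xi>))"
      show ?thesis unfolding X(2) wt xi by (rule laplacian_inverse_xhat[OF prem X(1) \<theta>])
    qed
    have cW: "continuous_on (\<Gamma> t) W" by (rule laplacian_continuous[where f="u t", OF Cu Lu])
    have cw: "continuous_on (\<Gamma> t) (w t)" by (rule laplacian_continuous[where f="xinv t", OF Cx Lx])
    have cB: "continuous_on (\<Gamma> t) ?B" by (rule tgrad_continuous) (rule Ck_on_2_imp_1[OF Cx])
    have cn: "continuous_on (\<Gamma> t) (\<nu> t)" using n unfolding unit_normal_field_def \<Gamma>t by blast
    have cH: "continuous_on (\<Gamma> t) (\<lambda>y. Hhat t y $ r $ c)" for r c
      by (simp add: Ht outer_def matrix_matrix_mult_def transpose_def) (intro continuous_intros cB cn)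
    \<comment> \<open>The coordinate description of Z uses a chart chosen separately for each point,
      so continuity is read off the global formula, with Cramer's rule for the inverse of
      \<open>Hhat\<close>.\<close>
    have cZ: "continuous_on (\<Gamma> t) Z"
    proof -
      have "continuous_on (\<Gamma> t) (\<lambda>y. \<chi> i. \<Sum>j\<in>UNIV. matrix_inv (Hhat t y) $ i $ j * (\<Sum>k\<in>UNIV. ?B y $ k $ j * w t y $ k))"
        by (intro continuous_intros continuous_on_matrix_inv cH pw(1) cB cw)
      then show ?thesis unfolding Z_def[abs_def] by (simp add: matrix_vector_mult_def transpose_def)
    qed
    show ?thesis
    proof (intro conjI ballI allI impI)
      fix \<zeta> D assume "weak_tgrad (\<Gamma> t) (\<nu> t) \<zeta> D"
      from integral_parts_H12[where f="xinv t", OF Cx Lx this]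
      show "0 = (LINT y:\<Gamma> t|surface_measure. w t y \<bullet> \<zeta> y) + (LINT y:\<Gamma> t|surface_measure. ?B y \<bullet> D y)"
        by (rule sym)
    next
      fix \<eta> D assume wk: "weak_tgrad (\<Gamma> t) (\<nu> t) \<eta> D"
      then have \<eta>: "\<eta> \<in> L2_on surface_measure (\<Gamma> t)" by (simp add: weak_tgrad_def)
      have 1: "(LINT y:\<Gamma> t|surface_measure. W y \<bullet> \<eta> y) + (LINT y:\<Gamma> t|surface_measure. tgrad (\<Gamma> t) (\<nu> t) (u t) y \<bullet> D y) = 0"
        by (rule integral_parts_H12[where f="u t", OF Cu Lu wk])
      have 2: "(LINT y:\<Gamma> t|surface_measure. w t y \<bullet> (?B y *v (matrix_inv (Hhat t y) *v \<eta> y)))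
        = (LINT y:\<Gamma> t|surface_measure. Z y \<bullet> \<eta> y)"
        unfolding set_lebesgue_integral_def
        by (rule Bochner_Integration.integral_cong[OF refl]) (simp add: pw(3) split: split_indicator)
      have 3: "\<alpha> * (LINT y:\<Gamma> t|surface_measure. ?v y \<bullet> \<eta> y)
          + (1 - \<alpha>) * (LINT y:\<Gamma> t|surface_measure. (?v y \<bullet> \<nu> t y) * (\<nu> t y \<bullet> \<eta> y))
        = (LINT y:\<Gamma> t|surface_measure. W y \<bullet> \<eta> y) - (LINT y:\<Gamma> t|surface_measure. Z y \<bullet> \<eta> y)"
        by (rule velocity_integral[where m="\<lambda>y. - mean_curvature M (x t) (\<nu> t) y", OF _ cW cZ \<eta> pw(4) _ pw(2)])
          (use \<alpha> in \<open>simp_all add: W_def\<close>)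
      show "0 = \<alpha> * (LINT y:\<Gamma> t|surface_measure. ?v y \<bullet> \<eta> y)
        + (1 - \<alpha>) * (LINT y:\<Gamma> t|surface_measure. (?v y \<bullet> \<nu> t y) * (\<nu> t y \<bullet> \<eta> y))
        + (LINT y:\<Gamma> t|surface_measure. tgrad (\<Gamma> t) (\<nu> t) (u t) y \<bullet> D y)
        + (LINT y:\<Gamma> t|surface_measure. w t y \<bullet> (?B y *v (matrix_inv (Hhat t y) *v \<eta> y)))"
        unfolding 2 3 using 1 by linarith
    qed
  qed
qed

end
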